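(* Let $G$ be a locally compact group and let $G_0$ be the set of elements of $G$ whose conjugacy classes are relatively compact (a normal subgroup of $G$). If the closed subgroup $[G,G_0]$ generated by the commutators $\{aba^{-1}b^{-1}: a\in G,\ b\in G_0\}$ is finite, then $\mathrm{ZL}^1(G)$ is amenable.
   Context: $\mathrm{L}^1(G)$ is the group algebra of $G$ (with respect to left Haar measure) under convolution and $\mathrm{ZL}^1(G)=\{f\in \mathrm{L}^1(G): f*g=g*f \text{ for all } g\in \mathrm{L}^1(G)\}$ is its centre (possibly $\{0\}$). A Banach algebra $\mathfrak{A}$ is amenable if it has a bounded approximate diagonal: a bounded net $(\mu_\alpha)$ in the projective tensor product $\mathfrak{A}\hat{\otimes}\mathfrak{A}$ with $m(\mu_\alpha)a\to a$, $a\,m(\mu_\alpha)\to a$ and $a\cdot\mu_\alpha-\mu_\alpha\cdot a\to 0$ for all $a\in\mathfrak{A}$, where $m$ is the multiplication map and $a\cdot(b\otimes c)=ab\otimes c$, $(b\otimes c)\cdot a=b\otimes ca$. *)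

theory Defs
  imports "HOL-Analysis.Analysis"
begin

(* Groups are written additively: the type class group_add is NOT commutative.
   a*b ~ a + b, a^{-1} ~ - a, identity ~ 0. *)

definition add_subgroup :: "'a::group_add set \<Rightarrow> bool" where
  "add_subgroup H \<longleftrightarrow> 0 \<in> H \<and> (\<forall>x\<in>H. \<forall>y\<in>H. x + y \<in> H) \<and> (\<forall>x\<in>H. - x \<in> H)"

definition closed_subgroup_generated :: "'a::{group_add,topological_space} set \<Rightarrow> 'a set" where
  "closed_subgroup_generated S = \<Inter>{H. add_subgroup H \<and> closed H \<and> S \<subseteq> H}"

definition rc_conj_elements :: "'a::{group_add,topological_space} set" where
  "rc_conj_elements = {b. compact (closure {a + b - a | a. True})}"

definition commutators_G_G0 :: "'a::{group_add,topological_space} set" where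
  "commutators_G_G0 = {a + b - a - b | a b. b \<in> rc_conj_elements}"

definition left_haar_measure :: "'a::{topological_group_add,t2_space} measure \<Rightarrow> bool" where
  "left_haar_measure M \<longleftrightarrow>
     sets M = sets borel \<and> space M = UNIV \<and>
     (\<forall>g. \<forall>A\<in>sets M. emeasure M ((\<lambda>x. g + x) ` A) = emeasure M A) \<and>
     (\<forall>K. compact K \<longrightarrow> emeasure M K < \<infinity>) \<and>
     (\<forall>U. open U \<and> U \<noteq> {} \<longrightarrow> emeasure M U > 0) \<and>
     (\<forall>A\<in>sets M. emeasure M A = (INF U\<in>{U. open U \<and> A \<subseteq> U}. emeasure M U)) \<and>
     (\<forall>U. open U \<longrightarrow> emeasure M U = (SUP K\<in>{K. compact K \<and> K \<subseteq> U}. emeasure M K))"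

definition L1norm :: "'a measure \<Rightarrow> ('a \<Rightarrow> complex) \<Rightarrow> real" where
  "L1norm M f = (\<integral>x. cmod (f x) \<partial>M)"

definition conv :: "'a::group_add measure \<Rightarrow> ('a \<Rightarrow> complex) \<Rightarrow> ('a \<Rightarrow> complex) \<Rightarrow> 'a \<Rightarrow> complex" where
  "conv M f g x = (\<integral>y. f y * g (- y + x) \<partial>M)"

(* centre ZL^1(G); equality in L^1 means equality a.e., i.e. L^1 distance 0 *)
definition ZL1 :: "'a::group_add measure \<Rightarrow> ('a \<Rightarrow> complex) set" where
  "ZL1 M = {f. integrable M f \<and>
     (\<forall>g. integrable M g \<longrightarrow> L1norm M (\<lambda>x. conv M f g x - conv M g f x) = 0)}"

(* Banach algebra of complex functions with carrier A, seminorm nrm (elements identified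
   when at distance 0), multiplication mul, pointwise linear operations.
   Unit ball of bounded complex-bilinear forms on A x A (dual of A \<otimes>^ A). *)
definition bil_unit :: "('a \<Rightarrow> complex) set \<Rightarrow> (('a \<Rightarrow> complex) \<Rightarrow> real)
    \<Rightarrow> (('a \<Rightarrow> complex) \<Rightarrow> ('a \<Rightarrow> complex) \<Rightarrow> complex) set" where
  "bil_unit A nrm = {\<phi>.
     (\<forall>f\<in>A. \<forall>g\<in>A. \<forall>h\<in>A. \<phi> (\<lambda>x. f x + g x) h = \<phi> f h + \<phi> g h \<and>
                          \<phi> h (\<lambda>x. f x + g x) = \<phi> h f + \<phi> h g) \<and>
     (\<forall>f\<in>A. \<forall>g\<in>A. \<forall>c. \<phi> (\<lambda>x. c * f x) g = c * \<phi> f g \<and> \<phi> f (\<lambda>x. c * g x) = c * \<phi> f g) \<and>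
     (\<forall>f\<in>A. \<forall>g\<in>A. cmod (\<phi> f g) \<le> nrm f * nrm g)}"

(* an element of the projective tensor product A \<otimes>^ A given by an absolutely convergent
   representation  \<Sum>n c_n \<otimes> d_n *)
definition tensor_rep :: "('a \<Rightarrow> complex) set \<Rightarrow> (('a \<Rightarrow> complex) \<Rightarrow> real)
    \<Rightarrow> (nat \<Rightarrow> 'a \<Rightarrow> complex) \<Rightarrow> (nat \<Rightarrow> 'a \<Rightarrow> complex) \<Rightarrow> bool" where
  "tensor_rep A nrm c d \<longleftrightarrow> (\<forall>n. c n \<in> A \<and> d n \<in> A) \<and> summable (\<lambda>n. nrm (c n) * nrm (d n))"

definition tensor_eval :: "(nat \<Rightarrow> 'a \<Rightarrow> complex) \<Rightarrow> (nat \<Rightarrow> 'a \<Rightarrow> complex)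
    \<Rightarrow> (('a \<Rightarrow> complex) \<Rightarrow> ('a \<Rightarrow> complex) \<Rightarrow> complex) \<Rightarrow> complex" where
  "tensor_eval c d \<phi> = (\<Sum>n. \<phi> (c n) (d n))"

(* projective tensor norm, computed through the duality (A \<otimes>^ A)^* = bounded bilinear forms *)
definition proj_norm :: "('a \<Rightarrow> complex) set \<Rightarrow> (('a \<Rightarrow> complex) \<Rightarrow> real)
    \<Rightarrow> ((('a \<Rightarrow> complex) \<Rightarrow> ('a \<Rightarrow> complex) \<Rightarrow> complex) \<Rightarrow> complex) \<Rightarrow> real" where
  "proj_norm A nrm T = (SUP \<phi>\<in>bil_unit A nrm. cmod (T \<phi>))"

(* amenability: existence of a bounded approximate diagonal (a bounded net = a proper
   filter on representations, eventually bounded) *)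
definition amenable_alg :: "('a \<Rightarrow> complex) set \<Rightarrow> (('a \<Rightarrow> complex) \<Rightarrow> real)
    \<Rightarrow> (('a \<Rightarrow> complex) \<Rightarrow> ('a \<Rightarrow> complex) \<Rightarrow> 'a \<Rightarrow> complex) \<Rightarrow> bool" where
  "amenable_alg A nrm mul \<longleftrightarrow>
    (\<exists>(F :: ((nat \<Rightarrow> 'a \<Rightarrow> complex) \<times> (nat \<Rightarrow> 'a \<Rightarrow> complex)) filter) C.
       F \<noteq> bot \<and>
       (\<forall>\<^sub>F (c, d) in F. tensor_rep A nrm c d \<and> proj_norm A nrm (tensor_eval c d) \<le> C) \<and>
       (\<forall>a\<in>A.
          ((\<lambda>(c, d). lim (\<lambda>N. nrm (\<lambda>x. mul (\<lambda>z. \<Sum>n<N. mul (c n) (d n) z) a x - a x)))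
              \<longlongrightarrow> 0) F \<and>
          ((\<lambda>(c, d). lim (\<lambda>N. nrm (\<lambda>x. mul a (\<lambda>z. \<Sum>n<N. mul (c n) (d n) z) x - a x)))
              \<longlongrightarrow> 0) F \<and>
          ((\<lambda>(c, d). proj_norm A nrm
               (\<lambda>\<phi>. (\<Sum>n. \<phi> (mul a (c n)) (d n)) - (\<Sum>n. \<phi> (c n) (mul (d n) a))))
              \<longlongrightarrow> 0) F))"

end

theory Submission
  imports Defs
begin

text \<open>Suppose that the centre is nonzero. For a nonzero central \<open>f\<close>, the length function
  \<open>x \<mapsto> \<parallel>f - \<delta>\<^sub>x * f\<parallel>\<close> is invariant under conjugation and is small only on a relatively compact set;
  hence the identity has a relatively compact conjugation-invariant neighbourhood, the group is
  unimodular, \<open>G\<^sub>0\<close> is open, and central functions live on \<open>G\<^sub>0\<close>. Let \<open>K = [G,G\<^sub>0]\<close>. The conjugacy classes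
  in \<open>G\<^sub>0\<close> lie in cosets of the finite group \<open>K\<close>, so averaging over them is a contractive projection onto the
  centre. The finite-dimensional commutative *-algebra of class functions on \<open>K\<close> contains finitely many
  minimal idempotents \<open>p\<close> with sum \<open>\<delta>\<^sub>0\<close>. For \<open>t \<in> G\<^sub>0\<close> the average of the class of \<open>t\<close>, cut down by \<open>p\<close>,
  is supported in one coset of \<open>K\<close> and is therefore a scalar multiple of a unitary; these unitaries form a
  commutative group whose norms are bounded by \<open>card K\<close>. If \<open>e\<close> is a central approximate unit and \<open>u\<close> ranges over a Folner
  sequence of that group, the averages of \<open>u e \<otimes> u\<^sup>* e\<close>, summed over \<open>p\<close>, form a bounded approximate
  diagonal.\<close>

section \<open>Haar integration\<close>

text \<open>The measure need not be sigma-finite, and rectangles need not generate the Borel sets of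
  the square, so Fubini does not apply. Riemann sums take its place: \<open>conv M a h\<close> is an
  L1 limit of combinations of left translates of \<open>h\<close>, with nodes and weights common to
  any prescribed finite family of functions \<open>h\<close>. Submultiplicativity, associativity,
  unimodularity and the approximation of central elements by class averages all rest on this. For
  the same reason locally null sets need care; they are null inside the support of an integrable
  function. Class averages need not be invertible, so they generate no bounded group to average
  over. Below a minimal idempotent \<open>p\<close> they do, up to scalars: a cut average times its
  adjoint lives on \<open>K\<close> and under \<open>p\<close>, where selfadjoint elements are real
  multiples of \<open>p\<close>. A unitary obtained in this way has the l2 norm of \<open>p\<close>,
  at most 1, and support in one coset turns this into an l1 bound.\<close>

lemma Hausdorff_space_t2: "Hausdorff_space (euclidean :: 'a::t2_space topology)"
  using hausdorff by (auto simp: Hausdorff_space_def disjnt_def)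

locale haar_group =
  fixes M :: "'a::{topological_group_add, t2_space} measure"
  assumes lc: "locally_compact_space (euclidean :: 'a topology)"
    and haar: "left_haar_measure M"
begin

lemma sets_M [simp, measurable_cong]: "sets M = sets borel"
  and space_M [simp]: "space M = UNIV"
  and emeasure_translate: "A \<in> sets borel \<Longrightarrow> emeasure M ((\<lambda>x. g + x) ` A) = emeasure M A"
  and emeasure_compact: "compact K \<Longrightarrow> emeasure M K < \<infinity>"
  and emeasure_open_pos: "open U \<Longrightarrow> U \<noteq> {} \<Longrightarrow> emeasure M U > 0"
  and outer_regular: "A \<in> sets borel \<Longrightarrow> emeasure M A = (INF U\<in>{U. open U \<and> A \<subseteq> U}. emeasure M U)"
  and inner_regular_open: "open U \<Longrightarrow> emeasure M U = (SUP K\<in>{K. compact K \<and> K \<subseteq> U}. emeasure M K)"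
proof -
  note h = haar[unfolded left_haar_measure_def]
  show s: "sets M = sets borel" using h by (rule conjunct1)
  show "space M = UNIV" using h by (elim conjE) 
  show "A \<in> sets borel \<Longrightarrow> emeasure M ((\<lambda>x. g + x) ` A) = emeasure M A" using h s by (elim conjE) simp
  show "compact K \<Longrightarrow> emeasure M K < \<infinity>" using h by (elim conjE) iprover
  show "open U \<Longrightarrow> U \<noteq> {} \<Longrightarrow> emeasure M U > 0" using h by (elim conjE) iprover
  show "A \<in> sets borel \<Longrightarrow> emeasure M A = (INF U\<in>{U. open U \<and> A \<subseteq> U}. emeasure M U)" using h s by (elim conjE) (drule bspec, simp, assumption)
  show "open U \<Longrightarrow> emeasure M U = (SUP K\<in>{K. compact K \<and> K \<subseteq> U}. emeasure M K)" using h by (elim conjE) iprover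
qed

lemma measurable_M [simp]: "measurable M N = measurable borel N"
  by (rule measurable_cong_sets) auto

lemma compact_borel [simp]: "compact (K::'a set) \<Longrightarrow> K \<in> sets borel"
  by (simp add: borel_closed compact_imp_closed)

section \<open>Compact neighbourhoods and Urysohn functions\<close>

lemma compact_between:
  assumes "compact (K::'a set)" "open U" "K \<subseteq> U"
  obtains V C where "open V" "compact C" "K \<subseteq> V" "V \<subseteq> C" "C \<subseteq> U"
proof -
  have nb: "neighbourhood_base_of (\<lambda>C. compactin euclidean C) (euclidean :: 'a topology)"
    using lc locally_compact_space_neighbourhood_base[of "euclidean :: 'a topology"] Hausdorff_space_t2 by blast
  have "\<exists>V C. open V \<and> compact C \<and> x \<in> V \<and> V \<subseteq> C \<and> C \<subseteq> U" if "x \<in> K" for x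
  proof -
    have "openin euclidean U \<and> x \<in> U" using that assms by auto
    then have "\<exists>V C. openin euclidean V \<and> compactin euclidean C \<and> x \<in> V \<and> V \<subseteq> C \<and> C \<subseteq> U"
      using nb[unfolded neighbourhood_base_of] by blast
    then show ?thesis by simp
  qed
  then obtain V C where VC: "\<And>x. x \<in> K \<Longrightarrow> open (V x) \<and> compact (C x) \<and> x \<in> V x \<and> V x \<subseteq> C x \<and> C x \<subseteq> U"
    by metis
  have "K \<subseteq> (\<Union>x\<in>K. V x)" using VC by blast
  then obtain F where F: "F \<subseteq> K" "finite F" "K \<subseteq> (\<Union>x\<in>F. V x)"
    using compactE_image[OF assms(1), of K V] VC by blast
  show thesis
  proof (rule that[of "\<Union>x\<in>F. V x" "\<Union>x\<in>F. C x"])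
    show "open (\<Union>x\<in>F. V x)" using F VC by (intro open_UN) blast
    show "compact (\<Union>x\<in>F. C x)" using F VC by (intro compact_UN) blast+
    show "(\<Union>x\<in>F. V x) \<subseteq> (\<Union>x\<in>F. C x)" using F VC by (intro UN_mono) blast+
    show "(\<Union>x\<in>F. C x) \<subseteq> U" using F VC by (intro UN_least) blast
  qed (rule F)
qed

lemma compact_nhd:
  obtains V C where "open V" "compact (C::'a set)" "0 \<in> V" "V \<subseteq> C"
  by (rule compact_between[of "{0}" UNIV]) auto

text \<open>Complete regularity of a locally compact Hausdorff space gives the function. Interposing
  \<open>V\<close> and \<open>C\<close> makes it vanish off a compact subset of \<open>U\<close>, so
  that it lies in \<open>Cc\<close> and between the indicators of \<open>K\<close> and
  \<open>U\<close>.\<close>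

lemma Urysohn_compact:
  assumes "compact (K::'a set)" "open U" "K \<subseteq> U"
  obtains e C where "continuous_on UNIV (e::'a \<Rightarrow> real)" "\<And>x. 0 \<le> e x" "\<And>x. e x \<le> 1" "\<And>x. x \<in> K \<Longrightarrow> e x = 1"
    "compact C" "C \<subseteq> U" "\<And>x. x \<notin> C \<Longrightarrow> e x = 0"
proof -
  obtain V C where VC: "open V" "compact C" "K \<subseteq> V" "V \<subseteq> C" "C \<subseteq> U"
    using compact_between assms by metis
  have "regular_space (euclidean :: 'a topology)"
    using lc locally_compact_Hausdorff_imp_regular_space Hausdorff_space_t2 by blast
  then have "completely_regular_space (euclidean :: 'a topology)"
    using lc locally_compact_regular_imp_completely_regular_space by auto
  then obtain f where f: "continuous_map euclidean (top_of_set {0..1::real}) f" "f ` (-V) \<subseteq> {0}" "f ` K \<subseteq> {1}"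
    using Urysohn_completely_regular_compact_closed[of 0 1 "euclidean :: 'a topology" K "-V"] assms(1) VC
    by (auto simp: disjnt_def)
  have "f x \<in> {0..1}" for x
    using f(1) by (auto simp: continuous_map_in_subtopology Pi_iff)
  moreover have "f x = 0" if "x \<notin> C" for x using f(2) VC that by auto
  moreover have "f x = 1" if "x \<in> K" for x using f(3) that by auto
  moreover have "continuous_on UNIV f" using f(1) by (simp add: continuous_map_in_subtopology)
  ultimately show thesis
    using VC by (intro that[of f C]) auto
qed

section \<open>Regularity on Borel sets of finite measure\<close>

lemma finite_emeasureI: "A \<in> sets borel \<Longrightarrow> A \<subseteq> B \<Longrightarrow> B \<in> sets borel \<Longrightarrow> emeasure M B < \<infinity> \<Longrightarrow> emeasure M A < \<infinity>"
  using emeasure_mono[of A B M] le_less_trans by auto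

lemma emeasure_fin: "emeasure M A < \<infinity> \<Longrightarrow> emeasure M A = ennreal (measure M A)"
  by (rule emeasure_eq_ennreal_measure) auto

lemma measure_Diff':
  assumes "A \<in> sets borel" "B \<in> sets borel" "B \<subseteq> A" "emeasure M A < \<infinity>"
  shows "measure M (A - B) = measure M A - measure M B"
  using assms by (intro measure_Diff) auto

lemma outer_approx:
  assumes A: "A \<in> sets borel" "emeasure M A < \<infinity>" and d: "0 < (d::real)"
  obtains U where "open U" "A \<subseteq> U" "emeasure M U < \<infinity>" "measure M (U - A) < d"
proof -
  have "emeasure M A + 0 < emeasure M A + d"
    using A d by (subst ennreal_add_left_cancel_less) (auto simp: less_top)
  then obtain U where U: "open U" "A \<subseteq> U" "emeasure M U < emeasure M A + d"
    using outer_regular[OF A(1)] by (auto simp: INF_less_iff)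
  have "emeasure M A + d < \<infinity>" using A(2) by simp
  then have fU: "emeasure M U < \<infinity>" using U(3) less_trans by blast
  have "ennreal (measure M U) < ennreal (measure M A) + ennreal d"
    using U(3) emeasure_fin[OF fU] emeasure_fin[OF A(2)] by simp
  also have "\<dots> = ennreal (measure M A + d)" using d by (simp add: ennreal_plus)
  finally have "measure M U < measure M A + d"
    by (subst (asm) ennreal_less_iff) auto
  then have "measure M (U - A) < d"
    using A U(1,2) fU by (subst measure_Diff') auto
  then show thesis using that U fU by blast
qed

lemma inner_approx_open:
  assumes U: "open U" "emeasure M U < \<infinity>" and d: "0 < (d::real)"
  obtains K where "compact K" "K \<subseteq> U" "measure M (U - K) < d"
proof (cases "measure M U < d")
  case True
  then show ?thesis using that[of "{}"] by auto
next
  case False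
  have "ennreal (measure M U - d) < ennreal (measure M U)"
    using d False by (intro ennreal_lessI) auto
  also have "\<dots> = emeasure M U" using emeasure_fin[OF U(2)] by simp
  finally obtain K where K: "compact K" "K \<subseteq> U" "ennreal (measure M U - d) < emeasure M K"
    using inner_regular_open[OF U(1)] by (auto simp: less_SUP_iff)
  have fK: "emeasure M K < \<infinity>" using emeasure_compact K by auto
  have "ennreal (measure M U - d) < ennreal (measure M K)"
    using K(3) emeasure_fin[OF fK] by simp
  then have "measure M U - d < measure M K"
    by (subst (asm) ennreal_less_iff) (use False in auto)
  then have "measure M (U - K) < d"
    using K(1,2) U by (subst measure_Diff') auto
  then show thesis using that K by blast
qed

text \<open>The axioms grant inner regularity on open sets only. For \<open>E\<close> of finite
  measure it follows by complementing inside an open \<open>U\<close>: with \<open>W\<close>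
  approximating \<open>U - E\<close> from outside and \<open>K0\<close> approximating
  \<open>U\<close> from inside, \<open>K0 - W\<close> is a compact core of \<open>E\<close>.\<close>

lemma regular:
  assumes E: "E \<in> sets borel" "emeasure M E < \<infinity>" and "0 < (\<epsilon>::real)"
  obtains K U where "compact K" "open U" "K \<subseteq> E" "E \<subseteq> U" "emeasure M U < \<infinity>" "measure M (U - K) < \<epsilon>"
proof -
  have e4: "\<epsilon>/4 > 0" using assms by simp
  obtain U where U: "open U" "E \<subseteq> U" "emeasure M U < \<infinity>" "measure M (U - E) < \<epsilon>/4"
    using outer_approx[OF E e4] by blast
  obtain K0 where K0: "compact K0" "K0 \<subseteq> U" "measure M (U - K0) < \<epsilon>/4"
    using inner_approx_open[OF U(1,3) e4] by blast
  have f1: "emeasure M (U - E) < \<infinity>" using U E by - (rule finite_emeasureI[of "U - E" U], auto)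
  obtain W where W: "open W" "U - E \<subseteq> W" "emeasure M W < \<infinity>" "measure M (W - (U - E)) < \<epsilon>/4"
    using outer_approx[OF _ f1 e4] U E by auto
  define K where "K = K0 - W"
  have f2: "emeasure M (U - K0) < \<infinity>" using U K0 by - (rule finite_emeasureI[of "U - K0" U], auto)
  have f3: "emeasure M (W - (U - E)) < \<infinity>" using U W E by - (rule finite_emeasureI[of "W - (U - E)" W], auto)
  have fm: "U - K0 \<in> fmeasurable M" "W - (U - E) \<in> fmeasurable M" "U - E \<in> fmeasurable M"
    unfolding fmeasurable_def using f1 f2 f3 E U(1) W(1) K0(1) by auto
  have bW: "W \<union> (U - E) \<in> sets borel \<and> W - (U - E) \<in> sets borel \<and> U - E \<in> sets borel \<and> U - K0 \<in> sets borel" using U(1) W(1) E(1) K0(1) by (intro conjI sets.Diff sets.Un) auto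
  have bK: "U - (K0 - W) \<in> sets borel" using U(1) W(1) K0(1) by (intro sets.Diff) auto
  \<comment> \<open>A point of \<open>U\<close> off \<open>K\<close> lies off \<open>K0\<close>, in
    the excess of \<open>W\<close>, or in \<open>U - E\<close>; each of the three pieces has measure
    below \<open>\<epsilon>/4\<close>.\<close>
  have "measure M (U - K) \<le> measure M ((U - K0) \<union> ((W - (U - E)) \<union> (U - E)))"
    using fm bK bW by (intro measure_mono_fmeasurable fmeasurable.Un fm) (auto simp: K_def)
  also have "\<dots> \<le> measure M (U - K0) + measure M ((W - (U - E)) \<union> (U - E))"
    using fm bW by (intro measure_Un_le) auto
  also have "\<dots> \<le> measure M (U - K0) + (measure M (W - (U - E)) + measure M (U - E))"
    using fm bW by (intro add_left_mono measure_Un_le) auto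
  also have "\<dots> < \<epsilon>" using U W K0 assms by linarith
  finally have "measure M (U - K) < \<epsilon>" .
  moreover have "compact K" unfolding K_def by (intro compact_diff K0 W)
  moreover have "K \<subseteq> E" using K0 W unfolding K_def by auto
  ultimately show thesis using that U by blast
qed

end

section \<open>Translates, the L1 seminorm and compactly supported continuous functions\<close>

lemma borel_compose:
  "f \<in> measurable borel N \<Longrightarrow> continuous_on UNIV h \<Longrightarrow> (\<lambda>x. f (h x)) \<in> measurable borel N"
  by (rule measurable_compose[OF borel_measurable_continuous_onI])

text \<open>The left translate, that is, convolution from the left with the point mass at
  \<open>s\<close>.\<close>

definition lt :: "'a::group_add \<Rightarrow> ('a \<Rightarrow> 'b) \<Rightarrow> 'a \<Rightarrow> 'b" where
  "lt s f = (\<lambda>x. f (- s + x))"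

lemma lt_add: "lt (s + t) f = lt s (lt t f)"
  by (simp add: lt_def minus_add add.assoc diff_conv_add_uminus del: add_uminus_conv_diff)

lemma lt_0 [simp]: "lt 0 f = f"
  by (simp add: lt_def)

definition Cc :: "('a::topological_space \<Rightarrow> complex) set" where
  "Cc = {g. continuous_on UNIV g \<and> (\<exists>C. compact C \<and> (\<forall>x. x \<notin> C \<longrightarrow> g x = 0))}"

lemma compact_plus: "compact A \<Longrightarrow> compact B \<Longrightarrow> compact {a + b | a b. a \<in> A \<and> b \<in> (B::'a::topological_group_add set)}"
proof -
  assume "compact A" "compact B"
  then have "compact ((\<lambda>(a,b). a + b) ` (A \<times> B))"
    by (intro compact_continuous_image compact_Times) (auto simp: split_beta intro!: continuous_intros)
  also have "(\<lambda>(a,b). a + b) ` (A \<times> B) = {a + b | a b. a \<in> A \<and> b \<in> B}" by auto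
  finally show ?thesis .
qed

lemma compact_uminus: "compact A \<Longrightarrow> compact (uminus ` (A::'a::topological_group_add set))"
  by (intro compact_continuous_image continuous_intros)

lemma conj_cancel: "- a + (a + x - a) - - a = (x::'b::group_add)"
  by (simp add: add.assoc[symmetric] diff_conv_add_uminus del: add_uminus_conv_diff)
    (simp add: add.assoc)

context haar_group begin

abbreviation N :: "('a \<Rightarrow> complex) \<Rightarrow> real" where "N \<equiv> L1norm M"

lemma vimage_translate: "(\<lambda>x. s + x) -` A = (\<lambda>x. - s + x) ` (A::'a set)"
proof -
  have "x \<in> (\<lambda>x. - s + x) ` A" if "s + x \<in> A" for x
    using that by (intro image_eqI[of _ _ "s + x"]) (simp_all add: add.assoc[symmetric])
  then show ?thesis by (auto simp: add.assoc[symmetric])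
qed

lemma distr_translate: "distr M borel (\<lambda>x. s + x) = M"
proof (rule measure_eqI)
  fix A assume "A \<in> sets (distr M borel (\<lambda>x. s + x))"
  then have A: "A \<in> sets borel" by simp
  have "emeasure (distr M borel (\<lambda>x. s + x)) A = emeasure M ((\<lambda>x. s + x) -` A \<inter> space M)"
    using A by (intro emeasure_distr) (auto intro!: borel_measurable_continuous_onI continuous_intros)
  also have "\<dots> = emeasure M A"
    using emeasure_translate[OF A, of "-s"] by (simp add: vimage_translate)
  finally show "emeasure (distr M borel (\<lambda>x. s + x)) A = emeasure M A" .
qed simp

lemma meas_translate: "(\<lambda>x. s + x) \<in> measurable M borel"
  by (simp add: borel_measurable_continuous_onI continuous_intros)

lemma integral_translate:
  fixes f :: "'a \<Rightarrow> 'b::{banach,second_countable_topology}"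
  assumes "f \<in> borel_measurable borel"
  shows "(\<integral>x. f (s + x) \<partial>M) = (\<integral>x. f x \<partial>M)"
proof -
  have "(\<integral>x. f x \<partial>distr M borel (\<lambda>x. s + x)) = (\<integral>x. f (s + x) \<partial>M)"
    using assms by (intro integral_distr meas_translate)
  then show ?thesis unfolding distr_translate by (rule sym)
qed

lemma integrable_translate:
  fixes f :: "'a \<Rightarrow> 'b::{banach,second_countable_topology}"
  assumes "integrable M f"
  shows "integrable M (\<lambda>x. f (s + x))"
proof -
  have "integrable (distr M borel (\<lambda>x. s + x)) f" unfolding distr_translate by (rule assms)
  then show ?thesis by (rule integrable_distr[OF meas_translate])
qed

lemma integrable_meas: "integrable M (f::'a \<Rightarrow> 'b::{banach,second_countable_topology}) \<Longrightarrow> f \<in> borel_measurable borel"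
  by (auto dest: borel_measurable_integrable)

lemma AE_translate:
  assumes "AE x in M. P x"
  shows "AE x in M. P (s + x)"
proof -
  obtain A where A: "{x. \<not> P x} \<subseteq> A" "emeasure M A = 0" "A \<in> sets borel"
    using assms by (auto elim!: AE_E)
  have "{x. \<not> P (s + x)} \<subseteq> (\<lambda>x. - s + x) ` A"
    using A(1) unfolding vimage_translate[symmetric] by auto
  moreover have "(\<lambda>x. - s + x) ` A \<in> null_sets M"
  proof -
    have "(\<lambda>x. s + x) -` A \<inter> space borel \<in> sets borel"
      by (rule measurable_sets[OF borel_measurable_continuous_onI A(3)]) (intro continuous_intros)
    then show ?thesis
      using A emeasure_translate[OF A(3), of "-s"] by (auto simp: null_sets_def vimage_translate)
  qed
  ultimately show ?thesis by (intro AE_I'[of "(\<lambda>x. - s + x) ` A"]) auto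
qed

lemma integrable_lt: "integrable M (f::'a \<Rightarrow> 'b::{banach,second_countable_topology}) \<Longrightarrow> integrable M (lt s f)"
  unfolding lt_def by (rule integrable_translate)

lemma N_lt: "integrable M f \<Longrightarrow> N (lt s f) = N f"
  unfolding L1norm_def lt_def
  by (rule integral_translate[where f="\<lambda>x. cmod (f x)"]) (auto dest!: integrable_meas)

lemma N_nonneg [simp]: "0 \<le> N f"
  unfolding L1norm_def by simp

lemma N_zero [simp]: "N (\<lambda>x. 0) = 0"
  unfolding L1norm_def by simp

lemma N_add:
  assumes "integrable M f" "integrable M g"
  shows "N (\<lambda>x. f x + g x) \<le> N f + N g"
proof -
  have "N (\<lambda>x. f x + g x) \<le> (\<integral>x. cmod (f x) + cmod (g x) \<partial>M)"
    unfolding L1norm_def using assms by (intro integral_mono norm_triangle_ineq) auto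
  also have "\<dots> = N f + N g" unfolding L1norm_def using assms by (intro Bochner_Integration.integral_add) auto
  finally show ?thesis .
qed

lemma N_tri: "integrable M f \<Longrightarrow> integrable M g \<Longrightarrow> integrable M h \<Longrightarrow>
    N (\<lambda>x. f x - h x) \<le> N (\<lambda>x. f x - g x) + N (\<lambda>x. g x - h x)"
  using N_add[of "\<lambda>x. f x - g x" "\<lambda>x. g x - h x"] by simp

lemma N_minus: "N (\<lambda>x. f x - g x) = N (\<lambda>x. g x - f x)"
  unfolding L1norm_def by (simp add: norm_minus_commute)

lemma N_rev: "integrable M f \<Longrightarrow> integrable M g \<Longrightarrow> N f - N g \<le> N (\<lambda>x. f x - g x)"
  using N_add[of "\<lambda>x. f x - g x" g] by simp

lemma N_cmult: "N (\<lambda>x. c * f x) = cmod c * N f"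
  unfolding L1norm_def by (simp add: norm_mult)

lemma N_sum:
  assumes "\<And>i. i \<in> I \<Longrightarrow> integrable M (f i)"
  shows "N (\<lambda>x. \<Sum>i\<in>I. f i x) \<le> (\<Sum>i\<in>I. N (f i))"
  using assms
proof (induction I rule: infinite_finite_induct)
  case (insert i I)
  then have "N (\<lambda>x. f i x + (\<Sum>i\<in>I. f i x)) \<le> N (f i) + N (\<lambda>x. \<Sum>i\<in>I. f i x)"
    by (intro N_add) auto
  with insert show ?case by force
qed auto

lemma N_cong_AE: "integrable M f \<Longrightarrow> integrable M g \<Longrightarrow> AE x in M. f x = g x \<Longrightarrow> N f = N g"
  unfolding L1norm_def by (rule integral_cong_AE) auto

lemma N_eq_0_iff: "integrable M f \<Longrightarrow> N f = 0 \<longleftrightarrow> (AE x in M. f x = 0)"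
  unfolding L1norm_def by (subst integral_nonneg_eq_0_iff_AE) auto

lemma N_mono: "integrable M g \<Longrightarrow> integrable M f \<Longrightarrow> (\<And>x. cmod (f x) \<le> cmod (g x)) \<Longrightarrow> N f \<le> N g"
  unfolding L1norm_def by (intro integral_mono) auto

lemma integrable_compact_supp:
  assumes "f \<in> borel_measurable borel" "compact D" "\<And>x. x \<notin> D \<Longrightarrow> f x = (0::complex)" "\<And>x. cmod (f x) \<le> B"
  shows "integrable M f"
proof (rule Bochner_Integration.integrable_bound[of M "\<lambda>x. B * indicator D x :: real"])
  show "integrable M (\<lambda>x. B * indicator D x)"
    using assms(2) emeasure_compact[of D] by (intro integrable_mult_right integrable_real_indicator) auto
  show "AE x in M. norm (f x) \<le> norm (B * indicator D x :: real)"
    using assms(3,4) by (intro AE_I2) (auto simp: indicator_def intro: order.trans[OF _ abs_ge_self])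
qed (use assms in auto)

lemma N_compact_supp:
  assumes "f \<in> borel_measurable borel" "compact D" "\<And>x. x \<notin> D \<Longrightarrow> f x = 0" "\<And>x. cmod (f x) \<le> B"
  shows "N f \<le> B * measure M D"
proof -
  have "N f \<le> (\<integral>x. B * indicator D x \<partial>M)"
    unfolding L1norm_def
  proof (rule integral_mono)
    show "integrable M (\<lambda>x. B * indicator D x)"
      using assms(2) emeasure_compact[of D] by (intro integrable_mult_right integrable_real_indicator) auto
    show "cmod (f x) \<le> B * indicator D x" for x
      using assms(3,4) by (auto simp: indicator_def)
  qed (use integrable_compact_supp[OF assms] in auto)
  also have "\<dots> = B * measure M D" by simp
  finally show ?thesis .
qed

lemma Cc_bounded:
  assumes "g \<in> Cc"
  obtains C B where "compact C" "\<And>x. x \<notin> C \<Longrightarrow> g x = 0" "\<And>x. cmod (g x) \<le> B" "0 \<le> B"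
proof -
  obtain C where C: "compact C" "\<And>x. x \<notin> C \<Longrightarrow> g x = 0" "continuous_on UNIV g"
    using assms unfolding Cc_def by auto
  have "compact (g ` C)" using C by (intro compact_continuous_image) (auto intro: continuous_on_subset)
  then obtain B where B: "\<And>y. y \<in> g ` C \<Longrightarrow> norm y \<le> B" using compact_imp_bounded bounded_iff by metis
  have "cmod (g x) \<le> max B 0" for x using B[of "g x"] C(2)[of x] by (cases "x \<in> C") auto
  then show thesis using C by (intro that[of C "max B 0"]) auto
qed

lemma Cc_meas: "g \<in> Cc \<Longrightarrow> g \<in> borel_measurable borel"
  unfolding Cc_def by (auto intro: borel_measurable_continuous_onI)

lemma Cc_integrable: "g \<in> Cc \<Longrightarrow> integrable M g"
  using Cc_bounded[of g] integrable_compact_supp[OF Cc_meas] by metis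

lemma Cc_add: "f \<in> Cc \<Longrightarrow> g \<in> Cc \<Longrightarrow> (\<lambda>x. f x + g x) \<in> Cc"
proof -
  assume "f \<in> Cc" "g \<in> Cc"
  then obtain C D where *: "compact C" "\<And>x. x \<notin> C \<Longrightarrow> f x = 0" "continuous_on UNIV f"
    "compact D" "\<And>x. x \<notin> D \<Longrightarrow> g x = 0" "continuous_on UNIV g" unfolding Cc_def by blast
  then have "compact (C \<union> D)" "\<forall>x. x \<notin> C \<union> D \<longrightarrow> f x + g x = 0" by (auto intro: compact_Un)
  then show ?thesis unfolding Cc_def using * by (blast intro: continuous_on_add)
qed

lemma Cc_cmult: "f \<in> Cc \<Longrightarrow> (\<lambda>x. c * f x) \<in> Cc"
  unfolding Cc_def by (auto intro!: continuous_intros)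

text \<open>Regularity and Urysohn functions settle indicators of sets of finite measure; sums and
  dominated limits then reach all integrable functions.\<close>

lemma Cc_dense:
  assumes "integrable M f" "0 < \<epsilon>"
  obtains g where "g \<in> Cc" "N (\<lambda>x. f x - g x) < \<epsilon>"
proof -
  have "\<forall>\<epsilon>>0. \<exists>g\<in>Cc. N (\<lambda>x. f x - g x) < \<epsilon>"
    using assms(1)
  proof (induction rule: integrable_induct)
    case (base A c)
    show ?case
    proof (intro allI impI)
      fix \<epsilon> :: real assume e: "\<epsilon> > 0"
      \<comment> \<open>Adding 1 keeps the quotient meaningful for \<open>c = 0\<close>.\<close>
      define d where "d = \<epsilon> / (cmod c + 1)"
      have d: "d > 0" using e unfolding d_def by (simp add: add_nonneg_pos)
      have A: "A \<in> sets borel" "emeasure M A < \<infinity>" using base by auto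
      obtain K U where KU: "compact K" "open U" "K \<subseteq> A" "A \<subseteq> U" "emeasure M U < \<infinity>" "measure M (U - K) < d"
        using regular[OF A d] by blast
      obtain e C where eC: "continuous_on UNIV (e::'a \<Rightarrow> real)" "\<And>x. 0 \<le> e x" "\<And>x. e x \<le> 1" "\<And>x. x \<in> K \<Longrightarrow> e x = 1"
        "compact C" "C \<subseteq> U" "\<And>x. x \<notin> C \<Longrightarrow> e x = 0"
        using Urysohn_compact[OF KU(1,2) order.trans[OF KU(3,4)]] by blast
      define g where "g = (\<lambda>x. complex_of_real (e x))"
      have gC: "g \<in> Cc" unfolding g_def Cc_def using eC by (auto intro!: continuous_intros exI[of _ C])
      have fin: "emeasure M (U - K) < \<infinity>" using KU by - (rule finite_emeasureI[of "U-K" U], auto)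
      have ptw: "cmod (indicator A x *\<^sub>R c - c * g x) \<le> cmod c * indicator (U - K) x" for x
      proof -
        have "indicator A x *\<^sub>R c - c * g x = of_real (indicator A x - e x) * c"
          by (simp add: g_def scaleR_conv_of_real algebra_simps)
        then have "cmod (indicator A x *\<^sub>R c - c * g x) = \<bar>indicator A x - e x\<bar> * cmod c"
          by (simp only: norm_mult norm_of_real)
        moreover have "\<bar>indicator A x - e x\<bar> \<le> indicator (U - K) x"
          using eC(2,3,4,7)[of x] eC(6) KU(3,4) by (auto simp: indicator_def)
        ultimately show ?thesis by (simp add: mult.commute mult_left_mono)
      qed
      have "N (\<lambda>x. indicator A x *\<^sub>R c - c * g x) \<le> (\<integral>x. cmod c * indicator (U - K) x \<partial>M)"
        unfolding L1norm_def
      proof (rule integral_mono)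
        have "integrable M (\<lambda>x. indicator A x *\<^sub>R c)"
          using base by (intro integrable_scaleR_left integrable_real_indicator) auto
        then show "integrable M (\<lambda>x. cmod (indicator A x *\<^sub>R c - c * g x))"
          using Cc_integrable[OF Cc_cmult[OF gC]] by auto
        show "integrable M (\<lambda>x. cmod c * indicator (U - K) x)"
          using fin KU by (intro integrable_mult_right integrable_real_indicator) auto
      qed (rule ptw)
      also have "\<dots> = cmod c * measure M (U - K)" by simp
      also have "\<dots> \<le> cmod c * d" using KU by (intro mult_left_mono) auto
      also have "\<dots> < \<epsilon>"
        proof -
          have "cmod c + 1 \<noteq> 0" using norm_ge_zero[of c] by linarith
          then have "d * (cmod c + 1) = \<epsilon>" unfolding d_def by simp
          then show ?thesis using d by (simp add: algebra_simps)
        qed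
      finally show "\<exists>g\<in>Cc. N (\<lambda>x. indicator A x *\<^sub>R c - g x) < \<epsilon>"
        using Cc_cmult[OF gC] by (intro bexI[of _ "\<lambda>x. c * g x"])
    qed
  next
    case (add f g)
    show ?case
    proof (intro allI impI)
      fix \<epsilon> :: real assume "\<epsilon> > 0"
      then obtain f' g' where fg: "f' \<in> Cc" "g' \<in> Cc" "N (\<lambda>x. f x - f' x) < \<epsilon>/2" "N (\<lambda>x. g x - g' x) < \<epsilon>/2"
        using add.IH by (meson half_gt_zero)
      have "N (\<lambda>x. (f x - f' x) + (g x - g' x)) \<le> N (\<lambda>x. f x - f' x) + N (\<lambda>x. g x - g' x)"
        using add.hyps fg Cc_integrable by (intro N_add) auto
      then have "N (\<lambda>x. f x + g x - (f' x + g' x)) < \<epsilon>" using fg by (simp add: algebra_simps)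
      then show "\<exists>h\<in>Cc. N (\<lambda>x. f x + g x - h x) < \<epsilon>"
        using Cc_add[OF fg(1,2)] by (intro bexI[of _ "\<lambda>x. f' x + g' x"])
    qed
  next
    case (lim f s)
    show ?case
    proof (intro allI impI)
      fix \<epsilon> :: real assume e: "\<epsilon> > 0"
      have "(\<lambda>i. \<integral>\<^sup>+x. norm (f x - s i x) \<partial>M) \<longlonglongrightarrow> (\<integral>\<^sup>+x. norm (f x - f x) \<partial>M)"
      \<comment> \<open>The approximants of the induction rule are dominated by
        \<open>2 * norm (f x)\<close>, hence the differences by three times the norm.\<close>
      proof (rule nn_integral_dominated_convergence[where w="\<lambda>x. 3 * norm (f x)"])
        have "integrable M (\<lambda>x. 3 * norm (f x))" using lim by auto
        then have "(\<integral>\<^sup>+x. norm (3 * norm (f x)) \<partial>M) < \<infinity>" unfolding integrable_iff_bounded by simp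
        then show "(\<integral>\<^sup>+x. ennreal (3 * norm (f x)) \<partial>M) < \<infinity>" by simp
        show "AE x in M. ennreal (norm (f x - s j x)) \<le> ennreal (3 * norm (f x))" for j
        proof (rule AE_I2)
          fix x assume "x \<in> space M"
          then have "norm (s j x) \<le> 2 * norm (f x)" using lim by auto
          then show "ennreal (norm (f x - s j x)) \<le> ennreal (3 * norm (f x))"
            using norm_triangle_ineq4[of "f x" "s j x"] by (intro ennreal_leI) linarith
        qed
        show "AE x in M. (\<lambda>i. ennreal (norm (f x - s i x))) \<longlonglongrightarrow> ennreal (norm (f x - f x))"
        proof (rule AE_I2)
          fix x
          have "(\<lambda>i. s i x) \<longlonglongrightarrow> f x" using lim by auto
          then show "(\<lambda>i. ennreal (norm (f x - s i x))) \<longlonglongrightarrow> ennreal (norm (f x - f x))"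
            by (intro tendsto_ennrealI tendsto_norm tendsto_diff tendsto_const)
        qed
      qed (use lim in \<open>auto dest!: integrable_meas\<close>)
      then have "(\<lambda>i. \<integral>\<^sup>+x. norm (f x - s i x) \<partial>M) \<longlonglongrightarrow> 0" by simp
      then obtain i where i: "(\<integral>\<^sup>+x. norm (f x - s i x) \<partial>M) < ennreal (\<epsilon>/2)"
        using order_tendstoD(2)[of _ 0 sequentially "ennreal (\<epsilon>/2)"] e by (auto simp: eventually_sequentially)
      have "(\<integral>\<^sup>+x. norm (f x - s i x) \<partial>M) = ennreal (N (\<lambda>x. f x - s i x))"
        unfolding L1norm_def using lim by (intro nn_integral_eq_integral) auto
      then have si: "N (\<lambda>x. f x - s i x) < \<epsilon>/2" using i e by (simp add: ennreal_less_iff)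
      obtain g where g: "g \<in> Cc" "N (\<lambda>x. s i x - g x) < \<epsilon>/2" using lim.IH e by (meson half_gt_zero)
      have "N (\<lambda>x. f x - g x) < \<epsilon>"
        using N_tri[of f "s i" g] si g lim Cc_integrable by force
      then show "\<exists>g\<in>Cc. N (\<lambda>x. f x - g x) < \<epsilon>" using g by blast
    qed
  qed
  then show thesis using that assms(2) by blast
qed

text \<open>By density it is enough to treat \<open>g\<close> in \<open>Cc\<close>. For small
  \<open>v\<close> both \<open>g\<close> and its translate live in one compact set, where uniform
  continuity turns a sup bound into an L1 bound.\<close>

lemma lt_continuous:
  assumes "integrable M f" "0 < \<epsilon>"
  obtains V where "open V" "0 \<in> V" "\<And>v. v \<in> V \<Longrightarrow> N (\<lambda>x. lt v f x - f x) < \<epsilon>"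
proof -
  obtain g where g: "g \<in> Cc" "N (\<lambda>x. f x - g x) < \<epsilon>/3" using Cc_dense[OF assms(1), of "\<epsilon>/3"] assms(2) by auto
  then obtain C where C: "compact C" "\<And>x. x \<notin> C \<Longrightarrow> g x = 0" "continuous_on UNIV g"
    unfolding Cc_def by auto
  obtain V0 C0 where V0: "open V0" "compact (C0::'a set)" "0 \<in> V0" "V0 \<subseteq> C0" using compact_nhd .
  \<comment> \<open>Off \<open>D\<close> both \<open>g\<close> and \<open>lt v g\<close> vanish for
    every \<open>v\<close> in \<open>V0\<close>, since 0 and \<open>v\<close> lie in
    \<open>C0\<close>.\<close>
  define D where "D = {a + b | a b. a \<in> C0 \<and> b \<in> C}"
  have D: "compact D" unfolding D_def using V0 C by (intro compact_plus)
  define \<delta> where "\<delta> = \<epsilon> / (3 * (measure M D + 1))"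
  have m: "measure M D \<ge> 0" "3 * measure M D + 3 > 0" by (simp, smt (verit) measure_nonneg)
  have d: "\<delta> > 0" using assms(2) m unfolding \<delta>_def by (intro divide_pos_pos) auto
  have cont: "continuous_on (UNIV \<times> D) (\<lambda>(v,x). g (- v + x))"
    unfolding split_beta by (rule continuous_on_compose2[OF C(3)]) (auto intro!: continuous_intros)
  obtain X where X: "0 \<in> X" "open X" "\<forall>v\<in>X \<inter> UNIV. \<forall>x\<in>D. dist (case (v,x) of (v,x) \<Rightarrow> g (- v + x)) (case (0,x) of (v,x) \<Rightarrow> g (- v + x)) \<le> \<delta>"
    using continuous_on_prod_compactE[OF cont D, of 0 \<delta>] d by blast
  have "N (\<lambda>x. lt v f x - f x) < \<epsilon>" if v: "v \<in> X \<inter> V0" for v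
  proof -
    have "N (\<lambda>x. lt v g x - g x) \<le> \<delta> * measure M D"
    proof (rule N_compact_supp[OF _ D])
      show "(\<lambda>x. lt v g x - g x) \<in> borel_measurable borel"
        unfolding lt_def by (intro borel_measurable_continuous_onI continuous_intros continuous_on_compose2[OF C(3)] C) auto
      show out: "lt v g x - g x = 0" if "x \<notin> D" for x
      proof -
        have "x = v + (- v + x)" by (simp add: add.assoc[symmetric])
        then have "- v + x \<notin> C" using that v V0 unfolding D_def by blast
        moreover have "x = 0 + x" by simp
        then have "x \<notin> C" using that V0 unfolding D_def by blast
        ultimately show ?thesis using C by (simp add: lt_def)
      qed
      show "cmod (lt v g x - g x) \<le> \<delta>" for x
        using out[of x] X(3) v d by (cases "x \<in> D") (auto simp: lt_def dist_norm)
    qed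
    also have "\<dots> < \<epsilon>/3" using assms(2) m unfolding \<delta>_def by (simp add: field_simps)
    finally have 1: "N (\<lambda>x. lt v g x - g x) < \<epsilon>/3" .
    have "N (\<lambda>x. lt v f x - lt v g x) = N (\<lambda>x. f x - g x)"
      using N_lt[of "\<lambda>x. f x - g x" v] assms Cc_integrable[OF g(1)] by (simp add: lt_def)
    then show ?thesis
      using N_tri[of "lt v f" "lt v g" f] N_tri[of "lt v g" g f] 1 g integrable_lt assms(1) Cc_integrable[OF g(1)] N_minus[of f g]
      by force
  qed
  then show thesis using that[of "X \<inter> V0"] X V0 by auto
qed

section \<open>Sigma-compactness of supports and locally null sets\<close>

lemma sigma_compact_finite:
  assumes "E \<in> sets borel" "emeasure M E < \<infinity>"
  obtains C where "\<And>n. compact (C n)" "\<And>n. C n \<subseteq> E" "emeasure M (E - (\<Union>n::nat. C n)) = 0"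
proof -
  have "\<exists>K. compact K \<and> K \<subseteq> E \<and> measure M (E - K) < 1 / real (Suc n)" for n
  proof -
    obtain K U where KU: "compact K" "open U" "K \<subseteq> E" "E \<subseteq> U" "emeasure M U < \<infinity>" "measure M (U - K) < 1 / real (Suc n)"
      using regular[OF assms, of "1 / real (Suc n)"] by auto
    have "emeasure M (U - K) < \<infinity>" using KU by - (rule finite_emeasureI[of "U - K" U], auto)
    then have "measure M (E - K) \<le> measure M (U - K)"
      using KU assms(1) by (intro measure_mono_fmeasurable fmeasurableI) (auto intro!: sets.Diff)
    then show ?thesis using KU by force
  qed
  then obtain C where C: "\<And>n. compact (C n)" "\<And>n. C n \<subseteq> E" "\<And>n. measure M (E - C n) < 1 / real (Suc n)"
    by metis
  have b: "C n \<in> sets borel" for n using C by simp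
  have fin: "emeasure M (E - C n) < \<infinity>" for n using assms b by - (rule finite_emeasureI[of "E - C n" E], auto)
  have bU: "(\<Union>n. C n) \<in> sets borel" using b by auto
  have finE: "emeasure M (E - (\<Union>n. C n)) < \<infinity>" using assms bU by - (rule finite_emeasureI[of _ E], auto)
  have "measure M (E - (\<Union>n. C n)) \<le> 1 / real (Suc n)" for n
  proof -
    have "measure M (E - (\<Union>n. C n)) \<le> measure M (E - C n)"
      using fin[of n] b bU assms(1) by (intro measure_mono_fmeasurable) (auto intro: fmeasurableI)
    then show ?thesis using C(3)[of n] by linarith
  qed
  then have "measure M (E - (\<Union>n. C n)) \<le> 0"
    using LIMSEQ_inverse_real_of_nat by (intro LIMSEQ_le_const) (auto simp: inverse_eq_divide)
  then have "measure M (E - (\<Union>n. C n)) = 0" by (simp add: measure_le_0_iff)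
  then have "emeasure M (E - (\<Union>n. C n)) = 0" using emeasure_fin[OF finE] by simp
  then show thesis using that C by blast
qed

lemma finite_level:
  assumes "integrable M (f::'a \<Rightarrow> complex)" "c > 0"
  shows "emeasure M {x. c \<le> cmod (f x)} < \<infinity>" "{x. c \<le> cmod (f x)} \<in> sets borel"
proof -
  have m: "f \<in> borel_measurable borel" using assms integrable_meas by blast
  show s: "{x. c \<le> cmod (f x)} \<in> sets borel"
    using m by measurable
  have "ennreal c * emeasure M {x. c \<le> cmod (f x)} = (\<integral>\<^sup>+x. ennreal c * indicator {x. c \<le> cmod (f x)} x \<partial>M)"
    using s by (simp add: nn_integral_cmult_indicator)
  also have "\<dots> \<le> (\<integral>\<^sup>+x. ennreal (cmod (f x)) \<partial>M)"
    by (intro nn_integral_mono) (auto simp: indicator_def intro: ennreal_leI)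
  also have "\<dots> < \<infinity>" using assms(1) by (simp add: integrable_iff_bounded)
  finally show "emeasure M {x. c \<le> cmod (f x)} < \<infinity>"
    using assms(2) by (auto simp: ennreal_mult_less_top less_top[symmetric])
qed

lemma supp_levels: "{x. (f::'a\<Rightarrow>complex) x \<noteq> 0} = (\<Union>n. {x. 1 / real (Suc n) \<le> cmod (f x)})"
proof (intro equalityI subsetI)
  fix x assume "x \<in> {x. f x \<noteq> 0}"
  then have "cmod (f x) > 0" by simp
  then obtain n where "inverse (real (Suc n)) < cmod (f x)" using reals_Archimedean by blast
  then show "x \<in> (\<Union>n. {x. 1 / real (Suc n) \<le> cmod (f x)})" by (auto simp: inverse_eq_divide intro!: exI[of _ n])
next
  fix x assume "x \<in> (\<Union>n. {x. 1 / real (Suc n) \<le> cmod (f x)})"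
  then obtain n where n: "1 / real (Suc n) \<le> cmod (f x)" by auto
  have "0 < 1 / real (Suc n)" by simp
  then have "0 < cmod (f x)" using n by linarith
  then show "x \<in> {x. f x \<noteq> 0}" by simp
qed

text \<open>The support is a countable union of level sets of finite measure, and each of these is
  sigma-compact up to a null set. Results for functions with compact support are carried over along
  this increasing exhaustion.\<close>

lemma sigma_compact_supp:
  assumes "integrable M (f::'a \<Rightarrow> complex)"
  obtains C where "\<And>n. compact (C n)" "\<And>n. C n \<subseteq> {x. f x \<noteq> 0}" "incseq C" "AE x in M. f x \<noteq> 0 \<longrightarrow> x \<in> (\<Union>n::nat. C n)"
proof -
  define E where "E n = {x. 1 / real (Suc n) \<le> cmod (f x)}" for n
  have E: "E n \<in> sets borel" "emeasure M (E n) < \<infinity>" for n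
    using finite_level[OF assms, of "1 / real (Suc n)"] unfolding E_def by auto
  have "\<exists>C. (\<forall>m. compact (C m) \<and> C m \<subseteq> E n) \<and> emeasure M (E n - (\<Union>m::nat. C m)) = 0" for n
    using sigma_compact_finite[OF E(1,2), of n] by metis
  then obtain C where C: "\<And>n m. compact (C n m) \<and> C n m \<subseteq> E n" "\<And>n. emeasure M (E n - (\<Union>m::nat. C n m)) = 0"
    by metis
  define D where "D j = (\<Union>i\<le>j. C (fst (prod_decode i)) (snd (prod_decode i)))" for j
  have D1: "compact (D j)" for j unfolding D_def using C by (intro compact_UN) auto
  have D2: "D j \<subseteq> {x. f x \<noteq> 0}" for j
    unfolding D_def supp_levels E_def[symmetric] using C by blast
  have D3: "incseq D" unfolding D_def by (intro monoI UN_mono) auto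
  have DU: "(\<Union>j. D j) = (\<Union>n. \<Union>m. C n m)"
  proof (intro equalityI subsetI)
    fix x assume "x \<in> (\<Union>j. D j)"
    then obtain i where "x \<in> C (fst (prod_decode i)) (snd (prod_decode i))" unfolding D_def by blast
    then show "x \<in> (\<Union>n. \<Union>m. C n m)" by blast
  next
    fix x assume "x \<in> (\<Union>n. \<Union>m. C n m)"
    then obtain n m where "x \<in> C n m" by auto
    then have "x \<in> D (prod_encode (n,m))" unfolding D_def by (intro UN_I[of "prod_encode (n,m)"]) auto
    then show "x \<in> (\<Union>j. D j)" by auto
  qed
  have "AE x in M. x \<notin> E n - (\<Union>m. C n m)" for n
  proof (rule AE_not_in)
    have "(\<Union>m. C n m) \<in> sets borel" using C(1) by (intro sets.countable_UN) auto
    then show "E n - (\<Union>m. C n m) \<in> null_sets M" using C(2)[of n] E(1)[of n] by (simp add: null_sets_def)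
  qed
  then have "AE x in M. \<forall>n. x \<notin> E n - (\<Union>m. C n m)" by (subst AE_all_countable) auto
  then have "AE x in M. f x \<noteq> 0 \<longrightarrow> x \<in> (\<Union>j. D j)"
  proof eventually_elim
    case (elim x)
    show ?case
    proof
      assume "f x \<noteq> 0"
      then have "x \<in> (\<Union>n. E n)" using supp_levels[of f] unfolding E_def by blast
      then show "x \<in> (\<Union>j. D j)" using elim unfolding DU by blast
    qed
  qed
  then show thesis using that[of D] D1 D2 D3 by blast
qed

text \<open>On a group that is not sigma-compact, a set whose compact subsets are all null can have
  infinite measure. Inside the support of an integrable function this cannot happen: its level sets
  have finite measure and are exhausted by compact sets up to a null set.\<close>

lemma locally_null:
  assumes "integrable M (f::'a \<Rightarrow> complex)" "E \<in> sets borel" "E \<subseteq> {x. f x \<noteq> 0}"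
    "\<And>K. compact K \<Longrightarrow> K \<subseteq> E \<Longrightarrow> emeasure M K = 0"
  shows "AE x in M. x \<notin> E"
proof -
  have "AE x in M. x \<notin> E \<inter> {x. 1 / real (Suc n) \<le> cmod (f x)}" for n
  proof (rule AE_not_in)
    let ?E = "E \<inter> {x. 1 / real (Suc n) \<le> cmod (f x)}"
    have lev: "emeasure M {x. 1 / real (Suc n) \<le> cmod (f x)} < \<infinity>" "{x. 1 / real (Suc n) \<le> cmod (f x)} \<in> sets borel"
      using finite_level[OF assms(1), of "1 / real (Suc n)"] by auto
    have E: "?E \<in> sets borel" using assms(2) lev by (intro sets.Int)
    have E: "?E \<in> sets borel" "emeasure M ?E < \<infinity>"
      by (rule E, rule finite_emeasureI[OF E _ lev(2,1)]) auto
    obtain C where C: "\<And>n. compact (C n)" "\<And>n. C n \<subseteq> ?E" "emeasure M (?E - (\<Union>n::nat. C n)) = 0"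
      using sigma_compact_finite[OF E] by metis
    have "C m \<in> null_sets M" for m using C(1,2)[of m] assms(4)[of "C m"] by (auto simp: null_sets_def)
    then have 1: "(\<Union>m. C m) \<in> null_sets M" by (intro null_sets_UN) auto
    have "(\<Union>n. C n) \<in> sets borel" using C(1) by (intro sets.countable_UN) auto
    then have 2: "?E - (\<Union>n. C n) \<in> null_sets M" using C(3) E(1) by (simp add: null_sets_def)
    have "(?E - (\<Union>n. C n)) \<union> (\<Union>m. C m) \<in> null_sets M" by (intro null_sets.Un 1 2)
    moreover have "(?E - (\<Union>n. C n)) \<union> (\<Union>m. C m) = ?E" using C(2) by blast
    ultimately show "?E \<in> null_sets M" by simp
  qed
  then have "AE x in M. \<forall>n. x \<notin> E \<inter> {x. 1 / real (Suc n) \<le> cmod (f x)}" by (subst AE_all_countable) auto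
  then show ?thesis
    by eventually_elim (use assms(3) supp_levels[of f] in blast)
qed

lemma N_cutoff:
  assumes f: "integrable M f" and C: "\<And>n::nat. C n \<in> sets borel" "incseq C" "AE x in M. f x \<noteq> 0 \<longrightarrow> x \<in> (\<Union>n. C n)"
    and e: "0 < \<epsilon>"
  obtains n where "N (\<lambda>x. f x - indicator (C n) x * f x) < \<epsilon>"
proof -
  have m: "f \<in> borel_measurable borel" using f integrable_meas by blast
  have "(\<lambda>n. N (\<lambda>x. f x - indicator (C n) x * f x)) \<longlonglongrightarrow> (\<integral>x. 0 \<partial>M)"
    unfolding L1norm_def
  proof (rule integral_dominated_convergence[where w="\<lambda>x. cmod (f x)"])
    show "AE x in M. (\<lambda>n. cmod (f x - indicator (C n) x * f x)) \<longlonglongrightarrow> 0"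
      using C(3)
    proof eventually_elim
      case (elim x)
      show ?case
      proof (cases "f x = 0")
        case False
        then obtain n where n: "x \<in> C n" using elim by auto
        have "\<forall>k\<ge>n. cmod (f x - indicator (C k) x * f x) = 0"
        proof (intro allI impI)
          fix k assume "n \<le> k"
          then have "C n \<subseteq> C k" using C(2) by (rule incseqD[rotated])
          then show "cmod (f x - indicator (C k) x * f x) = 0" using n by auto
        qed
        then show ?thesis by (intro tendsto_eventually) (auto simp: eventually_sequentially)
      qed auto
    qed
    show "AE x in M. norm (cmod (f x - indicator (C n) x * f x)) \<le> cmod (f x)" for n
      by (intro AE_I2) (auto simp: indicator_def)
  qed (use f m C(1) in auto)
  then have "\<forall>\<^sub>F n in sequentially. N (\<lambda>x. f x - indicator (C n) x * f x) < \<epsilon>"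
    using e by (intro order_tendstoD(2)) auto
  then show thesis using that by (auto simp: eventually_sequentially)
qed

text \<open>The weights and nodes do not depend on the parameter \<open>x\<close>, nor on the member of the family.\<close>

lemma Riemann_sum:
  fixes \<Phi> :: "'i \<Rightarrow> 'a \<Rightarrow> 'b \<Rightarrow> complex"
  assumes a: "integrable M a" and C: "compact C" "\<And>y. y \<notin> C \<Longrightarrow> a y = 0"
    and U: "\<And>s. s \<in> C \<Longrightarrow> open (U s) \<and> s \<in> U s"
    and \<Phi>: "\<And>i x. i \<in> I \<Longrightarrow> (\<lambda>y. \<Phi> i y x) \<in> borel_measurable borel"
    and close: "\<And>i s y x. i \<in> I \<Longrightarrow> s \<in> C \<Longrightarrow> y \<in> U s \<Longrightarrow> y \<in> C \<Longrightarrow> cmod (\<Phi> i y x - \<Phi> i s x) \<le> \<epsilon>"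
  obtains S w where "finite S" "S \<subseteq> C" "(\<Sum>s\<in>S. cmod (w s)) \<le> N a" "(\<Sum>s\<in>S. w s) = (\<integral>y. a y \<partial>M)"
    "\<And>i x. i \<in> I \<Longrightarrow> cmod ((\<integral>y. a y * \<Phi> i y x \<partial>M) - (\<Sum>s\<in>S. w s * \<Phi> i s x)) \<le> \<epsilon> * N a"
proof -
  obtain S where S: "S \<subseteq> C" "finite S" "C \<subseteq> (\<Union>s\<in>S. U s)"
    using compactE_image[OF C(1), of C U] U by blast
  obtain n :: nat and h where h: "bij_betw h {..<card S} S"
    using S(2) by (metis atLeast0LessThan ex_bij_betw_nat_finite)
  define r where "r = inv_into {..<card S} h"
  have rh: "r (h i) = i" if "i < card S" for i
    unfolding r_def using h that by (simp add: bij_betw_def)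
  have hr: "h (r s) = s" "r s < card S" if "s \<in> S" for s
    unfolding r_def using h that f_inv_into_f[of s h "{..<card S}"] inv_into_into[of s h "{..<card S}"] by (auto simp: bij_betw_def)
  \<comment> \<open>The cover is made disjoint: of each \<open>U s\<close> only the part of
    \<open>C\<close> that no earlier \<open>U t\<close> covers is kept.\<close>
  define E where "E s = (C \<inter> U s) - (\<Union>t\<in>{t\<in>S. r t < r s}. U t)" for s
  have Eb: "E s \<in> sets borel" if "s \<in> S" for s
  proof -
    have "open (\<Union>t\<in>{t\<in>S. r t < r s}. U t)" "open (U s)" using U S that by auto
    then show ?thesis unfolding E_def using C(1) by (intro sets.Diff sets.Int compact_borel borel_open)
  qed
  have Edisj: "s = t" if "y \<in> E s" "y \<in> E t" "s \<in> S" "t \<in> S" for y s t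
  proof -
    have "\<not> r s < r t" "\<not> r t < r s" using that unfolding E_def by auto
    then have "r s = r t" by linarith
    then show ?thesis using hr(1) that by metis
  qed
  have Ecov: "\<exists>s\<in>S. y \<in> E s" if y: "y \<in> C" for y
  proof -
    have "y \<in> (\<Union>s\<in>S. U s)" using S(3) y by (rule subsetD)
    then obtain s0 where "s0 \<in> S" "y \<in> U s0" by (elim UN_E)
    then have "s0 \<in> S \<and> y \<in> U s0" by (rule conjI)
    \<comment> \<open>The piece that contains \<open>y\<close> belongs to the earliest node whose
      neighbourhood contains \<open>y\<close>.\<close>
    from ex_has_least_nat[of "\<lambda>s. s \<in> S \<and> y \<in> U s", OF this, of r]
    obtain s where s: "s \<in> S" "y \<in> U s" "\<And>t. t \<in> S \<Longrightarrow> y \<in> U t \<Longrightarrow> r s \<le> r t" by blast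
    have "\<not> (\<exists>t\<in>S. r t < r s \<and> y \<in> U t)" using s(3) leD by blast
    then have "y \<in> E s" unfolding E_def using s(2) y by blast
    then show ?thesis using s by blast
  qed
  have decomp: "a y * F y = (\<Sum>s\<in>S. indicator (E s) y * a y * F y)" for y and F :: "'a \<Rightarrow> complex"
  proof (cases "y \<in> C")
    case True
    then obtain s where s: "s \<in> S" "y \<in> E s" using Ecov by blast
    have "(\<Sum>t\<in>S. indicator (E t) y * a y * F y) = (\<Sum>t\<in>S. if t = s then a y * F y else 0)"
      using s Edisj by (intro sum.cong) (auto simp: indicator_def)
    then show ?thesis using s S by simp
  next
    case False
    then show ?thesis using C by simp
  qed
  \<comment> \<open>The weight of a node is the integral of \<open>a\<close> over its piece, so it
    sees neither \<open>\<Phi>\<close> nor \<open>x\<close>.\<close>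
  define w where "w s = (\<integral>y. indicator (E s) y * a y \<partial>M)" for s
  have am: "a \<in> borel_measurable borel" using a integrable_meas by blast
  have inta: "integrable M (\<lambda>y. indicator (E s) y * a y)" if "s \<in> S" for s
    by (rule Bochner_Integration.integrable_bound[OF a]) (use am Eb[OF that] in \<open>auto simp: indicator_def\<close>)
  have Nsum: "(\<Sum>s\<in>S. N (\<lambda>y. indicator (E s) y * a y)) = N a"
  proof -
    have "(\<Sum>s\<in>S. N (\<lambda>y. indicator (E s) y * a y)) = (\<integral>y. (\<Sum>s\<in>S. cmod (indicator (E s) y * a y)) \<partial>M)"
      unfolding L1norm_def using inta by (subst Bochner_Integration.integral_sum) auto
    also have "(\<lambda>y. \<Sum>s\<in>S. cmod (indicator (E s) y * a y)) = (\<lambda>y. cmod (a y))"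
    proof
      fix y
      show "(\<Sum>s\<in>S. cmod (indicator (E s) y * a y)) = cmod (a y)"
      proof (cases "y \<in> C")
        case True
        then obtain s where s: "s \<in> S" "y \<in> E s" using Ecov by blast
        have "(\<Sum>t\<in>S. cmod (indicator (E t) y * a y)) = (\<Sum>t\<in>S. if t = s then cmod (a y) else 0)"
          using s Edisj by (intro sum.cong) (auto simp: indicator_def)
        then show ?thesis using s S by simp
      qed (simp add: C)
    qed
    finally show ?thesis by (simp add: L1norm_def)
  qed
  have le: "cmod (w s) \<le> N (\<lambda>y. indicator (E s) y * a y)" for s
    unfolding w_def L1norm_def by (rule integral_norm_bound)
  show thesis
  proof (rule that[of S w])
    show "(\<Sum>s\<in>S. cmod (w s)) \<le> N a" unfolding Nsum[symmetric] by (intro sum_mono le)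
    show "(\<Sum>s\<in>S. w s) = (\<integral>y. a y \<partial>M)"
      unfolding w_def using inta decomp[of _ "\<lambda>_. 1"]
      by (subst Bochner_Integration.integral_sum[symmetric]) auto
    fix i x assume i: "i \<in> I"
    have F: "(\<lambda>y. \<Phi> i y x) \<in> borel_measurable borel" using \<Phi> i by auto
    have ptw: "cmod (indicator (E s) y * a y * \<Phi> i y x - indicator (E s) y * a y * \<Phi> i s x) \<le> \<epsilon> * cmod (indicator (E s) y * a y)"
      if "s \<in> S" for s y
    proof (cases "y \<in> E s")
      case True
      then have "cmod (\<Phi> i y x - \<Phi> i s x) \<le> \<epsilon>" using that S i by (intro close) (auto simp: E_def)
      then have "cmod (a y) * cmod (\<Phi> i y x - \<Phi> i s x) \<le> cmod (a y) * \<epsilon>" by (intro mult_left_mono) auto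
      then show ?thesis using True by (simp add: norm_mult[symmetric] right_diff_distrib mult.commute)
    qed auto
    have int1: "integrable M (\<lambda>y. indicator (E s) y * a y * \<Phi> i y x)" if "s \<in> S" for s
    proof (rule Bochner_Integration.integrable_bound[of M "\<lambda>y. (\<epsilon> + cmod (\<Phi> i s x)) *\<^sub>R (indicator (E s) y * a y)"])
      show "AE y in M. cmod (indicator (E s) y * a y * \<Phi> i y x) \<le> norm ((\<epsilon> + cmod (\<Phi> i s x)) *\<^sub>R (indicator (E s) y * a y))"
      proof (rule AE_I2)
        fix y
        have "cmod (indicator (E s) y * a y * \<Phi> i y x) \<le> cmod (indicator (E s) y * a y * \<Phi> i y x - indicator (E s) y * a y * \<Phi> i s x)
            + cmod (indicator (E s) y * a y * \<Phi> i s x)" using norm_triangle_sub by (simp add: add.commute)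
        also have "\<dots> \<le> (\<epsilon> + cmod (\<Phi> i s x)) * cmod (indicator (E s) y * a y)"
          using ptw[OF that, of y] by (simp add: norm_mult algebra_simps)
        also have "\<dots> \<le> norm ((\<epsilon> + cmod (\<Phi> i s x)) *\<^sub>R (indicator (E s) y * a y))"
          by (simp add: mult_right_mono)
        finally show "cmod (indicator (E s) y * a y * \<Phi> i y x) \<le> norm ((\<epsilon> + cmod (\<Phi> i s x)) *\<^sub>R (indicator (E s) y * a y))" .
      qed
    qed (use inta[OF that] am F Eb[OF that] in auto)
    have eq: "(\<integral>y. a y * \<Phi> i y x \<partial>M) - (\<Sum>s\<in>S. w s * \<Phi> i s x)
        = (\<Sum>s\<in>S. \<integral>y. indicator (E s) y * a y * \<Phi> i y x - indicator (E s) y * a y * \<Phi> i s x \<partial>M)"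
    proof -
      have "(\<integral>y. a y * \<Phi> i y x \<partial>M) = (\<Sum>s\<in>S. \<integral>y. indicator (E s) y * a y * \<Phi> i y x \<partial>M)"
        using int1 by (subst Bochner_Integration.integral_sum[symmetric]) (auto simp: decomp[of _ "\<lambda>y. \<Phi> i y x"])
      moreover have "(\<integral>y. indicator (E s) y * a y * \<Phi> i y x - indicator (E s) y * a y * \<Phi> i s x \<partial>M)
          = (\<integral>y. indicator (E s) y * a y * \<Phi> i y x \<partial>M) - w s * \<Phi> i s x" if "s \<in> S" for s
        unfolding w_def using int1[OF that] inta[OF that] by (subst Bochner_Integration.integral_diff) auto
      ultimately show ?thesis by (simp add: sum_subtractf)
    qed
    have "cmod (\<integral>y. indicator (E s) y * a y * \<Phi> i y x - indicator (E s) y * a y * \<Phi> i s x \<partial>M)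
        \<le> \<epsilon> * N (\<lambda>y. indicator (E s) y * a y)" if "s \<in> S" for s
    proof -
      have "cmod (\<integral>y. indicator (E s) y * a y * \<Phi> i y x - indicator (E s) y * a y * \<Phi> i s x \<partial>M)
        \<le> (\<integral>y. cmod (indicator (E s) y * a y * \<Phi> i y x - indicator (E s) y * a y * \<Phi> i s x) \<partial>M)"
        by (rule integral_norm_bound)
      also have "\<dots> \<le> (\<integral>y. \<epsilon> * cmod (indicator (E s) y * a y) \<partial>M)"
        using int1[OF that] inta[OF that] ptw[OF that] by (intro integral_mono) auto
      finally show ?thesis by (simp add: L1norm_def)
    qed
    then show "cmod ((\<integral>y. a y * \<Phi> i y x \<partial>M) - (\<Sum>s\<in>S. w s * \<Phi> i s x)) \<le> \<epsilon> * N a"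
      unfolding eq Nsum[symmetric] sum_distrib_left by (intro order.trans[OF norm_sum] sum_mono) auto
  qed (use S in auto)
qed

text \<open>Joint continuity and compactness of \<open>D\<close> give each node a neighbourhood on
  which \<open>\<Phi> i\<close> varies little, uniformly in \<open>x\<close>. The index set is
  finite, so these neighbourhoods can be intersected and all members share nodes and
  weights.\<close>

lemma Riemann_sum_compact:
  fixes \<Phi> :: "'i \<Rightarrow> 'a \<Rightarrow> 'a \<Rightarrow> complex"
  assumes a: "integrable M a" and C: "compact C" "\<And>y. y \<notin> C \<Longrightarrow> a y = 0" and I: "finite I"
    and cont: "\<And>i. i \<in> I \<Longrightarrow> continuous_on UNIV (\<lambda>(y,x). \<Phi> i y x)"
    and D: "compact D" "\<And>i y x. i \<in> I \<Longrightarrow> y \<in> C \<Longrightarrow> x \<notin> D \<Longrightarrow> \<Phi> i y x = 0" and e: "0 < \<epsilon>"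
  obtains S w where "finite S" "S \<subseteq> C" "(\<Sum>s\<in>S. cmod (w s)) \<le> N a" "(\<Sum>s\<in>S. w s) = (\<integral>y. a y \<partial>M)"
    "\<And>i x. i \<in> I \<Longrightarrow> cmod ((\<integral>y. a y * \<Phi> i y x \<partial>M) - (\<Sum>s\<in>S. w s * \<Phi> i s x)) \<le> \<epsilon>"
proof -
  define d where "d = \<epsilon> / (N a + 1)"
  have Na: "N a + 1 > 0" using N_nonneg[of a] by linarith
  have d: "d > 0" unfolding d_def using e Na by simp
  have "\<exists>X. s \<in> X \<and> open X \<and> (\<forall>y\<in>X. \<forall>x\<in>D. cmod (\<Phi> i y x - \<Phi> i s x) \<le> d)" if "i \<in> I" for i s
  proof -
    have "continuous_on (UNIV \<times> D) (\<lambda>(y,x). \<Phi> i y x)" using cont[OF that] continuous_on_subset by blast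
    from continuous_on_prod_compactE[OF this D(1) UNIV_I d, of s]
    obtain X where X: "s \<in> X" "open X" "\<forall>y\<in>X \<inter> UNIV. \<forall>x\<in>D. dist (case (y,x) of (y,x) \<Rightarrow> \<Phi> i y x) (case (s,x) of (y,x) \<Rightarrow> \<Phi> i y x) \<le> d" .
    show ?thesis using X by (intro exI[of _ X]) (simp add: dist_norm)
  qed
  then obtain X where X: "\<And>i s. i \<in> I \<Longrightarrow> s \<in> X i s \<and> open (X i s) \<and> (\<forall>y\<in>X i s. \<forall>x\<in>D. cmod (\<Phi> i y x - \<Phi> i s x) \<le> d)"
    by metis
  define U where "U s = (\<Inter>i\<in>I. X i s)" for s
  have U: "open (U s) \<and> s \<in> U s" for s unfolding U_def using X I by (auto intro!: open_INT)
  have meas: "(\<lambda>y. \<Phi> i y x) \<in> borel_measurable borel" if "i \<in> I" for i x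
  proof -
    have "continuous_on UNIV (\<lambda>y. (\<lambda>(y,x). \<Phi> i y x) (y, x))"
      by (rule continuous_on_compose2[OF cont[OF that]]) (auto intro!: continuous_intros)
    then show ?thesis by (auto intro: borel_measurable_continuous_onI)
  qed
  have close: "cmod (\<Phi> i y x - \<Phi> i s x) \<le> d" if "i \<in> I" "s \<in> C" "y \<in> U s" "y \<in> C" for i s y x
  proof (cases "x \<in> D")
    case True
    then show ?thesis using X that unfolding U_def by blast
  next
    case False
    then show ?thesis using D(2) that d by auto
  qed
  obtain S w where S: "finite S" "S \<subseteq> C" "(\<Sum>s\<in>S. cmod (w s)) \<le> N a" "(\<Sum>s\<in>S. w s) = (\<integral>y. a y \<partial>M)"
    "\<And>i x. i \<in> I \<Longrightarrow> cmod ((\<integral>y. a y * \<Phi> i y x \<partial>M) - (\<Sum>s\<in>S. w s * \<Phi> i s x)) \<le> d * N a"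
    using Riemann_sum[OF a C, of U I \<Phi> d] U meas close by blast
  have "d * N a \<le> \<epsilon>" unfolding d_def using e Na by (simp add: field_simps)
  then show thesis using S by (intro that[of S w]) (auto intro: order.trans)
qed

section \<open>Convolution\<close>

text \<open>The convolution of nonnegative functions, which makes sense at every point with values
  up to infinity. Its finiteness at \<open>x\<close> decides whether the integral defining
  \<open>conv\<close> converges there.\<close>

definition nnc :: "('a \<Rightarrow> ennreal) \<Rightarrow> ('a \<Rightarrow> ennreal) \<Rightarrow> 'a \<Rightarrow> ennreal" where
  "nnc a g x = (\<integral>\<^sup>+y. a y * g (- y + x) \<partial>M)"

section \<open>Convolution with bounded functions and with functions in \<open>Cc\<close>\<close>

lemma borel_reflect: "g \<in> measurable borel L \<Longrightarrow> (\<lambda>y. g (- y + x)) \<in> measurable borel L"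
  for x :: 'a
  by (rule borel_compose) (auto intro!: continuous_intros)

lemma borel_translate: "g \<in> measurable borel L \<Longrightarrow> (\<lambda>y. g (x + y)) \<in> measurable borel L"
  for x :: 'a
  by (rule borel_compose) (auto intro!: continuous_intros)

lemma borel_translate_right: "g \<in> measurable borel L \<Longrightarrow> (\<lambda>y. g (y + x)) \<in> measurable borel L"
  for x :: 'a
  by (rule borel_compose) (auto intro!: continuous_intros)

lemma borel_uminus: "g \<in> measurable borel L \<Longrightarrow> (\<lambda>y. g (- y :: 'a)) \<in> measurable borel L"
  by (rule borel_compose) (auto intro!: continuous_intros)

lemma integrable_mult_bounded:
  assumes "integrable M f" "g \<in> borel_measurable borel" "\<And>x. cmod (g x) \<le> B"
  shows "integrable M (\<lambda>x. f x * g x)"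
proof (rule Bochner_Integration.integrable_bound[of M "\<lambda>x. B * cmod (f x)"])
  show "integrable M (\<lambda>x. B * cmod (f x))" using assms by auto
  show "(\<lambda>x. f x * g x) \<in> borel_measurable M" using assms integrable_meas by auto
  show "AE x in M. cmod (f x * g x) \<le> norm (B * cmod (f x))"
  proof (rule AE_I2)
    fix x
    have "cmod (f x * g x) \<le> B * cmod (f x)"
      using mult_right_mono[OF assms(3)[of x], of "cmod (f x)"] by (simp add: norm_mult mult.commute)
    then show "cmod (f x * g x) \<le> norm (B * cmod (f x))" by simp
  qed
qed

lemma conv_swap:
  assumes "a \<in> borel_measurable borel" "g \<in> borel_measurable borel"
  shows "conv M a g x = (\<integral>y. a (x + y) * g (- y) \<partial>M)"
proof -
  have "(\<integral>y. a (x + y) * g (- (x + y) + x) \<partial>M) = (\<integral>y. a y * g (- y + x) \<partial>M)"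
    by (rule integral_translate[where f="\<lambda>y. a y * g (- y + x)"])
      (intro borel_measurable_times borel_reflect assms)
  moreover have "- (x + y) + x = - y" for y :: 'a
    by (simp add: minus_add add.assoc del: add_uminus_conv_diff)
  ultimately show ?thesis unfolding conv_def by simp
qed

text \<open>After the substitution of \<open>conv_swap\<close> the variable \<open>x\<close> enters
  only through a translate of \<open>a\<close>. Increments are thus bounded by \<open>B\<close>
  times the L1 modulus of continuity of translation.\<close>

lemma conv_continuous:
  assumes a: "integrable M a" and g: "g \<in> borel_measurable borel" "\<And>x. cmod (g x) \<le> B"
  shows "continuous_on UNIV (conv M a g)"
proof -
  have am: "a \<in> borel_measurable borel" using a integrable_meas by blast
  have B: "B \<ge> 0" using g(2)[of 0] norm_ge_zero order.trans by blast
  have lip: "cmod (conv M a g x - conv M a g x0) \<le> B * N (\<lambda>z. lt (x0 - x) a z - a z)" for x x0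
  proof -
    have i: "integrable M (\<lambda>y. a (x + y) * g (- y))" for x
      using integrable_mult_bounded[OF integrable_translate[OF a, of x] borel_uminus[OF g(1)]] g(2) by blast
    have "conv M a g x - conv M a g x0 = (\<integral>y. a (x + y) * g (- y) - a (x0 + y) * g (- y) \<partial>M)"
      unfolding conv_swap[OF am g(1)] by (rule Bochner_Integration.integral_diff[symmetric]) (rule i)+
    also have "cmod \<dots> \<le> (\<integral>y. cmod (a (x + y) * g (- y) - a (x0 + y) * g (- y)) \<partial>M)"
      by (rule integral_norm_bound)
    also have "\<dots> \<le> (\<integral>y. B * cmod (a (x + y) - a (x0 + y)) \<partial>M)"
    proof (rule integral_mono)
      show "integrable M (\<lambda>y. B * cmod (a (x + y) - a (x0 + y)))"
        by (intro integrable_mult_right integrable_norm Bochner_Integration.integrable_diff integrable_translate a)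
      fix y show "cmod (a (x + y) * g (- y) - a (x0 + y) * g (- y)) \<le> B * cmod (a (x + y) - a (x0 + y))"
        using mult_left_mono[OF g(2)[of "-y"], of "cmod (a (x + y) - a (x0 + y))"]
        by (simp add: norm_mult[symmetric] left_diff_distrib right_diff_distrib mult.commute)
    qed (intro integrable_norm Bochner_Integration.integrable_diff i)
    also have "\<dots> = B * (\<integral>y. cmod (a (x + y) - a (x0 + y)) \<partial>M)" by simp
    also have "(\<integral>y. cmod (a (x + y) - a (x0 + y)) \<partial>M) = N (\<lambda>z. lt (x0 - x) a z - a z)"
    proof -
      have "(\<integral>y. cmod (lt (x0 - x) a (x0 + y) - a (x0 + y)) \<partial>M) = (\<integral>z. cmod (lt (x0 - x) a z - a z) \<partial>M)"
        by (rule integral_translate[where f="\<lambda>z. cmod (lt (x0 - x) a z - a z)"])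
          (use integrable_lt[OF a, of "x0-x"] am integrable_meas in auto)
      moreover have "lt (x0 - x) a (x0 + y) = a (x + y)" for y
      proof -
        have "- (x0 - x) + (x0 + y) = x + y"
          by (simp add: add.assoc[symmetric])
        then show ?thesis by (simp add: lt_def)
      qed
      ultimately show ?thesis by (simp add: L1norm_def)
    qed
    finally show ?thesis .
  qed
  have "(conv M a g \<longlongrightarrow> conv M a g x0) (nhds x0)" for x0
  proof (rule tendstoI)
    fix \<epsilon> :: real assume e: "\<epsilon> > 0"
    have B1: "B + 1 > 0" using B by simp
    have "\<epsilon> / (B + 1) > 0" using e B1 by simp
    then obtain V where V: "open V" "0 \<in> V" "\<And>v. v \<in> V \<Longrightarrow> N (\<lambda>x. lt v a x - a x) < \<epsilon> / (B + 1)"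
      by (rule lt_continuous[OF a]) (rule that; (assumption | blast))
    have "open ((\<lambda>x. x0 - x) -` V)" using V by (intro open_vimage continuous_intros)
    moreover have "x0 \<in> (\<lambda>x. x0 - x) -` V" using V by simp
    moreover have "dist (conv M a g x) (conv M a g x0) < \<epsilon>" if "x \<in> (\<lambda>x. x0 - x) -` V" for x
    proof -
      have "N (\<lambda>z. lt (x0 - x) a z - a z) < \<epsilon> / (B + 1)" using V(3) that by auto
      then have "(B + 1) * N (\<lambda>z. lt (x0 - x) a z - a z) < \<epsilon>" using B1 by (simp add: field_simps)
      moreover have "B * N (\<lambda>z. lt (x0 - x) a z - a z) \<le> (B + 1) * N (\<lambda>z. lt (x0 - x) a z - a z)"
        by (intro mult_right_mono) auto
      ultimately show ?thesis using lip[of x x0] unfolding dist_norm by linarith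
    qed
    ultimately show "\<forall>\<^sub>F x in nhds x0. dist (conv M a g x) (conv M a g x0) < \<epsilon>"
      unfolding eventually_nhds by blast
  qed
  then show ?thesis
    unfolding continuous_on_def by (blast intro: tendsto_mono[OF at_within_le_nhds])
qed

text \<open>The set where \<open>F\<close> is nonzero is open, and nonempty open sets have positive
  measure.\<close>

lemma continuous_AE_zero:
  assumes "continuous_on UNIV (F::'a \<Rightarrow> complex)" "AE x in M. F x = 0"
  shows "F x = 0"
proof (rule ccontr)
  assume ne: "F x \<noteq> 0"
  have o: "open {x. F x \<noteq> 0}"
    using open_vimage[of "-{0}" F] assms(1) by (simp add: vimage_def Collect_neg_eq open_Compl)
  then have "emeasure M {x. F x \<noteq> 0} > 0" using emeasure_open_pos ne by blast
  moreover have "{x. F x \<noteq> 0} \<in> null_sets M"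
    using assms(2) o by (subst (asm) AE_iff_null) auto
  ultimately show False by (auto simp: null_sets_def)
qed

text \<open>Convolution and Riemann sum both vanish off the compact set of sums of points of
  \<open>C\<close> and of the supports, so a uniform error bound becomes an L1 bound.\<close>

lemma conv_approx_Cc:
  fixes h :: "'i \<Rightarrow> 'a \<Rightarrow> complex"
  assumes a: "integrable M a" and C: "compact C" "\<And>y. y \<notin> C \<Longrightarrow> a y = 0" and I: "finite I"
    and h: "\<And>i. i \<in> I \<Longrightarrow> h i \<in> Cc" and e: "0 < \<epsilon>"
  obtains S w where "finite S" "S \<subseteq> C" "(\<Sum>s\<in>S. cmod (w s)) \<le> N a" "(\<Sum>s\<in>S. w s) = (\<integral>y. a y \<partial>M)"
    "\<And>i. i \<in> I \<Longrightarrow> integrable M (conv M a (h i))"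
    "\<And>i. i \<in> I \<Longrightarrow> N (\<lambda>x. conv M a (h i) x - (\<Sum>s\<in>S. w s * lt s (h i) x)) \<le> \<epsilon>"
proof -
  have "\<forall>i\<in>I. \<exists>D. compact D \<and> (\<forall>x. x \<notin> D \<longrightarrow> h i x = 0)" using h unfolding Cc_def by blast
  then obtain Q where Q: "\<And>i. i \<in> I \<Longrightarrow> compact (Q i)" "\<And>i x. i \<in> I \<Longrightarrow> x \<notin> Q i \<Longrightarrow> h i x = 0" by metis
  define D where "D = {y + c | y c. y \<in> C \<and> c \<in> (\<Union>i\<in>I. Q i)}"
  have D: "compact D" unfolding D_def using C Q I by (intro compact_plus compact_UN) auto
  have out: "h i (- y + x) = 0" if "i \<in> I" "y \<in> C" "x \<notin> D" for i y x
  proof (rule ccontr)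
    assume "h i (- y + x) \<noteq> 0"
    then have "- y + x \<in> Q i" using Q that by blast
    moreover have "x = y + (- y + x)" by (simp add: add.assoc[symmetric])
    ultimately have "x \<in> D" unfolding D_def using that by blast
    then show False using that by simp
  qed
  define d where "d = \<epsilon> / (measure M D + 1)"
  have m: "measure M D + 1 > 0" using measure_nonneg[of M D] by linarith
  have d: "d > 0" unfolding d_def using e m by simp
  have cont: "continuous_on UNIV (\<lambda>(y,x). h i (- y + x))" if "i \<in> I" for i
  proof -
    have "continuous_on UNIV (h i)" using h that by (simp add: Cc_def)
    moreover have "continuous_on UNIV (\<lambda>p. - fst p + snd p :: 'a)" by (intro continuous_intros)
    ultimately show ?thesis unfolding split_beta using continuous_on_compose2[of UNIV "h i" UNIV "\<lambda>p. - fst p + snd p"] by simp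
  qed
  obtain S w where S: "finite S" "S \<subseteq> C" "(\<Sum>s\<in>S. cmod (w s)) \<le> N a" "(\<Sum>s\<in>S. w s) = (\<integral>y. a y \<partial>M)"
    "\<And>i x. i \<in> I \<Longrightarrow> cmod ((\<integral>y. a y * h i (- y + x) \<partial>M) - (\<Sum>s\<in>S. w s * h i (- s + x))) \<le> d"
    using Riemann_sum_compact[OF a C I, of "\<lambda>i y x. h i (- y + x)" D d] cont D out d by blast
  have meas: "conv M a (h i) \<in> borel_measurable borel" if i: "i \<in> I" for i
  proof -
    obtain C B where "compact C" "\<And>x. x \<notin> C \<Longrightarrow> h i x = 0" and B: "\<And>x. cmod (h i x) \<le> B" and "0 \<le> B"
      by (rule Cc_bounded[OF h[OF i]]) (rule that; (assumption | blast))
    show ?thesis by (intro borel_measurable_continuous_onI conv_continuous[OF a Cc_meas[OF h[OF i]] B])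
  qed
  have zero: "conv M a (h i) x = 0" if "i \<in> I" "x \<notin> D" for i x
  proof -
    have "(\<lambda>y. a y * h i (- y + x)) = (\<lambda>_. 0)"
    proof
      fix y show "a y * h i (- y + x) = 0" using out[OF that(1) _ that(2), of y] C(2)[of y] by (cases "y \<in> C") simp_all
    qed
    then show ?thesis unfolding conv_def by simp
  qed
  have zero2: "(\<Sum>s\<in>S. w s * lt s (h i) x) = 0" if "i \<in> I" "x \<notin> D" for i x
  proof (rule sum.neutral, rule ballI)
    fix s assume "s \<in> S"
    then have "s \<in> C" using S(2) by blast
    then show "w s * lt s (h i) x = 0" unfolding lt_def using out[OF that(1) _ that(2)] by simp
  qed
  have meas2: "(\<lambda>x. \<Sum>s\<in>S. w s * lt s (h i) x) \<in> borel_measurable borel" if "i \<in> I" for i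
    unfolding lt_def by (intro borel_measurable_sum borel_measurable_times borel_measurable_const borel_translate Cc_meas h that)
  have bd: "cmod (conv M a (h i) x - (\<Sum>s\<in>S. w s * lt s (h i) x)) \<le> d" if "i \<in> I" for i x
    using S(5)[OF that, of x] by (simp add: conv_def lt_def)
  show thesis
  proof (rule that[OF S(1-4)])
    fix i assume i: "i \<in> I"
    have "integrable M (\<lambda>x. conv M a (h i) x - (\<Sum>s\<in>S. w s * lt s (h i) x))"
      using zero[OF i] zero2[OF i] bd[OF i] meas[OF i] meas2[OF i]
      by (intro integrable_compact_supp[OF _ D, where B=d]) auto
    moreover have "integrable M (\<lambda>x. \<Sum>s\<in>S. w s * lt s (h i) x)"
      by (intro Bochner_Integration.integrable_sum integrable_mult_right integrable_lt Cc_integrable h i)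
    ultimately have "integrable M (\<lambda>x. (conv M a (h i) x - (\<Sum>s\<in>S. w s * lt s (h i) x)) + (\<Sum>s\<in>S. w s * lt s (h i) x))"
      by (rule Bochner_Integration.integrable_add)
    then show "integrable M (conv M a (h i))" by simp
    have "N (\<lambda>x. conv M a (h i) x - (\<Sum>s\<in>S. w s * lt s (h i) x)) \<le> d * measure M D"
      using zero[OF i] zero2[OF i] bd[OF i] meas[OF i] meas2[OF i]
      by (intro N_compact_supp[OF _ D]) auto
    also have "\<dots> \<le> \<epsilon>" unfolding d_def using e m by (simp add: field_simps)
    finally show "N (\<lambda>x. conv M a (h i) x - (\<Sum>s\<in>S. w s * lt s (h i) x)) \<le> \<epsilon>" .
  qed
qed

lemma N_lincomb:
  assumes "integrable M h" "finite S"
  shows "N (\<lambda>x. \<Sum>s\<in>S. w s * lt s h x) \<le> (\<Sum>s\<in>S. cmod (w s)) * N h"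
proof -
  have "N (\<lambda>x. \<Sum>s\<in>S. w s * lt s h x) \<le> (\<Sum>s\<in>S. N (\<lambda>x. w s * lt s h x))"
    by (intro N_sum integrable_mult_right integrable_lt assms)
  also have "\<dots> = (\<Sum>s\<in>S. cmod (w s)) * N h"
    by (simp add: N_cmult N_lt[OF assms(1)] sum_distrib_right)
  finally show ?thesis .
qed

lemma integrable_lincomb:
  "integrable M (h::'a \<Rightarrow> complex) \<Longrightarrow> integrable M (\<lambda>x. \<Sum>s\<in>S. w s * lt s h x)"
  by (intro Bochner_Integration.integrable_sum integrable_mult_right integrable_lt)

lemma conv_approx_Cc1:
  assumes a: "integrable M a" and C: "compact C" "\<And>y. y \<notin> C \<Longrightarrow> a y = 0" and h: "h \<in> Cc" and e: "0 < \<epsilon>"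
  shows "\<exists>S w. finite S \<and> (\<Sum>s\<in>S. cmod (w s)) \<le> N a \<and> (\<Sum>s\<in>S. w s) = (\<integral>y. a y \<partial>M) \<and>
    integrable M (conv M a h) \<and> N (\<lambda>x. conv M a h x - (\<Sum>s\<in>S. w s * lt s h x)) \<le> \<epsilon>"
proof (rule conv_approx_Cc[where I="{()}" and h="\<lambda>_::unit. h", OF a C(1) _ _ _ e])
  fix S w
  assume "finite S" "S \<subseteq> C" "(\<Sum>s\<in>S. cmod (w s)) \<le> N a" "(\<Sum>s\<in>S. w s) = (\<integral>y. a y \<partial>M)"
    "\<And>i. i \<in> {()} \<Longrightarrow> integrable M (conv M a h)"
    "\<And>i. i \<in> {()} \<Longrightarrow> N (\<lambda>x. conv M a h x - (\<Sum>s\<in>S. w s * lt s h x)) \<le> \<epsilon>"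
  then show ?thesis by (intro exI[of _ S] exI[of _ w]) simp
qed (use C(2) h in simp_all)

text \<open>The Riemann sums have norm at most \<open>N a * N h\<close>, because translation
  preserves the norm and the weights have total mass at most \<open>N a\<close>.\<close>

lemma conv_Cc:
  assumes a: "integrable M a" and C: "compact C" "\<And>y. y \<notin> C \<Longrightarrow> a y = 0" and h: "h \<in> Cc"
  shows "integrable M (conv M a h)" "N (conv M a h) \<le> N a * N h"
proof -
  show int: "integrable M (conv M a h)"
    using conv_approx_Cc1[OF a C h zero_less_one] by blast
  have "N (conv M a h) \<le> N a * N h + \<epsilon>" if e: "\<epsilon> > 0" for \<epsilon>
  proof -
    obtain S w where S: "finite S" "(\<Sum>s\<in>S. cmod (w s)) \<le> N a" "(\<Sum>s\<in>S. w s) = (\<integral>y. a y \<partial>M)"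
      "N (\<lambda>x. conv M a h x - (\<Sum>s\<in>S. w s * lt s h x)) \<le> \<epsilon>"
      using conv_approx_Cc1[OF a C h e] by blast
    note S = S(1,2,4)
    have ih: "integrable M h" using h Cc_integrable by blast
    have "N (conv M a h) \<le> N (\<lambda>x. \<Sum>s\<in>S. w s * lt s h x) + N (\<lambda>x. conv M a h x - (\<Sum>s\<in>S. w s * lt s h x))"
      using N_rev[OF int integrable_lincomb[OF ih, of w S]] by linarith
    also have "\<dots> \<le> (\<Sum>s\<in>S. cmod (w s)) * N h + \<epsilon>"
      using N_lincomb[OF ih S(1), of w] S(3) by linarith
    also have "\<dots> \<le> N a * N h + \<epsilon>" using S(2) by (intro add_right_mono mult_right_mono) auto
    finally show ?thesis .
  qed
  then show "N (conv M a h) \<le> N a * N h" by (rule field_le_epsilon)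
qed

text \<open>Translation preserves integrals, so a Riemann sum integrates to the sum of its weights
  times the integral of \<open>h\<close>. This stands in for Fubini.\<close>

lemma integral_conv_Cc:
  assumes a: "integrable M a" and C: "compact C" "\<And>y. y \<notin> C \<Longrightarrow> a y = 0" and h: "h \<in> Cc"
  shows "(\<integral>x. conv M a h x \<partial>M) = (\<integral>x. a x \<partial>M) * (\<integral>x. h x \<partial>M)"
proof -
  have "cmod ((\<integral>x. conv M a h x \<partial>M) - (\<integral>x. a x \<partial>M) * (\<integral>x. h x \<partial>M)) \<le> 0 + \<epsilon>" if e: "\<epsilon> > 0" for \<epsilon>
  proof -
    obtain S w where S: "finite S" "(\<Sum>s\<in>S. cmod (w s)) \<le> N a" "(\<Sum>s\<in>S. w s) = (\<integral>y. a y \<partial>M)"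
      "N (\<lambda>x. conv M a h x - (\<Sum>s\<in>S. w s * lt s h x)) \<le> \<epsilon>"
      using conv_approx_Cc1[OF a C h e] by blast
    note S = S(1,3,4)
    have ih: "integrable M h" using h Cc_integrable by blast
    have "(\<integral>x. (\<Sum>s\<in>S. w s * lt s h x) \<partial>M) = (\<Sum>s\<in>S. w s * (\<integral>x. lt s h x \<partial>M))"
      using integrable_lt[OF ih] by (subst Bochner_Integration.integral_sum) auto
    also have "\<dots> = (\<Sum>s\<in>S. w s) * (\<integral>x. h x \<partial>M)"
      unfolding lt_def using integral_translate[OF Cc_meas[OF h]] by (simp add: sum_distrib_right)
    finally have "(\<integral>x. conv M a h x \<partial>M) - (\<integral>x. a x \<partial>M) * (\<integral>x. h x \<partial>M) = (\<integral>x. conv M a h x - (\<Sum>s\<in>S. w s * lt s h x) \<partial>M)"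
      using S(2) conv_Cc(1)[OF a C h] integrable_lincomb[OF ih, of w S] by simp
    then show ?thesis
      using order.trans[OF integral_norm_bound S(3)[unfolded L1norm_def]] by simp
  qed
  then have "cmod ((\<integral>x. conv M a h x \<partial>M) - (\<integral>x. a x \<partial>M) * (\<integral>x. h x \<partial>M)) \<le> 0" by (rule field_le_epsilon)
  then show ?thesis by simp
qed

section \<open>The L1 bound for nonnegative convolutions\<close>

definition absc :: "('a \<Rightarrow> complex) \<Rightarrow> 'a \<Rightarrow> complex" where "absc a = (\<lambda>y. complex_of_real (cmod (a y)))"

lemma absc_integrable: "integrable M a \<Longrightarrow> integrable M (absc a)"
  unfolding absc_def by (intro integrable_of_real integrable_norm)

lemma N_absc [simp]: "N (absc a) = N a"
  unfolding L1norm_def absc_def by simp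

lemma nn_N: "integrable M f \<Longrightarrow> (\<integral>\<^sup>+x. ennreal (cmod (f x)) \<partial>M) = ennreal (N f)"
  unfolding L1norm_def by (intro nn_integral_eq_integral) auto

text \<open>For bounded \<open>r\<close> the nonnegative convolution agrees with the Bochner
  convolution of \<open>absc a\<close>, which carries continuity and norm bounds over to
  \<open>nnc\<close>.\<close>

lemma nnc_bounded:
  assumes a: "integrable M a" and r: "r \<in> borel_measurable borel" "\<And>x. 0 \<le> r x" "\<And>x. r x \<le> (B::real)"
  shows "nnc (\<lambda>y. ennreal (cmod (a y))) (\<lambda>y. ennreal (r y)) x = ennreal (cmod (conv M (absc a) (\<lambda>y. complex_of_real (r y)) x))"
proof -
  have i: "integrable M (\<lambda>y. cmod (a y) * r (- y + x))"
  proof -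
    have "integrable M (\<lambda>y. absc a y * complex_of_real (r (- y + x)))"
      using r(2,3) order.trans by (intro integrable_mult_bounded[OF absc_integrable[OF a], where B=B] borel_reflect[where g="\<lambda>z. complex_of_real (r z)"])
        (use r in auto)
    then have "integrable M (\<lambda>y. Re (absc a y * complex_of_real (r (- y + x))))" by (rule integrable_Re)
    then show ?thesis by (simp add: absc_def)
  qed
  have "nnc (\<lambda>y. ennreal (cmod (a y))) (\<lambda>y. ennreal (r y)) x = (\<integral>\<^sup>+y. ennreal (cmod (a y) * r (- y + x)) \<partial>M)"
    unfolding nnc_def using r by (intro nn_integral_cong) (simp add: ennreal_mult)
  also have "\<dots> = ennreal (\<integral>y. cmod (a y) * r (- y + x) \<partial>M)"
    using r by (intro nn_integral_eq_integral i) auto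
  also have "(\<integral>y. cmod (a y) * r (- y + x) \<partial>M) = cmod (conv M (absc a) (\<lambda>y. complex_of_real (r y)) x)"
  proof -
    have "conv M (absc a) (\<lambda>y. complex_of_real (r y)) x = (\<integral>y. complex_of_real (cmod (a y) * r (- y + x)) \<partial>M)"
      unfolding conv_def absc_def by simp
    also have "\<dots> = complex_of_real (\<integral>y. cmod (a y) * r (- y + x) \<partial>M)" by (rule integral_complex_of_real)
    moreover have "0 \<le> (\<integral>y. cmod (a y) * r (- y + x) \<partial>M)" using r by (intro Bochner_Integration.integral_nonneg) auto
    ultimately show ?thesis by simp
  qed
  finally show ?thesis .
qed

lemma indicator_reflect: "E \<in> sets borel \<Longrightarrow> (\<lambda>y. indicator E (- y + x) :: ennreal) \<in> borel_measurable borel"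
  for x :: 'a
  by (rule borel_reflect) simp

lemma nnc_indicator:
  assumes "integrable M a" "E \<in> sets borel"
  shows "nnc (\<lambda>y. ennreal (cmod (a y))) (indicator E) x = ennreal (cmod (conv M (absc a) (indicator E) x))"
proof -
  have "indicator E = (\<lambda>y. ennreal (indicator E y :: real))" "indicator E = (\<lambda>y. complex_of_real (indicator E y :: real))"
    by (auto simp: indicator_def fun_eq_iff)
  then show ?thesis using nnc_bounded[OF assms(1), of "indicator E" 1] assms(2) by simp
qed

lemma conv_indicator_continuous:
  assumes "integrable M a" "E \<in> sets borel"
  shows "continuous_on UNIV (conv M a (indicator E))"
  using conv_continuous[OF assms(1), of "indicator E" 1] assms(2) by (simp add: indicator_def)

text \<open>A Urysohn function supported in a slightly larger open set dominates the indicator of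
  \<open>E\<close>, and the norm bound for \<open>Cc\<close> applies to it.\<close>

lemma nnc_compact:
  assumes a: "integrable M a" and C: "compact C" "\<And>y. y \<notin> C \<Longrightarrow> a y = 0" and E: "compact E"
  shows "(\<integral>\<^sup>+x. nnc (\<lambda>y. ennreal (cmod (a y))) (indicator E) x \<partial>M) \<le> ennreal (N a) * emeasure M E"
proof -
  have Na: "N a + 1 > 0" using N_nonneg[of a] by linarith
  have fE: "emeasure M E < \<infinity>" using emeasure_compact E by blast
  have "(\<integral>\<^sup>+x. nnc (\<lambda>y. ennreal (cmod (a y))) (indicator E) x \<partial>M) \<le> ennreal (N a * measure M E) + ennreal \<epsilon>"
    if e: "\<epsilon> > 0" for \<epsilon>
  proof -
    define d where "d = \<epsilon> / (N a + 1)"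
    have d: "d > 0" unfolding d_def using e Na by simp
    obtain U where U: "open U" "E \<subseteq> U" "emeasure M U < \<infinity>" "measure M (U - E) < d"
      using outer_approx[OF compact_borel[OF E] fE d] .
    obtain u Q where u: "continuous_on UNIV (u::'a \<Rightarrow> real)" "\<And>x. 0 \<le> u x" "\<And>x. u x \<le> 1" "\<And>x. x \<in> E \<Longrightarrow> u x = 1"
      "compact Q" "Q \<subseteq> U" "\<And>x. x \<notin> Q \<Longrightarrow> u x = 0"
      by (rule Urysohn_compact[OF E U(1,2)]) (rule that; (assumption | blast))
    define h where "h = (\<lambda>x. complex_of_real (u x))"
    have h: "h \<in> Cc" unfolding Cc_def h_def using u(5,7) by (auto intro!: continuous_intros u(1) exI[of _ Q])
    have Cc': "\<And>y. y \<notin> C \<Longrightarrow> absc a y = 0" using C(2) by (simp add: absc_def)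
    have um: "u \<in> borel_measurable borel" using u(1) by (rule borel_measurable_continuous_onI)
    have "(\<integral>\<^sup>+x. nnc (\<lambda>y. ennreal (cmod (a y))) (indicator E) x \<partial>M)
        \<le> (\<integral>\<^sup>+x. nnc (\<lambda>y. ennreal (cmod (a y))) (\<lambda>y. ennreal (u y)) x \<partial>M)"
      unfolding nnc_def using u(2,4) by (intro nn_integral_mono mult_left_mono) (auto simp: indicator_def)
    also have "\<dots> = (\<integral>\<^sup>+x. ennreal (cmod (conv M (absc a) h x)) \<partial>M)"
      unfolding h_def using nnc_bounded[OF a um u(2,3)] by simp
    also have "\<dots> = ennreal (N (conv M (absc a) h))"
      by (intro nn_N conv_Cc(1)[OF absc_integrable[OF a] C(1) Cc' h])
    also have "\<dots> \<le> ennreal (N a * N h)"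
      using conv_Cc(2)[OF absc_integrable[OF a] C(1) Cc' h] by (intro ennreal_leI) simp
    also have "N h \<le> measure M E + d"
    proof -
      have "N h \<le> (\<integral>x. indicator U x \<partial>M)"
        unfolding L1norm_def
      proof (rule integral_mono)
        show "integrable M (\<lambda>x. cmod (h x))" using Cc_integrable[OF h] by auto
        show "integrable M (indicator U :: 'a \<Rightarrow> real)" using U by (intro integrable_real_indicator) auto
        show "cmod (h x) \<le> indicator U x" for x
          using u(2)[of x] u(3)[of x] u(7)[of x] u(6) by (auto simp: indicator_def h_def)
      qed
      also have "\<dots> = measure M U" by simp
      also have "\<dots> \<le> measure M E + d"
        using measure_Diff'[OF borel_open[OF U(1)] compact_borel[OF E] U(2,3)] U(4) by linarith
      finally show ?thesis .
    qed
    then have "ennreal (N a * N h) \<le> ennreal (N a * (measure M E + d))" by (intro ennreal_leI mult_left_mono) auto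
    also have "N a * (measure M E + d) \<le> N a * measure M E + \<epsilon>"
      using Na e unfolding d_def by (simp add: field_simps)
    then have "ennreal (N a * (measure M E + d)) \<le> ennreal (N a * measure M E) + ennreal \<epsilon>"
      using e by (simp add: ennreal_plus[symmetric] ennreal_leI del: ennreal_plus)
    finally show ?thesis .
  qed
  then have "(\<integral>\<^sup>+x. nnc (\<lambda>y. ennreal (cmod (a y))) (indicator E) x \<partial>M) \<le> ennreal (N a * measure M E)"
    by - (rule ennreal_le_epsilon)
  then show ?thesis by (simp only: emeasure_fin[OF fE] ennreal_mult[OF N_nonneg measure_nonneg])
qed

text \<open>With \<open>K'\<close> the reflected set, the convolution of the indicators of
  \<open>K\<close> and \<open>K'\<close> has the value \<open>measure M K\<close> at
  \<open>x\<close>. It is continuous, and the L1 bound makes it zero almost everywhere when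
  \<open>K'\<close> is null. Null sets are thus seen to survive inversion without a modular
  function.\<close>

lemma null_reflect:
  assumes K: "compact K" and z: "emeasure M ((\<lambda>y. - y + x) ` K) = 0"
  shows "emeasure M K = 0"
proof -
  let ?K' = "(\<lambda>y. - y + x) ` K"
  let ?a = "indicator K :: 'a \<Rightarrow> complex"
  have K': "compact ?K'" using K by (intro compact_continuous_image continuous_intros)
  have a: "integrable M ?a"
    by (rule integrable_compact_supp[OF borel_measurable_indicator[OF compact_borel[OF K]] K, where B=1]) (auto simp: indicator_def)
  have abs: "absc ?a = ?a" by (auto simp: absc_def indicator_def)
  have "(\<integral>\<^sup>+x. nnc (\<lambda>y. ennreal (cmod (?a y))) (indicator ?K') x \<partial>M) \<le> ennreal (N ?a) * emeasure M ?K'"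
    by (rule nnc_compact[OF a K _ K']) auto
  then have "(\<integral>\<^sup>+x. ennreal (cmod (conv M ?a (indicator ?K') x)) \<partial>M) = 0"
    using z nnc_indicator[OF a compact_borel[OF K']] abs by simp
  moreover have cont: "continuous_on UNIV (conv M ?a (indicator ?K'))"
    by (rule conv_indicator_continuous[OF a compact_borel[OF K']])
  ultimately have "AE x in M. ennreal (cmod (conv M ?a (indicator ?K') x)) = 0"
    using borel_measurable_continuous_onI[OF cont] by (subst (asm) nn_integral_0_iff_AE) auto
  then have "AE x in M. conv M ?a (indicator ?K') x = 0" by auto
  then have "conv M ?a (indicator ?K') x = 0" by (rule continuous_AE_zero[OF cont])
  moreover have "conv M ?a (indicator ?K') x = (\<integral>y. ?a y \<partial>M)"
    unfolding conv_def by (intro Bochner_Integration.integral_cong) (auto simp: indicator_def)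
  moreover have "(\<integral>y. ?a y \<partial>M) = complex_of_real (\<integral>y. indicator K y \<partial>M)"
    unfolding integral_complex_of_real[symmetric] by (intro Bochner_Integration.integral_cong) (auto simp: indicator_def)
  ultimately have "measure M K = 0" using K by simp
  then show ?thesis by (simp only: emeasure_fin[OF emeasure_compact[OF K]] ennreal_0)
qed

text \<open>The value is zero at every point, not only at almost every one. The set of
  \<open>y\<close> in \<open>C\<close> with \<open>- y + x\<close> in \<open>E\<close> is exhausted,
  up to a null set, by compact sets whose reflections lie in the null set \<open>E\<close>; these
  are null by \<open>null_reflect\<close>.\<close>

lemma nnc_null:
  assumes a: "integrable M a" and C: "compact C" "\<And>y. y \<notin> C \<Longrightarrow> a y = 0" and E: "E \<in> sets borel" "emeasure M E = 0"
  shows "nnc (\<lambda>y. ennreal (cmod (a y))) (indicator E) x = 0"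
proof -
  let ?F = "C \<inter> (\<lambda>y. - y + x) -` E"
  have "(\<lambda>y. - y + x) -` E \<inter> space borel \<in> sets borel"
    by (rule measurable_sets[OF borel_measurable_continuous_onI E(1)]) (intro continuous_intros)
  then have F: "?F \<in> sets borel" using C(1) by auto
  have fF: "emeasure M ?F < \<infinity>"
    by (rule finite_emeasureI[OF F _ compact_borel[OF C(1)] emeasure_compact[OF C(1)]]) auto
  obtain D where D: "\<And>n. compact (D n)" "\<And>n. D n \<subseteq> ?F" "emeasure M (?F - (\<Union>n::nat. D n)) = 0"
    by (rule sigma_compact_finite[OF F fF]) (rule that; (assumption | blast))
  have "D n \<in> null_sets M" for n
  proof -
    have "compact ((\<lambda>y. - y + x) ` D n)" using D by (intro compact_continuous_image continuous_intros)
    moreover have "(\<lambda>y. - y + x) ` D n \<subseteq> E" using D(2) by auto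
    ultimately have "emeasure M ((\<lambda>y. - y + x) ` D n) = 0"
      using E emeasure_mono[of "(\<lambda>y. - y + x) ` D n" E M] by simp
    then have "emeasure M (D n) = 0" using null_reflect D by blast
    then show ?thesis using D by (simp add: null_sets_def)
  qed
  then have 1: "(\<Union>n. D n) \<in> null_sets M" by (intro null_sets_UN) auto
  then have 2: "?F - (\<Union>n. D n) \<in> null_sets M" using F D(3) by (auto simp: null_sets_def)
  have "(?F - (\<Union>n. D n)) \<union> (\<Union>n. D n) \<in> null_sets M" by (intro null_sets.Un 1 2)
  moreover have "(?F - (\<Union>n. D n)) \<union> (\<Union>n. D n) = ?F" using D(2) by blast
  ultimately have "AE y in M. y \<notin> ?F" by (intro AE_not_in) simp
  then have "AE y in M. ennreal (cmod (a y)) * indicator E (- y + x) = 0"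
    by eventually_elim (use C(2) in \<open>auto simp: indicator_def\<close>)
  then show ?thesis
    unfolding nnc_def using integrable_meas[OF a] indicator_reflect[OF E(1), of x]
    by (subst nn_integral_0_iff_AE) auto
qed

lemma nnc_meas_sup:
  assumes "A \<in> borel_measurable borel" "\<And>i. g i \<in> borel_measurable borel" "incseq g"
  shows "nnc A (\<lambda>y. SUP i. g i y) x = (SUP i::nat. nnc A (g i) x)"
proof -
  have "nnc A (\<lambda>y. SUP i. g i y) x = (\<integral>\<^sup>+y. (SUP i. A y * g i (- y + x)) \<partial>M)"
    unfolding nnc_def by (simp add: SUP_mult_left_ennreal)
  also have "\<dots> = (SUP i. nnc A (g i) x)"
    unfolding nnc_def
  proof (rule nn_integral_monotone_convergence_SUP)
    show "incseq (\<lambda>i y. A y * g i (- y + x))"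
      using assms(3) unfolding incseq_def le_fun_def by (intro allI impI mult_left_mono) auto
  qed (use assms borel_reflect[OF assms(2)] in auto)
  finally show ?thesis .
qed

text \<open>Induction over Borel functions. The decisive case is an indicator: a set of finite
  measure is replaced by an increasing sequence of compact subsets, and the remaining null set
  contributes nothing by \<open>nnc_null\<close>.\<close>

lemma nnc_bound_compact:
  assumes a: "integrable M a" and C: "compact C" "\<And>y. y \<notin> C \<Longrightarrow> a y = 0" and g: "g \<in> borel_measurable borel"
  shows "nnc (\<lambda>y. ennreal (cmod (a y))) g \<in> borel_measurable borel \<and>
    (\<integral>\<^sup>+x. nnc (\<lambda>y. ennreal (cmod (a y))) g x \<partial>M) \<le> ennreal (N a) * (\<integral>\<^sup>+x. g x \<partial>M)"
  using g
proof (induction rule: borel_measurable_induct)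
  let ?A = "\<lambda>y. ennreal (cmod (a y))"
  have A: "?A \<in> borel_measurable borel" using integrable_meas[OF a] by auto
  {
    case (cong f g)
    have "f = g" using cong(3) by auto
    with cong show ?case by simp
  next
    case (set E)
    have m: "nnc ?A (indicator E) \<in> borel_measurable borel"
      unfolding nnc_indicator[OF a set, abs_def]
      using borel_measurable_continuous_onI[OF conv_indicator_continuous[OF absc_integrable[OF a] set]] by auto
    moreover have "(\<integral>\<^sup>+x. nnc ?A (indicator E) x \<partial>M) \<le> ennreal (N a) * emeasure M E"
    proof (cases "emeasure M E < \<infinity>")
      case True
      obtain D0 where D0: "\<And>n. compact (D0 n)" "\<And>n. D0 n \<subseteq> E" "emeasure M (E - (\<Union>n::nat. D0 n)) = 0"
        by (rule sigma_compact_finite[OF set True]) (rule that; (assumption | blast))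
      \<comment> \<open>Partial unions make the compact sets increase, as monotone convergence
        requires.\<close>
      define D where "D n = (\<Union>i\<le>n. D0 i)" for n
      have D: "compact (D n)" "D n \<subseteq> E" for n unfolding D_def using D0 by (auto intro!: compact_UN)
      have Dinc: "D m \<subseteq> D n" if "m \<le> n" for m n unfolding D_def using that by (intro UN_mono) auto
      have dm: "(indicator (D m) y :: ennreal) \<le> indicator (D n) y" if "m \<le> n" for m n y
        using Dinc[OF that] by (auto simp: indicator_def)
      have DU: "(\<Union>n. D n) = (\<Union>n. D0 n)" unfolding D_def by auto
      have DUb: "(\<Union>n. D n) \<in> sets borel" using D by (intro sets.countable_UN) auto
      have DE: "(\<Union>n. D n) \<subseteq> E" using D by blast
      have Nul: "emeasure M (E - (\<Union>n. D n)) = 0" "E - (\<Union>n. D n) \<in> sets borel"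
        using D0(3) DUb set unfolding DU by auto
      have ind: "indicator (\<Union>n. D n) = (\<lambda>y. SUP n. (indicator (D n) y :: ennreal))"
      proof
        fix y
        show "indicator (\<Union>n. D n) y = (SUP n. (indicator (D n) y :: ennreal))"
        proof (cases "y \<in> (\<Union>n. D n)")
          case True
          then obtain n where n: "y \<in> D n" by blast
          have "(SUP n. (indicator (D n) y :: ennreal)) = 1"
            by (intro antisym SUP_least SUP_upper2[of n]) (use n in \<open>auto simp: indicator_def\<close>)
          then show ?thesis using True by simp
        next
          case False
          then have "(indicator (D n) y :: ennreal) = 0" for n by auto
          then show ?thesis using False by simp
        qed
      qed
      have split: "nnc ?A (indicator E) x = (SUP n. nnc ?A (indicator (D n)) x)" for x
      proof -
        have "nnc ?A (indicator E) x = nnc ?A (indicator (\<Union>n. D n)) x + nnc ?A (indicator (E - (\<Union>n. D n))) x"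
        proof -
          have "nnc ?A (indicator E) x = (\<integral>\<^sup>+y. ?A y * indicator (\<Union>n. D n) (- y + x) + ?A y * indicator (E - (\<Union>n. D n)) (- y + x) \<partial>M)"
            unfolding nnc_def using DE by (intro nn_integral_cong) (auto simp: indicator_def)
          also have "\<dots> = nnc ?A (indicator (\<Union>n. D n)) x + nnc ?A (indicator (E - (\<Union>n. D n))) x"
            unfolding nnc_def
            using A indicator_reflect[OF DUb, of x] indicator_reflect[OF Nul(2), of x]
            by (intro nn_integral_add) auto
          finally show ?thesis .
        qed
        also have "nnc ?A (indicator (E - (\<Union>n. D n))) x = 0"
          by (rule nnc_null[OF a C Nul(2,1)])
        also have "nnc ?A (indicator (\<Union>n. D n)) x = (SUP n. nnc ?A (indicator (D n)) x)"
          unfolding ind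
        proof (rule nnc_meas_sup[OF A])
          show "incseq (\<lambda>n. indicator (D n) :: 'a \<Rightarrow> ennreal)"
            unfolding incseq_def le_fun_def by (intro allI impI dm)
          show "indicator (D n) \<in> borel_measurable borel" for n by (intro borel_measurable_indicator compact_borel D)
        qed
        finally show ?thesis by simp
      qed
      have "(\<integral>\<^sup>+x. nnc ?A (indicator E) x \<partial>M) = (SUP n. \<integral>\<^sup>+x. nnc ?A (indicator (D n)) x \<partial>M)"
        unfolding split
      proof (rule nn_integral_monotone_convergence_SUP)
        show "incseq (\<lambda>n. nnc ?A (indicator (D n)))"
          unfolding nnc_def incseq_def le_fun_def by (intro allI impI nn_integral_mono mult_left_mono dm) auto
        show "nnc ?A (indicator (D n)) \<in> borel_measurable M" for n
          unfolding nnc_indicator[OF a compact_borel[OF D(1)], abs_def]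
          using borel_measurable_continuous_onI[OF conv_indicator_continuous[OF absc_integrable[OF a] compact_borel[OF D(1)]]] by auto
      qed
      also have "\<dots> \<le> ennreal (N a) * emeasure M E"
      proof (rule SUP_least)
        fix n
        have "(\<integral>\<^sup>+x. nnc ?A (indicator (D n)) x \<partial>M) \<le> ennreal (N a) * emeasure M (D n)"
          by (rule nnc_compact[OF a C D(1)])
        also have "\<dots> \<le> ennreal (N a) * emeasure M E"
          using D set by (intro mult_left_mono emeasure_mono) auto
        finally show "(\<integral>\<^sup>+x. nnc ?A (indicator (D n)) x \<partial>M) \<le> ennreal (N a) * emeasure M E" .
      qed
      finally show ?thesis .
    next
      case False
      \<comment> \<open>For a set of infinite measure the bound is infinite, unless
        \<open>N a\<close> is 0 and \<open>a\<close> vanishes almost everywhere.\<close>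
      then have inf: "emeasure M E = \<infinity>" by (simp add: less_top[symmetric])
      show ?thesis
      proof (cases "N a = 0")
        case True
        then have "AE y in M. a y = 0" using N_eq_0_iff[OF a] by simp
        then have "AE y in M. ?A y * indicator E (- y + x) = 0" for x by eventually_elim auto
        then have "nnc ?A (indicator E) x = 0" for x
          unfolding nnc_def using A indicator_reflect[OF set, of x]
          by (subst nn_integral_0_iff_AE) auto
        then show ?thesis by simp
      next
        case False
        then have "N a > 0" using N_nonneg[of a] by linarith
        then show ?thesis using inf by (simp add: ennreal_mult_top)
      qed
    qed
    ultimately show ?case using set by simp
  next
    case (mult u c)
    have eq: "nnc ?A (\<lambda>y. c * u y) x = c * nnc ?A u x" for x
      unfolding nnc_def using A borel_reflect[OF mult(2), of x]
      by (subst nn_integral_cmult[symmetric]) (auto simp: mult_ac)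
    show ?case
      using mult unfolding eq[abs_def]
      by (auto simp: nn_integral_cmult mult.left_commute intro!: mult_left_mono)
  next
    case (add u v)
    have um: "u \<in> borel_measurable borel" and vm: "v \<in> borel_measurable borel" using add by blast+
    have IHu: "nnc ?A u \<in> borel_measurable borel" "(\<integral>\<^sup>+x. nnc ?A u x \<partial>M) \<le> ennreal (N a) * (\<integral>\<^sup>+x. u x \<partial>M)"
      and IHv: "nnc ?A v \<in> borel_measurable borel" "(\<integral>\<^sup>+x. nnc ?A v x \<partial>M) \<le> ennreal (N a) * (\<integral>\<^sup>+x. v x \<partial>M)"
      using add.IH by blast+
    have eq: "nnc ?A (\<lambda>y. v y + u y) x = nnc ?A v x + nnc ?A u x" for x
      unfolding nnc_def distrib_left using A borel_reflect[OF um, of x] borel_reflect[OF vm, of x]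
      by (intro nn_integral_add) auto
    have "(\<integral>\<^sup>+x. nnc ?A v x + nnc ?A u x \<partial>M) = (\<integral>\<^sup>+x. nnc ?A v x \<partial>M) + (\<integral>\<^sup>+x. nnc ?A u x \<partial>M)"
      using IHu(1) IHv(1) by (intro nn_integral_add) auto
    also have "\<dots> \<le> ennreal (N a) * (\<integral>\<^sup>+x. v x \<partial>M) + ennreal (N a) * (\<integral>\<^sup>+x. u x \<partial>M)"
      by (intro add_mono IHu IHv)
    also have "\<dots> = ennreal (N a) * (\<integral>\<^sup>+x. v x + u x \<partial>M)"
      using um vm by (subst nn_integral_add) (auto simp: distrib_left)
    finally show ?case unfolding eq[abs_def] using IHu(1) IHv(1) by simp
  next
    case (seq U)
    have eq: "nnc ?A (\<lambda>y. SUP i. U i y) x = (SUP i. nnc ?A (U i) x)" for x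
      using seq by (intro nnc_meas_sup A) auto
    have SU: "Sup (range U) = (\<lambda>y. SUP i. U i y)" by (auto simp: fun_eq_iff image_comp)
    have inc: "incseq (\<lambda>i. nnc ?A (U i))"
    proof -
      have "incseq U" using seq by blast
      then have "U m z \<le> U n z" if "m \<le> n" for m n z using that by (rule incseqD[THEN le_funD])
      then show ?thesis unfolding nnc_def incseq_def le_fun_def by (intro allI impI nn_integral_mono mult_left_mono) auto
    qed
    have "(\<integral>\<^sup>+x. (SUP i. nnc ?A (U i) x) \<partial>M) = (SUP i. \<integral>\<^sup>+x. nnc ?A (U i) x \<partial>M)"
      using seq inc by (intro nn_integral_monotone_convergence_SUP) auto
    also have "\<dots> \<le> ennreal (N a) * (\<integral>\<^sup>+x. (SUP i. U i x) \<partial>M)"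
    proof (rule SUP_least)
      fix i
      have "(\<integral>\<^sup>+x. nnc ?A (U i) x \<partial>M) \<le> ennreal (N a) * (\<integral>\<^sup>+x. U i x \<partial>M)" using seq by auto
      also have "\<dots> \<le> ennreal (N a) * (\<integral>\<^sup>+x. (SUP i. U i x) \<partial>M)"
        by (intro mult_left_mono nn_integral_mono SUP_upper) auto
      finally show "(\<integral>\<^sup>+x. nnc ?A (U i) x \<partial>M) \<le> ennreal (N a) * (\<integral>\<^sup>+x. (SUP i. U i x) \<partial>M)" .
    qed
    moreover have "(\<lambda>x. SUP i. nnc ?A (U i) x) \<in> borel_measurable borel" using seq by (intro borel_measurable_SUP) auto
    ultimately show ?case unfolding SU eq[abs_def] by auto
  }
qed

text \<open>The support of \<open>a\<close> is exhausted by compact sets, and monotone convergence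
  passes from the truncations \<open>b n\<close> to \<open>a\<close>.\<close>

lemma nnc_bound:
  assumes a: "integrable M a" and g: "g \<in> borel_measurable borel"
  shows "nnc (\<lambda>y. ennreal (cmod (a y))) g \<in> borel_measurable borel"
    "(\<integral>\<^sup>+x. nnc (\<lambda>y. ennreal (cmod (a y))) g x \<partial>M) \<le> ennreal (N a) * (\<integral>\<^sup>+x. g x \<partial>M)"
proof -
  obtain C where C: "\<And>n. compact (C n)" "\<And>n. C n \<subseteq> {x. a x \<noteq> 0}" "incseq C" "AE x in M. a x \<noteq> 0 \<longrightarrow> x \<in> (\<Union>n::nat. C n)"
    by (rule sigma_compact_supp[OF a]) (rule that; (assumption | blast))
  define b where "b n = (\<lambda>y. indicator (C n) y * a y)" for n
  have bm: "b n \<in> borel_measurable borel" for n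
    unfolding b_def using C(1) integrable_meas[OF a] by (intro borel_measurable_times borel_measurable_indicator) auto
  have b: "integrable M (b n)" for n
    by (rule Bochner_Integration.integrable_bound[OF a]) (use bm in \<open>auto simp: b_def indicator_def\<close>)
  have b0: "y \<notin> C n \<Longrightarrow> b n y = 0" for n y by (simp add: b_def)
  have Nb: "N (b n) \<le> N a" for n by (intro N_mono a b) (auto simp: b_def indicator_def)
  let ?A = "\<lambda>y. ennreal (cmod (a y))"
  let ?B = "\<lambda>n y. ennreal (cmod (b n y))"
  have binc: "?B m y \<le> ?B n y" if "m \<le> n" for m n y
    using incseqD[OF C(3) that] by (auto simp: b_def indicator_def)
  have sup: "AE y in M. ?A y = (SUP n. ?B n y)"
    using C(4)
  proof eventually_elim
    case (elim y)
    show ?case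
    proof (cases "a y = 0")
      case False
      then obtain n where n: "y \<in> C n" using elim by blast
      show ?thesis
        by (intro antisym SUP_least SUP_upper2[of n]) (use n in \<open>auto simp: b_def indicator_def\<close>)
    qed (simp add: b_def)
  qed
  have eq: "nnc ?A g x = (SUP n. nnc (?B n) g x)" for x
  proof -
    have "nnc ?A g x = (\<integral>\<^sup>+y. (SUP n. ?B n y * g (- y + x)) \<partial>M)"
      unfolding nnc_def
    proof (rule nn_integral_cong_AE)
      show "AE y in M. ?A y * g (- y + x) = (SUP n. ?B n y * g (- y + x))"
        using sup by eventually_elim (simp only: SUP_mult_right_ennreal)
    qed
    also have "\<dots> = (SUP n. nnc (?B n) g x)"
      unfolding nnc_def
    proof (rule nn_integral_monotone_convergence_SUP)
      show "incseq (\<lambda>n y. ?B n y * g (- y + x))"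
        unfolding incseq_def le_fun_def by (intro allI impI mult_right_mono binc) auto
    qed (use bm borel_reflect[OF g, of x] in auto)
    finally show ?thesis .
  qed
  note bb = nnc_bound_compact[OF b C(1) b0 g]
  show "nnc ?A g \<in> borel_measurable borel"
    unfolding eq[abs_def] using bb by (intro borel_measurable_SUP) auto
  have inc: "incseq (\<lambda>n. nnc (?B n) g)"
    unfolding nnc_def incseq_def le_fun_def by (intro allI impI nn_integral_mono mult_right_mono binc) auto
  have "(\<integral>\<^sup>+x. (SUP n. nnc (?B n) g x) \<partial>M) = (SUP n. \<integral>\<^sup>+x. nnc (?B n) g x \<partial>M)"
    using bb inc by (intro nn_integral_monotone_convergence_SUP) auto
  also have "\<dots> \<le> ennreal (N a) * (\<integral>\<^sup>+x. g x \<partial>M)"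
  proof (rule SUP_least)
    fix n
    have "(\<integral>\<^sup>+x. nnc (?B n) g x \<partial>M) \<le> ennreal (N (b n)) * (\<integral>\<^sup>+x. g x \<partial>M)" using bb by blast
    also have "\<dots> \<le> ennreal (N a) * (\<integral>\<^sup>+x. g x \<partial>M)"
      using Nb by (intro mult_right_mono ennreal_leI) auto
    finally show "(\<integral>\<^sup>+x. nnc (?B n) g x \<partial>M) \<le> ennreal (N a) * (\<integral>\<^sup>+x. g x \<partial>M)" .
  qed
  finally show "(\<integral>\<^sup>+x. nnc ?A g x \<partial>M) \<le> ennreal (N a) * (\<integral>\<^sup>+x. g x \<partial>M)" unfolding eq .
qed

section \<open>Convolution on L1\<close>

lemma conv_AE_integrable:
  assumes f: "integrable M f" and g: "integrable M g"
  shows "AE x in M. integrable M (\<lambda>y. f y * g (- y + x))"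
    "nnc (\<lambda>y. ennreal (cmod (f y))) (\<lambda>y. ennreal (cmod (g y))) \<in> borel_measurable borel"
    "(\<integral>\<^sup>+x. nnc (\<lambda>y. ennreal (cmod (f y))) (\<lambda>y. ennreal (cmod (g y))) x \<partial>M) \<le> ennreal (N f * N g)"
    "integrable M (\<lambda>y. f y * g (- y + x)) \<longleftrightarrow> nnc (\<lambda>y. ennreal (cmod (f y))) (\<lambda>y. ennreal (cmod (g y))) x < \<infinity>"
proof -
  have fm: "f \<in> borel_measurable borel" and gm: "g \<in> borel_measurable borel" using f g integrable_meas by auto
  have G: "(\<lambda>y. ennreal (cmod (g y))) \<in> borel_measurable borel" using gm by measurable
  let ?n = "nnc (\<lambda>y. ennreal (cmod (f y))) (\<lambda>y. ennreal (cmod (g y)))"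
  show 1: "?n \<in> borel_measurable borel" by (rule nnc_bound(1)[OF f G])
  have "(\<integral>\<^sup>+x. ?n x \<partial>M) \<le> ennreal (N f) * (\<integral>\<^sup>+x. ennreal (cmod (g x)) \<partial>M)" by (rule nnc_bound(2)[OF f G])
  then show 2: "(\<integral>\<^sup>+x. ?n x \<partial>M) \<le> ennreal (N f * N g)" by (simp only: nn_N[OF g] ennreal_mult[OF N_nonneg N_nonneg])
  have iff: "integrable M (\<lambda>y. f y * g (- y + x)) \<longleftrightarrow> ?n x < \<infinity>" for x
  proof -
    have m: "(\<lambda>y. f y * g (- y + x)) \<in> borel_measurable borel" by (intro borel_measurable_times fm borel_reflect gm)
    have "(\<integral>\<^sup>+y. ennreal (cmod (f y * g (- y + x))) \<partial>M) = ?n x"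
      unfolding nnc_def by (simp add: norm_mult ennreal_mult)
    then show ?thesis unfolding integrable_iff_bounded using m by simp
  qed
  then show "integrable M (\<lambda>y. f y * g (- y + x)) \<longleftrightarrow> ?n x < \<infinity>" .
  have "(\<integral>\<^sup>+x. ?n x \<partial>M) \<noteq> \<infinity>" using 2 by (auto simp: top_unique)
  then have "AE x in M. ?n x \<noteq> \<infinity>" using 1 by (intro nn_integral_PInf_AE) auto
  then show "AE x in M. integrable M (\<lambda>y. f y * g (- y + x))" unfolding iff by (simp add: less_top)
qed

text \<open>Truncating \<open>g\<close> at height \<open>n\<close> gives continuous convolutions. On
  the Borel set \<open>G\<close> where the integral converges they tend to \<open>conv M f g\<close>
  by dominated convergence; off \<open>G\<close> the integral of a non-integrable function is 0 by
  convention.\<close>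

lemma conv_measurable:
  assumes f: "integrable M f" and g: "integrable M g"
  shows "conv M f g \<in> borel_measurable borel"
proof -
  have fm: "f \<in> borel_measurable borel" and gm: "g \<in> borel_measurable borel" using f g integrable_meas by auto
  let ?n = "nnc (\<lambda>y. ennreal (cmod (f y))) (\<lambda>y. ennreal (cmod (g y)))"
  define gn where "gn n = (\<lambda>y. if cmod (g y) \<le> real n then g y else 0)" for n :: nat
  have gnm: "gn n \<in> borel_measurable borel" for n unfolding gn_def using gm by measurable
  have gnb: "cmod (gn n x) \<le> real n" for n x unfolding gn_def by auto
  define G where "G = {x. ?n x < \<infinity>}"
  have G: "G \<in> sets borel" unfolding G_def using conv_AE_integrable(2)[OF f g] by measurable
  have lim: "(\<lambda>n. indicator G x * conv M f (gn n) x) \<longlonglongrightarrow> conv M f g x" for x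
  proof (cases "x \<in> G")
    case True
    then have i: "integrable M (\<lambda>y. f y * g (- y + x))" using conv_AE_integrable(4)[OF f g] unfolding G_def by simp
    have "(\<lambda>n. \<integral>y. f y * gn n (- y + x) \<partial>M) \<longlonglongrightarrow> (\<integral>y. f y * g (- y + x) \<partial>M)"
    proof (rule integral_dominated_convergence[where w="\<lambda>y. cmod (f y * g (- y + x))"])
      show "(\<lambda>y. f y * g (- y + x)) \<in> borel_measurable M" using i by auto
      show "(\<lambda>y. f y * gn n (- y + x)) \<in> borel_measurable M" for n
        unfolding measurable_M by (intro borel_measurable_times fm borel_reflect gnm)
      show "integrable M (\<lambda>y. cmod (f y * g (- y + x)))" using i by (rule integrable_norm)
      show "AE y in M. (\<lambda>n. f y * gn n (- y + x)) \<longlonglongrightarrow> f y * g (- y + x)"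
      proof (rule AE_I2)
        fix y
        obtain m where m: "cmod (g (- y + x)) \<le> real m" using real_arch_simple by blast
        have "\<forall>\<^sub>F n in sequentially. f y * gn n (- y + x) = f y * g (- y + x)"
          unfolding eventually_sequentially gn_def using m by (intro exI[of _ m]) auto
        then show "(\<lambda>n. f y * gn n (- y + x)) \<longlonglongrightarrow> f y * g (- y + x)" by (rule tendsto_eventually)
      qed
      show "AE y in M. norm (f y * gn n (- y + x)) \<le> cmod (f y * g (- y + x))" for n
        by (rule AE_I2) (simp add: gn_def)
    qed
    then show ?thesis using True by (simp add: conv_def)
  next
    case False
    then have "\<not> integrable M (\<lambda>y. f y * g (- y + x))" using conv_AE_integrable(4)[OF f g] unfolding G_def by simp
    then have "conv M f g x = 0" unfolding conv_def by (rule not_integrable_integral_eq)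
    then show ?thesis using False by simp
  qed
  show ?thesis
  proof (rule borel_measurable_LIMSEQ_metric[OF _ lim])
    fix n
    have "conv M f (gn n) \<in> borel_measurable borel"
      by (intro borel_measurable_continuous_onI conv_continuous[OF f gnm gnb])
    then show "(\<lambda>x. indicator G x * conv M f (gn n) x) \<in> borel_measurable borel"
      using G by (intro borel_measurable_times borel_measurable_indicator)
  qed
qed

lemma conv_norm_le: "integrable M f \<Longrightarrow> integrable M g \<Longrightarrow>
    ennreal (cmod (conv M f g x)) \<le> nnc (\<lambda>y. ennreal (cmod (f y))) (\<lambda>y. ennreal (cmod (g y))) x"
proof -
  assume f: "integrable M f" and g: "integrable M g"
  show ?thesis
  proof (cases "integrable M (\<lambda>y. f y * g (- y + x))")
    case True
    have "cmod (conv M f g x) \<le> (\<integral>y. cmod (f y * g (- y + x)) \<partial>M)" unfolding conv_def by (rule integral_norm_bound)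
    then have "ennreal (cmod (conv M f g x)) \<le> ennreal (\<integral>y. cmod (f y * g (- y + x)) \<partial>M)" by (rule ennreal_leI)
    also have "\<dots> = (\<integral>\<^sup>+y. ennreal (cmod (f y * g (- y + x))) \<partial>M)"
      using True by (intro nn_integral_eq_integral[symmetric]) auto
    also have "\<dots> = nnc (\<lambda>y. ennreal (cmod (f y))) (\<lambda>y. ennreal (cmod (g y))) x"
      unfolding nnc_def by (simp add: norm_mult ennreal_mult)
    finally show ?thesis .
  next
    case False
    then have "conv M f g x = 0" unfolding conv_def by (rule not_integrable_integral_eq)
    then show ?thesis by simp
  qed
qed

lemma conv_integrable:
  assumes f: "integrable M f" and g: "integrable M g"
  shows "integrable M (conv M f g)" and N_conv: "N (conv M f g) \<le> N f * N g"
proof -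
  have "(\<integral>\<^sup>+x. ennreal (cmod (conv M f g x)) \<partial>M)
      \<le> (\<integral>\<^sup>+x. nnc (\<lambda>y. ennreal (cmod (f y))) (\<lambda>y. ennreal (cmod (g y))) x \<partial>M)"
    by (intro nn_integral_mono conv_norm_le f g)
  also have "\<dots> \<le> ennreal (N f * N g)" by (rule conv_AE_integrable(3)[OF f g])
  finally have le: "(\<integral>\<^sup>+x. ennreal (cmod (conv M f g x)) \<partial>M) \<le> ennreal (N f * N g)" .
  also have "\<dots> < \<infinity>" by simp
  finally show i: "integrable M (conv M f g)"
    using conv_measurable[OF f g] unfolding integrable_iff_bounded by simp
  show "N (conv M f g) \<le> N f * N g"
    using le unfolding nn_N[OF i] by (subst (asm) ennreal_le_iff) (simp_all add: mult_nonneg_nonneg)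
qed

lemma conv_add_left:
  assumes "integrable M f" "integrable M f'" "integrable M g"
  shows "AE x in M. conv M (\<lambda>y. f y + f' y) g x = conv M f g x + conv M f' g x"
  using conv_AE_integrable(1)[OF assms(1,3)] conv_AE_integrable(1)[OF assms(2,3)]
  by eventually_elim (simp add: conv_def distrib_right)

lemma conv_add_right:
  assumes "integrable M f" "integrable M g" "integrable M g'"
  shows "AE x in M. conv M f (\<lambda>y. g y + g' y) x = conv M f g x + conv M f g' x"
  using conv_AE_integrable(1)[OF assms(1,2)] conv_AE_integrable(1)[OF assms(1,3)]
  by eventually_elim (simp add: conv_def distrib_left)

lemma conv_diff_left:
  assumes "integrable M f" "integrable M f'" "integrable M g"
  shows "AE x in M. conv M (\<lambda>y. f y - f' y) g x = conv M f g x - conv M f' g x"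
  using conv_AE_integrable(1)[OF assms(1,3)] conv_AE_integrable(1)[OF assms(2,3)]
  by eventually_elim (simp add: conv_def left_diff_distrib)

lemma conv_diff_right:
  assumes "integrable M f" "integrable M g" "integrable M g'"
  shows "AE x in M. conv M f (\<lambda>y. g y - g' y) x = conv M f g x - conv M f g' x"
  using conv_AE_integrable(1)[OF assms(1,2)] conv_AE_integrable(1)[OF assms(1,3)]
  by eventually_elim (simp add: conv_def right_diff_distrib)

lemma conv_cmult_left: "conv M (\<lambda>y. c * f y) g x = c * conv M f g x"
  by (simp add: conv_def mult.assoc)

lemma conv_cmult_right: "conv M f (\<lambda>y. c * g y) x = c * conv M f g x"
  by (simp add: conv_def mult.left_commute)

lemma N_conv_diff_left:
  assumes "integrable M f" "integrable M f'" "integrable M g"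
  shows "N (\<lambda>x. conv M f g x - conv M f' g x) \<le> N (\<lambda>x. f x - f' x) * N g"
proof -
  have "N (\<lambda>x. conv M f g x - conv M f' g x) = N (conv M (\<lambda>y. f y - f' y) g)"
    using conv_diff_left[OF assms] assms by (intro N_cong_AE) (auto intro!: conv_integrable(1))
  also have "\<dots> \<le> N (\<lambda>x. f x - f' x) * N g" using assms by (intro N_conv) auto
  finally show ?thesis .
qed

lemma N_conv_diff_right:
  assumes "integrable M f" "integrable M g" "integrable M g'"
  shows "N (\<lambda>x. conv M f g x - conv M f g' x) \<le> N f * N (\<lambda>x. g x - g' x)"
proof -
  have "N (\<lambda>x. conv M f g x - conv M f g' x) = N (conv M f (\<lambda>y. g y - g' y))"
    using conv_diff_right[OF assms] assms by (intro N_cong_AE) (auto intro!: conv_integrable(1))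
  also have "\<dots> \<le> N f * N (\<lambda>x. g x - g' x)" using assms by (intro N_conv) auto
  finally show ?thesis .
qed

lemma N_diff_eq_0:
  assumes "integrable M f" "integrable M g"
  shows "N (\<lambda>x. f x - g x) = 0 \<longleftrightarrow> (AE x in M. f x = g x)"
  using assms by (subst N_eq_0_iff) auto

lemma conv_cong_AE:
  assumes "integrable M f" "integrable M f'" "integrable M g" "integrable M g'"
    "AE x in M. f x = f' x" "AE x in M. g x = g' x"
  shows "AE x in M. conv M f g x = conv M f' g' x"
proof -
  have "N (\<lambda>x. f x - f' x) = 0" "N (\<lambda>x. g x - g' x) = 0" using assms N_diff_eq_0 by auto
  then have "N (\<lambda>x. conv M f g x - conv M f' g x) \<le> 0" "N (\<lambda>x. conv M f' g x - conv M f' g' x) \<le> 0"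
    using N_conv_diff_left[OF assms(1-3)] N_conv_diff_right[OF assms(2-4)] by auto
  then have "N (\<lambda>x. conv M f g x - conv M f' g x) = 0" "N (\<lambda>x. conv M f' g x - conv M f' g' x) = 0"
    using N_nonneg by (meson antisym)+
  then have "AE x in M. conv M f g x = conv M f' g x" "AE x in M. conv M f' g x = conv M f' g' x"
    using assms conv_integrable(1) by (simp_all add: N_diff_eq_0)
  then show ?thesis by eventually_elim simp
qed

section \<open>Convolutions as limits of combinations of translates\<close>

lemma conv_lt:
  assumes "f \<in> borel_measurable borel" "g \<in> borel_measurable borel"
  shows "conv M (lt s f) g = lt s (conv M f g)"
proof
  fix x
  have "(\<integral>y. lt s f (s + y) * g (- (s + y) + x) \<partial>M) = (\<integral>y. lt s f y * g (- y + x) \<partial>M)"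
    unfolding lt_def
    by (rule integral_translate[where f="\<lambda>y. f (- s + y) * g (- y + x)"])
      (intro borel_measurable_times borel_reflect borel_translate assms)
  moreover have "(\<lambda>y. lt s f (s + y) * g (- (s + y) + x)) = (\<lambda>y. f y * g (- y + (- s + x)))"
  proof
    fix y
    have "- (s + y) + x = - y + (- s + x)" by (simp only: minus_add add.assoc)
    moreover have "lt s f (s + y) = f y" by (simp add: lt_def add.assoc[symmetric])
    ultimately show "lt s f (s + y) * g (- (s + y) + x) = f y * g (- y + (- s + x))" by simp
  qed
  ultimately have "(\<integral>y. f y * g (- y + (- s + x)) \<partial>M) = (\<integral>y. lt s f y * g (- y + x) \<partial>M)" by simp
  moreover have "lt s (conv M f g) x = (\<integral>y. f y * g (- y + (- s + x)) \<partial>M)" by (simp only: lt_def conv_def)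
  moreover have "conv M (lt s f) g x = (\<integral>y. lt s f y * g (- y + x) \<partial>M)" by (simp only: conv_def)
  ultimately show "conv M (lt s f) g x = lt s (conv M f g) x" by simp
qed

lemma conv_lincomb_left:
  assumes "finite S" "integrable M f" "integrable M g"
  shows "AE x in M. conv M (\<lambda>x. \<Sum>s\<in>S. w s * lt s f x) g x = (\<Sum>s\<in>S. w s * lt s (conv M f g) x)"
  using assms(1)
proof induction
  case empty
  show ?case by (simp add: conv_def)
next
  case (insert s S)
  have m: "f \<in> borel_measurable borel" "g \<in> borel_measurable borel" using assms integrable_meas by auto
  have "AE x in M. conv M (\<lambda>x. w s * lt s f x + (\<Sum>s\<in>S. w s * lt s f x)) g x
      = conv M (\<lambda>x. w s * lt s f x) g x + conv M (\<lambda>x. \<Sum>s\<in>S. w s * lt s f x) g x"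
    by (intro conv_add_left integrable_mult_right integrable_lt integrable_lincomb assms)
  then show ?case using insert.IH
    by eventually_elim (simp add: insert.hyps conv_cmult_left conv_lt[OF m])
qed

lemma lincomb_diff: "(\<Sum>s\<in>S. w s * lt s (\<lambda>x. f x - g x) x) = (\<Sum>s\<in>S. w s * lt s f x) - (\<Sum>s\<in>S. w s * lt s g x)"
  for w :: "'a \<Rightarrow> complex" and f g :: "'a \<Rightarrow> complex"
  by (simp add: lt_def right_diff_distrib sum_subtractf)

text \<open>Density of \<open>Cc\<close> extends the approximation to integrable functions, while
  nodes and weights stay common to the family.\<close>

lemma conv_approx_compact:
  fixes h :: "'i \<Rightarrow> 'a \<Rightarrow> complex"
  assumes a: "integrable M a" and C': "compact C" "{y. a y \<noteq> 0} \<subseteq> C" and I: "finite I"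
    and h': "\<forall>i\<in>I. integrable M (h i)" and e: "0 < \<epsilon>"
  shows "\<exists>S w. finite S \<and> S \<subseteq> C \<and> (\<Sum>s\<in>S. cmod (w s)) \<le> N a \<and> (\<Sum>s\<in>S. w s) = (\<integral>y. a y \<partial>M) \<and>
    (\<forall>i\<in>I. N (\<lambda>x. conv M a (h i) x - (\<Sum>s\<in>S. w s * lt s (h i) x)) \<le> \<epsilon>)"
proof -
  have C: "compact C" "\<And>y. y \<notin> C \<Longrightarrow> a y = 0" using C' by auto
  have h: "\<And>i. i \<in> I \<Longrightarrow> integrable M (h i)" using h' by blast
  have Na: "2 * N a + 1 > 0" using N_nonneg[of a] by linarith
  \<comment> \<open>Replacing \<open>h i\<close> by \<open>k i\<close> costs \<open>N a * d\<close>
    once in the convolution and once in the sum; both together stay within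
    \<open>\<epsilon> / 2\<close>.\<close>
  define d where "d = \<epsilon> / 2 / (2 * N a + 1)"
  have d: "d > 0" unfolding d_def using e Na by simp
  have e2: "\<epsilon> / 2 > 0" using e by simp
  have "\<exists>k. k \<in> Cc \<and> N (\<lambda>x. h i x - k x) < d" if i: "i \<in> I" for i
    by (rule Cc_dense[OF h[OF i] d]) blast
  then obtain k where k: "\<And>i. i \<in> I \<Longrightarrow> k i \<in> Cc" "\<And>i. i \<in> I \<Longrightarrow> N (\<lambda>x. h i x - k i x) < d" by metis
  show ?thesis
  proof (rule conv_approx_Cc[where h=k, OF a C(1) _ I _ e2])
    fix S w
    assume S: "finite S" "S \<subseteq> C" "(\<Sum>s\<in>S. cmod (w s)) \<le> N a" "(\<Sum>s\<in>S. w s) = (\<integral>y. a y \<partial>M)"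
      and "\<And>i. i \<in> I \<Longrightarrow> integrable M (conv M a (k i))"
      and ap: "\<And>i. i \<in> I \<Longrightarrow> N (\<lambda>x. conv M a (k i) x - (\<Sum>s\<in>S. w s * lt s (k i) x)) \<le> \<epsilon> / 2"
    have "N (\<lambda>x. conv M a (h i) x - (\<Sum>s\<in>S. w s * lt s (h i) x)) \<le> \<epsilon>" if i: "i \<in> I" for i
    proof -
      have ik: "integrable M (k i)" and ih: "integrable M (h i)" using k(1) h i Cc_integrable by auto
      have "N (\<lambda>x. conv M a (h i) x - conv M a (k i) x) \<le> N a * N (\<lambda>x. h i x - k i x)"
        by (rule N_conv_diff_right[OF a ih ik])
      also have "\<dots> \<le> N a * d" using k(2)[OF i] by (intro mult_left_mono) auto
      finally have 1: "N (\<lambda>x. conv M a (h i) x - conv M a (k i) x) \<le> N a * d" .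
      have "N (\<lambda>x. (\<Sum>s\<in>S. w s * lt s (k i) x) - (\<Sum>s\<in>S. w s * lt s (h i) x))
          \<le> (\<Sum>s\<in>S. cmod (w s)) * N (\<lambda>x. k i x - h i x)"
        using N_lincomb[OF Bochner_Integration.integrable_diff[OF ik ih] S(1), of w] unfolding lincomb_diff .
      also have "\<dots> \<le> N a * d"
        using k(2)[OF i] S(3) unfolding N_minus[of "k i"] by (intro mult_mono) auto
      finally have 3: "N (\<lambda>x. (\<Sum>s\<in>S. w s * lt s (k i) x) - (\<Sum>s\<in>S. w s * lt s (h i) x)) \<le> N a * d" .
      have "N (\<lambda>x. conv M a (h i) x - (\<Sum>s\<in>S. w s * lt s (h i) x)) \<le> N (\<lambda>x. conv M a (h i) x - conv M a (k i) x)
          + N (\<lambda>x. conv M a (k i) x - (\<Sum>s\<in>S. w s * lt s (h i) x))"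
        by (intro N_tri conv_integrable(1) integrable_lincomb a ik ih)
      moreover have "N (\<lambda>x. conv M a (k i) x - (\<Sum>s\<in>S. w s * lt s (h i) x)) \<le>
          N (\<lambda>x. conv M a (k i) x - (\<Sum>s\<in>S. w s * lt s (k i) x)) + N (\<lambda>x. (\<Sum>s\<in>S. w s * lt s (k i) x) - (\<Sum>s\<in>S. w s * lt s (h i) x))"
        by (intro N_tri conv_integrable(1) integrable_lincomb a ik ih)
      moreover have "2 * (N a * d) \<le> \<epsilon> / 2"
      proof -
        have ne: "2 * N a + 1 \<noteq> 0" using Na by linarith
        have "d * (2 * N a + 1) = \<epsilon> / 2" by (rule iffD1[OF nonzero_eq_divide_eq[OF ne] d_def])
        then have "2 * (N a * d) = \<epsilon> / 2 - d" by (simp add: algebra_simps)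
        then show ?thesis using d by linarith
      qed
      ultimately show ?thesis using 1 3 ap[OF i] by linarith
    qed
    then show ?thesis using S by blast
  qed (use C(2) k(1) in blast)+
qed

text \<open>Cutting \<open>a\<close> off to a compact part of its support changes each convolution
  by at most the lost mass times \<open>N (h i)\<close>. The nodes stay where \<open>a\<close> is
  nonzero, which later places them in \<open>G0\<close>.\<close>

lemma conv_approx:
  fixes h :: "'i \<Rightarrow> 'a \<Rightarrow> complex"
  assumes a: "integrable M a" and I: "finite I"
    and h': "\<forall>i\<in>I. integrable M (h i)" and e: "0 < \<epsilon>"
  shows "\<exists>S w. finite S \<and> S \<subseteq> {x. a x \<noteq> 0} \<and>
    (\<forall>i\<in>I. N (\<lambda>x. conv M a (h i) x - (\<Sum>s\<in>S. w s * lt s (h i) x)) \<le> \<epsilon>)"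
proof (rule sigma_compact_supp[OF a])
  fix C
  assume C: "\<And>n. compact (C n)" "\<And>n. C n \<subseteq> {x. a x \<noteq> 0}" "incseq C" "AE x in M. a x \<noteq> 0 \<longrightarrow> x \<in> (\<Union>n::nat. C n)"
  have h: "\<And>i. i \<in> I \<Longrightarrow> integrable M (h i)" using h' by blast
  \<comment> \<open>A common bound for the norms \<open>N (h i)\<close>; the summand 1 keeps it
    positive.\<close>
  define B where "B = (\<Sum>i\<in>I. N (h i)) + 1"
  have B: "B > 0" unfolding B_def using sum_nonneg[of I "\<lambda>i. N (h i)"] by (simp add: add_nonneg_pos)
  have NB: "N (h i) \<le> B" if "i \<in> I" for i
    unfolding B_def using member_le_sum[OF that, of "\<lambda>i. N (h i)"] I by simp
  have "\<epsilon> / 2 / B > 0" using e B by simp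
  then obtain n where n: "N (\<lambda>x. a x - indicator (C n) x * a x) < \<epsilon> / 2 / B"
    using N_cutoff[OF a compact_borel[OF C(1)] C(3,4)] by blast
  define b where "b = (\<lambda>y. indicator (C n) y * a y)"
  have bm: "b \<in> borel_measurable borel"
    unfolding b_def using C(1) integrable_meas[OF a] by (intro borel_measurable_times borel_measurable_indicator compact_borel)
  have b: "integrable M b"
    by (rule Bochner_Integration.integrable_bound[OF a]) (use bm in \<open>auto simp: b_def indicator_def\<close>)
  have b0: "{y. b y \<noteq> 0} \<subseteq> C n" by (auto simp: b_def indicator_def)
  have e2: "\<epsilon> / 2 > 0" using e by simp
  obtain S w where S: "finite S" "S \<subseteq> C n" "\<forall>i\<in>I. N (\<lambda>x. conv M b (h i) x - (\<Sum>s\<in>S. w s * lt s (h i) x)) \<le> \<epsilon> / 2"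
    using conv_approx_compact[where a=b and C="C n" and I=I and h=h and \<epsilon>="\<epsilon> / 2", OF b C(1) b0 I h' e2] by (elim exE conjE) (rule that)
  have "N (\<lambda>x. conv M a (h i) x - (\<Sum>s\<in>S. w s * lt s (h i) x)) \<le> \<epsilon>" if i: "i \<in> I" for i
  proof -
    have "N (\<lambda>x. conv M a (h i) x - conv M b (h i) x) \<le> N (\<lambda>x. a x - b x) * N (h i)"
      by (rule N_conv_diff_left[OF a b h[OF i]])
    also have "\<dots> \<le> (\<epsilon> / 2 / B) * B" using n NB[OF i] e B unfolding b_def by (intro mult_mono) auto
    also have "\<dots> = \<epsilon> / 2" using B by simp
    finally have 1: "N (\<lambda>x. conv M a (h i) x - conv M b (h i) x) \<le> \<epsilon> / 2" .
    have "N (\<lambda>x. conv M a (h i) x - (\<Sum>s\<in>S. w s * lt s (h i) x)) \<le> N (\<lambda>x. conv M a (h i) x - conv M b (h i) x)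
          + N (\<lambda>x. conv M b (h i) x - (\<Sum>s\<in>S. w s * lt s (h i) x))"
      by (intro N_tri conv_integrable(1) integrable_lincomb a b h i)
    then show ?thesis using 1 S(3) i by fastforce
  qed
  then show ?thesis using S C(2)[of n] by (intro exI[of _ S] exI[of _ w]) blast
qed

text \<open>Convolution by \<open>h\<close> on the right commutes with left translation. Since one
  combination of translates approximates the action of \<open>f\<close> on \<open>g\<close> and on
  \<open>conv M g h\<close>, the two sides agree up to the error.\<close>

lemma conv_assoc:
  assumes f: "integrable M f" and g: "integrable M g" and h: "integrable M h"
  shows "AE x in M. conv M (conv M f g) h x = conv M f (conv M g h) x"
proof -
  have gh: "integrable M (conv M g h)" and fg: "integrable M (conv M f g)" using f g h conv_integrable(1) by auto
  have i1: "integrable M (conv M (conv M f g) h)" and i2: "integrable M (conv M f (conv M g h))"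
    using f gh fg h conv_integrable(1) by auto
  have "N (\<lambda>x. conv M (conv M f g) h x - conv M f (conv M g h) x) \<le> 0 + \<delta>" if d: "\<delta> > 0" for \<delta>
  proof -
    have Nh: "N h + 1 > 0" using N_nonneg[of h] by linarith
    define \<epsilon> where "\<epsilon> = \<delta> / (N h + 1)"
    have e: "\<epsilon> > 0" unfolding \<epsilon>_def using d Nh by simp
    \<comment> \<open>Both functions enter one family so that they receive the same nodes and
      weights.\<close>
    define k where "k b = (if b then g else conv M g h)" for b
    have "\<exists>S w. finite S \<and> S \<subseteq> {x. f x \<noteq> 0} \<and>
      (\<forall>i\<in>UNIV. N (\<lambda>x. conv M f (k i) x - (\<Sum>s\<in>S. w s * lt s (k i) x)) \<le> \<epsilon>)"
      by (rule conv_approx[OF f _ _ e]) (use g gh in \<open>auto simp: k_def\<close>)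
    then obtain S w where S: "finite S" "\<And>i. N (\<lambda>x. conv M f (k i) x - (\<Sum>s\<in>S. w s * lt s (k i) x)) \<le> \<epsilon>" by blast
    have S1: "N (\<lambda>x. conv M f g x - (\<Sum>s\<in>S. w s * lt s g x)) \<le> \<epsilon>" using S(2)[of True] by (simp add: k_def)
    have S2: "N (\<lambda>x. conv M f (conv M g h) x - (\<Sum>s\<in>S. w s * lt s (conv M g h) x)) \<le> \<epsilon>" using S(2)[of False] by (simp add: k_def)
    have il: "integrable M (\<lambda>x. \<Sum>s\<in>S. w s * lt s g x)" "integrable M (\<lambda>x. \<Sum>s\<in>S. w s * lt s (conv M g h) x)"
      using integrable_lincomb g gh by auto
    have "N (\<lambda>x. conv M (conv M f g) h x - (\<Sum>s\<in>S. w s * lt s (conv M g h) x))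
        = N (\<lambda>x. conv M (conv M f g) h x - conv M (\<lambda>x. \<Sum>s\<in>S. w s * lt s g x) h x)"
    proof (rule N_cong_AE)
      show "AE x in M. conv M (conv M f g) h x - (\<Sum>s\<in>S. w s * lt s (conv M g h) x)
          = conv M (conv M f g) h x - conv M (\<lambda>x. \<Sum>s\<in>S. w s * lt s g x) h x"
        using conv_lincomb_left[OF S(1) g h, of w] by eventually_elim simp
    qed (intro Bochner_Integration.integrable_diff i1 il conv_integrable(1) h)+
    also have "\<dots> \<le> N (\<lambda>x. conv M f g x - (\<Sum>s\<in>S. w s * lt s g x)) * N h"
      by (rule N_conv_diff_left[OF fg il(1) h])
    also have "\<dots> \<le> \<epsilon> * N h" using S1 by (intro mult_right_mono) auto
    finally have 1: "N (\<lambda>x. conv M (conv M f g) h x - (\<Sum>s\<in>S. w s * lt s (conv M g h) x)) \<le> \<epsilon> * N h" .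
    have "N (\<lambda>x. conv M (conv M f g) h x - conv M f (conv M g h) x) \<le>
        N (\<lambda>x. conv M (conv M f g) h x - (\<Sum>s\<in>S. w s * lt s (conv M g h) x)) + N (\<lambda>x. (\<Sum>s\<in>S. w s * lt s (conv M g h) x) - conv M f (conv M g h) x)"
      by (intro N_tri i1 il i2)
    also have "\<dots> \<le> \<epsilon> * N h + \<epsilon>" using 1 S2 unfolding N_minus[of "conv M f (conv M g h)"] by linarith
    also have "\<dots> = \<delta>"
    proof -
      have "\<epsilon> * (N h + 1) = \<delta>" unfolding \<epsilon>_def using Nh by simp
      then show ?thesis by (simp add: algebra_simps)
    qed
    finally show ?thesis by simp
  qed
  then have "N (\<lambda>x. conv M (conv M f g) h x - conv M f (conv M g h) x) \<le> 0" by (rule field_le_epsilon)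
  then have "N (\<lambda>x. conv M (conv M f g) h x - conv M f (conv M g h) x) = 0" using N_nonneg by (meson antisym)
  then show ?thesis using N_diff_eq_0[OF i1 i2] by simp
qed

section \<open>Approximate units of L1\<close>

definition unit_bump :: "'a set \<Rightarrow> 'a \<Rightarrow> complex" where
  "unit_bump V = (\<lambda>x. indicator V x / complex_of_real (measure M V))"

lemma unit_bump:
  assumes V: "compact V" "open U" "U \<subseteq> V" "U \<noteq> {}"
  shows "integrable M (unit_bump V)" "N (unit_bump V) = 1" "(\<integral>x. unit_bump V x \<partial>M) = 1" "unit_bump V \<in> borel_measurable borel"
    "\<And>x. cmod (unit_bump V x) \<le> 1 / measure M V"
proof -
  have fV: "emeasure M V < \<infinity>" by (rule emeasure_compact[OF V(1)])
  have "0 < emeasure M U" by (rule emeasure_open_pos[OF V(2,4)])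
  also have "\<dots> \<le> emeasure M V" using V(1,3) by (intro emeasure_mono) auto
  finally have "0 < measure M V" using fV by (simp add: measure_def enn2real_positive_iff)
  then have p: "measure M V > 0" .
  show m: "unit_bump V \<in> borel_measurable borel"
    unfolding unit_bump_def using compact_borel[OF V(1)] by (intro borel_measurable_divide borel_measurable_indicator) auto
  show b: "cmod (unit_bump V x) \<le> 1 / measure M V" for x
    using p by (auto simp: unit_bump_def indicator_def norm_divide)
  show i: "integrable M (unit_bump V)"
    by (rule integrable_compact_supp[OF m V(1) _ b]) (simp add: unit_bump_def)
  have r: "(\<integral>x. indicator V x / measure M V \<partial>M) = 1"
    using p by simp
  show "N (unit_bump V) = 1"
    unfolding L1norm_def unit_bump_def r[symmetric] using p
    by (intro Bochner_Integration.integral_cong) (auto simp: indicator_def norm_divide)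
  have "(\<integral>x. unit_bump V x \<partial>M) = (\<integral>x. complex_of_real (indicator V x / measure M V) \<partial>M)"
    unfolding unit_bump_def by (intro Bochner_Integration.integral_cong) (auto simp: indicator_def)
  also have "\<dots> = 1" unfolding integral_complex_of_real r by simp
  finally show "(\<integral>x. unit_bump V x \<partial>M) = 1" .
qed

text \<open>Convolution with a unit bump is close to a combination of translates by points of
  \<open>V\<close>, with weights of sum 1 and total mass at most 1. Each of these translates is
  already near \<open>h i\<close>.\<close>

lemma approximate_unit:
  fixes h :: "'i \<Rightarrow> 'a \<Rightarrow> complex"
  assumes I: "finite I" and h': "\<forall>i\<in>I. integrable M (h i)" and e: "0 < \<epsilon>" and W: "open W" "0 \<in> W"
  shows "\<exists>V U. compact V \<and> open U \<and> 0 \<in> U \<and> U \<subseteq> V \<and> V \<subseteq> W \<and> (\<forall>i\<in>I. N (\<lambda>x. conv M (unit_bump V) (h i) x - h i x) \<le> \<epsilon>)"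
proof -
  have h: "\<And>i. i \<in> I \<Longrightarrow> integrable M (h i)" using h' by blast
  have e2: "\<epsilon> / 2 > 0" using e by simp
  have "\<exists>X. open X \<and> 0 \<in> X \<and> (\<forall>v\<in>X. N (\<lambda>x. lt v (h i) x - h i x) < \<epsilon> / 2)" if i: "i \<in> I" for i
    by (rule lt_continuous[OF h[OF i] e2]) blast
  then obtain X where X: "\<And>i. i \<in> I \<Longrightarrow> open (X i)" "\<And>i. i \<in> I \<Longrightarrow> 0 \<in> X i"
      "\<And>i v. i \<in> I \<Longrightarrow> v \<in> X i \<Longrightarrow> N (\<lambda>x. lt v (h i) x - h i x) < \<epsilon> / 2" by metis
  have "open (W \<inter> (\<Inter>i\<in>I. X i))" "{0} \<subseteq> W \<inter> (\<Inter>i\<in>I. X i)" using X W I by (auto intro!: open_INT)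
  then obtain U V where UV: "open U" "compact V" "{0} \<subseteq> U" "U \<subseteq> V" "V \<subseteq> W \<inter> (\<Inter>i\<in>I. X i)"
    using compact_between[of "{0}" "W \<inter> (\<Inter>i\<in>I. X i)"] by auto
  have ne: "U \<noteq> {}" using UV by auto
  note ub = unit_bump[OF UV(2,1,4) ne]
  have u0: "{y. unit_bump V y \<noteq> 0} \<subseteq> V" by (auto simp: unit_bump_def indicator_def)
  obtain S w where S: "finite S" "S \<subseteq> V" "(\<Sum>s\<in>S. cmod (w s)) \<le> 1" "(\<Sum>s\<in>S. w s) = 1"
    "\<forall>i\<in>I. N (\<lambda>x. conv M (unit_bump V) (h i) x - (\<Sum>s\<in>S. w s * lt s (h i) x)) \<le> \<epsilon> / 2"
    using conv_approx_compact[where a="unit_bump V" and C=V and I=I and h=h and \<epsilon>="\<epsilon> / 2", OF ub(1) UV(2) u0 I h' e2] unfolding ub(2,3) by (elim exE conjE) (rule that)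
  have "N (\<lambda>x. conv M (unit_bump V) (h i) x - h i x) \<le> \<epsilon>" if i: "i \<in> I" for i
  proof -
    have "N (\<lambda>x. (\<Sum>s\<in>S. w s * lt s (h i) x) - h i x) = N (\<lambda>x. \<Sum>s\<in>S. w s * (lt s (h i) x - h i x))"
      using S(4) by (simp add: right_diff_distrib sum_subtractf sum_distrib_right[symmetric])
    also have "\<dots> \<le> (\<Sum>s\<in>S. N (\<lambda>x. w s * (lt s (h i) x - h i x)))"
      by (intro N_sum integrable_mult_right Bochner_Integration.integrable_diff integrable_lt h i)
    also have "\<dots> \<le> (\<Sum>s\<in>S. cmod (w s) * (\<epsilon> / 2))"
      unfolding N_cmult
    proof (intro sum_mono mult_left_mono)
      fix s assume "s \<in> S"
      then have "s \<in> X i" using S(2) UV(5) i by blast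
      then show "N (\<lambda>x. lt s (h i) x - h i x) \<le> \<epsilon> / 2" using X(3)[OF i] by (simp add: less_imp_le)
    qed simp
    also have "\<dots> = (\<Sum>s\<in>S. cmod (w s)) * (\<epsilon> / 2)" by (simp add: sum_distrib_right)
    also have "\<dots> \<le> 1 * (\<epsilon> / 2)" using S(3) e2 by (intro mult_right_mono) auto
    finally have 1: "N (\<lambda>x. (\<Sum>s\<in>S. w s * lt s (h i) x) - h i x) \<le> \<epsilon> / 2" by simp
    have "N (\<lambda>x. conv M (unit_bump V) (h i) x - h i x) \<le> N (\<lambda>x. conv M (unit_bump V) (h i) x - (\<Sum>s\<in>S. w s * lt s (h i) x))
        + N (\<lambda>x. (\<Sum>s\<in>S. w s * lt s (h i) x) - h i x)"
      by (intro N_tri conv_integrable(1) integrable_lincomb ub(1) h i)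
    then show ?thesis using 1 S(5) i by fastforce
  qed
  then show ?thesis using UV by (intro exI[of _ V] exI[of _ U]) auto
qed

section \<open>Consequences of a nontrivial centre\<close>

lemma ZL1_integrable: "f \<in> ZL1 M \<Longrightarrow> integrable M f"
  by (simp add: ZL1_def)

lemma ZL1_commute:
  assumes "f \<in> ZL1 M" "integrable M g"
  shows "AE x in M. conv M f g x = conv M g f x"
  using assms N_diff_eq_0[OF conv_integrable(1) conv_integrable(1)] by (auto simp: ZL1_def)

text \<open>The function \<open>shift f x\<close> is a length function on the group; it is invariant under conjugation for
  central \<open>f\<close>, and it exceeds \<open>N f\<close> off a compact set.\<close>

definition shift :: "('a \<Rightarrow> complex) \<Rightarrow> 'a \<Rightarrow> real" where
  "shift f x = N (\<lambda>z. f z - lt x f z)"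

lemma lt_diff: "lt s (\<lambda>z. f z - g z) = (\<lambda>z. lt s f z - lt s g z)"
  by (simp add: lt_def)

lemma shift_lt:
  assumes f: "integrable M f"
  shows "N (\<lambda>z. lt x0 f z - lt x f z) = shift f (- x0 + x)"
proof -
  have "lt x0 (\<lambda>z. f z - lt (- x0 + x) f z) = (\<lambda>z. lt x0 f z - lt x f z)"
    unfolding lt_diff lt_add[symmetric] by (simp add: add.assoc[symmetric])
  then show ?thesis
    unfolding shift_def using N_lt[of "\<lambda>z. f z - lt (- x0 + x) f z" x0] f integrable_lt by auto
qed

lemma shift_triangle:
  assumes f: "integrable M f"
  shows "shift f (x + y) \<le> shift f x + shift f y"
proof -
  have "shift f (x + y) \<le> N (\<lambda>z. f z - lt x f z) + N (\<lambda>z. lt x f z - lt (x + y) f z)"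
    unfolding shift_def by (intro N_tri f integrable_lt)
  also have "N (\<lambda>z. lt x f z - lt (x + y) f z) = shift f y"
    unfolding shift_lt[OF f] by (simp add: add.assoc[symmetric])
  finally show ?thesis by (simp add: shift_def)
qed

lemma shift_minus: "integrable M f \<Longrightarrow> shift f (- x) = shift f x"
  using shift_lt[of f x 0] by (simp add: shift_def N_minus[of f])

text \<open>By the triangle inequality the increment is at most the length of
  \<open>- x0 + x\<close>, which is small by continuity of translation.\<close>

lemma shift_continuous:
  assumes f: "integrable M f"
  shows "continuous_on UNIV (shift f)"
proof -
  have "(shift f \<longlongrightarrow> shift f x0) (nhds x0)" for x0
  proof (rule tendstoI)
    fix \<epsilon> :: real assume e: "\<epsilon> > 0"
    show "\<forall>\<^sub>F x in nhds x0. dist (shift f x) (shift f x0) < \<epsilon>"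
    proof (rule lt_continuous[OF f e])
      fix V assume V: "open V" "0 \<in> V" "\<And>v. v \<in> V \<Longrightarrow> N (\<lambda>x. lt v f x - f x) < \<epsilon>"
      have small: "shift f v < \<epsilon>" if "v \<in> V" for v
        using V(3)[OF that] by (simp add: shift_def N_minus[of f])
      have "open ((\<lambda>x. - x0 + x) -` V)" using V by (intro open_vimage continuous_intros)
      moreover have "x0 \<in> (\<lambda>x. - x0 + x) -` V" using V by simp
      moreover have "dist (shift f x) (shift f x0) < \<epsilon>" if "x \<in> (\<lambda>x. - x0 + x) -` V" for x
      proof -
        have s: "shift f (- x0 + x) < \<epsilon>" using small that by auto
        have "shift f x \<le> shift f x0 + shift f (- x0 + x)"
          using shift_triangle[OF f, of x0 "- x0 + x"] by (simp add: add.assoc[symmetric])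
        moreover have "shift f x0 \<le> shift f x + shift f (- x0 + x)"
        proof -
          have "shift f x0 \<le> shift f x + shift f (- x + x0)"
            using shift_triangle[OF f, of x "- x + x0"] by (simp add: add.assoc[symmetric])
          also have "shift f (- x + x0) = shift f (- x0 + x)"
            using shift_minus[OF f, of "- x0 + x"] by (simp add: minus_add)
          finally show ?thesis .
        qed
        ultimately show ?thesis using s by (simp add: dist_real_def abs_less_iff)
      qed
      ultimately show ?thesis unfolding eventually_nhds by blast
    qed
  qed
  then show ?thesis
    unfolding continuous_on_def by (blast intro: tendsto_mono[OF at_within_le_nhds])
qed

lemma N_lt_cong:
  assumes "integrable M G" "integrable M H" "AE x in M. G x = H x"
  shows "N (\<lambda>z. G z - lt x G z) = N (\<lambda>z. H z - lt x H z)"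
proof (rule N_cong_AE)
  show "AE z in M. G z - lt x G z = H z - lt x H z"
    using assms(3) AE_translate[OF assms(3), of "- x"] by eventually_elim (simp add: lt_def)
qed (intro Bochner_Integration.integrable_diff integrable_lt assms)+

text \<open>Convolving with a bump replaces \<open>f\<close> by \<open>F\<close>, at a cost of
  \<open>\<epsilon>\<close> on two occasions. After left translation by \<open>- a\<close>,
  centrality lets the bump change sides, so that translation by \<open>x\<close> falls on
  \<open>f\<close> alone: the difference becomes that of \<open>lt x f\<close> and \<open>f\<close>,
  convolved with a function of norm 1. This way right translations, whose effect on the measure is
  not yet known, do not appear.\<close>

lemma shift_conj_le:
  assumes f: "f \<in> ZL1 M"
  shows "shift f (a + x - a) \<le> shift f x"
proof (rule field_le_epsilon)
  fix \<delta> :: real assume "\<delta> > 0"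
  define \<epsilon> where "\<epsilon> = \<delta> / 2"
  have e: "\<epsilon> > 0" using \<open>\<delta> > 0\<close> by (simp add: \<epsilon>_def)
  have i: "integrable M f" using ZL1_integrable[OF f] .
  have fm: "f \<in> borel_measurable borel" using i integrable_meas by blast
  let ?s = "a + x - a"
  have "finite {()}" "\<forall>i\<in>{()}. integrable M f" using i by auto
  from approximate_unit[where h="\<lambda>_. f", OF this e open_UNIV UNIV_I]
  obtain V U where V: "compact V" "open U" "0 \<in> U" "U \<subseteq> V" "N (\<lambda>x. conv M (unit_bump V) f x - f x) \<le> \<epsilon>"
    by blast
  have "U \<noteq> {}" using V by auto
  note ub = unit_bump[OF V(1,2,4) this]
  define g where "g = unit_bump V"
  have g: "integrable M g" "N g = 1" "g \<in> borel_measurable borel" using ub by (auto simp: g_def)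
  define F where "F = conv M g f"
  have F: "integrable M F" unfolding F_def by (rule conv_integrable(1)[OF g(1) i])
  have NF: "N (\<lambda>x. F x - f x) \<le> \<epsilon>" using V(5) by (simp add: F_def g_def)
  have 1: "shift f ?s \<le> N (\<lambda>z. f z - F z) + N (\<lambda>z. F z - lt ?s f z)"
    unfolding shift_def by (intro N_tri i F integrable_lt)
  have 2: "N (\<lambda>z. F z - lt ?s f z) \<le> N (\<lambda>z. F z - lt ?s F z) + N (\<lambda>z. lt ?s F z - lt ?s f z)"
    by (intro N_tri i F integrable_lt)
  have 3: "N (\<lambda>z. lt ?s F z - lt ?s f z) = N (\<lambda>x. F x - f x)"
    using N_lt[OF Bochner_Integration.integrable_diff[OF F i], of ?s] unfolding lt_diff .
  \<comment> \<open>Translating by \<open>- a\<close> turns the translate of \<open>F\<close> by the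
    conjugate of \<open>x\<close> into the translate of \<open>G\<close> by \<open>x\<close>
    itself.\<close>
  define g' where "g' = lt (- a) g"
  have g': "integrable M g'" "N g' = 1" unfolding g'_def using g integrable_lt N_lt by auto
  define G where "G = lt (- a) F"
  have G: "integrable M G" unfolding G_def by (intro integrable_lt F)
  have "G = conv M g' f" unfolding G_def F_def g'_def conv_lt[OF g(3) fm] ..
  then have "AE z in M. G z = conv M f g' z" using ZL1_commute[OF f g'(1)] by auto
  moreover have H: "integrable M (conv M f g')" by (rule conv_integrable(1)[OF i g'(1)])
  ultimately have "N (\<lambda>z. G z - lt x G z) = N (\<lambda>z. conv M f g' z - lt x (conv M f g') z)"
    by (intro N_lt_cong G)
  also have "\<dots> = N (\<lambda>z. conv M f g' z - conv M (lt x f) g' z)"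
    using g'(1) by (simp add: conv_lt[OF fm integrable_meas])
  also have "\<dots> \<le> shift f x * N g'"
    unfolding shift_def by (rule N_conv_diff_left[OF i integrable_lt[OF i] g'(1)])
  finally have 4: "N (\<lambda>z. G z - lt x G z) \<le> shift f x" by (simp add: g'(2))
  have "N (\<lambda>z. F z - lt ?s F z) = N (lt (- a) (\<lambda>z. F z - lt ?s F z))"
    by (rule N_lt[symmetric]) (intro Bochner_Integration.integrable_diff integrable_lt F)
  also have "lt (- a) (\<lambda>z. F z - lt ?s F z) = (\<lambda>z. G z - lt x G z)"
  proof -
    have "- a + ?s = x + - a" by (simp add: add.assoc[symmetric] diff_conv_add_uminus del: add_uminus_conv_diff)
    then have "lt (- a) (lt ?s F) = lt x (lt (- a) F)" unfolding lt_add[symmetric] by simp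
    then show ?thesis unfolding lt_diff G_def by simp
  qed
  finally have 5: "N (\<lambda>z. F z - lt ?s F z) \<le> shift f x" using 4 by simp
  have "N (\<lambda>z. f z - F z) \<le> \<epsilon>" using NF unfolding N_minus[of f] .
  then show "shift f ?s \<le> shift f x + \<delta>" using 1 2 5 NF unfolding 3 \<epsilon>_def by linarith
qed

lemma shift_conj:
  assumes f: "f \<in> ZL1 M"
  shows "shift f (a + x - a) = shift f x"
  using shift_conj_le[OF f, of a x] shift_conj_le[OF f, of "- a" "a + x - a"] unfolding conj_cancel by linarith

text \<open>For \<open>g\<close> in \<open>Cc\<close> and \<open>x\<close> off \<open>Q\<close>, the
  functions \<open>g\<close> and \<open>lt x g\<close> have disjoint supports, so their distance is
  twice the norm of \<open>g\<close>. Passing between \<open>f\<close> and \<open>g\<close> costs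
  four errors of at most \<open>N f / 8\<close>, which leaves more than \<open>N f\<close>.\<close>

lemma shift_infinity:
  assumes f: "integrable M f" "N f \<noteq> 0"
  obtains Q where "compact Q" "\<And>x. x \<notin> Q \<Longrightarrow> N f < shift f x"
proof -
  have Np: "N f > 0" using f(2) N_nonneg[of f] by linarith
  then have "N f / 8 > 0" by simp
  then obtain g where g: "g \<in> Cc" "N (\<lambda>x. f x - g x) < N f / 8" by (rule Cc_dense[OF f(1)])
  obtain C where C: "compact C" "\<And>x. x \<notin> C \<Longrightarrow> g x = 0" using g(1) unfolding Cc_def by blast
  have ig: "integrable M g" using g Cc_integrable by blast
  define Q where "Q = {a + b | a b. a \<in> C \<and> b \<in> uminus ` C}"
  have Q: "compact Q" unfolding Q_def by (intro compact_plus compact_uminus C)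
  have "N f < shift f x" if x: "x \<notin> Q" for x
  proof -
    have pt: "cmod (g z - lt x g z) = cmod (g z) + cmod (lt x g z)" for z
    proof (cases "z \<in> C \<and> - x + z \<in> C")
      case True
      have "x = z + - (- x + z)" by (simp add: minus_add add.assoc[symmetric] diff_conv_add_uminus del: add_uminus_conv_diff)
      then have "x \<in> Q" unfolding Q_def using True by blast
      then show ?thesis using x by simp
    next
      case False
      then have "g z = 0 \<or> lt x g z = 0" using C(2)[of z] C(2)[of "- x + z"] by (auto simp: lt_def)
      then show ?thesis by auto
    qed
    have "N (\<lambda>z. g z - lt x g z) = N g + N (lt x g)"
      unfolding L1norm_def pt using integrable_lt[OF ig, of x] ig by (intro Bochner_Integration.integral_add) auto
    then have 1: "N (\<lambda>z. g z - lt x g z) = 2 * N g" using N_lt[OF ig] by simp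
    have "N (\<lambda>z. g z - lt x g z) \<le> N (\<lambda>z. g z - f z) + N (\<lambda>z. f z - lt x g z)"
      by (intro N_tri ig f(1) integrable_lt)
    moreover have "N (\<lambda>z. f z - lt x g z) \<le> shift f x + N (\<lambda>z. lt x f z - lt x g z)"
      unfolding shift_def by (intro N_tri ig f(1) integrable_lt)
    moreover have "N (\<lambda>z. lt x f z - lt x g z) = N (\<lambda>x. f x - g x)"
      using N_lt[OF Bochner_Integration.integrable_diff[OF f(1) ig], of x] unfolding lt_diff .
    moreover have "N f - N g \<le> N (\<lambda>x. f x - g x)" by (rule N_rev[OF f(1) ig])
    ultimately show ?thesis using 1 g(2) Np unfolding N_minus[of g f] by linarith
  qed
  then show thesis using that Q by blast
qed

text \<open>The sublevel set of the length function at half of \<open>N f\<close> will do: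
  differences of its elements have length below \<open>N f\<close> and hence lie in the compact set
  \<open>Q\<close>.\<close>

lemma invariant_neighbourhood:
  assumes f: "f \<in> ZL1 M" "N f \<noteq> 0"
  obtains V W :: "'a set" where "open V" "0 \<in> V" "compact W" "\<And>v v'. v \<in> V \<Longrightarrow> v' \<in> V \<Longrightarrow> - v + v' \<in> W"
    "\<And>a v. v \<in> V \<Longrightarrow> a + v - a \<in> V"
proof -
  have i: "integrable M f" using ZL1_integrable[OF f(1)] .
  obtain Q where Q: "compact Q" "\<And>x. x \<notin> Q \<Longrightarrow> N f < shift f x" by (rule shift_infinity[OF i f(2)]) blast
  have Np: "N f > 0" using f(2) N_nonneg[of f] by linarith
  define V where "V = {x. shift f x < N f / 2}"
  show thesis
  proof (rule that[of V Q])
    have "V = shift f -` {..<N f / 2}" by (auto simp: V_def)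
    then show "open V" using shift_continuous[OF i] by (simp add: open_vimage)
    show "0 \<in> V" using Np by (simp add: V_def shift_def)
    show "a + v - a \<in> V" if "v \<in> V" for a v using that shift_conj[OF f(1)] by (simp add: V_def)
    fix v v' assume "v \<in> V" "v' \<in> V"
    then have "shift f (- v + v') < N f"
      using shift_triangle[OF i, of "- v" v'] shift_minus[OF i, of v] by (simp add: V_def)
    then show "- v + v' \<in> Q" using Q(2)[of "- v + v'"] by force
  qed (rule Q(1))
qed

section \<open>Unimodularity\<close>

lemma class_bump:
  assumes f: "f \<in> ZL1 M" "N f \<noteq> 0"
  obtains \<phi> where "\<phi> \<in> Cc" "\<And>a x. \<phi> (a + x - a) = \<phi> x" "(\<integral>x. \<phi> x \<partial>M) \<noteq> 0"
proof -
  have i: "integrable M f" using ZL1_integrable[OF f(1)] .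
  obtain Q where Q: "compact Q" "\<And>x. x \<notin> Q \<Longrightarrow> N f < shift f x" by (rule shift_infinity[OF i f(2)]) blast
  have Np: "N f > 0" using f(2) N_nonneg[of f] by linarith
  \<comment> \<open>Continuous, conjugation-invariant, zero off \<open>Q\<close> and equal to
    \<open>N f\<close> at 0: this is a nonnegative class function in \<open>Cc\<close> with nonzero
    integral.\<close>
  define r where "r x = max 0 (N f - shift f x)" for x
  define \<phi> where "\<phi> x = complex_of_real (r x)" for x
  have rc: "continuous_on UNIV r" unfolding r_def by (intro continuous_intros shift_continuous[OF i])
  have c: "continuous_on UNIV \<phi>" unfolding \<phi>_def by (intro continuous_intros rc)
  have z: "\<phi> x = 0" if "x \<notin> Q" for x using Q(2)[OF that] by (simp add: \<phi>_def r_def)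
  have Cc: "\<phi> \<in> Cc" unfolding Cc_def using c Q z by blast
  have r0: "r 0 = N f" using Np by (simp add: r_def shift_def)
  have "(\<integral>x. \<phi> x \<partial>M) \<noteq> 0"
  proof
    assume "(\<integral>x. \<phi> x \<partial>M) = 0"
    then have "(\<integral>x. r x \<partial>M) = 0" unfolding \<phi>_def integral_complex_of_real by simp
    then have "N \<phi> = 0" unfolding L1norm_def \<phi>_def by (simp add: r_def)
    then have "AE x in M. \<phi> x = 0" using N_eq_0_iff[OF Cc_integrable[OF Cc]] by simp
    then have "\<phi> 0 = 0" by (rule continuous_AE_zero[OF c])
    then show False using r0 Np by (simp add: \<phi>_def)
  qed
  moreover have "\<phi> (a + x - a) = \<phi> x" for a x by (simp add: \<phi>_def r_def shift_conj[OF f(1)])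
  ultimately show thesis using that Cc by blast
qed

text \<open>The integral of \<open>conv M \<phi> h\<close> is computed twice. Directly it is the
  product of the integrals of \<open>\<phi>\<close> and \<open>h\<close>. Since
  \<open>\<phi> (x + y) = \<phi> (y + x)\<close>, the convolution is also an integral of left
  translates of \<open>\<phi>\<close> against \<open>k\<close>, the reflection of \<open>h\<close>,
  which gives the product of the integrals of \<open>\<phi>\<close> and \<open>k\<close>. The
  nonzero integral of \<open>\<phi>\<close> cancels.\<close>

lemma integral_uminus_Cc:
  assumes f: "f \<in> ZL1 M" "N f \<noteq> 0" and h: "h \<in> Cc"
  shows "(\<integral>x. h (- x) \<partial>M) = (\<integral>x. h x \<partial>M)"
proof -
  obtain \<phi> where \<phi>: "\<phi> \<in> Cc" "\<And>a x. \<phi> (a + x - a) = \<phi> x" "(\<integral>x. \<phi> x \<partial>M) \<noteq> 0"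
    by (rule class_bump[OF f]) blast
  obtain A where A: "compact A" "\<And>x. x \<notin> A \<Longrightarrow> \<phi> x = 0" "continuous_on UNIV \<phi>" using \<phi>(1) unfolding Cc_def by blast
  obtain B where B: "compact B" "\<And>x. x \<notin> B \<Longrightarrow> h x = 0" "continuous_on UNIV h" using h unfolding Cc_def by blast
  define k where "k = (\<lambda>x. h (- x))"
  have kz: "k y = 0" if "y \<notin> uminus ` B" for y
    using B(2)[of "- y"] that by (force simp: k_def)
  have B': "compact (uminus ` B)" by (rule compact_uminus[OF B(1)])
  have kc: "continuous_on UNIV k" unfolding k_def by (rule continuous_on_compose2[OF B(3)]) (auto intro!: continuous_intros)
  have kC: "k \<in> Cc" unfolding Cc_def using kc B' kz by blast
  have ik: "integrable M k" by (rule Cc_integrable[OF kC])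
  have i\<phi>: "integrable M \<phi>" by (rule Cc_integrable[OF \<phi>(1)])
  have comm: "\<phi> (x + y) = \<phi> (y + x)" for x y
    using \<phi>(2)[of y "x + y"] by (simp add: add.assoc[symmetric])
  have eq: "conv M \<phi> h x = (\<integral>y. k y * \<phi> (y + x) \<partial>M)" for x
    unfolding conv_swap[OF Cc_meas[OF \<phi>(1)] Cc_meas[OF h]] k_def by (simp add: comm[of x] mult.commute)
  define D where "D = {a + b | a b. a \<in> B \<and> b \<in> A}"
  have D: "compact D" unfolding D_def by (intro compact_plus A B)
  have out: "\<phi> (y + x) = 0" if "y \<in> uminus ` B" "x \<notin> D" for y x
  proof (rule ccontr)
    assume "\<phi> (y + x) \<noteq> 0"
    then have "y + x \<in> A" using A(2) by blast
    moreover have "x = - y + (y + x)" by (simp add: add.assoc[symmetric])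
    moreover have "- y \<in> B" using that(1) by auto
    ultimately have "x \<in> D" unfolding D_def by blast
    then show False using that by simp
  qed
  have cont: "continuous_on UNIV (\<lambda>(y, x). \<phi> (y + x))"
  proof -
    have "continuous_on UNIV (\<lambda>p. fst p + snd p :: 'a)" by (intro continuous_intros)
    then show ?thesis unfolding split_beta using continuous_on_compose2[OF A(3), of UNIV "\<lambda>p. fst p + snd p"] by simp
  qed
  have conv1: "(\<integral>x. conv M \<phi> h x \<partial>M) = (\<integral>x. \<phi> x \<partial>M) * (\<integral>x. h x \<partial>M)"
    by (rule integral_conv_Cc[OF i\<phi> A(1,2) h])
  have iconv: "integrable M (conv M \<phi> h)" by (rule conv_integrable(1)[OF i\<phi> Cc_integrable[OF h]])
  have zero: "conv M \<phi> h x = 0" if "x \<notin> D" for x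
  proof -
    have "(\<lambda>y. k y * \<phi> (y + x)) = (\<lambda>_. 0)"
    proof
      fix y show "k y * \<phi> (y + x) = 0" using out[OF _ that, of y] kz[of y] by (cases "y \<in> uminus ` B") simp_all
    qed
    then show ?thesis unfolding eq by simp
  qed
  have "cmod ((\<integral>x. conv M \<phi> h x \<partial>M) - (\<integral>x. k x \<partial>M) * (\<integral>x. \<phi> x \<partial>M)) \<le> 0 + \<epsilon>" if e: "\<epsilon> > 0" for \<epsilon>
  proof -
    have m: "measure M D + 1 > 0" using measure_nonneg[of M D] by linarith
    define d where "d = \<epsilon> / (measure M D + 1)"
    have d: "d > 0" unfolding d_def using e m by simp
    have "\<exists>S w. finite S \<and> S \<subseteq> uminus ` B \<and> (\<Sum>s\<in>S. w s) = (\<integral>y. k y \<partial>M) \<and>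
      (\<forall>x. cmod ((\<integral>y. k y * \<phi> (y + x) \<partial>M) - (\<Sum>s\<in>S. w s * \<phi> (s + x))) \<le> d)"
    proof (rule Riemann_sum_compact[where I="{()}" and \<Phi>="\<lambda>_::unit. \<lambda>y x. \<phi> (y + x)" and D=D and \<epsilon>=d, OF ik B'])
      fix S w
      assume "finite S" "S \<subseteq> uminus ` B" "(\<Sum>s\<in>S. w s) = (\<integral>y. k y \<partial>M)"
       "\<And>i x. i \<in> {()} \<Longrightarrow> cmod ((\<integral>y. k y * \<phi> (y + x) \<partial>M) - (\<Sum>s\<in>S. w s * \<phi> (s + x))) \<le> d"
      then show ?thesis by (intro exI[of _ S] exI[of _ w]) simp
    qed (use kz cont D out d in \<open>simp_all\<close>)
    then obtain S w where S: "finite S" "S \<subseteq> uminus ` B" "(\<Sum>s\<in>S. w s) = (\<integral>y. k y \<partial>M)"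
      "\<And>x. cmod (conv M \<phi> h x - (\<Sum>s\<in>S. w s * \<phi> (s + x))) \<le> d" unfolding eq[symmetric] by blast
    have isum: "integrable M (\<lambda>x. \<Sum>s\<in>S. w s * \<phi> (s + x))"
      by (intro Bochner_Integration.integrable_sum integrable_mult_right integrable_translate i\<phi>)
    have "(\<integral>x. (\<Sum>s\<in>S. w s * \<phi> (s + x)) \<partial>M) = (\<Sum>s\<in>S. w s * (\<integral>x. \<phi> (s + x) \<partial>M))"
      using integrable_translate[OF i\<phi>] by (subst Bochner_Integration.integral_sum) auto
    also have "\<dots> = (\<integral>x. k x \<partial>M) * (\<integral>x. \<phi> x \<partial>M)"
      unfolding integral_translate[OF Cc_meas[OF \<phi>(1)]] by (simp add: sum_distrib_right[symmetric] S(3))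
    finally have "(\<integral>x. conv M \<phi> h x \<partial>M) - (\<integral>x. k x \<partial>M) * (\<integral>x. \<phi> x \<partial>M) = (\<integral>x. conv M \<phi> h x - (\<Sum>s\<in>S. w s * \<phi> (s + x)) \<partial>M)"
      using iconv isum by simp
    also have "cmod \<dots> \<le> N (\<lambda>x. conv M \<phi> h x - (\<Sum>s\<in>S. w s * \<phi> (s + x)))"
      unfolding L1norm_def by (rule integral_norm_bound)
    also have "\<dots> \<le> d * measure M D"
    proof (rule N_compact_supp[OF _ D _ S(4)])
      show "(\<lambda>x. conv M \<phi> h x - (\<Sum>s\<in>S. w s * \<phi> (s + x))) \<in> borel_measurable borel"
        by (intro integrable_meas Bochner_Integration.integrable_diff iconv isum)
      fix x assume x: "x \<notin> D"
      have "(\<Sum>s\<in>S. w s * \<phi> (s + x)) = 0"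
      proof (rule sum.neutral, rule ballI)
        fix s assume "s \<in> S"
        then have "s \<in> uminus ` B" using S(2) by (rule subsetD[rotated])
        then show "w s * \<phi> (s + x) = 0" using out[OF _ x] by simp
      qed
      then show "conv M \<phi> h x - (\<Sum>s\<in>S. w s * \<phi> (s + x)) = 0" using zero[OF x] by simp
    qed
    also have "\<dots> \<le> \<epsilon>" unfolding d_def using e m by (simp add: field_simps)
    finally show ?thesis by simp
  qed
  then have "cmod ((\<integral>x. conv M \<phi> h x \<partial>M) - (\<integral>x. k x \<partial>M) * (\<integral>x. \<phi> x \<partial>M)) \<le> 0" by (rule field_le_epsilon)
  then show ?thesis unfolding conv1 k_def using \<phi>(3) by (simp add: mult.commute)
qed

text \<open>Invariance on \<open>Cc\<close> passes to compact sets inside open ones by Urysohn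
  functions, to open sets by inner regularity and to Borel sets by outer regularity. Applied to the
  reflected set as well, the inequality becomes an equality.\<close>

lemma emeasure_uminus_le:
  assumes f: "f \<in> ZL1 M" "N f \<noteq> 0" and E: "E \<in> sets borel"
  shows "emeasure M (uminus ` E) \<le> emeasure M E"
proof -
  have 1: "emeasure M (uminus ` K) \<le> emeasure M U" if K: "compact K" and U: "open U" "K \<subseteq> U" for K U
  proof (cases "emeasure M U < \<infinity>")
    case True
    obtain u Q where u: "continuous_on UNIV (u::'a \<Rightarrow> real)" "\<And>x. 0 \<le> u x" "\<And>x. u x \<le> 1" "\<And>x. x \<in> K \<Longrightarrow> u x = 1"
      "compact Q" "Q \<subseteq> U" "\<And>x. x \<notin> Q \<Longrightarrow> u x = 0"
      by (rule Urysohn_compact[OF K U]) (rule that; (assumption | blast))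
    define h where "h = (\<lambda>x. complex_of_real (u x))"
    have h: "h \<in> Cc" unfolding Cc_def h_def using u(5,7) by (auto intro!: continuous_intros u(1) exI[of _ Q])
    have K': "compact (uminus ` K)" by (rule compact_uminus[OF K])
    have fK: "emeasure M (uminus ` K) < \<infinity>" using emeasure_compact[OF K'] .
    have inv: "(\<integral>x. u (- x) \<partial>M) = (\<integral>x. u x \<partial>M)"
    proof -
      have "complex_of_real (\<integral>x. u (- x) \<partial>M) = complex_of_real (\<integral>x. u x \<partial>M)"
        using integral_uminus_Cc[OF f h] unfolding h_def integral_complex_of_real .
      then show ?thesis by simp
    qed
    have iu: "integrable M u" using integrable_Re[OF Cc_integrable[OF h]] by (simp add: h_def)
    have h': "(\<lambda>x. h (- x)) \<in> Cc"
    proof -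
      have "continuous_on UNIV h" using h by (simp add: Cc_def)
      then have "continuous_on UNIV (\<lambda>x. h (- x))"
        by (rule continuous_on_compose2) (auto intro!: continuous_intros)
      moreover have "h (- x) = 0" if "x \<notin> uminus ` Q" for x
        using u(7)[of "- x"] that by (force simp: h_def)
      ultimately show ?thesis unfolding Cc_def using compact_uminus[OF u(5)] by blast
    qed
    have iu': "integrable M (\<lambda>x. u (- x))" using integrable_Re[OF Cc_integrable[OF h']] by (simp add: h_def)
    have "measure M (uminus ` K) = (\<integral>x. indicator (uminus ` K) x \<partial>M)" by simp
    also have "\<dots> \<le> (\<integral>x. u (- x) \<partial>M)"
    proof (rule integral_mono[OF _ iu'])
      show "integrable M (indicator (uminus ` K) :: 'a \<Rightarrow> real)"
        using fK K' by (intro integrable_real_indicator) auto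
      show "indicator (uminus ` K) x \<le> u (- x)" for x using u(2)[of "-x"] u(4)[of "- x"] by (auto simp: indicator_def)
    qed
    also have "\<dots> = (\<integral>x. u x \<partial>M)" by (rule inv)
    also have "\<dots> \<le> (\<integral>x. indicator U x \<partial>M)"
    proof (rule integral_mono[OF iu])
      show "integrable M (indicator U :: 'a \<Rightarrow> real)" using True U by (intro integrable_real_indicator) auto
      show "u x \<le> indicator U x" for x using u(3)[of x] u(7)[of x] subsetD[OF u(6), of x] by (cases "x \<in> Q") (auto simp: indicator_def)
    qed
    also have "\<dots> = measure M U" by simp
    finally show ?thesis unfolding emeasure_fin[OF True] emeasure_fin[OF fK] by (rule ennreal_leI)
  next
    case False
    then show ?thesis by (simp add: less_top[symmetric])
  qed
  have 2: "emeasure M (uminus ` U) \<le> emeasure M U" if U: "open U" for U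
  proof -
    have "uminus ` U = uminus -` U" by force
    then have "open (uminus ` U)" using U by (simp add: open_vimage continuous_intros)
    then have "emeasure M (uminus ` U) = (SUP K\<in>{K. compact K \<and> K \<subseteq> uminus ` U}. emeasure M K)"
      by (rule inner_regular_open)
    also have "\<dots> \<le> emeasure M U"
    proof (rule SUP_least)
      fix K assume "K \<in> {K. compact K \<and> K \<subseteq> uminus ` U}"
      then have K: "compact (uminus ` K)" "uminus ` K \<subseteq> U" by (auto intro: compact_uminus)
      have "uminus ` uminus ` K = K" by (simp add: image_comp)
      then show "emeasure M K \<le> emeasure M U" using 1[OF K(1) U K(2)] by simp
    qed
    finally show ?thesis .
  qed
  show ?thesis unfolding outer_regular[OF E]
  proof (rule INF_greatest)
    fix U assume "U \<in> {U. open U \<and> E \<subseteq> U}"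
    then have U: "open U" "E \<subseteq> U" by auto
    have "uminus ` U = uminus -` U" by force
    then have "open (uminus ` U)" using U by (simp add: open_vimage continuous_intros)
    then have "emeasure M (uminus ` E) \<le> emeasure M (uminus ` U)"
      using U by (intro emeasure_mono) auto
    also have "\<dots> \<le> emeasure M U" by (rule 2[OF U(1)])
    finally show "emeasure M (uminus ` E) \<le> emeasure M U" .
  qed
qed

lemma distr_uminus:
  assumes f: "f \<in> ZL1 M" "N f \<noteq> 0"
  shows "distr M borel uminus = M"
proof (rule measure_eqI)
  fix A assume "A \<in> sets (distr M borel uminus)"
  then have A: "A \<in> sets borel" by simp
  have um: "uminus \<in> borel_measurable (borel :: 'a measure)"
    by (intro borel_measurable_continuous_onI continuous_intros)
  have img: "uminus ` A = uminus -` A" by force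
  have A': "uminus ` A \<in> sets borel" unfolding img using measurable_sets[OF um A] by simp
  have "emeasure (distr M borel uminus) A = emeasure M (uminus -` A \<inter> space M)"
    using A um by (intro emeasure_distr) auto
  also have "\<dots> = emeasure M (uminus ` A)" by (simp add: img)
  also have "\<dots> = emeasure M A"
  proof (rule antisym[OF emeasure_uminus_le[OF f A]])
    have "uminus ` uminus ` A = A" by (simp add: image_comp)
    then show "emeasure M A \<le> emeasure M (uminus ` A)" using emeasure_uminus_le[OF f A'] by simp
  qed
  finally show "emeasure (distr M borel uminus) A = emeasure M A" .
qed simp

end

section \<open>Finitely supported functions acting on functions\<close>

text \<open>Sum over the support, with value 0 when the support is infinite. Reindexing along a
  bijection is then unconditional, so identities such as commutativity can be proved without
  tracking finiteness.\<close>

definition ssum :: "('b \<Rightarrow> 'c::comm_monoid_add) \<Rightarrow> 'c" where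
  "ssum g = (\<Sum>s | g s \<noteq> 0. g s)"

lemma ssum_superset: "finite S \<Longrightarrow> {s. g s \<noteq> 0} \<subseteq> S \<Longrightarrow> ssum g = sum g S"
  unfolding ssum_def by (rule sum.mono_neutral_left) auto

lemma ssum_reindex:
  assumes "bij h"
  shows "ssum (\<lambda>t. g (h t)) = ssum g"
  unfolding ssum_def
proof (rule sum.reindex_bij_betw)
  show "bij_betw h {t. g (h t) \<noteq> 0} {s. g s \<noteq> 0}"
    using assms by (auto simp: bij_betw_def inj_on_def bij_def surj_def image_iff)
qed

text \<open>Convolution of the discrete measure with weights \<open>u\<close> and the function
  \<open>f\<close>. For finitely supported \<open>f\<close> it is the product of the group algebra,
  so that one operation serves as product and as action.\<close>

definition act :: "('a::group_add \<Rightarrow> complex) \<Rightarrow> ('a \<Rightarrow> complex) \<Rightarrow> 'a \<Rightarrow> complex" where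
  "act u f x = ssum (\<lambda>s. u s * f (- s + x))"

definition fsupp :: "('a \<Rightarrow> complex) \<Rightarrow> 'a set" where "fsupp u = {s. u s \<noteq> 0}"

definition star :: "('a::group_add \<Rightarrow> complex) \<Rightarrow> 'a \<Rightarrow> complex" where "star u = (\<lambda>x. cnj (u (- x)))"

definition dirac :: "'a::group_add \<Rightarrow> complex" where "dirac = (\<lambda>x. if x = 0 then 1 else 0)"

definition class_fn :: "('a::group_add \<Rightarrow> complex) \<Rightarrow> bool" where
  "class_fn f \<longleftrightarrow> (\<forall>a x. f (a + x - a) = f x)"

definition cl :: "'a::group_add \<Rightarrow> 'a set" where "cl x = {a + x - a | a. True}"

lemma class_fnD: "class_fn f \<Longrightarrow> f (a + x - a) = f x"
  by (simp add: class_fn_def)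

lemma act_sum: "finite S \<Longrightarrow> fsupp u \<subseteq> S \<Longrightarrow> act u f x = (\<Sum>s\<in>S. u s * f (- s + x))"
  unfolding act_def by (rule ssum_superset) (auto simp: fsupp_def)

lemma bij_diff_left: "bij (\<lambda>t. x - (t::'a::group_add))"
  by (rule bij_betw_byWitness[where f'="\<lambda>t. - t + x"]) (auto simp: algebra_simps)

lemma bij_plus_left: "bij (\<lambda>t. x + (t::'a::group_add))"
  by (rule bij_betw_byWitness[where f'="\<lambda>t. - x + t"]) (auto simp: add.assoc[symmetric])

lemma bij_conj: "bij (\<lambda>t. a + (t::'a::group_add) - a)"
proof (rule bij_betw_byWitness[where f'="\<lambda>t. - a + t - - a"])
  show "\<forall>t\<in>UNIV. - a + (a + t - a) - - a = t" by (intro ballI conj_cancel)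
  show "\<forall>t\<in>UNIV. a + (- a + t - - a) - a = t"
    using conj_cancel[of "- a", unfolded minus_minus] by (intro ballI)
qed auto

lemma conj_minus: "- (a + s - a) = a + (- s) - (a::'a::group_add)"
  by (simp add: minus_add add.assoc diff_conv_add_uminus del: add_uminus_conv_diff)

lemma conj_add: "(a + s - a) + (a + t - a) = a + (s + t) - (a::'a::group_add)"
  by (simp add: add.assoc[symmetric] diff_conv_add_uminus del: add_uminus_conv_diff) (simp add: add.assoc)

lemma conj_conj: "a + (b + x - b) - a = (a + b) + x - (a + (b::'a::group_add))"
  by (simp add: minus_add add.assoc diff_conv_add_uminus del: add_uminus_conv_diff)

lemma act_class:
  assumes "class_fn u" "class_fn f"
  shows "class_fn (act u f)"
  unfolding class_fn_def
proof (intro allI)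
  fix a x
  have "act u f (a + x - a) = ssum (\<lambda>s. u (a + s - a) * f (- (a + s - a) + (a + x - a)))"
    unfolding act_def by (rule ssum_reindex[OF bij_conj, symmetric])
  also have "\<dots> = act u f x"
    unfolding act_def conj_minus conj_add class_fnD[OF assms(1)] class_fnD[OF assms(2)] ..
  finally show "act u f (a + x - a) = act u f x" .
qed

text \<open>Substituting \<open>s = x - t\<close> turns one product into the other, because a class
  function satisfies \<open>u (x - t) = u (- t + x)\<close>.\<close>

lemma act_commute:
  assumes "class_fn u"
  shows "act u v = act v u"
proof
  fix x
  have "act u v x = ssum (\<lambda>t. u (x - t) * v (- (x - t) + x))"
    unfolding act_def by (rule ssum_reindex[OF bij_diff_left, symmetric])
  also have "\<dots> = act v u x"
  proof -
    have "u (x - t) = u (- t + x)" for t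
      using class_fnD[OF assms, of "- t" "x - t"] by (simp add: add.assoc)
    then show ?thesis unfolding act_def by (simp add: mult.commute)
  qed
  finally show "act u v x = act v u x" .
qed

lemma class_star:
  assumes "class_fn u"
  shows "class_fn (star u)"
  unfolding class_fn_def
proof (intro allI)
  fix a x
  show "star u (a + x - a) = star u x"
    unfolding star_def conj_minus class_fnD[OF assms] ..
qed

lemma star_act:
  assumes "class_fn u"
  shows "star (act u v) = act (star u) (star v)"
proof
  fix x
  have c: "class_fn (star u)" by (rule class_star[OF assms])
  have "star (act u v) x = ssum (\<lambda>s. cnj (u s) * cnj (v (- s - x)))"
    unfolding star_def act_def ssum_def by simp
  also have "\<dots> = ssum (\<lambda>t. cnj (u (- x + t)) * cnj (v (- (- x + t) - x)))"
    by (rule ssum_reindex[OF bij_plus_left, symmetric])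
  also have "\<dots> = act (star v) (star u) x"
    unfolding act_def star_def by (simp add: mult.commute minus_add add.assoc)
  finally show "star (act u v) x = act (star u) (star v) x" unfolding act_commute[OF c] .
qed

lemma star_star [simp]: "star (star u) = u"
  by (simp add: star_def)

lemma fsupp_star: "fsupp (star u) = uminus ` fsupp u"
  by (force simp: fsupp_def star_def image_iff)

lemma fsupp_act: "fsupp (act u v) \<subseteq> {s + t | s t. s \<in> fsupp u \<and> t \<in> fsupp v}"
proof
  fix x assume "x \<in> fsupp (act u v)"
  then have "act u v x \<noteq> 0" by (simp add: fsupp_def)
  then obtain s where "u s * v (- s + x) \<noteq> 0"
    unfolding act_def ssum_def by (metis (no_types, lifting) mem_Collect_eq sum.neutral)
  then have "s \<in> fsupp u" "- s + x \<in> fsupp v" "x = s + (- s + x)" by (auto simp: fsupp_def add.assoc[symmetric])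
  then show "x \<in> {s + t | s t. s \<in> fsupp u \<and> t \<in> fsupp v}" by blast
qed

lemma finite_plus: "finite A \<Longrightarrow> finite B \<Longrightarrow> finite {s + t | s t. s \<in> A \<and> t \<in> (B::'a::group_add set)}"
proof -
  assume "finite A" "finite B"
  then have "finite ((\<lambda>(s,t). s + t) ` (A \<times> B))" by simp
  moreover have "{s + t | s t. s \<in> A \<and> t \<in> B} = (\<lambda>(s,t). s + t) ` (A \<times> B)" by auto
  ultimately show ?thesis by simp
qed

lemma act_assoc:
  assumes u: "finite (fsupp u)" and v: "finite (fsupp v)"
  shows "act (act u v) f = act u (act v f)"
proof
  fix x
  define R where "R = {s + t | s t. s \<in> fsupp u \<and> t \<in> fsupp v}"
  have R: "finite R" unfolding R_def by (rule finite_plus[OF u v])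
  have inner: "(\<Sum>r\<in>R. v (- s + r) * f (- r + x)) = act v f (- s + x)" if s: "s \<in> fsupp u" for s
  proof -
    have "(\<Sum>r\<in>R. v (- s + r) * f (- r + x)) = ssum (\<lambda>r. v (- s + r) * f (- r + x))"
    proof (rule ssum_superset[OF R, symmetric], safe)
      fix r assume "v (- s + r) * f (- r + x) \<noteq> 0"
      then have "- s + r \<in> fsupp v" "r = s + (- s + r)" by (auto simp: fsupp_def add.assoc[symmetric])
      then show "r \<in> R" unfolding R_def using s by blast
    qed
    also have "\<dots> = ssum (\<lambda>t. v (- s + (s + t)) * f (- (s + t) + x))"
      by (rule ssum_reindex[OF bij_plus_left, symmetric])
    also have "\<dots> = act v f (- s + x)"
      unfolding act_def by (simp add: add.assoc[symmetric] minus_add diff_conv_add_uminus del: add_uminus_conv_diff)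
    finally show ?thesis .
  qed
  have "act (act u v) f x = (\<Sum>r\<in>R. act u v r * f (- r + x))"
    using fsupp_act[of u v] unfolding R_def[symmetric] by (rule act_sum[OF R])
  also have "\<dots> = (\<Sum>r\<in>R. \<Sum>s\<in>fsupp u. u s * (v (- s + r) * f (- r + x)))"
    by (simp add: act_sum[OF u order_refl] sum_distrib_right mult.assoc)
  also have "\<dots> = (\<Sum>s\<in>fsupp u. u s * (\<Sum>r\<in>R. v (- s + r) * f (- r + x)))"
    by (subst sum.swap) (simp add: sum_distrib_left)
  also have "\<dots> = (\<Sum>s\<in>fsupp u. u s * act v f (- s + x))" using inner by simp
  also have "\<dots> = act u (act v f) x" by (simp add: act_sum[OF u order_refl])
  finally show "act (act u v) f x = act u (act v f) x" .
qed

lemma act_add_right: "finite (fsupp u) \<Longrightarrow> act u (\<lambda>x. f x + g x) = (\<lambda>x. act u f x + act u g x)"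
  by (simp add: fun_eq_iff act_sum[OF _ order_refl] distrib_left sum.distrib)

lemma act_diff_right: "finite (fsupp u) \<Longrightarrow> act u (\<lambda>x. f x - g x) = (\<lambda>x. act u f x - act u g x)"
  by (simp add: fun_eq_iff act_sum[OF _ order_refl] right_diff_distrib sum_subtractf)

lemma act_cmult_right: "finite (fsupp u) \<Longrightarrow> act u (\<lambda>x. c * f x) = (\<lambda>x. c * act u f x)"
  by (simp add: fun_eq_iff act_sum[OF _ order_refl] sum_distrib_left mult.left_commute)

lemma act_sum_right: "finite (fsupp u) \<Longrightarrow> act u (\<lambda>x. \<Sum>i\<in>I. f i x) = (\<lambda>x. \<Sum>i\<in>I. act u (f i) x)"
  by (subst fun_eq_iff, simp add: act_sum[OF _ order_refl] sum_distrib_left, subst sum.swap, simp)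

lemma act_add_left:
  assumes "finite (fsupp u)" "finite (fsupp v)"
  shows "act (\<lambda>x. u x + v x) f = (\<lambda>x. act u f x + act v f x)"
proof
  fix x
  have f: "finite (fsupp u \<union> fsupp v)" using assms by simp
  have "fsupp (\<lambda>x. u x + v x) \<subseteq> fsupp u \<union> fsupp v" by (auto simp: fsupp_def)
  then show "act (\<lambda>x. u x + v x) f x = act u f x + act v f x"
    by (simp add: act_sum[OF f] distrib_right sum.distrib)
qed

lemma act_cmult_left: "finite (fsupp u) \<Longrightarrow> act (\<lambda>x. c * u x) f = (\<lambda>x. c * act u f x)"
proof
  fix x assume f: "finite (fsupp u)"
  have "fsupp (\<lambda>x. c * u x) \<subseteq> fsupp u" by (auto simp: fsupp_def)
  then show "act (\<lambda>x. c * u x) f x = c * act u f x"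
    by (simp add: act_sum[OF f] sum_distrib_left mult.assoc)
qed

lemma act_diff_left:
  assumes "finite (fsupp u)" "finite (fsupp v)"
  shows "act (\<lambda>x. u x - v x) f = (\<lambda>x. act u f x - act v f x)"
proof -
  have "finite (fsupp (\<lambda>x. - 1 * v x))" using assms(2) by (simp add: fsupp_def)
  from act_add_left[OF assms(1) this, of f] show ?thesis
    unfolding act_cmult_left[OF assms(2)] by simp
qed

lemma act_dirac [simp]: "act dirac f = f"
proof
  fix x
  have "fsupp dirac \<subseteq> {0::'a}" by (auto simp: fsupp_def dirac_def)
  then show "act dirac f x = f x" by (simp add: act_sum[of "{0}"] dirac_def)
qed

section \<open>Norms and trace of finitely supported functions\<close>

definition n1 :: "('a \<Rightarrow> complex) \<Rightarrow> real" where "n1 u = (\<Sum>s\<in>fsupp u. cmod (u s))"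
text \<open>The square of the l2 norm, where \<open>n1\<close> is the l1 norm. It is the value at 0
  of the product of \<open>u\<close> with \<open>star u\<close>, so that evaluation at 0 plays the
  role of a trace.\<close>

definition n2 :: "('a \<Rightarrow> complex) \<Rightarrow> real" where "n2 u = (\<Sum>s\<in>fsupp u. (cmod (u s))\<^sup>2)"

lemma n1_superset: "finite S \<Longrightarrow> fsupp u \<subseteq> S \<Longrightarrow> n1 u = (\<Sum>s\<in>S. cmod (u s))"
  unfolding n1_def by (rule sum.mono_neutral_left) (auto simp: fsupp_def)

lemma n2_superset: "finite S \<Longrightarrow> fsupp u \<subseteq> S \<Longrightarrow> n2 u = (\<Sum>s\<in>S. (cmod (u s))\<^sup>2)"
  unfolding n2_def by (rule sum.mono_neutral_left) (auto simp: fsupp_def)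

lemma n2_nonneg: "0 \<le> n2 u"
  unfolding n2_def by (auto intro: sum_nonneg)

lemma n2_eq_0: "finite (fsupp u) \<Longrightarrow> n2 u = 0 \<Longrightarrow> u = (\<lambda>x. 0)"
  unfolding n2_def by (subst (asm) sum_nonneg_eq_0_iff) (auto simp: fsupp_def)

lemma cmod_le_n2: "finite (fsupp u) \<Longrightarrow> (cmod (u x))\<^sup>2 \<le> n2 u"
proof (cases "x \<in> fsupp u")
  case True
  assume "finite (fsupp u)"
  then show ?thesis unfolding n2_def using member_le_sum[OF True, of "\<lambda>s. (cmod (u s))\<^sup>2"] by simp
next
  case False
  then show ?thesis using n2_nonneg[of u] by (simp add: fsupp_def)
qed

text \<open>Cauchy-Schwarz on a finite set containing the support; this is where the factors
  \<open>card K\<close> originate.\<close>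

lemma n1_le_n2: "finite S \<Longrightarrow> fsupp u \<subseteq> S \<Longrightarrow> (n1 u)\<^sup>2 \<le> card S * n2 u"
  using sum_squared_le_sum_of_squares[of "\<lambda>s. cmod (u s)" S] by (simp add: n1_superset n2_superset mult.commute)

lemma act_star_0: "finite (fsupp u) \<Longrightarrow> act u (star v) 0 = (\<Sum>s\<in>fsupp u. u s * cnj (v s))"
  by (simp add: act_sum[OF _ order_refl] star_def)

lemma act_star_self: "finite (fsupp u) \<Longrightarrow> act u (star u) 0 = complex_of_real (n2 u)"
  by (simp add: act_star_0 n2_def complex_norm_square[symmetric] del: of_real_power)

lemma n1_star: "n1 (star u) = n1 u"
  unfolding n1_def fsupp_star by (subst sum.reindex) (auto simp: inj_on_def star_def)

lemma finite_fsupp_act: "finite (fsupp u) \<Longrightarrow> finite (fsupp v) \<Longrightarrow> finite (fsupp (act u v))"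
  by (rule finite_subset[OF fsupp_act finite_plus])

text \<open>Young's inequality for l1 and l2.\<close>

lemma n2_act_le:
  assumes u: "finite (fsupp u)" and v: "finite (fsupp v)"
  shows "n2 (act u v) \<le> (n1 u)\<^sup>2 * n2 v"
proof -
  define R where "R = {s + t | s t. s \<in> fsupp u \<and> t \<in> fsupp v}"
  have R: "finite R" unfolding R_def by (rule finite_plus[OF u v])
  have pt: "(cmod (act u v x))\<^sup>2 \<le> n1 u * (\<Sum>s\<in>fsupp u. cmod (u s) * (cmod (v (- s + x)))\<^sup>2)" for x
  proof -
    \<comment> \<open>Splitting \<open>cmod (u s)\<close> into two square roots prepares
      Cauchy-Schwarz with respect to the weights \<open>cmod (u s)\<close>.\<close>
    have "cmod (act u v x) \<le> (\<Sum>s\<in>fsupp u. sqrt (cmod (u s)) * (sqrt (cmod (u s)) * cmod (v (- s + x))))"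
      unfolding act_sum[OF u order_refl] by (rule order.trans[OF norm_sum]) (simp add: norm_mult mult.assoc[symmetric])
    then have "(cmod (act u v x))\<^sup>2 \<le> (\<Sum>s\<in>fsupp u. sqrt (cmod (u s)) * (sqrt (cmod (u s)) * cmod (v (- s + x))))\<^sup>2"
      by (rule power_mono) simp
    also have "\<dots> \<le> (\<Sum>s\<in>fsupp u. (sqrt (cmod (u s)))\<^sup>2) * (\<Sum>s\<in>fsupp u. (sqrt (cmod (u s)) * cmod (v (- s + x)))\<^sup>2)"
      by (rule Cauchy_Schwarz_ineq_sum)
    also have "\<dots> = n1 u * (\<Sum>s\<in>fsupp u. cmod (u s) * (cmod (v (- s + x)))\<^sup>2)"
      by (simp add: n1_def power_mult_distrib)
    finally show ?thesis .
  qed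
  have inner: "(\<Sum>x\<in>R. (cmod (v (- s + x)))\<^sup>2) = n2 v" if s: "s \<in> fsupp u" for s
  proof -
    have "n2 v = (\<Sum>x\<in>(\<lambda>t. s + t) ` fsupp v. (cmod (v (- s + x)))\<^sup>2)"
      unfolding n2_def by (subst sum.reindex) (auto simp: inj_on_def add.assoc[symmetric])
    also have "\<dots> = (\<Sum>x\<in>R. (cmod (v (- s + x)))\<^sup>2)"
    proof (rule sum.mono_neutral_left[OF R])
      show "(\<lambda>t. s + t) ` fsupp v \<subseteq> R" unfolding R_def using s by blast
      show "\<forall>x\<in>R - (\<lambda>t. s + t) ` fsupp v. (cmod (v (- s + x)))\<^sup>2 = 0"
      proof
        fix x assume x: "x \<in> R - (\<lambda>t. s + t) ` fsupp v"
        have "x = s + (- s + x)" by (simp add: add.assoc[symmetric])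
        then have "- s + x \<notin> fsupp v" using x by blast
        then show "(cmod (v (- s + x)))\<^sup>2 = 0" by (simp add: fsupp_def)
      qed
    qed
    finally show ?thesis by simp
  qed
  have "n2 (act u v) = (\<Sum>x\<in>R. (cmod (act u v x))\<^sup>2)"
    using fsupp_act[of u v] unfolding R_def[symmetric] by (rule n2_superset[OF R])
  also have "\<dots> \<le> (\<Sum>x\<in>R. n1 u * (\<Sum>s\<in>fsupp u. cmod (u s) * (cmod (v (- s + x)))\<^sup>2))"
    by (intro sum_mono pt)
  also have "\<dots> = n1 u * (\<Sum>s\<in>fsupp u. cmod (u s) * (\<Sum>x\<in>R. (cmod (v (- s + x)))\<^sup>2))"
    by (simp add: sum_distrib_left[symmetric], subst sum.swap, simp add: sum_distrib_left)
  also have "\<dots> = n1 u * (\<Sum>s\<in>fsupp u. cmod (u s) * n2 v)" using inner by simp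
  also have "(\<Sum>s\<in>fsupp u. cmod (u s) * n2 v) = n1 u * n2 v" by (simp add: n1_def sum_distrib_right)
  also have "n1 u * (n1 u * n2 v) = (n1 u)\<^sup>2 * n2 v" by (simp add: power2_eq_square)
  finally show ?thesis .
qed

lemma n1_act_le:
  assumes u: "finite (fsupp u)" and v: "finite (fsupp v)"
  shows "n1 (act u v) \<le> n1 u * n1 v"
proof -
  define R where "R = {s + t | s t. s \<in> fsupp u \<and> t \<in> fsupp v}"
  have R: "finite R" unfolding R_def by (rule finite_plus[OF u v])
  have inner: "(\<Sum>x\<in>R. cmod (v (- s + x))) = n1 v" if s: "s \<in> fsupp u" for s
  proof -
    have "n1 v = (\<Sum>x\<in>(\<lambda>t. s + t) ` fsupp v. cmod (v (- s + x)))"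
      unfolding n1_def by (subst sum.reindex) (auto simp: inj_on_def add.assoc[symmetric])
    also have "\<dots> = (\<Sum>x\<in>R. cmod (v (- s + x)))"
    proof (rule sum.mono_neutral_left[OF R])
      show "(\<lambda>t. s + t) ` fsupp v \<subseteq> R" unfolding R_def using s by blast
      show "\<forall>x\<in>R - (\<lambda>t. s + t) ` fsupp v. cmod (v (- s + x)) = 0"
      proof
        fix x assume x: "x \<in> R - (\<lambda>t. s + t) ` fsupp v"
        have "x = s + (- s + x)" by (simp add: add.assoc[symmetric])
        then have "- s + x \<notin> fsupp v" using x by blast
        then show "cmod (v (- s + x)) = 0" by (simp add: fsupp_def)
      qed
    qed
    finally show ?thesis by simp
  qed
  have "n1 (act u v) = (\<Sum>x\<in>R. cmod (act u v x))"
    using fsupp_act[of u v] unfolding R_def[symmetric] by (rule n1_superset[OF R])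
  also have "\<dots> \<le> (\<Sum>x\<in>R. \<Sum>s\<in>fsupp u. cmod (u s) * cmod (v (- s + x)))"
    unfolding act_sum[OF u order_refl] by (intro sum_mono order.trans[OF norm_sum]) (simp add: norm_mult)
  also have "\<dots> = (\<Sum>s\<in>fsupp u. cmod (u s) * (\<Sum>x\<in>R. cmod (v (- s + x))))"
    by (subst sum.swap) (simp add: sum_distrib_left)
  also have "\<dots> = (\<Sum>s\<in>fsupp u. cmod (u s) * n1 v)" using inner by simp
  also have "\<dots> = n1 u * n1 v" by (simp add: n1_def sum_distrib_right)
  finally show ?thesis .
qed

lemma act_sum_list:
  assumes "\<And>p. p \<in> set ps \<Longrightarrow> finite (fsupp p)"
  shows "finite (fsupp (\<lambda>x. \<Sum>p\<leftarrow>ps. p x)) \<and> act (\<lambda>x. \<Sum>p\<leftarrow>ps. p x) f = (\<lambda>x. \<Sum>p\<leftarrow>ps. act p f x)"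
  using assms
proof (induction ps)
  case Nil
  show ?case by (simp add: fsupp_def act_def ssum_def)
next
  case (Cons p ps)
  then have f: "finite (fsupp p)" "finite (fsupp (\<lambda>x. \<Sum>p\<leftarrow>ps. p x))" by auto
  have "fsupp (\<lambda>x. p x + (\<Sum>p\<leftarrow>ps. p x)) \<subseteq> fsupp p \<union> fsupp (\<lambda>x. \<Sum>p\<leftarrow>ps. p x)" by (auto simp: fsupp_def)
  then have "finite (fsupp (\<lambda>x. p x + (\<Sum>p\<leftarrow>ps. p x)))" by (rule finite_subset) (use f in simp)
  then show ?case using act_add_left[OF f, of f] Cons by simp
qed

section \<open>Central idempotents\<close>

text \<open>The purely algebraic situation, free of topology: the commutators of group elements with
  elements of the normal subgroup \<open>G0\<close> lie in the finite subgroup \<open>K\<close>.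
  Conjugacy classes in \<open>G0\<close> are therefore contained in cosets of \<open>K\<close> and
  finite.\<close>

locale finite_commutator =
  fixes G0 K :: "'a::group_add set"
  assumes finite_K: "finite K" and subgroup_K: "add_subgroup K" and subgroup_G0: "add_subgroup G0"
    and K_G0: "K \<subseteq> G0" and conj_G0: "x \<in> G0 \<Longrightarrow> a + x - a \<in> G0"
    and comm_K: "x \<in> G0 \<Longrightarrow> a + x - a - x \<in> K"
begin

lemma K_0: "0 \<in> K" and K_add: "x \<in> K \<Longrightarrow> y \<in> K \<Longrightarrow> x + y \<in> K" and K_minus: "x \<in> K \<Longrightarrow> - x \<in> K"
  using subgroup_K by (auto simp: add_subgroup_def)

lemma G0_0: "0 \<in> G0" and G0_add: "x \<in> G0 \<Longrightarrow> y \<in> G0 \<Longrightarrow> x + y \<in> G0" and G0_minus: "x \<in> G0 \<Longrightarrow> - x \<in> G0"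
  using subgroup_G0 by (auto simp: add_subgroup_def)

lemma conj_coset: "x \<in> G0 \<Longrightarrow> \<exists>k\<in>K. a + x - a = k + x"
  using comm_K[of x a] by (intro bexI[of _ "a + x - a - x"]) auto

lemma conj_K: "k \<in> K \<Longrightarrow> a + k - a \<in> K"
proof -
  assume k: "k \<in> K"
  then have "k \<in> G0" using K_G0 by (rule subsetD[rotated])
  then obtain l where "l \<in> K" "a + k - a = l + k" using conj_coset by blast
  then show ?thesis using K_add k by metis
qed

lemma coset_commute: "k \<in> K \<Longrightarrow> \<exists>k'\<in>K. s + k = k' + s"
  using conj_K[of k s] by (intro bexI[of _ "s + k - s"]) auto

definition coset :: "'a \<Rightarrow> 'a set" where "coset s = (\<lambda>k. k + s) ` K"

lemma finite_coset [simp]: "finite (coset s)" and card_coset: "card (coset s) = card K"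
  and coset_0 [simp]: "coset 0 = K"
  unfolding coset_def using finite_K by (auto intro: card_image simp: inj_on_def)

lemma card_K_pos: "card K > 0"
  using finite_K K_0 by (auto simp: card_gt_0_iff)

lemma coset_add: "x \<in> coset s \<Longrightarrow> y \<in> coset t \<Longrightarrow> x + y \<in> coset (s + t)"
proof -
  assume "x \<in> coset s" "y \<in> coset t"
  then obtain k l where kl: "k \<in> K" "l \<in> K" "x = k + s" "y = l + t" unfolding coset_def by blast
  obtain l' where l': "l' \<in> K" "s + l = l' + s" using coset_commute[OF kl(2)] by blast
  have "x + y = k + (s + l) + t" by (simp add: kl add.assoc)
  also have "\<dots> = (k + l') + (s + t)" by (simp add: l' add.assoc)
  finally show ?thesis unfolding coset_def using K_add[OF kl(1) l'(1)] by blast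
qed

lemma coset_minus: "x \<in> coset s \<Longrightarrow> - x \<in> coset (- s)"
proof -
  assume "x \<in> coset s"
  then obtain k where k: "k \<in> K" "x = k + s" unfolding coset_def by blast
  obtain l where l: "l \<in> K" "- s + - k = l + - s" using coset_commute[OF K_minus[OF k(1)]] by blast
  have "- x = - s + - k" unfolding k(2) by (rule minus_add)
  then show ?thesis unfolding coset_def l(2) using l(1) by (rule image_eqI)
qed

lemma coset_G0: "s \<in> G0 \<Longrightarrow> coset s \<subseteq> G0"
  unfolding coset_def using G0_add K_G0 by blast

text \<open>Invariance is under conjugation by the whole group, so these are central elements of the
  full group algebra that happen to be supported in \<open>G0\<close>.\<close>

definition ZZ :: "('a \<Rightarrow> complex) set" where
  "ZZ = {u. class_fn u \<and> finite (fsupp u) \<and> fsupp u \<subseteq> G0}"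

lemma ZZD: "u \<in> ZZ \<Longrightarrow> class_fn u" "u \<in> ZZ \<Longrightarrow> finite (fsupp u)" "u \<in> ZZ \<Longrightarrow> fsupp u \<subseteq> G0"
  by (auto simp: ZZ_def)

lemma ZZ_act: "u \<in> ZZ \<Longrightarrow> v \<in> ZZ \<Longrightarrow> act u v \<in> ZZ"
proof -
  assume u: "u \<in> ZZ" and v: "v \<in> ZZ"
  have "fsupp (act u v) \<subseteq> G0" using fsupp_act[of u v] ZZD(3)[OF u] ZZD(3)[OF v] G0_add by blast
  then show ?thesis using act_class[OF ZZD(1)[OF u] ZZD(1)[OF v]] finite_fsupp_act[OF ZZD(2)[OF u] ZZD(2)[OF v]]
    by (simp add: ZZ_def)
qed

lemma ZZ_star: "u \<in> ZZ \<Longrightarrow> star u \<in> ZZ"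
  using G0_minus by (auto simp: ZZ_def fsupp_star intro: class_star)

lemma ZZ_comm: "u \<in> ZZ \<Longrightarrow> act u v = act v u"
  by (rule act_commute[OF ZZD(1)])

lemma ZZ_assoc: "u \<in> ZZ \<Longrightarrow> v \<in> ZZ \<Longrightarrow> act (act u v) f = act u (act v f)"
  by (intro act_assoc ZZD)

lemma ZZ_star_act: "u \<in> ZZ \<Longrightarrow> star (act u v) = act (star u) (star v)"
  by (rule star_act[OF ZZD(1)])

lemma ZZ_lin: "u \<in> ZZ \<Longrightarrow> v \<in> ZZ \<Longrightarrow> (\<lambda>x. a * u x + b * v x) \<in> ZZ"
proof -
  assume u: "u \<in> ZZ" and v: "v \<in> ZZ"
  have "fsupp (\<lambda>x. a * u x + b * v x) \<subseteq> fsupp u \<union> fsupp v" by (auto simp: fsupp_def)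
  moreover have "finite (fsupp u \<union> fsupp v)" using u v ZZD(2) by simp
  moreover have "class_fn (\<lambda>x. a * u x + b * v x)"
    unfolding class_fn_def by (simp add: class_fnD[OF ZZD(1)[OF u]] class_fnD[OF ZZD(1)[OF v]])
  ultimately show ?thesis using ZZD(3)[OF u] ZZD(3)[OF v] unfolding ZZ_def by (blast intro: finite_subset)
qed

lemma ZZ_cmult: "u \<in> ZZ \<Longrightarrow> (\<lambda>x. a * u x) \<in> ZZ"
  using ZZ_lin[of u u a 0] by simp

lemma ZZ_add: "u \<in> ZZ \<Longrightarrow> v \<in> ZZ \<Longrightarrow> (\<lambda>x. u x + v x) \<in> ZZ"
  using ZZ_lin[of u v 1 1] by simp

definition BB :: "('a \<Rightarrow> complex) set" where "BB = {u. class_fn u \<and> fsupp u \<subseteq> K}"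

lemma BB_ZZ: "u \<in> BB \<Longrightarrow> u \<in> ZZ"
  using finite_subset[OF _ finite_K, of "fsupp u"] K_G0 by (auto simp: BB_def ZZ_def)

lemma BB_K: "u \<in> BB \<Longrightarrow> fsupp u \<subseteq> K" by (simp add: BB_def)

lemma BB_I: "u \<in> ZZ \<Longrightarrow> fsupp u \<subseteq> K \<Longrightarrow> u \<in> BB" by (simp add: BB_def ZZ_def)

lemma fsupp_act_coset: "fsupp u \<subseteq> coset s \<Longrightarrow> fsupp v \<subseteq> coset t \<Longrightarrow> fsupp (act u v) \<subseteq> coset (s + t)"
  using fsupp_act[of u v] coset_add by blast

lemma fsupp_star_coset: "fsupp u \<subseteq> coset s \<Longrightarrow> fsupp (star u) \<subseteq> coset (- s)"
  unfolding fsupp_star using coset_minus by blast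

lemma BB_act: "u \<in> BB \<Longrightarrow> v \<in> BB \<Longrightarrow> act u v \<in> BB"
  using fsupp_act_coset[of u 0 v 0] BB_K[of u] BB_K[of v] by (intro BB_I[OF ZZ_act[OF BB_ZZ BB_ZZ]]) auto

lemma BB_cmult: "u \<in> BB \<Longrightarrow> (\<lambda>x. a * u x) \<in> BB"
  using BB_K[of u] by (intro BB_I[OF ZZ_cmult[OF BB_ZZ]]) (auto simp: fsupp_def)

lemma BB_add: "u \<in> BB \<Longrightarrow> v \<in> BB \<Longrightarrow> (\<lambda>x. u x + v x) \<in> BB"
proof (rule BB_I[OF ZZ_add[OF BB_ZZ BB_ZZ]])
  assume "u \<in> BB" "v \<in> BB"
  then have "fsupp u \<subseteq> K" "fsupp v \<subseteq> K" by (auto simp: BB_def)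
  then show "fsupp (\<lambda>x. u x + v x) \<subseteq> K" by (force simp: fsupp_def)
qed

lemma BB_diff: "u \<in> BB \<Longrightarrow> v \<in> BB \<Longrightarrow> (\<lambda>x. u x - v x) \<in> BB"
  using BB_add[of u "\<lambda>x. - 1 * v x"] BB_cmult[of v "-1"] by simp

section \<open>Selfadjoint idempotents and their traces\<close>

definition Idem :: "('a \<Rightarrow> complex) set" where
  "Idem = {e \<in> BB. star e = e \<and> act e e = e}"

lemma IdD: "e \<in> Idem \<Longrightarrow> e \<in> BB" "e \<in> Idem \<Longrightarrow> e \<in> ZZ" "e \<in> Idem \<Longrightarrow> star e = e" "e \<in> Idem \<Longrightarrow> act e e = e"
  by (auto simp: Idem_def BB_ZZ)

lemma dirac_Id: "dirac \<in> Idem"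
proof -
  have "class_fn (dirac :: 'a \<Rightarrow> complex)"
  proof -
    have "a + x - a = 0 \<longleftrightarrow> x = 0" for a x :: 'a
    proof
      assume "a + x - a = 0"
      then have "a + x = a" by simp
      then have "a + x = a + 0" by (simp only: add_0_right)
      then show "x = 0" by (simp only: add_left_cancel)
    qed simp
    then show ?thesis by (simp add: class_fn_def dirac_def)
  qed
  moreover have "fsupp dirac \<subseteq> K" using K_0 by (auto simp: fsupp_def dirac_def)
  moreover have "star dirac = (dirac :: 'a \<Rightarrow> complex)" by (auto simp: star_def dirac_def)
  ultimately show ?thesis by (simp add: Idem_def BB_def)
qed

lemma Id_trace: "e \<in> Idem \<Longrightarrow> e 0 = complex_of_real (n2 e)"
  using act_star_self[OF ZZD(2)[OF IdD(2)], of e] by (simp add: IdD)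

text \<open>The value of \<open>e\<close> at 0 is its squared l2 norm, which in turn dominates the
  square of that value.\<close>

lemma Id_trace_le: "e \<in> Idem \<Longrightarrow> n2 e \<le> 1"
proof -
  assume e: "e \<in> Idem"
  have "(n2 e)\<^sup>2 \<le> n2 e" using cmod_le_n2[OF ZZD(2)[OF IdD(2)[OF e]], of 0] n2_nonneg[of e] unfolding Id_trace[OF e] by simp
  show ?thesis
  proof (rule ccontr)
    assume "\<not> n2 e \<le> 1"
    then have "n2 e * 1 < n2 e * n2 e" by (intro mult_strict_left_mono) auto
    then show False using \<open>(n2 e)\<^sup>2 \<le> n2 e\<close> by (simp add: power2_eq_square)
  qed
qed

lemma n1_pos: "finite (fsupp u) \<Longrightarrow> u \<noteq> (\<lambda>x. 0) \<Longrightarrow> 0 < n1 u"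
proof -
  assume f: "finite (fsupp u)" and "u \<noteq> (\<lambda>x. 0)"
  then have "fsupp u \<noteq> {}" by (auto simp: fsupp_def)
  then show ?thesis unfolding n1_def using f by (intro sum_pos) (auto simp: fsupp_def)
qed

text \<open>A nonzero idempotent has l1 norm at least 1 by submultiplicativity, and Cauchy-Schwarz
  on \<open>K\<close> turns this into a lower bound for the trace. It makes the repeated splitting
  of an idempotent terminate.\<close>

lemma Id_trace_ge: "e \<in> Idem \<Longrightarrow> e \<noteq> (\<lambda>x. 0) \<Longrightarrow> 1 \<le> card K * n2 e"
proof -
  assume e: "e \<in> Idem" and ne: "e \<noteq> (\<lambda>x. 0)"
  note f = ZZD(2)[OF IdD(2)[OF e]]
  have p: "0 < n1 e" by (rule n1_pos[OF f ne])
  have "n1 e \<le> n1 e * n1 e" using n1_act_le[OF f f] IdD(4)[OF e] by simp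
  then have "1 \<le> n1 e" using p by simp
  then have "1 \<le> (n1 e)\<^sup>2" by simp
  also have "\<dots> \<le> card K * n2 e" by (rule n1_le_n2[OF finite_K BB_K[OF IdD(1)[OF e]]])
  finally show ?thesis .
qed

text \<open>Since \<open>b\<close> is selfadjoint, \<open>n2 (b\<^sup>n)\<close> is the moment sequence of its spectral measure; the normalised
  even powers of \<open>b\<close> converge to the projection onto the eigenspace of the largest eigenvalue of \<open>b\<^sup>2\<close>.\<close>

fun pw :: "('a \<Rightarrow> complex) \<Rightarrow> nat \<Rightarrow> 'a \<Rightarrow> complex" where
  "pw b 0 = b" | "pw b (Suc n) = act b (pw b n)"

lemma pw_BB: "b \<in> BB \<Longrightarrow> pw b n \<in> BB"
proof (induction n)
  case (Suc n)
  then show ?case unfolding pw.simps by (intro BB_act)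
qed (simp only: pw.simps)

lemma pw_star: "b \<in> BB \<Longrightarrow> star b = b \<Longrightarrow> star (pw b n) = pw b n"
proof (induction n)
  case (Suc n)
  then show ?case unfolding pw.simps by (simp only: ZZ_star_act[OF BB_ZZ])
qed (simp only: pw.simps)

text \<open>\<open>pw b n\<close> is the power with exponent \<open>n + 1\<close>; the exponents
  \<open>m + 1\<close> and \<open>n + 1\<close> add up to that of index
  \<open>Suc (m + n)\<close>.\<close>

lemma pw_add: "b \<in> BB \<Longrightarrow> act (pw b m) (pw b n) = pw b (Suc (m + n))"
proof (induction m)
  case (Suc m)
  have "act (act b (pw b m)) (pw b n) = act b (act (pw b m) (pw b n))"
    by (rule ZZ_assoc[OF BB_ZZ[OF Suc.prems] BB_ZZ[OF pw_BB[OF Suc.prems]]])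
  then show ?case unfolding pw.simps add_Suc Suc.IH[OF Suc.prems] .
qed (simp only: pw.simps add_0)

text \<open>\<open>\<rho>\<close> is the top eigenvalue of the square of \<open>b\<close>, and
  \<open>q\<close> the projection belonging to it. As a limit of multiples of powers of
  \<open>b\<close>, \<open>q\<close> is fixed by every element of \<open>BB\<close> that fixes
  \<open>b\<close>. This places \<open>q\<close> below \<open>p\<close> whenever \<open>b\<close>
  is, so that minimality of \<open>p\<close> can be applied.\<close>

lemma spectral_idempotent:
  assumes b: "b \<in> BB" "star b = b" "b \<noteq> (\<lambda>x. 0)"
  obtains q \<rho> where "q \<in> Idem" "q \<noteq> (\<lambda>x. 0)" "act (act b b) q = (\<lambda>x. complex_of_real \<rho> * q x)"
    "\<And>p. p \<in> BB \<Longrightarrow> act p b = b \<Longrightarrow> act p q = q"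
proof -
  have fin: "finite (fsupp (pw b n))" for n using ZZD(2)[OF BB_ZZ[OF pw_BB[OF b(1)]]] .
  define m where "m n = n2 (pw b n)" for n
  \<comment> \<open>Powers of \<open>b\<close> are selfadjoint, so the trace of a product of two of
    them is their inner product.\<close>
  have tr: "(pw b (Suc (i + j))) 0 = (\<Sum>s\<in>K. pw b i s * cnj (pw b j s))" for i j
  proof -
    have "pw b (Suc (i + j)) 0 = act (pw b i) (star (pw b j)) 0"
      unfolding pw_add[OF b(1), symmetric] pw_star[OF b(1,2)] ..
    also have "\<dots> = (\<Sum>s\<in>fsupp (pw b i). pw b i s * cnj (pw b j s))" by (rule act_star_0[OF fin])
    also have "\<dots> = (\<Sum>s\<in>K. pw b i s * cnj (pw b j s))"
      using BB_K[OF pw_BB[OF b(1)]] by (intro sum.mono_neutral_left finite_K) (auto simp: fsupp_def)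
    finally show ?thesis .
  qed
  have mK: "m n = (\<Sum>s\<in>K. (cmod (pw b n s))\<^sup>2)" for n
    unfolding m_def by (rule n2_superset[OF finite_K BB_K[OF pw_BB[OF b(1)]]])
  have trm: "pw b (Suc (i + i)) 0 = complex_of_real (m i)" for i
    unfolding tr mK by (simp add: complex_norm_square[symmetric] del: of_real_power)
  have m_pos: "m n > 0" for n
  proof -
    \<comment> \<open>Strong induction: an even power has the trace \<open>m i\<close>, positive by
      an earlier case, and an odd power is multiplied by \<open>b\<close> once more to reach an even
      one.\<close>
    have ne: "pw b n \<noteq> (\<lambda>x. 0)" for n
    proof (induction n rule: less_induct)
      case (less n)
      show ?case
      proof (cases n)
        case (Suc k)
        define i where "i = k div 2"
        have "i < n" "n \<le> Suc (i + i) \<or> n = Suc (Suc (i + i))" using Suc unfolding i_def by linarith+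
        have ki: "k = i + i \<or> k = Suc (i + i)" unfolding i_def by linarith
        have mi: "m j > 0" if "j < n" for j
        proof -
          have "m j \<noteq> 0" using less.IH[OF that] n2_eq_0[OF fin[of j]] unfolding m_def by blast
          then show ?thesis using n2_nonneg[of "pw b j"] unfolding m_def by linarith
        qed
        from ki show ?thesis
        proof
          assume "k = i + i"
          then have "pw b n 0 = complex_of_real (m i)" using trm[of i] Suc by simp
          then show ?thesis using mi[OF \<open>i < n\<close>] by auto
        next
          assume k: "k = Suc (i + i)"
          have "Suc i < n" using k Suc by linarith
          show ?thesis
          proof
            assume z: "pw b n = (\<lambda>x. 0)"
            have "pw b (Suc (Suc i + Suc i)) = act b (pw b n)" using Suc k by simp
            also have "\<dots> = (\<lambda>x. 0)" unfolding z by (rule ext) (simp add: act_def ssum_def)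
            finally have "complex_of_real (m (Suc i)) = 0" using trm[of "Suc i"] by simp
            then show False using mi[OF \<open>Suc i < n\<close>] by simp
          qed
        qed
      qed (use b in simp)
    qed
    have "m n \<noteq> 0" using ne[of n] n2_eq_0[OF fin[of n]] unfolding m_def by blast
    then show ?thesis using n2_nonneg[of "pw b n"] unfolding m_def by linarith
  qed
  define r where "r n = m (Suc n) / m n" for n
  \<comment> \<open>Log-convexity of the moments by Cauchy-Schwarz; it makes the ratios
    \<open>r\<close> increase.\<close>
  have CS: "(m (Suc n))\<^sup>2 \<le> m n * m (Suc (Suc n))" for n
  proof -
    have "m (Suc n) = cmod (pw b (Suc (n + Suc (Suc n))) 0)"
      using trm[of "Suc n"] m_pos[of "Suc n"] by simp
    also have "\<dots> \<le> (\<Sum>s\<in>K. cmod (pw b n s) * cmod (pw b (Suc (Suc n)) s))"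
      unfolding tr by (rule order.trans[OF norm_sum]) (simp add: norm_mult del: pw.simps)
    finally have "(m (Suc n))\<^sup>2 \<le> (\<Sum>s\<in>K. cmod (pw b n s) * cmod (pw b (Suc (Suc n)) s))\<^sup>2"
      using m_pos[of "Suc n"] by (intro power_mono) auto
    also have "\<dots> \<le> m n * m (Suc (Suc n))"
      unfolding mK by (rule Cauchy_Schwarz_ineq_sum)
    finally show ?thesis .
  qed
  have r_inc: "incseq r"
  proof (rule incseq_SucI)
    fix n
    show "r n \<le> r (Suc n)"
      unfolding r_def using CS[of n] m_pos[of n] m_pos[of "Suc n"] by (simp add: divide_simps power2_eq_square mult.commute)
  qed
  \<comment> \<open>Young's inequality bounds the ratios, so they converge.\<close>
  have r_bd: "r n \<le> (n1 b)\<^sup>2" for n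
    unfolding r_def using n2_act_le[OF ZZD(2)[OF BB_ZZ[OF b(1)]] fin[of n]] m_pos[of n]
    by (simp add: m_def divide_simps)
  obtain \<rho> where rho: "r \<longlonglongrightarrow> \<rho>" "\<And>n. r n \<le> \<rho>"
    using incseq_convergent[OF r_inc, of "(n1 b)\<^sup>2"] r_bd by blast
  have rho_pos: "\<rho> > 0" using rho(2)[of 0] m_pos unfolding r_def by (smt (verit) divide_pos_pos)
  \<comment> \<open>No ratio exceeds \<open>\<rho>\<close>, so the rescaled moments
    decrease.\<close>
  define y where "y n = m n / \<rho> ^ n" for n
  have y_pos: "y n > 0" for n unfolding y_def using m_pos rho_pos by simp
  have y_dec: "decseq y"
  proof (rule decseq_SucI)
    fix n
    have "m (Suc n) \<le> \<rho> * m n" using rho(2)[of n] m_pos[of n] unfolding r_def by (simp add: divide_simps)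
    then show "y (Suc n) \<le> y n" unfolding y_def using rho_pos by (simp add: divide_simps mult.commute)
  qed
  obtain Y where Y: "y \<longlonglongrightarrow> Y" "\<And>n. Y \<le> y n"
    using decseq_convergent[OF y_dec, of 0] y_pos less_imp_le by metis
  \<comment> \<open>\<open>pw b (2n+1)\<close> is \<open>b\<close> to the power \<open>2(n+1)\<close>.\<close>
  define q where "q n = (\<lambda>x. complex_of_real (1 / \<rho> ^ n) * pw b (Suc (n + n)) x)" for n
  have qBB: "q n \<in> BB" for n unfolding q_def by (intro BB_cmult pw_BB b)
  note qZZ = BB_ZZ[OF qBB] note qf = ZZD(2)[OF qZZ]
  have qstar: "star (q n) = q n" for n
    using pw_star[OF b(1,2)] by (simp add: q_def star_def fun_eq_iff del: pw.simps)
  have qact: "act (q i) (q j) = (\<lambda>x. complex_of_real \<rho> * q (Suc (i + j)) x)" for i j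
  proof -
    have f: "finite (fsupp (\<lambda>x. complex_of_real (1 / \<rho> ^ j) * pw b (Suc (j + j)) x))"
      using qf[of j] by (simp add: q_def)
    have "act (q i) (q j) = (\<lambda>x. complex_of_real (1 / \<rho> ^ i) * (complex_of_real (1 / \<rho> ^ j) * act (pw b (Suc (i + i))) (pw b (Suc (j + j))) x))"
      unfolding q_def act_cmult_left[OF fin] act_cmult_right[OF fin] ..
    also have "act (pw b (Suc (i + i))) (pw b (Suc (j + j))) = pw b (Suc (Suc (i + j) + Suc (i + j)))"
      unfolding pw_add[OF b(1)] by (simp add: algebra_simps del: pw.simps)
    also have "(\<lambda>x. complex_of_real (1 / \<rho> ^ i) * (complex_of_real (1 / \<rho> ^ j) * pw b (Suc (Suc (i + j) + Suc (i + j))) x))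
       = (\<lambda>x. complex_of_real \<rho> * q (Suc (i + j)) x)"
      using rho_pos by (simp add: q_def fun_eq_iff power_add del: pw.simps)
    finally show ?thesis .
  qed
  have qinner: "(\<Sum>s\<in>K. q i s * cnj (q j s)) = complex_of_real (\<rho> * y (Suc (i + j)))" for i j
  proof -
    have "(\<Sum>s\<in>K. q i s * cnj (q j s)) = (\<Sum>s\<in>fsupp (q i). q i s * cnj (q j s))"
      using BB_K[OF qBB] by (intro sum.mono_neutral_right finite_K) (auto simp: fsupp_def)
    also have "\<dots> = act (q i) (star (q j)) 0" by (rule act_star_0[OF qf, symmetric])
    also have "\<dots> = complex_of_real \<rho> * q (Suc (i + j)) 0" unfolding qstar qact ..
    also have "q (Suc (i + j)) 0 = complex_of_real (y (Suc (i + j)))"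
      unfolding q_def y_def trm by simp
    finally show ?thesis by simp
  qed
  \<comment> \<open>The squared distance expands into terms of the convergent sequence
    \<open>y\<close> whose limits cancel, which gives the Cauchy property.\<close>
  have qdist: "(cmod (q i x - q j x))\<^sup>2 \<le> \<rho> * (y (Suc (i + i)) - 2 * y (Suc (i + j)) + y (Suc (j + j)))" for i j x
  proof -
    have "complex_of_real (\<Sum>s\<in>K. (cmod (q i s - q j s))\<^sup>2) = (\<Sum>s\<in>K. (q i s - q j s) * cnj (q i s - q j s))"
      by (simp add: complex_norm_square del: of_real_power)
    also have "\<dots> = (\<Sum>s\<in>K. q i s * cnj (q i s)) - (\<Sum>s\<in>K. q i s * cnj (q j s)) - (\<Sum>s\<in>K. q j s * cnj (q i s)) + (\<Sum>s\<in>K. q j s * cnj (q j s))"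
      by (simp add: algebra_simps sum.distrib sum_subtractf)
    also have "\<dots> = complex_of_real (\<rho> * (y (Suc (i + i)) - 2 * y (Suc (i + j)) + y (Suc (j + j))))"
      unfolding qinner by (simp add: algebra_simps)
    finally have "(\<Sum>s\<in>K. (cmod (q i s - q j s))\<^sup>2) = \<rho> * (y (Suc (i + i)) - 2 * y (Suc (i + j)) + y (Suc (j + j)))"
      using of_real_eq_iff by blast
    moreover have "(cmod (q i x - q j x))\<^sup>2 \<le> (\<Sum>s\<in>K. (cmod (q i s - q j s))\<^sup>2)"
    proof (cases "x \<in> K")
      case True
      then show ?thesis using member_le_sum[OF True, of "\<lambda>s. (cmod (q i s - q j s))\<^sup>2"] finite_K by simp
    next
      case False
      then have "q i x = 0" "q j x = 0" using BB_K[OF qBB] by (auto simp: fsupp_def)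
      then show ?thesis by (simp add: sum_nonneg)
    qed
    ultimately show ?thesis by simp
  qed
  have "Cauchy (\<lambda>n. q n x)" for x
  proof (rule metric_CauchyI)
    fix \<epsilon> :: real assume e: "\<epsilon> > 0"
    define d where "d = \<epsilon>\<^sup>2 / (4 * \<rho>)"
    have d: "d > 0" unfolding d_def using e rho_pos by simp
    have "\<forall>\<^sub>F n in sequentially. y n < Y + d" using order_tendstoD(2)[OF Y(1), of "Y + d"] d by simp
    then obtain n0 where n0: "\<And>n. n \<ge> n0 \<Longrightarrow> y n < Y + d" unfolding eventually_sequentially by blast
    show "\<exists>M. \<forall>i\<ge>M. \<forall>j\<ge>M. dist (q i x) (q j x) < \<epsilon>"
    proof (intro exI[of _ n0] allI impI)
      fix i j assume ij: "n0 \<le> i" "n0 \<le> j"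
      have "y (Suc (i + i)) - 2 * y (Suc (i + j)) + y (Suc (j + j)) \<le> 2 * d"
        using n0[of "Suc (i + i)"] n0[of "Suc (j + j)"] Y(2)[of "Suc (i + j)"] ij by linarith
      then have "\<rho> * (y (Suc (i + i)) - 2 * y (Suc (i + j)) + y (Suc (j + j))) \<le> \<rho> * (2 * d)"
        using rho_pos by (intro mult_left_mono) auto
      also have "\<rho> * (2 * d) = \<epsilon>\<^sup>2 / 2" unfolding d_def using rho_pos by (simp add: field_simps)
      also have "\<dots> < \<epsilon>\<^sup>2" using e by simp
      finally have "(cmod (q i x - q j x))\<^sup>2 < \<epsilon>\<^sup>2" using qdist[of i x j] by linarith
      then show "dist (q i x) (q j x) < \<epsilon>" unfolding dist_norm using e by (simp add: power_less_imp_less_base)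
    qed
  qed
  then have "\<forall>x. \<exists>l. (\<lambda>n. q n x) \<longlonglongrightarrow> l" using Cauchy_convergent_iff convergent_def by blast
  then obtain l where l: "\<And>x. (\<lambda>n. q n x) \<longlonglongrightarrow> l x" by metis
  have lK: "l x = 0" if "x \<notin> K" for x
  proof -
    have "(\<lambda>n. q n x) = (\<lambda>n. 0)" using BB_K[OF qBB] that by (auto simp: fsupp_def)
    then have "(\<lambda>n. 0) \<longlonglongrightarrow> l x" using l[of x] by simp
    then show ?thesis using LIMSEQ_unique tendsto_const by blast
  qed
  have lBB: "l \<in> BB"
  proof -
    have "class_fn l" unfolding class_fn_def
    proof (intro allI)
      fix a x
      have "(\<lambda>n. q n (a + x - a)) = (\<lambda>n. q n x)" using class_fnD[OF ZZD(1)[OF qZZ]] by simp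
      then show "l (a + x - a) = l x" using l[of x] l[of "a + x - a"] LIMSEQ_unique by metis
    qed
    then show ?thesis using lK by (auto simp: BB_def fsupp_def)
  qed
  have lstar: "star l = l"
  proof
    fix x
    have "(\<lambda>n. star (q n) x) \<longlonglongrightarrow> star l x" unfolding star_def by (intro tendsto_cnj l)
    then show "star l x = l x" unfolding qstar using l LIMSEQ_unique by blast
  qed
  have lim_act: "(\<lambda>n. act u (q n) x) \<longlonglongrightarrow> act u l x" if u: "u \<in> BB" for u x
    unfolding act_sum[OF finite_K BB_K[OF u]] by (intro tendsto_sum tendsto_mult tendsto_const l)
  have ll: "act l l = (\<lambda>x. complex_of_real \<rho> * l x)"
  proof
    fix x
    have 1: "(\<lambda>n. act (q n) (q n) x) \<longlonglongrightarrow> act l l x"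
      unfolding act_sum[OF finite_K BB_K[OF qBB]] act_sum[OF finite_K BB_K[OF lBB]]
      by (intro tendsto_sum tendsto_mult l)
    have "strict_mono (\<lambda>n. Suc (n + n))" by (rule strict_monoI) simp
    from LIMSEQ_subseq_LIMSEQ[OF l[of x] this]
    have "(\<lambda>n. q (Suc (n + n)) x) \<longlonglongrightarrow> l x" by (simp add: o_def)
    then have "(\<lambda>n. act (q n) (q n) x) \<longlonglongrightarrow> complex_of_real \<rho> * l x" unfolding qact by (intro tendsto_mult tendsto_const)
    then show "act l l x = complex_of_real \<rho> * l x" using 1 LIMSEQ_unique by blast
  qed
  have bbl: "act (act b b) l = (\<lambda>x. complex_of_real \<rho> * l x)"
  proof
    fix x
    have bb: "act b b = q 0" by (simp add: q_def)
    have "(\<lambda>n. act (act b b) (q n) x) \<longlonglongrightarrow> act (act b b) l x" by (intro lim_act BB_act b)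
    moreover have "(\<lambda>n. act (act b b) (q n) x) \<longlonglongrightarrow> complex_of_real \<rho> * l x"
      unfolding bb qact using LIMSEQ_Suc[OF l[of x]] by (intro tendsto_mult tendsto_const) simp
    ultimately show "act (act b b) l x = complex_of_real \<rho> * l x" using LIMSEQ_unique by blast
  qed
  have ratio: "(\<lambda>n. m (n + k) / m n) \<longlonglongrightarrow> \<rho> ^ k" for k
  proof (induction k)
    case 0
    have "(\<lambda>n. m (n + 0) / m n) = (\<lambda>n. 1)" using m_pos by (auto simp: less_imp_neq[symmetric])
    then show ?case by simp
  next
    case (Suc k)
    have "(\<lambda>n. r (n + k) * (m (n + k) / m n)) \<longlonglongrightarrow> \<rho> * \<rho> ^ k"
      by (intro tendsto_mult Suc.IH LIMSEQ_ignore_initial_segment rho(1))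
    moreover have "(\<lambda>n. r (n + k) * (m (n + k) / m n)) = (\<lambda>n. m (n + Suc k) / m n)"
    proof
      fix n show "r (n + k) * (m (n + k) / m n) = m (n + Suc k) / m n"
        unfolding r_def using m_pos[of "n + k"] by simp
    qed
    ultimately show ?case by (simp only: power_Suc)
  qed
  \<comment> \<open>If the rescaled moments tended to 0, some \<open>q N\<close> would have l1 norm
    at most \<open>\<rho> / 2\<close>. Multiplication by it would shrink \<open>y\<close> by a
    factor 4 over a fixed distance \<open>k\<close>, whereas the ratio over a fixed distance tends
    to 1.\<close>
  have Ypos: "Y > 0"
  proof (rule ccontr)
    assume "\<not> Y > 0"
    moreover have "Y \<ge> 0" using Y(1) y_pos by (intro LIMSEQ_le_const) (auto intro: less_imp_le)
    ultimately have Y0: "Y = 0" by simp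
    have cK: "real (card K) > 0" using card_K_pos by simp
    have "\<forall>\<^sub>F n in sequentially. y n < \<rho> / (4 * card K)"
      using order_tendstoD(2)[OF Y(1), of "\<rho> / (4 * card K)"] rho_pos cK unfolding Y0 by simp
    then obtain N where N: "\<And>n. n \<ge> N \<Longrightarrow> y n < \<rho> / (4 * card K)" unfolding eventually_sequentially by blast
    have n2q: "n2 (q i) = \<rho> * y (Suc (i + i))" for i
    proof -
      have "complex_of_real (n2 (q i)) = (\<Sum>s\<in>K. q i s * cnj (q i s))"
        unfolding n2_superset[OF finite_K BB_K[OF qBB]] by (simp add: complex_norm_square del: of_real_power)
      then show ?thesis unfolding qinner using of_real_eq_iff by blast
    qed
    have "(n1 (q N))\<^sup>2 \<le> card K * (\<rho> * y (Suc (N + N)))"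
      using n1_le_n2[OF finite_K BB_K[OF qBB[of N]]] unfolding n2q .
    also have "\<dots> \<le> card K * (\<rho> * (\<rho> / (4 * card K)))"
      using N[of "Suc (N + N)"] rho_pos cK by (intro mult_left_mono less_imp_le) auto
    also have "\<dots> = \<rho>\<^sup>2 / 4" using cK by (simp add: power2_eq_square)
    finally have n1q: "(n1 (q N))\<^sup>2 \<le> \<rho>\<^sup>2 / 4" .
    have step: "y (Suc (Suc (N + i) + Suc (N + i))) \<le> y (Suc (i + i)) / 4" for i
    proof -
      have "\<rho>\<^sup>2 * (\<rho> * y (Suc (Suc (N + i) + Suc (N + i)))) = n2 (act (q N) (q i))"
      proof -
        have "n2 (\<lambda>x. complex_of_real \<rho> * q (Suc (N + i)) x) = \<rho>\<^sup>2 * n2 (q (Suc (N + i)))"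
          using rho_pos by (simp add: n2_def fsupp_def norm_mult power_mult_distrib sum_distrib_left)
        then show ?thesis unfolding qact n2q by simp
      qed
      also have "\<dots> \<le> (n1 (q N))\<^sup>2 * n2 (q i)" by (rule n2_act_le[OF qf qf])
      also have "\<dots> \<le> \<rho>\<^sup>2 / 4 * n2 (q i)" by (intro mult_right_mono n1q n2_nonneg)
      also have "\<dots> = \<rho>\<^sup>2 * (\<rho> * (y (Suc (i + i)) / 4))" unfolding n2q by simp
      finally show ?thesis using rho_pos by simp
    qed
    \<comment> \<open>Multiplication by \<open>q N\<close> moves the index
      \<open>Suc (i + i)\<close> to \<open>Suc (Suc (N + i) + Suc (N + i))\<close>, that is, by
      twice \<open>Suc N\<close>.\<close>
    define k where "k = 2 * Suc N"
    have "(\<lambda>n. m (n + k) / m n / \<rho> ^ k) \<longlonglongrightarrow> \<rho> ^ k / \<rho> ^ k" by (intro tendsto_divide ratio tendsto_const) (use rho_pos in auto)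
    then have "(\<lambda>n. y (n + k) / y n) \<longlonglongrightarrow> 1"
      using rho_pos by (simp add: y_def power_add field_simps)
    then have "\<forall>\<^sub>F n in sequentially. 1 / 2 < y (n + k) / y n" by (rule order_tendstoD) simp
    then obtain n0 where n0: "\<And>n. n \<ge> n0 \<Longrightarrow> 1 / 2 < y (n + k) / y n" unfolding eventually_sequentially by blast
    have "1 / 2 < y (Suc (n0 + n0) + k) / y (Suc (n0 + n0))" by (rule n0) simp
    moreover have eq: "Suc (n0 + n0) + k = Suc (Suc (N + n0) + Suc (N + n0))" unfolding k_def by simp
    ultimately have 1: "1 / 2 < y (Suc (Suc (N + n0) + Suc (N + n0))) / y (Suc (n0 + n0))" by (simp only: eq)
    have "1 / 2 * y (Suc (n0 + n0)) < y (Suc (Suc (N + n0) + Suc (N + n0)))"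
      using 1 by (simp only: pos_less_divide_eq[OF y_pos])
    then show False using step[of n0] y_pos[of "Suc (n0 + n0)"] by linarith
  qed
  have l_ne: "l \<noteq> (\<lambda>x. 0)"
  proof
    assume l0: "l = (\<lambda>x. 0)"
    have "(\<lambda>n. q n 0) \<longlonglongrightarrow> 0" using l[of 0] unfolding l0 .
    moreover have "(\<lambda>n. q n 0) = (\<lambda>n. complex_of_real (y n))" unfolding q_def y_def trm by simp
    moreover have "(\<lambda>n. complex_of_real (y n)) \<longlonglongrightarrow> complex_of_real Y" by (intro tendsto_of_real Y)
    ultimately have "complex_of_real Y = 0" using LIMSEQ_unique by metis
    then show False using Ypos by simp
  qed
  \<comment> \<open>The square of \<open>l\<close> is \<open>\<rho>\<close> times \<open>l\<close>,
    so division by \<open>\<rho>\<close> gives an idempotent.\<close>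
  define e where "e = (\<lambda>x. complex_of_real (1 / \<rho>) * l x)"
  have lf: "finite (fsupp l)" using ZZD(2)[OF BB_ZZ[OF lBB]] .
  have eBB: "e \<in> BB" unfolding e_def by (intro BB_cmult lBB)
  have "act e e = e"
    unfolding e_def act_cmult_left[OF lf] act_cmult_right[OF lf] ll using rho_pos by simp
  moreover have "star e = e" using lstar by (simp add: e_def star_def fun_eq_iff)
  ultimately have eId: "e \<in> Idem" using eBB by (simp add: Idem_def)
  show thesis
  proof (rule that[OF eId])
    show "e \<noteq> (\<lambda>x. 0)"
    proof
      assume "e = (\<lambda>x. 0)"
      then have "l x = 0" for x using rho_pos unfolding e_def by (metis divide_eq_0_iff mult_eq_0_iff of_real_eq_0_iff zero_neq_one less_irrefl)
      then show False using l_ne by blast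
    qed
    have bbf: "finite (fsupp (act b b))" using ZZD(2)[OF BB_ZZ[OF BB_act[OF b(1) b(1)]]] .
    show "act (act b b) e = (\<lambda>x. complex_of_real \<rho> * e x)"
      unfolding e_def act_cmult_right[OF bbf] bbl by (simp add: mult.left_commute)
    fix p assume p: "p \<in> BB" "act p b = b"
    have pf: "finite (fsupp p)" using ZZD(2)[OF BB_ZZ[OF p(1)]] .
    have "act p (pw b n) = pw b n" for n
    proof (cases n)
      case (Suc k)
      have "act p (act b (pw b k)) = act (act p b) (pw b k)"
        using p b pw_BB by (intro ZZ_assoc[symmetric] BB_ZZ)
      then show ?thesis using Suc p by simp
    qed (use p in simp)
    then have "act p (q n) = q n" for n unfolding q_def act_cmult_right[OF pf] by (simp del: pw.simps)
    then have "act p l = l" using lim_act[OF p(1)] l LIMSEQ_unique by (metis ext)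
    then show "act p e = e" unfolding e_def act_cmult_right[OF pf] by simp
  qed
qed

end

section \<open>Invariant means on central unitaries\<close>

lemma norm_sum_list_le: "cmod (\<Sum>x\<leftarrow>xs. f x) \<le> (\<Sum>x\<leftarrow>xs. cmod (f x))"
  by (induction xs) (auto intro: order.trans[OF norm_triangle_ineq])

text \<open>Amenability of a commutative semigroup, with explicit lists. Orbit segments under one
  element \<open>v\<close> telescope, and elements already treated stay almost invariant because
  they commute past the powers of \<open>v\<close>. The list is chosen before
  \<open>\<Theta>\<close>, so the estimate is uniform over bounded functions and later over all
  bilinear forms.\<close>

lemma Folner:
  fixes op :: "'b \<Rightarrow> 'b \<Rightarrow> 'b"
  assumes closed: "\<And>u v. u \<in> U \<Longrightarrow> v \<in> U \<Longrightarrow> op u v \<in> U"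
    and comm: "\<And>u v w. u \<in> U \<Longrightarrow> v \<in> U \<Longrightarrow> w \<in> U \<Longrightarrow> op u (op v w) = op v (op u w)"
    and ne: "u0 \<in> U" and d: "0 < (\<delta>::real)" and vs: "set vs \<subseteq> U"
  shows "\<exists>W. W \<noteq> [] \<and> set W \<subseteq> U \<and> (\<forall>v\<in>set vs. \<forall>\<Theta> B. (\<forall>u\<in>U. cmod (\<Theta> u) \<le> B) \<longrightarrow>
    cmod (\<Sum>u\<leftarrow>W. \<Theta> (op v u) - \<Theta> u) \<le> \<delta> * B * length W)"
  using vs
proof (induction vs)
  case Nil
  show ?case using ne by (intro exI[of _ "[u0]"]) simp
next
  case (Cons v vs)
  then obtain W where W: "W \<noteq> []" "set W \<subseteq> U"
    "\<And>v \<Theta> B. v \<in> set vs \<Longrightarrow> (\<forall>u\<in>U. cmod (\<Theta> u) \<le> B) \<Longrightarrow> cmod (\<Sum>u\<leftarrow>W. \<Theta> (op v u) - \<Theta> u) \<le> \<delta> * B * length W"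
    by auto
  have v: "v \<in> U" and vs: "set vs \<subseteq> U" using Cons.prems by auto
  define pv where "pv i = (op v ^^ i)" for i :: nat
  have pvU: "pv i u \<in> U" if "u \<in> U" for i u unfolding pv_def using that by (induction i) (auto intro: closed v)
  have pvc: "op w (pv i u) = pv i (op w u)" if "u \<in> U" "w \<in> U" for i u w
  proof (induction i)
    case (Suc i)
    have "op w (pv (Suc i) u) = op w (op v (pv i u))" by (simp add: pv_def)
    also have "\<dots> = op v (op w (pv i u))" by (rule comm[OF that(2) v pvU[OF that(1)]])
    also have "\<dots> = pv (Suc i) (op w u)" unfolding Suc.IH by (simp add: pv_def)
    finally show ?case .
  qed (simp add: pv_def)
  \<comment> \<open>The two end terms left by telescoping have size at most \<open>2 * B\<close> and
    are spread over \<open>n\<close> layers.\<close>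
  obtain n :: nat where n: "2 / \<delta> < real n" using reals_Archimedean2 by blast
  have npos: "n > 0" using n d by (cases n) (auto simp: field_simps)
  have nd: "2 \<le> \<delta> * real n" using n d by (simp add: field_simps)
  define W' where "W' = concat (map (\<lambda>i. map (pv i) W) [0..<n])"
  have len: "length W' = n * length W"
    unfolding W'_def by (simp add: length_concat o_def sum_list_triv)
  have sumW: "(\<Sum>u\<leftarrow>W'. f u) = (\<Sum>i\<leftarrow>[0..<n]. \<Sum>u\<leftarrow>W. f (pv i u))" for f :: "'b \<Rightarrow> complex"
    unfolding W'_def by (induction n) (simp_all add: map_concat o_def)
  show ?case
  proof (intro exI[of _ W'] conjI ballI allI impI)
    show "W' \<noteq> []" using W(1) len npos by auto
    show "set W' \<subseteq> U" unfolding W'_def using W(2) pvU by auto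
    fix w \<Theta> B
    assume w: "w \<in> set (v # vs)" and B: "\<forall>u\<in>U. cmod (\<Theta> u) \<le> B"
    have B0: "0 \<le> B" using B ne norm_ge_zero order.trans by blast
    show "cmod (\<Sum>u\<leftarrow>W'. \<Theta> (op w u) - \<Theta> u) \<le> \<delta> * B * length W'"
    proof (cases "w \<in> set vs")
      case True
      have wU: "w \<in> U" using True vs by auto
      \<comment> \<open>\<open>w\<close> passes through the powers of \<open>v\<close>, so each
        layer is covered by the induction hypothesis for the function composed with
        \<open>pv i\<close>.\<close>
      have "(\<Sum>u\<leftarrow>W'. \<Theta> (op w u) - \<Theta> u) = (\<Sum>i\<leftarrow>[0..<n]. \<Sum>u\<leftarrow>W. \<Theta> (pv i (op w u)) - \<Theta> (pv i u))"
        unfolding sumW using W(2) wU by (intro arg_cong[where f=sum_list] map_cong refl) (auto simp: pvc)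
      also have "cmod \<dots> \<le> (\<Sum>i\<leftarrow>[0..<n]. cmod (\<Sum>u\<leftarrow>W. \<Theta> (pv i (op w u)) - \<Theta> (pv i u)))"
        by (rule norm_sum_list_le)
      also have "\<dots> \<le> (\<Sum>i\<leftarrow>[0..<n]. \<delta> * B * length W)"
      proof (rule sum_list_mono)
        fix i
        show "cmod (\<Sum>u\<leftarrow>W. \<Theta> (pv i (op w u)) - \<Theta> (pv i u)) \<le> \<delta> * B * length W"
          using W(3)[OF True, of "\<lambda>u. \<Theta> (pv i u)" B] B pvU by blast
      qed
      also have "\<dots> = \<delta> * B * length W'" by (simp add: len sum_list_triv)
      finally show ?thesis .
    next
      case False
      then have wv: "w = v" using w by simp
      \<comment> \<open>Multiplication by \<open>v\<close> shifts each layer to the next; only the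
        last and the first survive.\<close>
      have "(\<Sum>u\<leftarrow>W'. \<Theta> (op w u) - \<Theta> u) = (\<Sum>u\<leftarrow>W. \<Theta> (pv n u) - \<Theta> u)"
        unfolding sumW wv
      proof (induction n)
        case (Suc n)
        then show ?case
          by (simp add: pv_def sum_list_subtractf)
      qed (simp add: pv_def)
      also have "cmod \<dots> \<le> (\<Sum>u\<leftarrow>W. cmod (\<Theta> (pv n u) - \<Theta> u))"
        by (rule norm_sum_list_le)
      also have "\<dots> \<le> (\<Sum>u\<leftarrow>W. 2 * B)"
      proof (rule sum_list_mono)
        fix u assume "u \<in> set W"
        then have u: "u \<in> U" using W(2) by auto
        have "cmod (\<Theta> (pv n u) - \<Theta> u) \<le> cmod (\<Theta> (pv n u)) + cmod (\<Theta> u)" by (rule norm_triangle_ineq4)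
        then show "cmod (\<Theta> (pv n u) - \<Theta> u) \<le> 2 * B" using bspec[OF B u] bspec[OF B pvU[OF u, of n]] by linarith
      qed
      also have "\<dots> = 2 * (B * length W)" by (simp add: sum_list_triv)
      also have "\<dots> \<le> (\<delta> * real n) * (B * length W)" using nd B0 by (intro mult_right_mono) auto
      also have "\<dots> = \<delta> * B * length W'" by (simp add: len)
      finally show ?thesis .
    qed
  qed
qed

context finite_commutator begin

section \<open>Minimal idempotents\<close>

definition Minimal :: "('a \<Rightarrow> complex) set" where
  "Minimal = {p \<in> Idem. p \<noteq> (\<lambda>x. 0) \<and> (\<forall>q\<in>Idem. act p q = q \<longrightarrow> q = (\<lambda>x. 0) \<or> q = p)}"

lemma Id_diff:
  assumes p: "p \<in> Idem" and q: "q \<in> Idem" and pq: "act p q = q"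
  shows "(\<lambda>x. p x - q x) \<in> Idem"
proof -
  note [simp] = IdD(3,4)[OF p] IdD(3,4)[OF q]
  have f: "finite (fsupp p)" "finite (fsupp q)" using p q IdD(2) ZZD(2) by auto
  have qp: "act q p = q" using ZZ_comm[OF IdD(2)[OF q], of p] pq by simp
  have "star (\<lambda>x. p x - q x) = (\<lambda>x. p x - q x)"
  proof -
    have "star p x = p x" "star q x = q x" for x by simp_all
    then show ?thesis by (simp add: star_def fun_eq_iff)
  qed
  moreover have "act (\<lambda>x. p x - q x) (\<lambda>x. p x - q x) = (\<lambda>x. p x - q x)"
    unfolding act_diff_left[OF f] act_diff_right[OF f(1)] act_diff_right[OF f(2)] by (simp add: pq qp)
  ultimately show ?thesis using BB_diff[OF IdD(1)[OF p] IdD(1)[OF q]] by (simp add: Idem_def)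
qed

text \<open>Induction on an integer above \<open>card K\<close> times the trace. Splitting
  \<open>p\<close> into \<open>q\<close> and \<open>p - q\<close> lowers this quantity by at least 1
  for either part, since the other part is a nonzero idempotent.\<close>

lemma minimal_decomposition:
  assumes "p \<in> Idem"
  shows "\<exists>es. set es \<subseteq> Minimal \<and> (\<forall>x. (\<Sum>e\<leftarrow>es. e x) = p x)"
proof -
  have "\<forall>p\<in>Idem. card K * n2 p < real n \<longrightarrow> (\<exists>es. set es \<subseteq> Minimal \<and> (\<forall>x. (\<Sum>e\<leftarrow>es. e x) = p x))" for n
  proof (induction n)
    case 0
    have "0 \<le> card K * n2 p" for p by (intro mult_nonneg_nonneg n2_nonneg) simp
    then have "\<not> card K * n2 p < real 0" for p by (simp only: of_nat_0 not_less)
    then show ?case by blast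
  next
    case (Suc n)
    show ?case
    proof (intro ballI impI)
      fix p assume p: "p \<in> Idem" and lt: "card K * n2 p < real (Suc n)"
      consider "p = (\<lambda>x. 0)" | "p \<in> Minimal" | q where "q \<in> Idem" "act p q = q" "q \<noteq> (\<lambda>x. 0)" "q \<noteq> p"
        using p unfolding Minimal_def by blast
      then show "\<exists>es. set es \<subseteq> Minimal \<and> (\<forall>x. (\<Sum>e\<leftarrow>es. e x) = p x)"
      proof cases
        case 1
        then show ?thesis by (intro exI[of _ "[]"]) simp
      next
        case 2
        then show ?thesis by (intro exI[of _ "[p]"]) simp
      next
        case (3 q)
        define q' where "q' = (\<lambda>x. p x - q x)"
        have q': "q' \<in> Idem" unfolding q'_def by (rule Id_diff[OF p 3(1,2)])
        have q'0: "q' \<noteq> (\<lambda>x. 0)"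
        proof
          assume "q' = (\<lambda>x. 0)"
          then have "p x - q x = 0" for x unfolding q'_def by meson
          then have "q = p" by (simp add: fun_eq_iff)
          then show False using 3(4) by simp
        qed
        have "complex_of_real (n2 q') = complex_of_real (n2 p - n2 q)"
          using Id_trace[OF q'] Id_trace[OF p] Id_trace[OF 3(1)] by (simp add: q'_def)
        then have n2: "n2 q' = n2 p - n2 q" using of_real_eq_iff by blast
        have "card K * n2 q = card K * n2 p - card K * n2 q'" unfolding n2 by (simp add: right_diff_distrib)
        then have "card K * n2 q < real n" using Id_trace_ge[OF q' q'0] lt by simp
        then obtain es where es: "set es \<subseteq> Minimal" "\<And>x. (\<Sum>e\<leftarrow>es. e x) = q x" using Suc.IH 3(1) by blast
        have "card K * n2 q' = card K * n2 p - card K * n2 q" unfolding n2 by (rule right_diff_distrib)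
        then have "card K * n2 q' < real n" using Id_trace_ge[OF 3(1,3)] lt by simp
        then obtain es' where es': "set es' \<subseteq> Minimal" "\<And>x. (\<Sum>e\<leftarrow>es'. e x) = q' x" using Suc.IH q' by blast
        show ?thesis using es es' by (intro exI[of _ "es @ es'"]) (simp add: q'_def)
      qed
    qed
  qed
  moreover obtain n :: nat where "card K * n2 p < real n" using reals_Archimedean2 by blast
  ultimately show ?thesis using assms by blast
qed

text \<open>The spectral idempotent of \<open>b\<close> lies below \<open>p\<close> and equals
  \<open>p\<close> by minimality; on it the square of \<open>b\<close> is the scalar
  \<open>\<rho>\<close>.\<close>

lemma minimal_square:
  assumes p: "p \<in> Minimal" and b: "b \<in> BB" "star b = b" "act p b = b"
  shows "\<exists>\<rho>::real. act b b = (\<lambda>x. complex_of_real \<rho> * p x)"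
proof (cases "b = (\<lambda>x. 0)")
  case True
  then show ?thesis by (intro exI[of _ 0]) (simp add: fun_eq_iff act_def ssum_def)
next
  case False
  have pI: "p \<in> Idem" using p by (simp add: Minimal_def)
  obtain q \<rho> where q: "q \<in> Idem" "q \<noteq> (\<lambda>x. 0)" "act (act b b) q = (\<lambda>x. complex_of_real \<rho> * q x)"
    "\<And>p. p \<in> BB \<Longrightarrow> act p b = b \<Longrightarrow> act p q = q"
    by (rule spectral_idempotent[OF b(1,2) False]) (rule that; (assumption | blast))
  have "act p q = q" by (rule q(4)[OF IdD(1)[OF pI] b(3)])
  then have qp: "q = p" using p q(1,2) by (auto simp: Minimal_def)
  have bp: "act b p = b" using ZZ_comm[OF BB_ZZ[OF b(1)], of p] b(3) by simp
  have "act (act b b) p = act b b" unfolding ZZ_assoc[OF BB_ZZ[OF b(1)] BB_ZZ[OF b(1)]] bp ..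
  then have "act b b = (\<lambda>x. complex_of_real \<rho> * p x)" using q(3) unfolding qp by (rule trans[OF sym])
  then show ?thesis by blast
qed

text \<open>Polarisation: \<open>b\<close> is recovered from the squares of \<open>b\<close> and of
  \<open>b + p\<close>, both of which are real multiples of \<open>p\<close>.\<close>

lemma minimal_scalar:
  assumes p: "p \<in> Minimal" and b: "b \<in> BB" "star b = b" "act p b = b"
  shows "\<exists>c::real. b = (\<lambda>x. complex_of_real c * p x)"
proof -
  have pI: "p \<in> Idem" using p by (simp add: Minimal_def)
  note pB = IdD(1)[OF pI]
  have f: "finite (fsupp p)" "finite (fsupp b)" using pB b BB_ZZ ZZD(2) by auto
  have bp: "act b p = b" using ZZ_comm[OF BB_ZZ[OF b(1)], of p] b(3) by simp
  obtain \<rho> :: real where r: "act b b = (\<lambda>x. complex_of_real \<rho> * p x)" using minimal_square[OF p b] by blast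
  have star: "star (\<lambda>x. b x + p x) = (\<lambda>x. b x + p x)"
  proof -
    have "star b x = b x" "star p x = p x" for x using b(2) IdD(3)[OF pI] by simp_all
    then show ?thesis by (simp add: star_def fun_eq_iff)
  qed
  have abs: "act p (\<lambda>x. b x + p x) = (\<lambda>x. b x + p x)"
    unfolding act_add_right[OF f(1)] b(3) IdD(4)[OF pI] ..
  obtain \<rho>' :: real where r': "act (\<lambda>x. b x + p x) (\<lambda>x. b x + p x) = (\<lambda>x. complex_of_real \<rho>' * p x)"
    using minimal_square[OF p BB_add[OF b(1) pB] star abs] by blast
  have "act (\<lambda>x. b x + p x) (\<lambda>x. b x + p x) = (\<lambda>x. (complex_of_real \<rho> * p x + b x) + (b x + p x))"
    unfolding act_add_left[OF f(2,1)] act_add_right[OF f(1)] act_add_right[OF f(2)] r bp b(3) IdD(4)[OF pI] ..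
  then have eq: "(complex_of_real \<rho> * p x + b x) + (b x + p x) = complex_of_real \<rho>' * p x" for x
    using r' by metis
  have "b x = complex_of_real ((\<rho>' - \<rho> - 1) / 2) * p x" for x
    using eq[of x] by (simp add: field_simps)
  then show ?thesis by blast
qed

text \<open>The unitary elements of the corner cut out by \<open>p\<close> that live on a single
  coset of \<open>K\<close>. Confinement to a coset, which products and adjoints preserve, is what
  bounds their l1 norm.\<close>

definition unitaries :: "('a \<Rightarrow> complex) \<Rightarrow> ('a \<Rightarrow> complex) set" where
  "unitaries p = {u \<in> ZZ. (\<exists>s\<in>G0. fsupp u \<subseteq> coset s) \<and> act u (star u) = p}"

lemma unitariesD: "u \<in> unitaries p \<Longrightarrow> u \<in> ZZ" "u \<in> unitaries p \<Longrightarrow> act u (star u) = p"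
  by (auto simp: unitaries_def)

lemma unitaries_act:
  assumes p: "p \<in> Idem" and u: "u \<in> unitaries p" and v: "v \<in> unitaries p"
  shows "act u v \<in> unitaries p"
proof -
  note uZ = unitariesD(1)[OF u] and vZ = unitariesD(1)[OF v]
  note sv = ZZ_star[OF vZ] and su = ZZ_star[OF uZ]
  have "act (act u v) (star (act u v)) = act (act u v) (act (star u) (star v))" unfolding ZZ_star_act[OF uZ] ..
  also have "\<dots> = act u (act v (act (star u) (star v)))" by (rule ZZ_assoc[OF uZ vZ])
  also have "act v (act (star u) (star v)) = act (star u) (act v (star v))"
    unfolding ZZ_comm[OF su, of "star v"] ZZ_assoc[OF vZ sv, symmetric] by (rule ZZ_comm[OF ZZ_act[OF vZ sv]])
  also have "act u (act (star u) (act v (star v))) = act (act u (star u)) (act v (star v))" by (rule ZZ_assoc[OF uZ su, symmetric])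
  also have "\<dots> = p" unfolding unitariesD(2)[OF u] unitariesD(2)[OF v] by (rule IdD(4)[OF p])
  finally have "act (act u v) (star (act u v)) = p" .
  moreover obtain s t where "s \<in> G0" "fsupp u \<subseteq> coset s" "t \<in> G0" "fsupp v \<subseteq> coset t"
    using u v by (auto simp: unitaries_def)
  ultimately show ?thesis unfolding unitaries_def using ZZ_act[OF uZ vZ] fsupp_act_coset G0_add by blast
qed

lemma unitaries_unit: "p \<in> Idem \<Longrightarrow> p \<in> unitaries p"
  unfolding unitaries_def using IdD[of p] BB_K[of p] G0_0 by (auto intro!: bexI[of _ 0])

text \<open>With \<open>d\<close> the complementary idempotent, the product of
  \<open>act d u\<close> with its adjoint is a multiple of \<open>act d p\<close>, hence 0. Its
  trace is the squared l2 norm of \<open>act d u\<close>, which therefore vanishes.\<close>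

lemma unitaries_absorb:
  assumes p: "p \<in> Idem" and u: "u \<in> unitaries p"
  shows "act p u = u"
proof -
  note uZ = unitariesD(1)[OF u] and pZ = IdD(2)[OF p]
  define d where "d = (\<lambda>x. dirac x - p x)"
  have dI: "d \<in> Idem" unfolding d_def by (rule Id_diff[OF dirac_Id p act_dirac])
  note dZ = IdD(2)[OF dI]
  have f: "finite (fsupp (dirac :: 'a \<Rightarrow> complex))" "finite (fsupp p)"
    using ZZD(2)[OF IdD(2)[OF dirac_Id]] ZZD(2)[OF pZ] by blast+
  have du: "act d u = (\<lambda>x. u x - act p u x)" unfolding d_def act_diff_left[OF f(1,2)] act_dirac ..
  have dp: "act d p = (\<lambda>x. 0)" unfolding d_def act_diff_left[OF f(1,2)] act_dirac IdD(4)[OF p] by simp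
  have "act (act d u) (star (act d u)) = act (act d u) (act d (star u))"
    unfolding ZZ_star_act[OF dZ] IdD(3)[OF dI] ..
  also have "\<dots> = act d (act u (act d (star u)))" by (rule ZZ_assoc[OF dZ uZ])
  also have "act u (act d (star u)) = act d (act u (star u))"
    unfolding ZZ_assoc[OF uZ dZ, symmetric] ZZ_comm[OF uZ, of d] by (rule ZZ_assoc[OF dZ uZ])
  also have "act d (act d (act u (star u))) = (\<lambda>x. 0)"
    unfolding unitariesD(2)[OF u] dp by (simp add: fun_eq_iff act_def ssum_def)
  finally have "act (act d u) (star (act d u)) 0 = 0" by simp
  then have "n2 (act d u) = 0" using act_star_self[OF ZZD(2)[OF ZZ_act[OF dZ uZ]]] by simp
  then have "act d u = (\<lambda>x. 0)" by (rule n2_eq_0[OF ZZD(2)[OF ZZ_act[OF dZ uZ]]])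
  then have "u x - act p u x = 0" for x unfolding du by meson
  then show ?thesis by (simp add: fun_eq_iff)
qed

text \<open>The squared l2 norm of \<open>u\<close> is the trace of \<open>p\<close>, at most 1, and
  \<open>u\<close> lives on at most \<open>card K\<close> points.\<close>

lemma unitaries_n1:
  assumes p: "p \<in> Idem" and u: "u \<in> unitaries p"
  shows "n1 u \<le> card K" "n1 (star u) \<le> card K"
proof -
  obtain s where s: "fsupp u \<subseteq> coset s" using u by (auto simp: unitaries_def)
  have "complex_of_real (n2 u) = complex_of_real (n2 p)"
    using act_star_self[OF ZZD(2)[OF unitariesD(1)[OF u]]] Id_trace[OF p] unfolding unitariesD(2)[OF u] by simp
  then have n2: "n2 u \<le> 1" using Id_trace_le[OF p] by simp
  have K1: "1 \<le> real (card K)" using card_K_pos by simp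
  have "(n1 u)\<^sup>2 \<le> card (coset s) * n2 u" by (rule n1_le_n2[OF finite_coset s])
  also have "\<dots> \<le> card K * card K" unfolding card_coset
    using mult_left_mono[of "n2 u" "real (card K)" "real (card K)"] n2 K1 by simp
  finally have "(n1 u)\<^sup>2 \<le> (real (card K))\<^sup>2" by (simp add: power2_eq_square)
  then show "n1 u \<le> card K" by (rule power2_le_imp_le) simp
  then show "n1 (star u) \<le> card K" unfolding n1_star .
qed

section \<open>Class averages and their unitary parts\<close>

definition avg :: "'a \<Rightarrow> 'a \<Rightarrow> complex" where
  "avg t = (\<lambda>x. if x \<in> cl t then 1 / of_nat (card (cl t)) else 0)"

lemma cl_self: "x \<in> cl x"
  unfolding cl_def by (rule CollectI, rule exI[of _ 0]) simp

lemma cl_conj: "cl (a + x - a) = cl (x::'a)"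
proof -
  have "cl (a + x - a) \<subseteq> cl x" for a x :: 'a
    unfolding cl_def using conj_conj by blast
  from this[of a x] this[of "- a" "a + x - a"] show ?thesis unfolding conj_cancel by blast
qed

lemma cl_eq: "y \<in> cl x \<Longrightarrow> cl y = cl (x::'a)"
proof -
  assume "y \<in> cl x"
  then obtain a where "y = a + x - a" unfolding cl_def by blast
  then show ?thesis by (simp only: cl_conj)
qed

lemma cl_coset: "x \<in> G0 \<Longrightarrow> cl x \<subseteq> coset x"
proof
  fix y assume x: "x \<in> G0" and "y \<in> cl x"
  then obtain a where "y = a + x - a" unfolding cl_def by blast
  then show "y \<in> coset x" using conj_coset[OF x, of a] unfolding coset_def by blast
qed

lemma finite_cl: "x \<in> G0 \<Longrightarrow> finite (cl x)"
  by (rule finite_subset[OF cl_coset]) auto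

lemma cl_G0: "x \<in> G0 \<Longrightarrow> cl x \<subseteq> G0"
  using cl_coset coset_G0 by blast

lemma avg_ZZ: "t \<in> G0 \<Longrightarrow> avg t \<in> ZZ"
proof -
  assume t: "t \<in> G0"
  have s: "fsupp (avg t) \<subseteq> cl t" by (auto simp: fsupp_def avg_def)
  have "a + x - a \<in> cl t \<longleftrightarrow> x \<in> cl t" for a x
    using cl_eq[of "a + x - a" t] cl_eq[of x t] cl_conj[of a x] cl_self[of x] cl_self[of "a + x - a"] by auto
  then have "class_fn (avg t)" by (simp add: class_fn_def avg_def)
  then show ?thesis using s finite_cl[OF t] cl_G0[OF t] unfolding ZZ_def by (blast intro: finite_subset)
qed

text \<open>The product of \<open>w\<close> with its adjoint is supported in the coset of 0,
  selfadjoint and fixed by \<open>p\<close>, hence a real multiple \<open>c\<close> of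
  \<open>p\<close>. Comparing traces gives \<open>c \<ge> 0\<close>, and scaling by
  \<open>1 / sqrt c\<close> produces the unitary.\<close>

lemma avg_unitary:
  assumes p: "p \<in> Minimal" and t: "t \<in> G0"
  shows "\<exists>u\<in>unitaries p. \<exists>c. act p (avg t) = (\<lambda>x. c * u x)"
proof -
  have pI: "p \<in> Idem" using p by (simp add: Minimal_def)
  note pZ = IdD(2)[OF pI]
  define w where "w = act p (avg t)"
  have wZ: "w \<in> ZZ" unfolding w_def by (intro ZZ_act pZ avg_ZZ t)
  note sZ = ZZ_star[OF wZ]
  have wf: "finite (fsupp w)" by (rule ZZD(2)[OF wZ])
  have "fsupp (avg t) \<subseteq> coset t" using cl_coset[OF t] by (auto simp: fsupp_def avg_def)
  then have ws: "fsupp w \<subseteq> coset t"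
    using fsupp_act_coset[of p 0 "avg t" t] BB_K[OF IdD(1)[OF pI]] unfolding w_def by simp
  have pw: "act p w = w" unfolding w_def ZZ_assoc[OF pZ pZ, symmetric] IdD(4)[OF pI] ..
  define b where "b = act w (star w)"
  have bB: "b \<in> BB"
    using fsupp_act_coset[OF ws fsupp_star_coset[OF ws]] unfolding b_def
    by (intro BB_I[OF ZZ_act[OF wZ sZ]]) simp
  have "star b = b" unfolding b_def ZZ_star_act[OF wZ] star_star by (rule ZZ_comm[OF sZ])
  moreover have "act p b = b" unfolding b_def ZZ_assoc[OF pZ wZ, symmetric] pw ..
  ultimately obtain c :: real where c: "b = (\<lambda>x. complex_of_real c * p x)" using minimal_scalar[OF p bB] by blast
  have "complex_of_real (n2 w) = complex_of_real (c * n2 p)"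
    using act_star_self[OF wf] unfolding b_def[symmetric] c Id_trace[OF pI] by simp
  then have cn: "n2 w = c * n2 p" using of_real_eq_iff by blast
  have p1: "n2 p > 0" using Id_trace_ge[OF pI] p n2_nonneg[of p] by (cases "n2 p = 0") (auto simp: Minimal_def)
  have c0: "c \<ge> 0" using cn n2_nonneg[of w] p1 by (simp add: zero_le_mult_iff)
  show ?thesis
  proof (cases "c = 0")
    case True
    then have "n2 w = 0" using cn by simp
    then have "w = (\<lambda>x. 0)" by (rule n2_eq_0[OF wf])
    \<comment> \<open>A vanishing cut average counts as 0 times the unitary
      \<open>p\<close>.\<close>
    then show ?thesis using unitaries_unit[OF pI] unfolding w_def by (intro bexI[of _ p] exI[of _ 0]) auto
  next
    case False
    then have cp: "c > 0" using c0 by simp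
    define r where "r = 1 / sqrt c"
    have r: "r * r * c = 1" "r \<noteq> 0" using cp by (simp_all add: r_def)
    define u where "u = (\<lambda>x. complex_of_real r * w x)"
    have uZ: "u \<in> ZZ" unfolding u_def by (rule ZZ_cmult[OF wZ])
    have su: "star u = (\<lambda>x. complex_of_real r * star w x)" by (simp add: u_def star_def)
    have "act u (star u) = (\<lambda>x. complex_of_real r * (complex_of_real r * b x))"
      unfolding su unfolding u_def act_cmult_left[OF wf] act_cmult_right[OF wf] b_def ..
    also have "\<dots> = (\<lambda>x. complex_of_real (r * r * c) * p x)" unfolding c by (simp add: mult.assoc)
    also have "\<dots> = p" unfolding r by simp
    finally have "act u (star u) = p" .
    moreover have "fsupp u \<subseteq> coset t" using ws by (auto simp: u_def fsupp_def)
    ultimately have "u \<in> unitaries p" using uZ t by (auto simp: unitaries_def)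
    moreover have "act p (avg t) = (\<lambda>x. (1 / complex_of_real r) * u x)" using r(2) by (simp add: u_def w_def[symmetric])
    ultimately show ?thesis by blast
  qed
qed

lemma unitaries_star:
  assumes u: "u \<in> unitaries p"
  shows "star u \<in> unitaries p"
proof -
  obtain s where s: "s \<in> G0" "fsupp u \<subseteq> coset s" using u by (auto simp: unitaries_def)
  have "act (star u) (star (star u)) = p"
    using unitariesD[OF u] ZZ_comm[OF unitariesD(1)[OF u], of "star u"] by simp
  then show ?thesis
    using ZZ_star[OF unitariesD(1)[OF u]] fsupp_star_coset[OF s(2)] G0_minus[OF s(1)] unfolding unitaries_def by blast
qed

text \<open>Since \<open>u\<close> absorbs \<open>p\<close>, multiplying it by \<open>avg s\<close>
  is, up to a scalar independent of \<open>u\<close>, multiplication by the unitary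
  \<open>v\<close>. Class averages thus act as translations in the commutative group of
  unitaries.\<close>

lemma avg_factor:
  assumes p: "p \<in> Minimal" and s: "s \<in> G0"
  shows "\<exists>v\<in>unitaries p. \<exists>c. \<forall>u\<in>unitaries p. \<forall>f. act u (act (avg s) f) = (\<lambda>x. c * act (act v u) f x)"
proof -
  have pI: "p \<in> Idem" using p by (simp add: Minimal_def)
  note pZ = IdD(2)[OF pI]
  obtain v c where v: "v \<in> unitaries p" and c: "act p (avg s) = (\<lambda>x. c * v x)"
    using avg_unitary[OF p s] by (elim bexE exE) (rule that)
  note vZ = unitariesD(1)[OF v]
  have "act u (act (avg s) f) = (\<lambda>x. c * act (act v u) f x)" if u: "u \<in> unitaries p" for u f
  proof -
    note uZ = unitariesD(1)[OF u]
    have up: "act u p = u" using unitaries_absorb[OF pI u] ZZ_comm[OF uZ, of p] by simp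
    have "act u (act (avg s) f) = act (act (act u p) (avg s)) f" unfolding up by (rule ZZ_assoc[OF uZ avg_ZZ[OF s], symmetric])
    also have "act (act u p) (avg s) = act u (\<lambda>x. c * v x)" unfolding ZZ_assoc[OF uZ pZ] c ..
    also have "\<dots> = (\<lambda>x. c * act v u x)" unfolding act_cmult_right[OF ZZD(2)[OF uZ]] ZZ_comm[OF uZ, of v] ..
    also have "act \<dots> f = (\<lambda>x. c * act (act v u) f x)" by (rule act_cmult_left[OF ZZD(2)[OF ZZ_act[OF vZ uZ]]])
    finally show ?thesis .
  qed
  then show ?thesis using v by blast
qed

end

section \<open>Class functions on the group\<close>

text \<open>What a nonzero central function leaves behind: a measure invariant under inversion, an
  open \<open>G0\<close>, and a conjugation-invariant neighbourhood \<open>V\<close> of 0 whose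
  differences lie in the compact set \<open>W\<close>. Classes of points off \<open>G0\<close> are
  contained in no compact set.\<close>

locale in_group = haar_group M + finite_commutator G0 K
  for M :: "'a::{topological_group_add, t2_space} measure" and G0 K :: "'a set" +
  fixes V W :: "'a set"
  assumes uminus_invariant: "distr M borel uminus = M"
    and open_G0: "open G0"
    and not_G0: "x \<notin> G0 \<Longrightarrow> compact C \<Longrightarrow> \<exists>y\<in>cl x. y \<notin> C"
    and V: "open V" "0 \<in> V" "\<And>a v. v \<in> V \<Longrightarrow> a + v - a \<in> V"
    and W: "compact W" "\<And>v v'. v \<in> V \<Longrightarrow> v' \<in> V \<Longrightarrow> - v + v' \<in> W"
begin

section \<open>Inversion, right translation and conjugation\<close>

lemma meas_uminus: "uminus \<in> measurable M (borel :: 'a measure)"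
  by (simp add: borel_measurable_continuous_onI continuous_intros)

lemma integral_uminus:
  fixes f :: "'a \<Rightarrow> 'b::{banach,second_countable_topology}"
  assumes "f \<in> borel_measurable borel"
  shows "(\<integral>x. f (- x) \<partial>M) = (\<integral>x. f x \<partial>M)"
proof -
  have "(\<integral>x. f x \<partial>distr M borel uminus) = (\<integral>x. f (- x) \<partial>M)"
    using assms by (intro integral_distr meas_uminus)
  then show ?thesis unfolding uminus_invariant by (rule sym)
qed

lemma integrable_uminus:
  fixes f :: "'a \<Rightarrow> 'b::{banach,second_countable_topology}"
  assumes "integrable M f"
  shows "integrable M (\<lambda>x. f (- x))"
proof -
  have "integrable (distr M borel uminus) f" unfolding uminus_invariant by (rule assms)
  then show ?thesis by (rule integrable_distr[OF meas_uminus])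
qed

lemma minus_translate: "- (- s + x) = - x + (s::'a)"
  by (simp add: minus_add)

lemma integral_translate_right:
  fixes f :: "'a \<Rightarrow> 'b::{banach,second_countable_topology}"
  assumes "f \<in> borel_measurable borel"
  shows "(\<integral>x. f (x + s) \<partial>M) = (\<integral>x. f x \<partial>M)"
proof -
  have "(\<integral>x. f (x + s) \<partial>M) = (\<integral>x. f (- x + s) \<partial>M)"
    by (rule integral_uminus[symmetric, OF borel_translate_right[OF assms]])
  also have "\<dots> = (\<integral>x. f (- (- s + x)) \<partial>M)" unfolding minus_translate ..
  also have "\<dots> = (\<integral>x. f (- x) \<partial>M)" by (rule integral_translate[OF borel_uminus[OF assms]])
  also have "\<dots> = (\<integral>x. f x \<partial>M)" by (rule integral_uminus[OF assms])
  finally show ?thesis .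
qed

lemma integrable_translate_right:
  fixes f :: "'a \<Rightarrow> 'b::{banach,second_countable_topology}"
  assumes "integrable M f"
  shows "integrable M (\<lambda>x. f (x + s))"
proof -
  have "integrable M (\<lambda>x. f (- (- s + - x)))"
    by (rule integrable_uminus[OF integrable_translate[OF integrable_uminus[OF assms]]])
  then show ?thesis unfolding minus_translate minus_minus .
qed

lemma integrable_reflect:
  fixes f :: "'a \<Rightarrow> 'b::{banach,second_countable_topology}"
  assumes "integrable M f"
  shows "integrable M (\<lambda>y. f (- y + x))"
  using integrable_uminus[OF integrable_translate_right[OF assms, of x]] by simp

lemma integral_conj:
  fixes f :: "'a \<Rightarrow> 'b::{banach,second_countable_topology}"
  assumes "f \<in> borel_measurable borel"
  shows "(\<integral>x. f (a + x - a) \<partial>M) = (\<integral>x. f x \<partial>M)"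
proof -
  have "(\<integral>x. f (a + x + - a) \<partial>M) = (\<integral>x. f (x + - a) \<partial>M)"
    by (rule integral_translate[where f="\<lambda>x. f (x + - a)", OF borel_translate_right[OF assms]])
  then show ?thesis using integral_translate_right[OF assms, of "- a"] by simp
qed

section \<open>Description of the centre\<close>

lemma central_class_fn:
  assumes h: "class_fn h" "integrable M h"
  shows "h \<in> ZL1 M"
proof -
  have "conv M h g x = conv M g h x" if g: "integrable M g" for g x
  proof -
    have hm: "h \<in> borel_measurable borel" and gm: "g \<in> borel_measurable borel"
      using h g integrable_meas by auto
    have k: "(\<lambda>y. h y * g (- y + x)) \<in> borel_measurable borel"
      by (intro borel_measurable_times hm borel_reflect gm)
    have "conv M h g x = (\<integral>y. h (x + y) * g (- (x + y) + x) \<partial>M)"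
      unfolding conv_def by (rule integral_translate[symmetric, OF k])
    \<comment> \<open>Inversion invariance completes the substitution of \<open>x - y\<close> for
      \<open>y\<close>, after which the class property interchanges the factors.\<close>
    also have "\<dots> = (\<integral>y. h (x + - y) * g (- (x + - y) + x) \<partial>M)"
      by (rule integral_uminus[symmetric, OF borel_translate[OF k]])
    also have "\<dots> = (\<integral>y. g y * h (- y + x) \<partial>M)"
    proof (rule Bochner_Integration.integral_cong[OF refl])
      fix y
      have "- (x + - y) + x = y" by (simp add: minus_add add.assoc)
      moreover have "h (x + - y) = h (- y + x)"
        using class_fnD[OF h(1), of "- y" "x + - y"] by (simp add: add.assoc)
      ultimately show "h (x + - y) * g (- (x + - y) + x) = g y * h (- y + x)" by (simp add: mult.commute)
    qed
    finally show ?thesis by (simp add: conv_def)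
  qed
  then show ?thesis using h(2) by (simp add: ZL1_def)
qed

text \<open>The test function is the reflected conjugate phase of \<open>h\<close> on a compact set
  \<open>C\<close>. It is bounded, so the convolution is continuous and vanishes everywhere; its
  value at 0 is the integral of \<open>cmod (h y)\<close> over \<open>C\<close>.\<close>

lemma conv_eq_0_imp:
  assumes h: "integrable M h" and z: "\<And>g. integrable M g \<Longrightarrow> AE x in M. conv M h g x = 0"
  shows "AE x in M. h x = 0"
proof -
  have hm: "h \<in> borel_measurable borel" using h integrable_meas by blast
  have null: "emeasure M C = 0" if C: "compact C" "C \<subseteq> {x. h x \<noteq> 0}" for C
  proof -
    define g where "g = (\<lambda>z. indicator C (- z) * (cnj (h (- z)) / complex_of_real (cmod (h (- z)))))"
    have gm: "g \<in> borel_measurable borel"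
      unfolding g_def
    proof (rule borel_uminus[where g="\<lambda>z. indicator C z * (cnj (h z) / complex_of_real (cmod (h z)))"])
      have "(\<lambda>z. cnj (h z)) \<in> borel_measurable borel"
        by (rule measurable_compose[OF hm borel_measurable_continuous_onI]) (intro continuous_intros)
      moreover have "(\<lambda>z. complex_of_real (cmod (h z))) \<in> borel_measurable borel" using hm by measurable
      ultimately show "(\<lambda>z. indicator C z * (cnj (h z) / complex_of_real (cmod (h z)))) \<in> borel_measurable borel"
        by (intro borel_measurable_times borel_measurable_indicator borel_measurable_divide compact_borel C(1))
    qed
    have gb: "cmod (g z) \<le> 1" for z by (simp add: g_def indicator_def norm_mult norm_divide)
    have g0: "g z = 0" if "z \<notin> uminus ` C" for z
    proof -
      have "- z \<notin> C" using that by (metis image_eqI minus_minus)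
      then show ?thesis by (simp add: g_def)
    qed
    have gi: "integrable M g" by (rule integrable_compact_supp[OF gm compact_uminus[OF C(1)] g0 gb])
    have "conv M h g 0 = 0" by (rule continuous_AE_zero[OF conv_continuous[OF h gm gb] z[OF gi]])
    then have 0: "(\<integral>y. h y * g (- y) \<partial>M) = 0" by (simp add: conv_def)
    have "h y * g (- y) = complex_of_real (indicator C y * cmod (h y))" for y
    proof (cases "h y = 0")
      case False
      have "h y * cnj (h y) = complex_of_real (cmod (h y)) * complex_of_real (cmod (h y))"
        by (simp add: complex_norm_square[symmetric] power2_eq_square)
      then show ?thesis using False by (simp add: g_def indicator_def)
    qed (simp add: g_def)
    then have "(\<integral>y. complex_of_real (indicator C y * cmod (h y)) \<partial>M) = 0" using 0 by simp
    then have "(\<integral>y. indicator C y * cmod (h y) \<partial>M) = 0" unfolding integral_complex_of_real by simp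
    moreover have "integrable M (\<lambda>y. indicator C y * cmod (h y))"
      by (rule Bochner_Integration.integrable_bound[OF h]) (use hm compact_borel[OF C(1)] in \<open>auto simp: indicator_def\<close>)
    ultimately have "AE y in M. indicator C y * cmod (h y) = 0"
      by (subst (asm) integral_nonneg_eq_0_iff_AE) auto
    then have "AE y in M. y \<notin> C"
      by eventually_elim (use C(2) in \<open>auto simp: indicator_def split: if_splits\<close>)
    then show ?thesis using C(1) by (subst (asm) AE_iff_null) (auto simp: null_sets_def)
  qed
  have "{x. h x \<noteq> 0} \<in> sets borel" using hm by measurable
  from locally_null[OF h this order_refl null] show ?thesis by simp
qed

text \<open>In \<open>conv M f (lt a g)\<close> the translation moves onto \<open>f\<close> as a
  right translate. Commuting \<open>f\<close> with \<open>g\<close> and with \<open>lt a g\<close>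
  shows that the left and the right translate of \<open>f\<close> have the same convolution with
  every \<open>g\<close>, so they agree almost everywhere.\<close>

lemma central_conj:
  assumes f: "f \<in> ZL1 M"
  shows "AE x in M. f (a + x - a) = f x"
proof -
  have i: "integrable M f" by (rule ZL1_integrable[OF f])
  have fm: "f \<in> borel_measurable borel" using i integrable_meas by blast
  define h where "h = (\<lambda>x. lt a f x - f (x + - a))"
  have ir: "integrable M (\<lambda>x. f (x + - a))" by (rule integrable_translate_right[OF i])
  have hi: "integrable M h" unfolding h_def by (intro Bochner_Integration.integrable_diff integrable_lt i ir)
  have "AE x in M. h x = 0"
  proof (rule conv_eq_0_imp[OF hi])
    fix g :: "'a \<Rightarrow> complex" assume g: "integrable M g"
    then have gm: "g \<in> borel_measurable borel" using integrable_meas by blast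
    have r: "conv M f (lt a g) = conv M (\<lambda>x. f (x + - a)) g"
    proof
      fix x
      have "(\<integral>y. f (y + a + - a) * g (- (y + a) + x) \<partial>M) = (\<integral>y. f (y + - a) * g (- y + x) \<partial>M)"
        by (rule integral_translate_right[where f="\<lambda>y. f (y + - a) * g (- y + x)"])
          (intro borel_measurable_times borel_reflect borel_translate_right fm gm)
      then show "conv M f (lt a g) x = conv M (\<lambda>x. f (x + - a)) g x"
        unfolding conv_def lt_def by (simp only: minus_add add.assoc right_minus add_0_right)
    qed
    have "AE x in M. lt a (conv M f g) x = lt a (conv M g f) x"
      using AE_translate[OF ZL1_commute[OF f g], of "- a"] by (simp add: lt_def)
    then have "AE x in M. conv M (lt a f) g x = conv M (lt a g) f x"
      unfolding conv_lt[OF fm gm] conv_lt[OF gm fm] .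
    moreover have "AE x in M. conv M f (lt a g) x = conv M (lt a g) f x" by (rule ZL1_commute[OF f integrable_lt[OF g]])
    moreover have "AE x in M. conv M h g x = conv M (lt a f) g x - conv M (\<lambda>x. f (x + - a)) g x"
      unfolding h_def by (rule conv_diff_left[OF integrable_lt[OF i] ir g])
    ultimately show "AE x in M. conv M h g x = 0" unfolding r by eventually_elim simp
  qed
  from AE_translate[OF this, of a] show ?thesis
    by eventually_elim (simp add: h_def lt_def add.assoc[symmetric])
qed

text \<open>The class of a point off \<open>G0\<close> leaves every compact set, so it contains
  arbitrarily many points with disjoint neighbourhoods \<open>T y\<close>. Conjugation preserves
  \<open>f\<close> and permutes these neighbourhoods, so each holds the same mass of
  \<open>f\<close>, which must be 0.\<close>

lemma central_supp:
  assumes f: "f \<in> ZL1 M"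
  shows "AE x in M. x \<notin> G0 \<longrightarrow> f x = 0"
proof -
  have i: "integrable M f" by (rule ZL1_integrable[OF f])
  have fm: "f \<in> borel_measurable borel" using i integrable_meas by blast
  \<comment> \<open>The translate of \<open>V\<close> by \<open>x\<close>; \<open>T x\<close> and
    \<open>T y\<close> are disjoint once \<open>y - x\<close> lies outside \<open>W\<close>.\<close>
  define T where "T x = {z. z - x \<in> V}" for x
  have To: "open (T x)" for x
  proof -
    have "T x = (\<lambda>z. z - x) -` V" by (auto simp: T_def)
    then show ?thesis using V(1) by (auto intro!: open_vimage continuous_intros)
  qed
  have Tb: "T x \<in> sets borel" for x by (rule borel_open[OF To])
  have Tx: "x \<in> T x" for x using V(2) by (simp add: T_def)
  define J where "J x = (\<integral>z. indicator (T x) z * cmod (f z) \<partial>M)" for x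
  have iJ: "integrable M (\<lambda>z. indicator (T x) z * cmod (f z))" for x
    by (rule Bochner_Integration.integrable_bound[OF i]) (use fm Tb in \<open>auto simp: indicator_def\<close>)
  have disj: "z \<notin> T y" if "z \<in> T x" "y - x \<notin> W" for x y z
  proof
    assume "z \<in> T y"
    then have "- (z - y) + (z - x) \<in> W" by (intro W(2)) (use that(1) in \<open>simp_all add: T_def\<close>)
    moreover have "- (z - y) + (z - x) = y - x" by (simp add: add_diff_eq)
    ultimately show False using that(2) by simp
  qed
  have J0: "J x0 = 0" if x0: "x0 \<notin> G0" for x0
  proof -
    have Jc: "J y = J x0" if "y \<in> cl x0" for y
    proof -
      obtain a where y: "y = a + x0 - a" using \<open>y \<in> cl x0\<close> unfolding cl_def by blast
      have T: "a + z - a \<in> T y \<longleftrightarrow> z \<in> T x0" for z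
      proof -
        have e: "(a + z - a) - (a + x0 - a) = a + (z - x0) - a"
          by (simp only: diff_conv_add_uminus[of "a + z - a" "a + x0 - a"] diff_conv_add_uminus[of z x0] conj_minus conj_add)
        have "a + (z - x0) - a \<in> V \<longleftrightarrow> z - x0 \<in> V"
          using V(3)[of "z - x0" a] V(3)[of "a + (z - x0) - a" "- a"] unfolding conj_cancel by blast
        then show ?thesis unfolding T_def y mem_Collect_eq e .
      qed
      have "J y = (\<integral>z. indicator (T y) (a + z - a) * cmod (f (a + z - a)) \<partial>M)"
        unfolding J_def by (rule integral_conj[symmetric, where f="\<lambda>z. indicator (T y) z * cmod (f z)"]) (use iJ integrable_meas in blast)
      also have "\<dots> = J x0"
        unfolding J_def
      proof (rule integral_cong_AE)
        show "AE z in M. indicator (T y) (a + z - a) * cmod (f (a + z - a)) = indicator (T x0) z * cmod (f z)"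
          using central_conj[OF f, of a] by eventually_elim (simp add: indicator_def T)
        have m: "(\<lambda>z. indicator (T y) z * cmod (f z)) \<in> borel_measurable borel" using iJ integrable_meas by blast
        show "(\<lambda>z. indicator (T y) (a + z - a) * cmod (f (a + z - a))) \<in> borel_measurable M"
          unfolding measurable_M by (rule borel_compose[OF m]) (intro continuous_intros)
        show "(\<lambda>z. indicator (T x0) z * cmod (f z)) \<in> borel_measurable M"
          unfolding measurable_M using iJ integrable_meas by blast
      qed
      finally show ?thesis .
    qed
    \<comment> \<open>Greedy choice: finitely many translates of \<open>W\<close> form a compact
      set, which cannot contain the class, and a point outside it has a neighbourhood disjoint from
      the earlier ones.\<close>
    have ex: "\<exists>S. finite S \<and> card S = n \<and> S \<subseteq> cl x0 \<and> (\<forall>x\<in>S. \<forall>y\<in>S. x \<noteq> y \<longrightarrow> T x \<inter> T y = {})" for n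
    proof (induction n)
      case 0
      show ?case by (intro exI[of _ "{}"]) simp
    next
      case (Suc n)
      then obtain S where S: "finite S" "card S = n" "S \<subseteq> cl x0" "\<forall>x\<in>S. \<forall>y\<in>S. x \<noteq> y \<longrightarrow> T x \<inter> T y = {}" by (elim exE conjE) (rule that)
      define C where "C = {w + x | w x. w \<in> W \<and> x \<in> S}"
      have "compact C" unfolding C_def by (rule compact_plus[OF W(1) finite_imp_compact[OF S(1)]])
      then obtain y where y: "y \<in> cl x0" "y \<notin> C" using not_G0[OF x0] by blast
      have yx: "y - x \<notin> W" if "x \<in> S" for x
      proof
        assume "y - x \<in> W"
        moreover have "y = (y - x) + x" by simp
        ultimately have "y \<in> C" unfolding C_def using that by blast
        then show False using y by simp
      qed
      have yS: "y \<notin> S" using yx[of y] W(2)[OF V(2) V(2)] by auto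
      have "T x \<inter> T y = {}" if "x \<in> S" for x using disj[OF _ yx[OF that]] by blast
      then have "\<forall>a\<in>insert y S. \<forall>b\<in>insert y S. a \<noteq> b \<longrightarrow> T a \<inter> T b = {}" using S(4) by blast
      then show ?case using S(1-3) y(1) yS by (intro exI[of _ "insert y S"]) simp
    qed
    have bound: "real n * J x0 \<le> N f" for n
    proof -
      obtain S where S: "finite S" "card S = n" "S \<subseteq> cl x0" "\<forall>x\<in>S. \<forall>y\<in>S. x \<noteq> y \<longrightarrow> T x \<inter> T y = {}" using ex[of n] by (elim exE conjE) (rule that)
      have "real n * J x0 = (\<Sum>y\<in>S. J y)" using Jc S(2,3) by (simp add: subset_iff)
      also have "\<dots> = (\<integral>z. (\<Sum>y\<in>S. indicator (T y) z * cmod (f z)) \<partial>M)"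
        unfolding J_def by (rule Bochner_Integration.integral_sum[symmetric]) (rule iJ)
      also have "\<dots> \<le> N f"
        unfolding L1norm_def
      proof (rule integral_mono)
        show "integrable M (\<lambda>z. \<Sum>y\<in>S. indicator (T y) z * cmod (f z))" by (intro Bochner_Integration.integrable_sum iJ)
        show "integrable M (\<lambda>z. cmod (f z))" using i by auto
        fix z
        show "(\<Sum>y\<in>S. indicator (T y) z * cmod (f z)) \<le> cmod (f z)"
        proof (cases "\<exists>x\<in>S. z \<in> T x")
          case True
          then obtain x where x: "x \<in> S" "z \<in> T x" by blast
          have eq: "(\<Sum>y\<in>S. indicator (T y) z * cmod (f z)) = (\<Sum>y\<in>S. if y = x then cmod (f z) else 0)"
            using x S(4) by (intro sum.cong) (auto simp: indicator_def)
          have "(\<Sum>y\<in>S. if y = x then cmod (f z) else 0) = cmod (f z)" using x(1) S(1) by simp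
          then show ?thesis unfolding eq by simp
        next
          case False
          then have "(\<Sum>y\<in>S. indicator (T y) z * cmod (f z)) = 0" by (intro sum.neutral) (auto simp: indicator_def)
          then show ?thesis by simp
        qed
      qed
      finally show ?thesis .
    qed
    have nonneg: "J x0 \<ge> 0" unfolding J_def by (intro Bochner_Integration.integral_nonneg) auto
    show ?thesis
    proof (rule ccontr)
      assume "J x0 \<noteq> 0"
      then have "0 < J x0" using nonneg by linarith
      then obtain n :: nat where "N f < real n * J x0" using reals_Archimedean3 by blast
      then show False using bound[of n] by linarith
    qed
  qed
  \<comment> \<open>A compact set off \<open>G0\<close> is covered by finitely many
    \<open>T x\<close>, none of which carries mass of \<open>f\<close>.\<close>
  have "emeasure M C = 0" if C: "compact C" "C \<subseteq> {x. x \<notin> G0 \<and> f x \<noteq> 0}" for C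
  proof -
    have "C \<subseteq> (\<Union>x\<in>C. T x)" using Tx by blast
    then obtain F where F: "F \<subseteq> C" "finite F" "C \<subseteq> (\<Union>x\<in>F. T x)"
      using compactE_image[OF C(1), of C T] To by blast
    have "AE z in M. indicator (T x) z * cmod (f z) = 0" if "x \<in> F" for x
    proof -
      have "x \<notin> G0" using that F C by blast
      then have "J x = 0" by (rule J0)
      then show ?thesis unfolding J_def using iJ by (subst (asm) integral_nonneg_eq_0_iff_AE) auto
    qed
    then have "AE z in M. \<forall>x\<in>F. indicator (T x) z * cmod (f z) = 0" using F(2) by (intro AE_finite_allI)
    then have "AE z in M. z \<notin> C"
    proof eventually_elim
      case (elim z)
      show ?case
      proof
        assume z: "z \<in> C"
        then obtain x where "x \<in> F" "z \<in> T x" using F(3) by blast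
        then show False using elim z C(2) by auto
      qed
    qed
    then show ?thesis using C(1) by (subst (asm) AE_iff_null) (auto simp: null_sets_def)
  qed
  moreover have "{x. x \<notin> G0 \<and> f x \<noteq> 0} \<in> sets borel"
  proof -
    have "{x. x \<notin> G0 \<and> f x \<noteq> 0} = - G0 \<inter> {x. f x \<noteq> 0}" by auto
    moreover have "{x. f x \<noteq> 0} \<in> sets borel" using fm by measurable
    ultimately show ?thesis using open_G0 by auto
  qed
  ultimately have "AE x in M. x \<notin> {x. x \<notin> G0 \<and> f x \<noteq> 0}" by (intro locally_null[OF i]) auto
  then show ?thesis by eventually_elim auto
qed

section \<open>Averaging over conjugacy classes\<close>

definition P :: "('a \<Rightarrow> complex) \<Rightarrow> 'a \<Rightarrow> complex" where
  "P f x = (if x \<in> G0 then (\<Sum>y\<in>cl x. f y) / of_nat (card (cl x)) else 0)"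

text \<open>The points that \<open>k\<close> moves within their own class. They turn the sum over a
  varying class into a sum over the fixed set \<open>K\<close> with Borel weights, whence the
  measurability of \<open>P f\<close>.\<close>

definition Y :: "'a \<Rightarrow> 'a set" where "Y k = {x \<in> G0. k + x \<in> cl x}"

lemma Y_comm: "Y k = (\<Union>a. {x \<in> G0. a + x - a - x = k})"
proof -
  have "k + x \<in> cl x \<longleftrightarrow> (\<exists>a. a + x - a - x = k)" for x
    unfolding cl_def by (auto simp: eq_diff_eq diff_eq_eq) (metis diff_eq_eq)+
  then show ?thesis unfolding Y_def by blast
qed

text \<open>On \<open>G0\<close> the commutator with \<open>a\<close> takes values in the finite set
  \<open>K\<close>, so a fibre is the preimage of the complement of a finite set.\<close>

lemma open_Y_part: "open {x \<in> G0. a + x - a - x = k}"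
proof -
  let ?c = "\<lambda>x. a + x - a - (x::'a)"
  have "open (?c -` (- (K - {k})))"
    using finite_K by (intro open_vimage continuous_intros open_Compl finite_imp_closed) auto
  then have "open (G0 \<inter> ?c -` (- (K - {k})))" using open_G0 by (intro open_Int)
  also have "G0 \<inter> ?c -` (- (K - {k})) = {x \<in> G0. a + x - a - x = k}" using comm_K by auto
  finally show ?thesis .
qed

lemma Y_borel [simp]: "Y k \<in> sets borel"
  unfolding Y_comm by (intro borel_open open_UN ballI open_Y_part)

lemma cl_Y: "x \<in> G0 \<Longrightarrow> cl x = (\<lambda>k. k + x) ` {k \<in> K. x \<in> Y k}"
proof -
  assume x: "x \<in> G0"
  have "y \<in> (\<lambda>k. k + x) ` {k \<in> K. x \<in> Y k}" if "y \<in> cl x" for y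
  proof -
    obtain k where "k \<in> K" "y = k + x" using cl_coset[OF x] \<open>y \<in> cl x\<close> unfolding coset_def by blast
    then show ?thesis using that x unfolding Y_def by blast
  qed
  then show ?thesis unfolding Y_def by blast
qed

definition cnt :: "'a \<Rightarrow> complex" where "cnt x = (\<Sum>k\<in>K. indicator (Y k) x)"

lemma inj_add_right: "inj_on (\<lambda>k. k + x) S" for x :: 'a
  by (simp add: inj_on_def)

lemma sum_Y: "x \<in> G0 \<Longrightarrow> (\<Sum>y\<in>cl x. f y) = (\<Sum>k\<in>K. indicator (Y k) x * f (k + x))"
  for f :: "'a \<Rightarrow> complex"
proof -
  assume x: "x \<in> G0"
  have "(\<Sum>y\<in>cl x. f y) = (\<Sum>k\<in>{k \<in> K. x \<in> Y k}. f (k + x))"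
    unfolding cl_Y[OF x] by (subst sum.reindex[OF inj_add_right]) simp
  also have "\<dots> = (\<Sum>k\<in>K. if x \<in> Y k then f (k + x) else 0)"
    by (rule sum.inter_filter[OF finite_K])
  also have "\<dots> = (\<Sum>k\<in>K. indicator (Y k) x * f (k + x))"
    by (intro sum.cong) (auto simp: indicator_def)
  finally show ?thesis .
qed

lemma cnt_card: "x \<in> G0 \<Longrightarrow> cnt x = of_nat (card (cl x))"
  using sum_Y[of x "\<lambda>_. 1"] by (simp add: cnt_def)

lemma card_cl: "x \<in> G0 \<Longrightarrow> card (cl x) > 0"
  using finite_cl[of x] cl_self[of x] card_gt_0_iff by blast

lemma P_alt: "P f x = (\<Sum>k\<in>K. indicator (Y k) x * f (k + x) / cnt x)"
proof (cases "x \<in> G0")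
  case True
  then show ?thesis by (simp add: P_def sum_Y cnt_card sum_divide_distrib)
next
  case False
  then have "indicator (Y k) x = (0::complex)" for k by (simp add: Y_def)
  then show ?thesis using False by (simp add: P_def)
qed

lemma cnt_meas: "cnt \<in> borel_measurable borel"
  unfolding cnt_def[abs_def] by (intro borel_measurable_sum borel_measurable_indicator Y_borel)

lemma cnt_conj: "x \<in> G0 \<Longrightarrow> y \<in> cl x \<Longrightarrow> cnt y = cnt x"
  using cl_eq[of y x] cl_G0[of x] by (simp add: cnt_card subset_iff)

lemma cnt_Y: "x \<in> Y k \<Longrightarrow> 1 \<le> cmod (cnt x)"
proof -
  assume "x \<in> Y k"
  then have x: "x \<in> G0" by (simp add: Y_def)
  have "1 \<le> card (cl x)" using card_cl[OF x] by linarith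
  then show ?thesis unfolding cnt_card[OF x] by simp
qed

lemma weight_bound: "cmod (indicator (Y k) x / cnt x) \<le> 1"
proof (cases "x \<in> Y k")
  case True
  then show ?thesis using cnt_Y[OF True] by (simp add: norm_divide divide_le_eq_1)
qed simp

lemma weight_meas: "(\<lambda>x. indicator (Y k) x / cnt x) \<in> borel_measurable borel"
  by (intro borel_measurable_divide borel_measurable_indicator Y_borel cnt_meas)

lemma P_integrable: "integrable M f \<Longrightarrow> integrable M (P f)"
proof -
  assume f: "integrable M f"
  have "P f = (\<lambda>x. \<Sum>k\<in>K. f (k + x) * (indicator (Y k) x / cnt x))"
    unfolding P_alt[abs_def] by (intro ext sum.cong refl) (simp add: mult.commute)
  then show ?thesis
    by (simp only:) (intro Bochner_Integration.integrable_sum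
      integrable_mult_bounded[OF integrable_translate[OF f] weight_meas weight_bound])
qed

lemma Y_swap: "- k + x \<in> Y k \<longleftrightarrow> x \<in> Y (- k)" if k: "k \<in> K"
proof -
  have kG: "k \<in> G0" using k K_G0 by blast
  have c: "k + (- k + x) = x" by (simp add: add.assoc[symmetric])
  have G: "- k + x \<in> G0 \<longleftrightarrow> x \<in> G0"
    using G0_add[OF kG, of "- k + x"] G0_add[OF G0_minus[OF kG], of x] unfolding c by blast
  have "x \<in> cl (- k + x) \<longleftrightarrow> - k + x \<in> cl x"
    using cl_eq[of x "- k + x"] cl_eq[of "- k + x" x] cl_self[of x] cl_self[of "- k + x"] by blast
  then show ?thesis unfolding Y_def mem_Collect_eq c G by blast
qed

text \<open>In the summand for \<open>k\<close>, substituting \<open>- k + x\<close> for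
  \<open>x\<close> produces the summand for \<open>- k\<close>: the sets correspond by
  \<open>Y_swap\<close>, and the class size is constant along a class.\<close>

lemma P_selfadjoint:
  assumes f: "integrable M f" and h: "h \<in> borel_measurable borel" "\<And>x. cmod (h x) \<le> B"
  shows "(\<integral>x. P f x * h x \<partial>M) = (\<integral>x. f x * P h x \<partial>M)"
proof -
  have fm: "f \<in> borel_measurable borel" using f integrable_meas by blast
  have B0: "0 \<le> B" using h(2)[of 0] norm_ge_zero order.trans by blast
  have wm: "(\<lambda>x. indicator (Y k) x / cnt x * h x) \<in> borel_measurable borel" for k
    by (intro borel_measurable_times weight_meas h)
  have wb: "cmod (indicator (Y k) x / cnt x * h z) \<le> B" for k x z
    using order.trans[OF mult_mono[OF weight_bound[of k x] h(2)[of z]]] B0 by (simp only: norm_mult mult_1 norm_ge_zero zero_le_one order_refl)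
  have i1: "integrable M (\<lambda>x. f (k + x) * (indicator (Y k) x / cnt x * h x))" for k
    by (rule integrable_mult_bounded[OF integrable_translate[OF f] wm wb])
  have wm2: "(\<lambda>x. indicator (Y k) x / cnt x * h (k + x)) \<in> borel_measurable borel" for k
    by (intro borel_measurable_times weight_meas borel_translate h)
  have i2: "integrable M (\<lambda>x. f x * (indicator (Y k) x / cnt x * h (k + x)))" for k
    by (rule integrable_mult_bounded[OF f wm2 wb])
  have "(\<integral>x. P f x * h x \<partial>M) = (\<integral>x. (\<Sum>k\<in>K. f (k + x) * (indicator (Y k) x / cnt x * h x)) \<partial>M)"
    unfolding P_alt sum_distrib_right by (intro Bochner_Integration.integral_cong refl sum.cong) simp
  also have "\<dots> = (\<Sum>k\<in>K. \<integral>x. f (k + x) * (indicator (Y k) x / cnt x * h x) \<partial>M)"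
    by (rule Bochner_Integration.integral_sum[OF i1])
  also have "\<dots> = (\<Sum>k\<in>K. \<integral>x. f x * (indicator (Y (- k)) x / cnt x * h (- k + x)) \<partial>M)"
  proof (rule sum.cong[OF refl])
    fix k assume k: "k \<in> K"
    have "(\<integral>x. f (k + x) * (indicator (Y k) x / cnt x * h x) \<partial>M)
        = (\<integral>x. f (k + (- k + x)) * (indicator (Y k) (- k + x) / cnt (- k + x) * h (- k + x)) \<partial>M)"
      by (rule integral_translate[symmetric, where f="\<lambda>x. f (k + x) * (indicator (Y k) x / cnt x * h x)"])
        (intro borel_measurable_times borel_translate fm wm)
    also have "\<dots> = (\<integral>x. f x * (indicator (Y (- k)) x / cnt x * h (- k + x)) \<partial>M)"
    proof (rule Bochner_Integration.integral_cong[OF refl])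
      fix x
      have c: "k + (- k + x) = x" by (simp add: add.assoc[symmetric])
      show "f (k + (- k + x)) * (indicator (Y k) (- k + x) / cnt (- k + x) * h (- k + x))
          = f x * (indicator (Y (- k)) x / cnt x * h (- k + x))"
      proof (cases "x \<in> Y (- k)")
        case True
        then have "x \<in> G0" "- k + x \<in> cl x" by (auto simp: Y_def)
        then have "cnt (- k + x) = cnt x" by (rule cnt_conj)
        then show ?thesis using True Y_swap[OF k, of x] unfolding c by simp
      next
        case False
        then show ?thesis using Y_swap[OF k, of x] by simp
      qed
    qed
    finally show "(\<integral>x. f (k + x) * (indicator (Y k) x / cnt x * h x) \<partial>M)
        = (\<integral>x. f x * (indicator (Y (- k)) x / cnt x * h (- k + x)) \<partial>M)" .
  qed
  also have "\<dots> = (\<Sum>k\<in>K. \<integral>x. f x * (indicator (Y k) x / cnt x * h (k + x)) \<partial>M)"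
    by (rule sum.reindex_bij_witness[where i=uminus and j=uminus]) (auto intro: K_minus)
  also have "\<dots> = (\<integral>x. (\<Sum>k\<in>K. f x * (indicator (Y k) x / cnt x * h (k + x))) \<partial>M)"
    by (rule Bochner_Integration.integral_sum[OF i2, symmetric])
  also have "\<dots> = (\<integral>x. f x * P h x \<partial>M)"
    unfolding P_alt sum_distrib_left by (intro Bochner_Integration.integral_cong refl sum.cong) simp
  finally show ?thesis .
qed

lemma P_const: "P (\<lambda>_. 1) x = indicator G0 x"
  using card_cl[of x] by (cases "x \<in> G0") (simp_all add: P_def)

text \<open>\<open>P f\<close> is dominated by \<open>P\<close> of the absolute value.
  Selfadjointness moves \<open>P\<close> onto the constant 1, where it gives the indicator of
  \<open>G0\<close>.\<close>

lemma N_P: "integrable M f \<Longrightarrow> N (P f) \<le> N f"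
proof -
  assume f: "integrable M f"
  have fm: "f \<in> borel_measurable borel" using f integrable_meas by blast
  define g where "g x = (if x \<in> G0 then (\<Sum>y\<in>cl x. cmod (f y)) / card (cl x) else 0)" for x
  have Pg: "P (absc f) x = complex_of_real (g x)" for x by (simp add: P_def g_def absc_def)
  have ai: "integrable M (absc f)" by (rule absc_integrable[OF f])
  have gi: "integrable M g" using integrable_Re[OF P_integrable[OF ai]] unfolding Pg by simp
  have le: "cmod (P f x) \<le> g x" for x
    using norm_sum[of f "cl x"] by (simp add: P_def g_def norm_divide divide_right_mono)
  have "N (P f) \<le> (\<integral>x. g x \<partial>M)"
    unfolding L1norm_def using P_integrable[OF f] gi le by (intro integral_mono) auto
  also have "(\<integral>x. g x \<partial>M) = (\<integral>x. cmod (f x) * indicator G0 x \<partial>M)"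
  proof -
    have "complex_of_real (\<integral>x. g x \<partial>M) = (\<integral>x. P (absc f) x * 1 \<partial>M)"
      unfolding Pg mult_1_right integral_complex_of_real ..
    also have "\<dots> = (\<integral>x. absc f x * P (\<lambda>_. 1) x \<partial>M)"
      by (rule P_selfadjoint[OF ai, where B=1]) auto
    also have "\<dots> = (\<integral>x. complex_of_real (cmod (f x) * indicator G0 x) \<partial>M)"
      unfolding P_const by (intro Bochner_Integration.integral_cong refl) (simp add: absc_def indicator_def)
    also have "\<dots> = complex_of_real (\<integral>x. cmod (f x) * indicator G0 x \<partial>M)" by (rule integral_complex_of_real)
    finally show ?thesis by simp
  qed
  also have "\<dots> \<le> N f"
    unfolding L1norm_def
  proof (rule integral_mono)
    show "integrable M (\<lambda>x. cmod (f x) * indicator G0 x)"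
    proof (rule Bochner_Integration.integrable_bound[OF f])
      show "(\<lambda>x. cmod (f x) * indicator G0 x) \<in> borel_measurable M"
      proof -
        have "(\<lambda>x. cmod (f x)) \<in> borel_measurable borel" using fm by measurable
        then show ?thesis unfolding measurable_M by (intro borel_measurable_times borel_measurable_indicator borel_open open_G0)
      qed
    qed (auto simp: indicator_def)
    show "integrable M (\<lambda>x. cmod (f x))" using f by auto
    show "cmod (f x) * indicator G0 x \<le> cmod (f x)" for x by (simp add: indicator_def)
  qed
  finally show ?thesis .
qed

lemma P_diff: "P (\<lambda>x. f x - g x) = (\<lambda>x. P f x - P g x)"
  by (simp add: P_def fun_eq_iff sum_subtractf diff_divide_distrib)

lemma P_lincomb: "P (\<lambda>x. \<Sum>s\<in>S. w s * f s x) = (\<lambda>x. \<Sum>s\<in>S. w s * P (f s) x)"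
proof
  fix x
  show "P (\<lambda>x. \<Sum>s\<in>S. w s * f s x) x = (\<Sum>s\<in>S. w s * P (f s) x)"
  proof (cases "x \<in> G0")
    case True
    have "(\<Sum>y\<in>cl x. \<Sum>s\<in>S. w s * f s y) = (\<Sum>s\<in>S. w s * (\<Sum>y\<in>cl x. f s y))"
      by (subst sum.swap) (simp add: sum_distrib_left)
    then show ?thesis using True by (simp add: P_def sum_divide_distrib[of "\<lambda>s. w s * sum (f s) (cl x)"])
  qed (simp add: P_def)
qed

section \<open>The contractive projection onto class functions\<close>

lemma G0_conj_iff: "a + x - a \<in> G0 \<longleftrightarrow> x \<in> G0"
  using conj_G0[of x a] conj_G0[of "a + x - a" "- a"] unfolding conj_cancel by blast

lemma P_class: "class_fn (P f)"
  by (simp add: class_fn_def P_def G0_conj_iff cl_conj)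

text \<open>Representatives with pointwise invariance, so that identities along single classes,
  which may be null sets, are at hand. Each central element has one, namely its image under
  \<open>P\<close>.\<close>

definition ZF :: "('a \<Rightarrow> complex) set" where
  "ZF = {f. class_fn f \<and> integrable M f \<and> (\<forall>x. x \<notin> G0 \<longrightarrow> f x = 0)}"

lemma ZFD: "f \<in> ZF \<Longrightarrow> class_fn f" "f \<in> ZF \<Longrightarrow> integrable M f" "f \<in> ZF \<Longrightarrow> x \<notin> G0 \<Longrightarrow> f x = 0"
  by (auto simp: ZF_def)

lemma ZF_ZL1: "f \<in> ZF \<Longrightarrow> f \<in> ZL1 M"
  by (intro central_class_fn ZFD)

lemma P_ZF: "integrable M f \<Longrightarrow> P f \<in> ZF"
  using P_class P_integrable by (simp add: ZF_def) (simp add: P_def)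

lemma P_fixed: "f \<in> ZF \<Longrightarrow> P f = f"
proof
  fix x assume f: "f \<in> ZF"
  show "P f x = f x"
  proof (cases "x \<in> G0")
    case True
    have "f y = f x" if "y \<in> cl x" for y
      using that class_fnD[OF ZFD(1)[OF f]] unfolding cl_def by blast
    then have "(\<Sum>y\<in>cl x. f y) = of_nat (card (cl x)) * f x" by simp
    then show ?thesis using True card_cl[OF True] by (simp add: P_def)
  qed (simp add: P_def ZFD(3)[OF f])
qed

text \<open>Invariance under one \<open>a\<close> holds off a null set, but there may be uncountably
  many \<open>a\<close>. A compact part of \<open>Y k\<close> is covered by finitely many open sets
  on each of which a single \<open>a\<close> moves \<open>x\<close> to \<open>k + x\<close>. The
  exceptional set therefore has only null compact subsets, and it lies in the support of an
  integrable function.\<close>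

lemma P_central:
  assumes f: "f \<in> ZL1 M"
  shows "AE x in M. P f x = f x"
proof -
  have i: "integrable M f" by (rule ZL1_integrable[OF f])
  have fm: "f \<in> borel_measurable borel" using i integrable_meas by blast
  have "AE x in M. x \<in> Y k \<longrightarrow> f (k + x) = f x" for k
  proof -
    define h where "h = (\<lambda>x. f (k + x) - f x)"
    have hi: "integrable M h" unfolding h_def by (intro Bochner_Integration.integrable_diff integrable_translate i)
    have hm: "h \<in> borel_measurable borel" using hi integrable_meas by blast
    let ?E = "Y k \<inter> {x. h x \<noteq> 0}"
    have E: "?E \<in> sets borel"
    proof -
      have "{x. h x \<noteq> 0} \<in> sets borel" using hm by measurable
      then show ?thesis by (intro sets.Int Y_borel)
    qed
    have "emeasure M C = 0" if C: "compact C" "C \<subseteq> ?E" for C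
    proof -
      define R where "R a = {x \<in> G0. a + x - a - x = k}" for a
      have "C \<subseteq> (\<Union>a\<in>UNIV. R a)" using C(2) unfolding Y_comm R_def by blast
      then obtain F where F: "F \<subseteq> UNIV" "finite F" "C \<subseteq> (\<Union>a\<in>F. R a)"
        using compactE_image[OF C(1), of UNIV R] open_Y_part unfolding R_def by blast
      have "AE x in M. \<forall>a\<in>F. f (a + x - a) = f x" using F(2) central_conj[OF f] by (intro AE_finite_allI)
      then have "AE x in M. x \<notin> C"
      proof eventually_elim
        case (elim x)
        show ?case
        proof
          assume x: "x \<in> C"
          then obtain a where a: "a \<in> F" "x \<in> R a" using F(3) by blast
          then have "a + x - a = k + x" unfolding R_def by (simp add: diff_eq_eq)
          then have "h x = 0" using elim a(1) by (simp add: h_def) (metis eq_iff_diff_eq_0)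
          then show False using C(2) x by blast
        qed
      qed
      then show ?thesis using C(1) by (subst (asm) AE_iff_null) (auto simp: null_sets_def)
    qed
    then have "AE x in M. x \<notin> ?E" by (intro locally_null[OF hi E]) auto
    then show ?thesis by eventually_elim (auto simp: h_def)
  qed
  then have "AE x in M. \<forall>k\<in>K. x \<in> Y k \<longrightarrow> f (k + x) = f x" by (intro AE_finite_allI finite_K)
  then show ?thesis using central_supp[OF f]
  proof eventually_elim
    case (elim x)
    show ?case
    proof (cases "x \<in> G0")
      case True
      have "f y = f x" if "y \<in> cl x" for y
        using that elim(1) unfolding cl_Y[OF True] by blast
      then have "(\<Sum>y\<in>cl x. f y) = of_nat (card (cl x)) * f x" by simp
      then show ?thesis using True card_cl[OF True] by (simp add: P_def)
    qed (use elim(2) in \<open>simp add: P_def\<close>)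
  qed
qed

lemma minus_G0_iff: "s \<in> G0 \<Longrightarrow> - s + x \<in> G0 \<longleftrightarrow> x \<in> G0"
  using G0_add[of "- s" x] G0_add[of s "- s + x"] G0_minus[of s] by (auto simp: add.assoc[symmetric])

text \<open>The double sum of \<open>f (- y + z)\<close> over \<open>y\<close> in the class of
  \<open>s\<close> and \<open>z\<close> in the class of \<open>x\<close> is evaluated by rows and by
  columns. By simultaneous conjugation all row sums agree, and so do all column sums.\<close>

lemma P_lt:
  assumes f: "f \<in> ZF" and s: "s \<in> G0"
  shows "P (lt s f) = act (avg s) f"
proof
  fix x
  have A: "act (avg s) f x = (\<Sum>y\<in>cl s. f (- y + x)) / of_nat (card (cl s))"
  proof -
    have "act (avg s) f x = (\<Sum>y\<in>cl s. avg s y * f (- y + x))"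
      by (rule act_sum[OF finite_cl[OF s]]) (auto simp: fsupp_def avg_def)
    then show ?thesis by (simp add: avg_def sum_divide_distrib)
  qed
  show "P (lt s f) x = act (avg s) f x"
  proof (cases "x \<in> G0")
    case False
    have "f (- y + x) = 0" if "y \<in> cl s" for y
      using minus_G0_iff[of y x] cl_G0[OF s] that False by (intro ZFD(3)[OF f]) blast
    then show ?thesis using False unfolding A by (simp add: P_def)
  next
    case True
    have conjf: "f (- (a + y - a) + (a + z - a)) = f (- y + z)" for a y z
      unfolding conj_minus conj_add class_fnD[OF ZFD(1)[OF f]] ..
    have bij: "(\<Sum>z\<in>cl t. g (a + z - a)) = (\<Sum>z\<in>cl t. g z)" for t a and g :: "'a \<Rightarrow> complex"
    proof (rule sum.reindex_bij_witness[where i="\<lambda>z. - a + z - - a" and j="\<lambda>z. a + z - a"])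
      fix z assume z: "z \<in> cl t"
      show "- a + (a + z - a) - - a = z" by (rule conj_cancel)
      show "a + z - a \<in> cl t" using cl_conj[of a z] cl_eq[OF z] cl_self[of "a + z - a"] by simp
      show "a + (- a + z - - a) - a = z" using conj_cancel[of "- a", unfolded minus_minus] .
      show "- a + z - - a \<in> cl t" using cl_conj[of "- a" z] cl_eq[OF z] cl_self[of "- a + z - - a"] by simp
    qed simp
    have c1: "(\<Sum>z\<in>cl x. f (- y + z)) = (\<Sum>z\<in>cl x. f (- s + z))" if "y \<in> cl s" for y
    proof -
      obtain a where y: "y = a + s - a" using \<open>y \<in> cl s\<close> unfolding cl_def by blast
      have "(\<Sum>z\<in>cl x. f (- y + (a + z - a))) = (\<Sum>z\<in>cl x. f (- y + z))"
        by (rule bij[where g="\<lambda>z. f (- y + z)"])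
      then show ?thesis unfolding y conjf by simp
    qed
    have c2: "(\<Sum>y\<in>cl s. f (- y + z)) = (\<Sum>y\<in>cl s. f (- y + x))" if "z \<in> cl x" for z
    proof -
      obtain a where z: "z = a + x - a" using \<open>z \<in> cl x\<close> unfolding cl_def by blast
      have "(\<Sum>y\<in>cl s. f (- (a + y - a) + z)) = (\<Sum>y\<in>cl s. f (- y + z))"
        by (rule bij[where g="\<lambda>y. f (- y + z)"])
      then show ?thesis unfolding z conjf by simp
    qed
    have "of_nat (card (cl s)) * (\<Sum>z\<in>cl x. f (- s + z)) = (\<Sum>y\<in>cl s. \<Sum>z\<in>cl x. f (- y + z))"
      using c1 by simp
    also have "\<dots> = (\<Sum>z\<in>cl x. \<Sum>y\<in>cl s. f (- y + z))" by (rule sum.swap)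
    also have "\<dots> = of_nat (card (cl x)) * (\<Sum>y\<in>cl s. f (- y + x))" using c2 by simp
    finally show ?thesis
      using True card_cl[OF True] card_cl[OF s] unfolding A by (simp add: P_def lt_def field_simps)
  qed
qed

lemma conv_ZF:
  assumes "f \<in> ZF" "g \<in> ZF"
  shows "conv M f g \<in> ZF"
proof -
  note i = ZFD(2)[OF assms(1)] ZFD(2)[OF assms(2)]
  have m: "f \<in> borel_measurable borel" "g \<in> borel_measurable borel" using i integrable_meas by auto
  have "conv M f g (a + x - a) = conv M f g x" for a x
  proof -
    have "(\<integral>y. f (a + y - a) * g (- (a + y - a) + (a + x - a)) \<partial>M) = (\<integral>y. f y * g (- y + (a + x - a)) \<partial>M)"
      by (rule integral_conj[where f="\<lambda>y. f y * g (- y + (a + x - a))"]) (intro borel_measurable_times borel_reflect m)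
    then show ?thesis
      unfolding conv_def conj_minus conj_add class_fnD[OF ZFD(1)[OF assms(1)]] class_fnD[OF ZFD(1)[OF assms(2)]] by simp
  qed
  moreover have "conv M f g x = 0" if "x \<notin> G0" for x
  proof -
    have "(\<lambda>y. f y * g (- y + x)) = (\<lambda>_. 0)"
    proof
      fix y
      show "f y * g (- y + x) = 0"
        using ZFD(3)[OF assms(1), of y] ZFD(3)[OF assms(2), of "- y + x"] minus_G0_iff[of y x] that by (cases "y \<in> G0") simp_all
    qed
    then show ?thesis unfolding conv_def by simp
  qed
  ultimately show ?thesis using conv_integrable(1)[OF i] by (simp add: ZF_def class_fn_def)
qed

text \<open>\<open>P\<close> is a module map over class functions. By \<open>P_lt\<close>, averaging
  \<open>f (- y + z)\<close> over \<open>z\<close> in the class of \<open>x\<close> equals averaging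
  \<open>f (- t + x)\<close> over \<open>t\<close> in the class of \<open>y\<close>; selfadjointness
  then moves \<open>P\<close> onto \<open>g\<close>.\<close>

lemma conv_P:
  assumes g: "integrable M g" "\<And>x. cmod (g x) \<le> B" and f: "f \<in> ZF"
  shows "conv M (P g) f = P (conv M g f)"
proof
  fix x
  have gm: "g \<in> borel_measurable borel" using g integrable_meas by blast
  have i: "integrable M f" by (rule ZFD(2)[OF f])
  show "conv M (P g) f x = P (conv M g f) x"
  proof (cases "x \<in> G0")
    case True
    have F: "integrable M (\<lambda>y. f (- y + z))" for z by (rule integrable_reflect[OF i])
    have igf: "integrable M (\<lambda>y. g y * f (- y + z))" for z
      using integrable_mult_bounded[OF F gm g(2)] by (simp add: mult.commute)
    have "P (conv M g f) x = (\<Sum>z\<in>cl x. \<integral>y. g y * f (- y + z) \<partial>M) / of_nat (card (cl x))"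
      using True by (simp add: P_def conv_def)
    also have "(\<Sum>z\<in>cl x. \<integral>y. g y * f (- y + z) \<partial>M) = (\<integral>y. (\<Sum>z\<in>cl x. g y * f (- y + z)) \<partial>M)"
      by (rule Bochner_Integration.integral_sum[OF igf, symmetric])
    also have "\<dots> / of_nat (card (cl x)) = (\<integral>y. (\<Sum>z\<in>cl x. g y * f (- y + z)) / of_nat (card (cl x)) \<partial>M)"
      by (rule integral_divide_zero[symmetric])
    also have "\<dots> = (\<integral>y. P (\<lambda>y. f (- y + x)) y * g y \<partial>M)"
    proof (rule Bochner_Integration.integral_cong[OF refl])
      fix y
      show "(\<Sum>z\<in>cl x. g y * f (- y + z)) / of_nat (card (cl x)) = P (\<lambda>y. f (- y + x)) y * g y"
      proof (cases "y \<in> G0")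
        case y: True
        have "(\<Sum>z\<in>cl x. g y * f (- y + z)) / of_nat (card (cl x)) = g y * P (lt y f) x"
          using True by (simp add: P_def lt_def sum_distrib_left)
        also have "P (lt y f) x = P (\<lambda>y. f (- y + x)) y"
        proof -
          have "act (avg y) f x = (\<Sum>t\<in>cl y. avg y t * f (- t + x))"
            by (rule act_sum[OF finite_cl[OF y]]) (auto simp: fsupp_def avg_def)
          then show ?thesis unfolding P_lt[OF f y] using y by (simp add: P_def avg_def sum_divide_distrib)
        qed
        finally show ?thesis by (simp add: mult.commute)
      next
        case y: False
        have "f (- y + z) = 0" if z: "z \<in> cl x" for z
        proof (rule ZFD(3)[OF f])
          have zG: "z \<in> G0" using cl_G0[OF True] z by blast
          show "- y + z \<notin> G0"
          proof
            assume "- y + z \<in> G0"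
            then have "- (- y + z) \<in> G0" by (rule G0_minus)
            from G0_add[OF zG this] have "z + - (- y + z) \<in> G0" .
            moreover have "z + - (- y + z) = y" by (simp add: minus_add add.assoc[symmetric] diff_conv_add_uminus del: add_uminus_conv_diff)
            ultimately show False using y by simp
          qed
        qed
        then show ?thesis using y by (simp add: P_def)
      qed
    qed
    also have "\<dots> = (\<integral>y. f (- y + x) * P g y \<partial>M)" by (rule P_selfadjoint[OF F gm g(2)])
    also have "\<dots> = conv M (P g) f x" unfolding conv_def by (simp add: mult.commute)
    finally show ?thesis by simp
  next
    case False
    have "(\<lambda>y. P g y * f (- y + x)) = (\<lambda>_. 0)"
    proof
      fix y
      show "P g y * f (- y + x) = 0"
        using ZFD(3)[OF f, of "- y + x"] minus_G0_iff[of y x] False by (cases "y \<in> G0") (simp_all add: P_def)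
    qed
    then show ?thesis using False by (simp add: conv_def P_def)
  qed
qed

text \<open>The image under \<open>P\<close> of a unit bump. As \<open>P\<close> is a contractive
  module map, averaging does not increase the error.\<close>

lemma central_approximate_unit:
  assumes S: "finite S" "S \<subseteq> ZL1 M" and e: "0 < \<epsilon>"
  obtains e where "e \<in> ZF" "N e \<le> 1" "\<And>a. a \<in> S \<Longrightarrow> N (\<lambda>x. conv M e a x - a x) \<le> \<epsilon>"
proof -
  have h: "\<forall>a\<in>S. integrable M (P a)" using S(2) ZL1_integrable P_integrable by blast
  obtain V U where VU: "compact V" "open U" "0 \<in> U" "U \<subseteq> V" "\<forall>a\<in>S. N (\<lambda>x. conv M (unit_bump V) (P a) x - P a x) \<le> \<epsilon>"
    using approximate_unit[OF S(1) h e open_UNIV UNIV_I] by (elim exE conjE) (rule that)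
  have ne: "U \<noteq> {}" using VU by auto
  note ub = unit_bump[OF VU(1,2,4) ne]
  let ?g = "unit_bump V"
  have PZ: "P ?g \<in> ZF" by (rule P_ZF[OF ub(1)])
  show thesis
  proof (rule that[OF PZ])
    show "N (P ?g) \<le> 1" using N_P[OF ub(1)] ub(2) by simp
    fix a assume a: "a \<in> S"
    then have aZ: "a \<in> ZL1 M" using S by blast
    have ia: "integrable M a" by (rule ZL1_integrable[OF aZ])
    have PaZ: "P a \<in> ZF" by (rule P_ZF[OF ia])
    note ig = ZFD(2)[OF PZ] and iPa = ZFD(2)[OF PaZ]
    have AE1: "AE x in M. P a x = a x" by (rule P_central[OF aZ])
    have "AE x in M. conv M (P ?g) a x = conv M (P ?g) (P a) x"
      using AE1 by (intro conv_cong_AE ig ia iPa) auto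
    then have "N (\<lambda>x. conv M (P ?g) a x - a x) = N (\<lambda>x. conv M (P ?g) (P a) x - P a x)"
    proof (intro N_cong_AE Bochner_Integration.integrable_diff conv_integrable(1) ig ia iPa)
      assume "AE x in M. conv M (P ?g) a x = conv M (P ?g) (P a) x"
      then show "AE x in M. conv M (P ?g) a x - a x = conv M (P ?g) (P a) x - P a x"
        using AE1 by eventually_elim simp
    qed
    also have "(\<lambda>x. conv M (P ?g) (P a) x - P a x) = P (\<lambda>x. conv M ?g (P a) x - P a x)"
      unfolding P_diff conv_P[OF ub(1,5) PaZ] P_fixed[OF PaZ] ..
    also have "N \<dots> \<le> N (\<lambda>x. conv M ?g (P a) x - P a x)"
      by (intro N_P Bochner_Integration.integrable_diff conv_integrable(1) ub(1) iPa)
    also have "\<dots> \<le> \<epsilon>" using VU(5) a by blast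
    finally show "N (\<lambda>x. conv M (P ?g) a x - a x) \<le> \<epsilon>" .
  qed
qed

text \<open>Applying \<open>P\<close> to a Riemann sum turns the translates \<open>lt s f\<close>
  into \<open>act (avg s) f\<close> without increasing the error. The nodes lie where
  \<open>P a\<close> is nonzero, hence in \<open>G0\<close>.\<close>

lemma central_approx:
  assumes a: "a \<in> ZL1 M" and f: "f \<in> ZF" and e: "0 < \<epsilon>"
  obtains S w where "finite S" "S \<subseteq> G0" "N (\<lambda>x. conv M a f x - (\<Sum>s\<in>S. w s * act (avg s) f x)) \<le> \<epsilon>"
proof -
  have ia: "integrable M a" by (rule ZL1_integrable[OF a])
  have PaZ: "P a \<in> ZF" by (rule P_ZF[OF ia])
  note iPa = ZFD(2)[OF PaZ] and i = ZFD(2)[OF f]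
  have "finite {()}" "\<forall>i\<in>{()}. integrable M f" using i by auto
  from conv_approx[where h="\<lambda>_. f", OF iPa this e]
  obtain S w where S: "finite S" "S \<subseteq> {x. P a x \<noteq> 0}" "N (\<lambda>x. conv M (P a) f x - (\<Sum>s\<in>S. w s * lt s f x)) \<le> \<epsilon>"
    by auto
  have SG: "S \<subseteq> G0" using S(2) by (auto simp: P_def split: if_splits)
  have eq: "P (\<lambda>x. conv M (P a) f x - (\<Sum>s\<in>S. w s * lt s f x)) = (\<lambda>x. conv M (P a) f x - (\<Sum>s\<in>S. w s * act (avg s) f x))"
    unfolding P_diff P_lincomb P_fixed[OF conv_ZF[OF PaZ f]] using P_lt[OF f] SG by (simp add: subset_iff cong: sum.cong)
  have il: "integrable M (\<lambda>x. conv M (P a) f x - (\<Sum>s\<in>S. w s * lt s f x))"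
    by (intro Bochner_Integration.integrable_diff conv_integrable(1) integrable_lincomb iPa i)
  have "N (\<lambda>x. conv M (P a) f x - (\<Sum>s\<in>S. w s * act (avg s) f x)) \<le> \<epsilon>"
    using N_P[OF il] S(3) unfolding eq by linarith
  moreover have "N (\<lambda>x. conv M a f x - (\<Sum>s\<in>S. w s * act (avg s) f x)) = N (\<lambda>x. conv M (P a) f x - (\<Sum>s\<in>S. w s * act (avg s) f x))"
  proof -
    have is2: "integrable M (\<lambda>x. \<Sum>s\<in>S. w s * act (avg s) f x)"
    proof -
      have "integrable M (\<lambda>x. conv M (P a) f x - (\<Sum>s\<in>S. w s * act (avg s) f x))"
        using P_integrable[OF il] unfolding eq .
      from Bochner_Integration.integrable_diff[OF conv_integrable(1)[OF iPa i] this]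
      show ?thesis by simp
    qed
    have "AE x in M. conv M a f x = conv M (P a) f x"
      using P_central[OF a] by (intro conv_cong_AE ia iPa i) auto
    then have "AE x in M. conv M a f x - (\<Sum>s\<in>S. w s * act (avg s) f x) = conv M (P a) f x - (\<Sum>s\<in>S. w s * act (avg s) f x)"
      by eventually_elim simp
    with Bochner_Integration.integrable_diff[OF conv_integrable(1)[OF ia i] is2]
      Bochner_Integration.integrable_diff[OF conv_integrable(1)[OF iPa i] is2]
    show ?thesis by (rule N_cong_AE)
  qed
  ultimately have "N (\<lambda>x. conv M a f x - (\<Sum>s\<in>S. w s * act (avg s) f x)) \<le> \<epsilon>" by simp
  then show thesis by (rule that[OF S(1) SG])
qed

end

section \<open>Finite tensors\<close>

text \<open>The filter is generated by the sets \<open>good (S, \<epsilon>)\<close>, which shrink as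
  \<open>S\<close> grows and \<open>\<epsilon>\<close> decreases. It is proper because each of them
  is nonempty.\<close>

lemma amenableI:
  assumes "\<And>S \<epsilon>. finite S \<Longrightarrow> S \<subseteq> A \<Longrightarrow> 0 < (\<epsilon>::real) \<Longrightarrow> \<exists>c d. tensor_rep A nrm c d \<and> proj_norm A nrm (tensor_eval c d) \<le> C \<and>
    (\<forall>a\<in>S. \<bar>lim (\<lambda>N. nrm (\<lambda>x. mul (\<lambda>z. \<Sum>n<N. mul (c n) (d n) z) a x - a x))\<bar> < \<epsilon> \<and>
      \<bar>lim (\<lambda>N. nrm (\<lambda>x. mul a (\<lambda>z. \<Sum>n<N. mul (c n) (d n) z) x - a x))\<bar> < \<epsilon> \<and>
      \<bar>proj_norm A nrm (\<lambda>\<phi>. (\<Sum>n. \<phi> (mul a (c n)) (d n)) - (\<Sum>n. \<phi> (c n) (mul (d n) a)))\<bar> < \<epsilon>)"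
  shows "amenable_alg A nrm mul"
proof -
  define q1 where "q1 a = (\<lambda>(c, d). lim (\<lambda>N. nrm (\<lambda>x. mul (\<lambda>z. \<Sum>n<N. mul (c n) (d n) z) a x - a x)))" for a
  define q2 where "q2 a = (\<lambda>(c, d). lim (\<lambda>N. nrm (\<lambda>x. mul a (\<lambda>z. \<Sum>n<N. mul (c n) (d n) z) x - a x)))" for a
  define q3 where "q3 a = (\<lambda>(c, d). proj_norm A nrm (\<lambda>\<phi>. (\<Sum>n. \<phi> (mul a (c n)) (d n)) - (\<Sum>n. \<phi> (c n) (mul (d n) a))))" for a
  define good where "good p = {t. tensor_rep A nrm (fst t) (snd t) \<and> proj_norm A nrm (tensor_eval (fst t) (snd t)) \<le> C \<and>
    (\<forall>a\<in>fst p. \<bar>q1 a t\<bar> < snd p \<and> \<bar>q2 a t\<bar> < snd p \<and> \<bar>q3 a t\<bar> < snd p)}" for p :: "('a \<Rightarrow> complex) set \<times> real"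
  define I where "I = {p :: ('a \<Rightarrow> complex) set \<times> real. finite (fst p) \<and> fst p \<subseteq> A \<and> 0 < snd p}"
  define F where "F = (INF p\<in>I. principal (good p))"
  have nonempty: "good p \<noteq> {}" if "p \<in> I" for p
  proof -
    have "finite (fst p)" "fst p \<subseteq> A" "0 < snd p" using that by (auto simp: I_def)
    from assms[OF this] obtain c d where "tensor_rep A nrm c d \<and> proj_norm A nrm (tensor_eval c d) \<le> C \<and>
      (\<forall>a\<in>fst p. \<bar>lim (\<lambda>N. nrm (\<lambda>x. mul (\<lambda>z. \<Sum>n<N. mul (c n) (d n) z) a x - a x))\<bar> < snd p \<and>
        \<bar>lim (\<lambda>N. nrm (\<lambda>x. mul a (\<lambda>z. \<Sum>n<N. mul (c n) (d n) z) x - a x))\<bar> < snd p \<and>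
        \<bar>proj_norm A nrm (\<lambda>\<phi>. (\<Sum>n. \<phi> (mul a (c n)) (d n)) - (\<Sum>n. \<phi> (c n) (mul (d n) a)))\<bar> < snd p)"
      by (elim exE) (rule that)
    then have "(c, d) \<in> good p" by (simp add: good_def q1_def q2_def q3_def)
    then show ?thesis by blast
  qed
  have ev: "eventually Q F \<longleftrightarrow> (\<exists>p\<in>I. \<forall>t\<in>good p. Q t)" for Q
  proof -
    have "eventually Q F \<longleftrightarrow> (\<exists>p\<in>I. eventually Q (principal (good p)))"
      unfolding F_def
    proof (rule eventually_INF_base)
      show "I \<noteq> {}" unfolding I_def by (metis (mono_tags, lifting) empty_iff empty_subsetI finite.emptyI fst_conv mem_Collect_eq snd_conv zero_less_one)
      fix p p' assume p: "p \<in> I" "p' \<in> I"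
      \<comment> \<open>Directedness: the union of the finite sets and the smaller tolerance refine
        both conditions.\<close>
      let ?r = "(fst p \<union> fst p', min (snd p) (snd p'))"
      have "?r \<in> I" using p by (auto simp: I_def)
      moreover have "good ?r \<subseteq> good p \<inter> good p'" by (auto simp: good_def)
      ultimately show "\<exists>x\<in>I. principal (good x) \<le> inf (principal (good p)) (principal (good p'))" by auto
    qed
    then show ?thesis by (simp add: eventually_principal)
  qed
  have small: "(q \<longlongrightarrow> 0) F" if q: "\<And>\<epsilon>. \<exists>S. finite S \<and> S \<subseteq> A \<and> (\<forall>t \<epsilon>. t \<in> good (S, \<epsilon>) \<longrightarrow> \<bar>q t\<bar> < \<epsilon>)" for q :: "_ \<Rightarrow> real"
  proof (rule tendstoI)
    fix \<epsilon> :: real assume e: "0 < \<epsilon>"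
    obtain S where S: "finite S" "S \<subseteq> A" "\<forall>t \<epsilon>. t \<in> good (S, \<epsilon>) \<longrightarrow> \<bar>q t\<bar> < \<epsilon>" using q by blast
    have I: "(S, \<epsilon>) \<in> I" using S e by (simp add: I_def)
    show "\<forall>\<^sub>F t in F. dist (q t) 0 < \<epsilon>" unfolding ev dist_real_def diff_0_right
      by (rule bexI[OF _ I], rule ballI, rule S(3)[rule_format])
  qed
  have lim: "(q1 a \<longlongrightarrow> 0) F" "(q2 a \<longlongrightarrow> 0) F" "(q3 a \<longlongrightarrow> 0) F" if "a \<in> A" for a
    by (rule small, rule exI[of _ "{a}"], use that in \<open>simp add: good_def\<close>)+
  have bot: "F \<noteq> bot"
  proof
    assume "F = bot"
    then have "eventually (\<lambda>_. False) F" by simp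
    then show False unfolding ev using nonempty by blast
  qed
  have bd: "\<forall>\<^sub>F (c, d) in F. tensor_rep A nrm c d \<and> proj_norm A nrm (tensor_eval c d) \<le> C"
    unfolding ev by (rule bexI[of _ "({}, 1)"]) (auto simp: good_def I_def)
  show ?thesis
    unfolding amenable_alg_def
    using bot bd lim[unfolded q1_def q2_def q3_def] by blast
qed

lemma sum_nth: "(\<Sum>n<length xs. f (xs ! n)) = (\<Sum>p\<leftarrow>xs. f p)" for f :: "'b \<Rightarrow> 'c::comm_monoid_add"
  by (simp add: sum_list_sum_nth atLeast0LessThan)

context haar_group begin

section \<open>The centre as an algebra and its bilinear forms\<close>

lemma ZL1_zero: "(\<lambda>x. 0) \<in> ZL1 M"
  by (simp add: ZL1_def conv_def)

lemma ZL1_I: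
  assumes "integrable M f" "\<And>g. integrable M g \<Longrightarrow> AE x in M. conv M f g x = conv M g f x"
  shows "f \<in> ZL1 M"
  using assms N_diff_eq_0[OF conv_integrable(1) conv_integrable(1)] by (simp add: ZL1_def)

lemma ZL1_lin:
  assumes f: "f \<in> ZL1 M" and g: "g \<in> ZL1 M"
  shows "(\<lambda>x. f x + c * g x) \<in> ZL1 M"
proof (rule ZL1_I)
  note i = ZL1_integrable[OF f] ZL1_integrable[OF g]
  have ic: "integrable M (\<lambda>x. c * g x)" using i by simp
  show "integrable M (\<lambda>x. f x + c * g x)" using i by simp
  fix h :: "'a \<Rightarrow> complex" assume h: "integrable M h"
  show "AE x in M. conv M (\<lambda>x. f x + c * g x) h x = conv M h (\<lambda>x. f x + c * g x) x"
    using conv_add_left[OF i(1) ic h] conv_add_right[OF h i(1) ic] ZL1_commute[OF f h] ZL1_commute[OF g h]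
    by eventually_elim (simp add: conv_cmult_left conv_cmult_right)
qed

lemma ZL1_add: "f \<in> ZL1 M \<Longrightarrow> g \<in> ZL1 M \<Longrightarrow> (\<lambda>x. f x + g x) \<in> ZL1 M"
  using ZL1_lin[of f g 1] by simp

lemma ZL1_cmult: "f \<in> ZL1 M \<Longrightarrow> (\<lambda>x. c * f x) \<in> ZL1 M"
  using ZL1_lin[OF ZL1_zero, of f c] by simp

lemma ZL1_diff: "f \<in> ZL1 M \<Longrightarrow> g \<in> ZL1 M \<Longrightarrow> (\<lambda>x. f x - g x) \<in> ZL1 M"
  using ZL1_lin[of f g "-1"] by simp

lemma ZL1_sum: "finite S \<Longrightarrow> (\<And>s. s \<in> S \<Longrightarrow> f s \<in> ZL1 M) \<Longrightarrow> (\<lambda>x. \<Sum>s\<in>S. w s * f s x) \<in> ZL1 M"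
proof (induction rule: finite_induct)
  case (insert s S)
  then have "(\<lambda>x. w s * f s x + (\<Sum>s\<in>S. w s * f s x)) \<in> ZL1 M" by (intro ZL1_add ZL1_cmult) auto
  then show ?case using insert.hyps by simp
qed (simp add: ZL1_zero)

text \<open>Associativity moves \<open>g\<close> past \<open>f\<close> and then past
  \<open>a\<close>.\<close>

lemma ZL1_conv:
  assumes a: "a \<in> ZL1 M" and f: "f \<in> ZL1 M"
  shows "conv M a f \<in> ZL1 M"
proof (rule ZL1_I)
  note ia = ZL1_integrable[OF a] and i = ZL1_integrable[OF f]
  show "integrable M (conv M a f)" by (rule conv_integrable(1)[OF ia i])
  fix g :: "'a \<Rightarrow> complex" assume g: "integrable M g"
  have 1: "AE x in M. conv M a (conv M f g) x = conv M a (conv M g f) x"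
    by (rule conv_cong_AE[OF ia ia conv_integrable(1)[OF i g] conv_integrable(1)[OF g i] _ ZL1_commute[OF f g]]) simp
  have 2: "AE x in M. conv M (conv M a g) f x = conv M (conv M g a) f x"
    by (rule conv_cong_AE[OF conv_integrable(1)[OF ia g] conv_integrable(1)[OF g ia] i i ZL1_commute[OF a g]]) simp
  show "AE x in M. conv M (conv M a f) g x = conv M g (conv M a f) x"
    using conv_assoc[OF ia i g] 1 conv_assoc[OF ia g i] 2 conv_assoc[OF g ia i] by eventually_elim simp
qed

abbreviation bil :: "(('a \<Rightarrow> complex) \<Rightarrow> ('a \<Rightarrow> complex) \<Rightarrow> complex) set" where
  "bil \<equiv> bil_unit (ZL1 M) N"

lemma bil_add: "\<phi> \<in> bil \<Longrightarrow> f \<in> ZL1 M \<Longrightarrow> g \<in> ZL1 M \<Longrightarrow> h \<in> ZL1 M \<Longrightarrow> \<phi> (\<lambda>x. f x + g x) h = \<phi> f h + \<phi> g h \<and> \<phi> h (\<lambda>x. f x + g x) = \<phi> h f + \<phi> h g"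
  and bil_cmult: "\<phi> \<in> bil \<Longrightarrow> f \<in> ZL1 M \<Longrightarrow> g \<in> ZL1 M \<Longrightarrow> \<phi> (\<lambda>x. c * f x) g = c * \<phi> f g \<and> \<phi> f (\<lambda>x. c * g x) = c * \<phi> f g"
  and bil_bound: "\<phi> \<in> bil \<Longrightarrow> f \<in> ZL1 M \<Longrightarrow> g \<in> ZL1 M \<Longrightarrow> cmod (\<phi> f g) \<le> N f * N g"
  unfolding bil_unit_def by blast+

lemma bil_zero: "\<phi> \<in> bil \<Longrightarrow> g \<in> ZL1 M \<Longrightarrow> \<phi> (\<lambda>x. 0) g = 0 \<and> \<phi> g (\<lambda>x. 0) = 0"
  using bil_cmult[of \<phi> g g 0] by simp

lemma bil_diff:
  assumes "\<phi> \<in> bil" "f \<in> ZL1 M" "g \<in> ZL1 M" "h \<in> ZL1 M"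
  shows "\<phi> (\<lambda>x. f x - g x) h = \<phi> f h - \<phi> g h" "\<phi> h (\<lambda>x. f x - g x) = \<phi> h f - \<phi> h g"
  using bil_add[OF assms(1,2) ZL1_cmult[OF assms(3), of "-1"] assms(4)] bil_cmult[OF assms(1,3,4), of "-1"] bil_cmult[OF assms(1,4,3), of "-1"]
  by simp_all

lemma bil_sum:
  assumes "\<phi> \<in> bil" "finite S" "\<And>s. s \<in> S \<Longrightarrow> f s \<in> ZL1 M" "g \<in> ZL1 M"
  shows "\<phi> (\<lambda>x. \<Sum>s\<in>S. w s * f s x) g = (\<Sum>s\<in>S. w s * \<phi> (f s) g)"
    "\<phi> g (\<lambda>x. \<Sum>s\<in>S. w s * f s x) = (\<Sum>s\<in>S. w s * \<phi> g (f s))"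
proof -
  have "\<phi> (\<lambda>x. \<Sum>s\<in>S. w s * f s x) g = (\<Sum>s\<in>S. w s * \<phi> (f s) g) \<and> \<phi> g (\<lambda>x. \<Sum>s\<in>S. w s * f s x) = (\<Sum>s\<in>S. w s * \<phi> g (f s))"
    using assms(2,3)
  proof (induction rule: finite_induct)
    case empty
    then show ?case using bil_zero[OF assms(1,4)] by simp
  next
    case (insert s S)
    have 1: "f s \<in> ZL1 M" "(\<lambda>x. \<Sum>s\<in>S. w s * f s x) \<in> ZL1 M" using insert by (auto intro: ZL1_sum)
    show ?case
      using bil_add[OF assms(1) ZL1_cmult[OF 1(1), of "w s"] 1(2) assms(4)] bil_cmult[OF assms(1) 1(1) assms(4), of "w s"]
        bil_cmult[OF assms(1) assms(4) 1(1), of "w s"] insert by simp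
  qed
  then show "\<phi> (\<lambda>x. \<Sum>s\<in>S. w s * f s x) g = (\<Sum>s\<in>S. w s * \<phi> (f s) g)"
    "\<phi> g (\<lambda>x. \<Sum>s\<in>S. w s * f s x) = (\<Sum>s\<in>S. w s * \<phi> g (f s))" by blast+
qed

lemma bil_close:
  assumes "\<phi> \<in> bil" "f \<in> ZL1 M" "f' \<in> ZL1 M" "g \<in> ZL1 M"
  shows "cmod (\<phi> f g - \<phi> f' g) \<le> N (\<lambda>x. f x - f' x) * N g" "cmod (\<phi> g f - \<phi> g f') \<le> N g * N (\<lambda>x. f x - f' x)"
  using bil_bound[OF assms(1) ZL1_diff[OF assms(2,3)] assms(4)] bil_bound[OF assms(1) assms(4) ZL1_diff[OF assms(2,3)]]
  unfolding bil_diff[OF assms] by simp_all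

lemma zero_bil: "(\<lambda>_ _. 0) \<in> bil"
  by (simp add: bil_unit_def)

text \<open>The zero form belongs to the unit ball, so the supremum runs over a nonempty bounded
  set.\<close>

lemma proj_norm_le:
  assumes "\<And>\<phi>. \<phi> \<in> bil \<Longrightarrow> cmod (T \<phi>) \<le> B"
  shows "proj_norm (ZL1 M) N T \<le> B" "0 \<le> proj_norm (ZL1 M) N T"
proof -
  show "proj_norm (ZL1 M) N T \<le> B" unfolding proj_norm_def using zero_bil assms by (intro cSUP_least) auto
  have "bdd_above ((\<lambda>\<phi>. cmod (T \<phi>)) ` bil)" using assms by (intro bdd_aboveI2) auto
  then have "cmod (T (\<lambda>_ _. 0)) \<le> proj_norm (ZL1 M) N T" unfolding proj_norm_def using zero_bil by (intro cSUP_upper)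
  then show "0 \<le> proj_norm (ZL1 M) N T" using norm_ge_zero order.trans by blast
qed

text \<open>A finite list is read as a sequence continued by zeros, for which the limits and series
  in the definition are finite expressions. By duality the projective norm is controlled through
  estimates uniform over the forms in the unit ball.\<close>

lemma amenable_finite_tensors:
  assumes "\<And>S \<epsilon>. finite S \<Longrightarrow> S \<subseteq> ZL1 M \<Longrightarrow> 0 < (\<epsilon>::real) \<Longrightarrow> \<exists>xs. (\<forall>p\<in>set xs. fst p \<in> ZL1 M \<and> snd p \<in> ZL1 M) \<and>
    (\<forall>\<phi>\<in>bil. cmod (\<Sum>p\<leftarrow>xs. \<phi> (fst p) (snd p)) \<le> C) \<and>
    (\<forall>a\<in>S. N (\<lambda>x. conv M (\<lambda>z. \<Sum>p\<leftarrow>xs. conv M (fst p) (snd p) z) a x - a x) < \<epsilon> \<and>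
      N (\<lambda>x. conv M a (\<lambda>z. \<Sum>p\<leftarrow>xs. conv M (fst p) (snd p) z) x - a x) < \<epsilon> \<and>
      (\<forall>\<phi>\<in>bil. cmod ((\<Sum>p\<leftarrow>xs. \<phi> (conv M a (fst p)) (snd p)) - (\<Sum>p\<leftarrow>xs. \<phi> (fst p) (conv M (snd p) a))) \<le> \<epsilon>))"
  shows "amenable_alg (ZL1 M) N (conv M)"
proof (rule amenableI[where C=C])
  fix S and \<epsilon> :: real
  assume S: "finite S" "S \<subseteq> ZL1 M" and e: "0 < \<epsilon>"
  \<comment> \<open>Halving turns the non-strict bound for a supremum into a strict one.\<close>
  then have e2: "0 < \<epsilon> / 2" by simp
  obtain xs where xs: "\<forall>p\<in>set xs. fst p \<in> ZL1 M \<and> snd p \<in> ZL1 M"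
    "\<forall>\<phi>\<in>bil. cmod (\<Sum>p\<leftarrow>xs. \<phi> (fst p) (snd p)) \<le> C"
    "\<forall>a\<in>S. N (\<lambda>x. conv M (\<lambda>z. \<Sum>p\<leftarrow>xs. conv M (fst p) (snd p) z) a x - a x) < \<epsilon> / 2 \<and>
      N (\<lambda>x. conv M a (\<lambda>z. \<Sum>p\<leftarrow>xs. conv M (fst p) (snd p) z) x - a x) < \<epsilon> / 2 \<and>
      (\<forall>\<phi>\<in>bil. cmod ((\<Sum>p\<leftarrow>xs. \<phi> (conv M a (fst p)) (snd p)) - (\<Sum>p\<leftarrow>xs. \<phi> (fst p) (conv M (snd p) a))) \<le> \<epsilon> / 2)"
    using assms[OF S e2] by (elim exE conjE) (rule that)
  let ?L = "length xs"
  define c where "c n = (if n < ?L then fst (xs ! n) else (\<lambda>x. 0))" for n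
  define d where "d n = (if n < ?L then snd (xs ! n) else (\<lambda>x. 0))" for n
  have c0: "conv M f (\<lambda>x. 0) = (\<lambda>x. 0)" "conv M (\<lambda>x. 0) f = (\<lambda>x. 0)" for f by (simp_all add: conv_def fun_eq_iff)
  have mem: "c n \<in> ZL1 M" "d n \<in> ZL1 M" for n
    using xs(1) ZL1_zero nth_mem[of n xs] unfolding c_def d_def by auto
  have fin: "(\<Sum>n. f n) = (\<Sum>n<?L. f n)" if "\<And>n. n \<ge> ?L \<Longrightarrow> f n = 0" for f :: "nat \<Rightarrow> complex"
    using that by (intro suminf_finite) auto
  have rep: "tensor_rep (ZL1 M) N c d"
    unfolding tensor_rep_def
  proof (intro conjI allI mem)
    show "summable (\<lambda>n. N (c n) * N (d n))"
      by (rule summable_finite[of "{..<?L}"]) (auto simp: c_def L1norm_def)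
  qed
  have ev: "tensor_eval c d \<phi> = (\<Sum>p\<leftarrow>xs. \<phi> (fst p) (snd p))" if "\<phi> \<in> bil" for \<phi>
  proof -
    have "tensor_eval c d \<phi> = (\<Sum>n<?L. \<phi> (c n) (d n))"
      unfolding tensor_eval_def by (rule fin) (use bil_zero[OF that mem(2)] in \<open>simp add: c_def\<close>)
    also have "\<dots> = (\<Sum>n<?L. \<phi> (fst (xs ! n)) (snd (xs ! n)))" by (simp add: c_def d_def)
    finally show ?thesis unfolding sum_nth[of "\<lambda>p. \<phi> (fst p) (snd p)"] .
  qed
  have bd: "proj_norm (ZL1 M) N (tensor_eval c d) \<le> C"
    using xs(2) by (intro proj_norm_le(1)) (simp add: ev)
  have prod: "(\<Sum>n<m. conv M (c n) (d n) z) = (\<Sum>p\<leftarrow>xs. conv M (fst p) (snd p) z)" if "m \<ge> ?L" for m z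
  proof -
    have "(\<Sum>n<m. conv M (c n) (d n) z) = (\<Sum>n<?L. conv M (c n) (d n) z)"
      using that by (intro sum.mono_neutral_right) (auto simp: c_def c0)
    also have "\<dots> = (\<Sum>n<?L. conv M (fst (xs ! n)) (snd (xs ! n)) z)" by (simp add: c_def d_def)
    finally show ?thesis unfolding sum_nth[of "\<lambda>p. conv M (fst p) (snd p) z"] .
  qed
  have lim_const: "lim g = g ?L" if "\<And>m. m \<ge> ?L \<Longrightarrow> g m = g ?L" for g :: "nat \<Rightarrow> real"
  proof (rule limI, rule tendsto_eventually)
    show "\<forall>\<^sub>F m in sequentially. g m = g ?L" unfolding eventually_sequentially using that by blast
  qed
  have l1: "lim (\<lambda>m. N (\<lambda>x. conv M (\<lambda>z. \<Sum>n<m. conv M (c n) (d n) z) a x - a x))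
      = N (\<lambda>x. conv M (\<lambda>z. \<Sum>p\<leftarrow>xs. conv M (fst p) (snd p) z) a x - a x)" for a
    by (subst lim_const) (simp_all add: prod)
  have l2: "lim (\<lambda>m. N (\<lambda>x. conv M a (\<lambda>z. \<Sum>n<m. conv M (c n) (d n) z) x - a x))
      = N (\<lambda>x. conv M a (\<lambda>z. \<Sum>p\<leftarrow>xs. conv M (fst p) (snd p) z) x - a x)" for a
    by (subst lim_const) (simp_all add: prod)
  have l3: "\<bar>proj_norm (ZL1 M) N (\<lambda>\<phi>. (\<Sum>n. \<phi> (conv M a (c n)) (d n)) - (\<Sum>n. \<phi> (c n) (conv M (d n) a)))\<bar> \<le> \<epsilon> / 2"
    if a: "a \<in> S" for a
  proof -
    have "cmod ((\<Sum>n. \<phi> (conv M a (c n)) (d n)) - (\<Sum>n. \<phi> (c n) (conv M (d n) a))) \<le> \<epsilon> / 2" if \<phi>: "\<phi> \<in> bil" for \<phi>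
    proof -
      have "(\<Sum>n. \<phi> (conv M a (c n)) (d n)) = (\<Sum>n<?L. \<phi> (conv M a (c n)) (d n))"
        by (rule fin) (use bil_zero[OF \<phi> mem(2)] in \<open>simp add: c_def c0\<close>)
      also have "\<dots> = (\<Sum>n<?L. \<phi> (conv M a (fst (xs ! n))) (snd (xs ! n)))" by (simp add: c_def d_def)
      finally have 1: "(\<Sum>n. \<phi> (conv M a (c n)) (d n)) = (\<Sum>p\<leftarrow>xs. \<phi> (conv M a (fst p)) (snd p))"
        unfolding sum_nth[of "\<lambda>p. \<phi> (conv M a (fst p)) (snd p)"] .
      have "(\<Sum>n. \<phi> (c n) (conv M (d n) a)) = (\<Sum>n<?L. \<phi> (c n) (conv M (d n) a))"
        by (rule fin) (use bil_zero[OF \<phi> mem(1)] in \<open>simp add: d_def c0\<close>)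
      also have "\<dots> = (\<Sum>n<?L. \<phi> (fst (xs ! n)) (conv M (snd (xs ! n)) a))" by (simp add: c_def d_def)
      finally have 2: "(\<Sum>n. \<phi> (c n) (conv M (d n) a)) = (\<Sum>p\<leftarrow>xs. \<phi> (fst p) (conv M (snd p) a))"
        unfolding sum_nth[of "\<lambda>p. \<phi> (fst p) (conv M (snd p) a)"] .
      show ?thesis unfolding 1 2 using xs(3) a \<phi> by blast
    qed
    note this = proj_norm_le[where T="\<lambda>\<phi>. (\<Sum>n. \<phi> (conv M a (c n)) (d n)) - (\<Sum>n. \<phi> (c n) (conv M (d n) a))", OF this]
    then show ?thesis by simp
  qed
  have "\<bar>lim (\<lambda>N'. N (\<lambda>x. conv M (\<lambda>z. \<Sum>n<N'. conv M (c n) (d n) z) a x - a x))\<bar> < \<epsilon> \<and>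
      \<bar>lim (\<lambda>N'. N (\<lambda>x. conv M a (\<lambda>z. \<Sum>n<N'. conv M (c n) (d n) z) x - a x))\<bar> < \<epsilon> \<and>
      \<bar>proj_norm (ZL1 M) N (\<lambda>\<phi>. (\<Sum>n. \<phi> (conv M a (c n)) (d n)) - (\<Sum>n. \<phi> (c n) (conv M (d n) a)))\<bar> < \<epsilon>" if a: "a \<in> S" for a
  proof -
    have "N (\<lambda>x. conv M (\<lambda>z. \<Sum>p\<leftarrow>xs. conv M (fst p) (snd p) z) a x - a x) < \<epsilon> / 2"
      "N (\<lambda>x. conv M a (\<lambda>z. \<Sum>p\<leftarrow>xs. conv M (fst p) (snd p) z) x - a x) < \<epsilon> / 2" using xs(3) a by blast+
    then show ?thesis unfolding l1 l2 using l3[OF a] e by auto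
  qed
  then show "\<exists>c d. tensor_rep (ZL1 M) N c d \<and> proj_norm (ZL1 M) N (tensor_eval c d) \<le> C \<and>
    (\<forall>a\<in>S. \<bar>lim (\<lambda>N'. N (\<lambda>x. conv M (\<lambda>z. \<Sum>n<N'. conv M (c n) (d n) z) a x - a x))\<bar> < \<epsilon> \<and>
      \<bar>lim (\<lambda>N'. N (\<lambda>x. conv M a (\<lambda>z. \<Sum>n<N'. conv M (c n) (d n) z) x - a x))\<bar> < \<epsilon> \<and>
      \<bar>proj_norm (ZL1 M) N (\<lambda>\<phi>. (\<Sum>n. \<phi> (conv M a (c n)) (d n)) - (\<Sum>n. \<phi> (c n) (conv M (d n) a)))\<bar> < \<epsilon>)"
    using rep bd by blast
qed

text \<open>All elements are at distance 0 from zero, so the empty tensor is a diagonal.\<close>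

lemma amenable_trivial:
  assumes "\<And>f. f \<in> ZL1 M \<Longrightarrow> N f = 0"
  shows "amenable_alg (ZL1 M) N (conv M)"
proof (rule amenable_finite_tensors[where C=0], rule exI[of _ "[]"])
  fix S :: "('a \<Rightarrow> complex) set" and \<epsilon> :: real assume S: "S \<subseteq> ZL1 M" and e: "0 < \<epsilon>"
  have "N (\<lambda>x. conv M (\<lambda>z. 0) a x - a x) = 0" "N (\<lambda>x. conv M a (\<lambda>z. 0) x - a x) = 0" if "a \<in> S" for a
    using assms[of a] that S by (auto simp: conv_def L1norm_def)
  then show "(\<forall>p\<in>set []. fst p \<in> ZL1 M \<and> snd p \<in> ZL1 M) \<and>
    (\<forall>\<phi>\<in>bil. cmod (\<Sum>p\<leftarrow>[]. \<phi> (fst p) (snd p)) \<le> 0) \<and>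
    (\<forall>a\<in>S. N (\<lambda>x. conv M (\<lambda>z. \<Sum>p\<leftarrow>[]. conv M (fst p) (snd p) z) a x - a x) < \<epsilon> \<and>
      N (\<lambda>x. conv M a (\<lambda>z. \<Sum>p\<leftarrow>[]. conv M (fst p) (snd p) z) x - a x) < \<epsilon> \<and>
      (\<forall>\<phi>\<in>bil. cmod ((\<Sum>p\<leftarrow>[]. \<phi> (conv M a (fst p)) (snd p)) - (\<Sum>p\<leftarrow>[]. \<phi> (fst p) (conv M (snd p) a))) \<le> \<epsilon>))"
    using e by simp
qed

end

section \<open>The approximate diagonal\<close>

context in_group begin

section \<open>Finitely supported class functions acting on L1\<close>

lemma act_lincomb: "u \<in> ZZ \<Longrightarrow> act u f = (\<lambda>x. \<Sum>s\<in>fsupp u. u s * lt s f x)"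
  using act_sum[OF ZZD(2) order_refl] by (simp add: lt_def fun_eq_iff)

lemma integrable_act: "u \<in> ZZ \<Longrightarrow> integrable M f \<Longrightarrow> integrable M (act u f)"
  by (simp only: act_lincomb integrable_lincomb)

lemma N_act: "u \<in> ZZ \<Longrightarrow> integrable M f \<Longrightarrow> N (act u f) \<le> n1 u * N f"
  unfolding act_lincomb n1_def by (rule N_lincomb[OF _ ZZD(2)])

lemma act_ZF:
  assumes u: "u \<in> ZZ" and f: "f \<in> ZF"
  shows "act u f \<in> ZF"
proof -
  have "act u f x = 0" if x: "x \<notin> G0" for x
  proof -
    have "lt s f x = 0" if "s \<in> fsupp u" for s
      using ZFD(3)[OF f, of "- s + x"] ZZD(3)[OF u] that x minus_G0_iff[of s x] by (auto simp: lt_def)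
    then show ?thesis unfolding act_lincomb[OF u] by simp
  qed
  then show ?thesis
    using act_class[OF ZZD(1)[OF u] ZFD(1)[OF f]] integrable_act[OF u ZFD(2)[OF f]] by (simp add: ZF_def)
qed

lemma act_cong_AE:
  assumes u: "u \<in> ZZ" and eq: "AE x in M. f x = g x"
  shows "AE x in M. act u f x = act u g x"
proof -
  have "AE x in M. \<forall>s\<in>fsupp u. lt s f x = lt s g x"
    unfolding AE_finite_all[OF ZZD(2)[OF u]] using AE_translate[OF eq] by (simp add: lt_def)
  then show ?thesis unfolding act_lincomb[OF u] by eventually_elim simp
qed

lemma conv_act_left:
  assumes u: "u \<in> ZZ" and f: "integrable M f" and g: "integrable M g"
  shows "AE x in M. conv M (act u f) g x = act u (conv M f g) x"
  unfolding act_lincomb[OF u] by (rule conv_lincomb_left[OF ZZD(2)[OF u] f g])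

text \<open>Commutation with the central \<open>a\<close> puts \<open>act u f\<close> on the left,
  where \<open>u\<close> can be pulled out, and commuting \<open>a\<close> with \<open>f\<close>
  finishes the exchange.\<close>

lemma conv_act_right:
  assumes u: "u \<in> ZZ" and f: "f \<in> ZF" and a: "a \<in> ZL1 M"
  shows "AE x in M. conv M a (act u f) x = act u (conv M a f) x"
    "AE x in M. conv M (act u f) a x = act u (conv M a f) x"
proof -
  note i = ZFD(2)[OF f] and ia = ZL1_integrable[OF a]
  have "AE x in M. act u (conv M f a) x = act u (conv M a f) x"
    by (rule act_cong_AE[OF u]) (use ZL1_commute[OF a i] in \<open>auto elim: eventually_mono\<close>)
  with conv_act_left[OF u i ia] show 1: "AE x in M. conv M (act u f) a x = act u (conv M a f) x"
    by eventually_elim simp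
  with ZL1_commute[OF a integrable_act[OF u i]] show "AE x in M. conv M a (act u f) x = act u (conv M a f) x"
    by eventually_elim simp
qed

lemma act_unitary_bound:
  assumes p: "p \<in> Idem" and u: "u \<in> unitaries p" and f: "f \<in> ZL1 M"
  shows "N (act u f) \<le> card K * N f"
proof -
  have "N (act u f) \<le> n1 u * N f" by (rule N_act[OF unitariesD(1)[OF u] ZL1_integrable[OF f]])
  also have "\<dots> \<le> card K * N f" by (intro mult_right_mono unitaries_n1[OF p u]) simp
  finally show ?thesis .
qed

text \<open>\<open>\<Theta> u\<close> evaluates the form at \<open>act u e\<close> and
  \<open>act (act (v s) (star u)) e\<close>. Since \<open>v s\<close> is unitary in the corner,
  \<open>v s\<close> times the adjoint of \<open>act (v s) u\<close> is \<open>star u\<close>, so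
  the difference to be averaged is \<open>c s\<close> times
  \<open>\<Theta> (act (v s) u) - \<Theta> u\<close>. Folner lists make its average small.\<close>

lemma Folner_avg:
  assumes p: "p \<in> Minimal" and e: "e \<in> ZF" "N e \<le> 1" and T: "finite T" "T \<subseteq> G0" and d: "0 < (\<delta>::real)"
  shows "\<exists>W. W \<noteq> [] \<and> set W \<subseteq> unitaries p \<and> (\<forall>s\<in>T. \<forall>\<phi>\<in>bil.
    cmod (\<Sum>u\<leftarrow>W. \<phi> (act u (act (avg s) e)) (act (star u) e) - \<phi> (act u e) (act (star u) (act (avg s) e))) \<le> \<delta> * length W)"
proof -
  have pI: "p \<in> Idem" using p by (simp add: Minimal_def)
  let ?U = "unitaries p" and ?k = "real (card K)"
  have k: "?k > 0" using card_K_pos by simp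
  have "\<forall>s\<in>T. \<exists>v c. v \<in> ?U \<and> (\<forall>u\<in>?U. \<forall>f. act u (act (avg s) f) = (\<lambda>x. c * act (act v u) f x))"
    using avg_factor[OF p] T(2) by blast
  then obtain v c where v: "\<And>s. s \<in> T \<Longrightarrow> v s \<in> ?U"
    and vc: "\<And>s u f. s \<in> T \<Longrightarrow> u \<in> ?U \<Longrightarrow> act u (act (avg s) f) = (\<lambda>x. c s * act (act (v s) u) f x)"
    by metis
  define C where "C = 1 + (\<Sum>s\<in>T. cmod (c s))"
  have C: "C > 0" unfolding C_def by (intro add_pos_nonneg sum_nonneg) auto
  have cC: "cmod (c s) \<le> C" if "s \<in> T" for s
    using member_le_sum[of s T "\<lambda>s. cmod (c s)"] that T(1) by (simp add: C_def)
  \<comment> \<open>\<open>\<Theta>\<close> is bounded by the square of \<open>card K\<close>, and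
    the scalars \<open>c s\<close> by \<open>C\<close>.\<close>
  define \<delta>' where "\<delta>' = \<delta> / (?k * ?k * C)"
  have d': "0 < \<delta>'" using d k C by (simp add: \<delta>'_def)
  obtain vs where vs: "set vs = v ` T" using finite_list[OF finite_imageI[OF T(1), of v]] by (elim exE) (rule that)
  have comm: "act u (act w z) = act w (act u z)" if "u \<in> ?U" "w \<in> ?U" "z \<in> ?U" for u w z
    using ZZ_assoc[OF unitariesD(1)[OF that(1)] unitariesD(1)[OF that(2)], of z]
      ZZ_assoc[OF unitariesD(1)[OF that(2)] unitariesD(1)[OF that(1)], of z] ZZ_comm[OF unitariesD(1)[OF that(1)], of w] by simp
  have vsU: "set vs \<subseteq> ?U" using vs v by auto
  have "\<exists>W. W \<noteq> [] \<and> set W \<subseteq> ?U \<and> (\<forall>v\<in>set vs. \<forall>\<Theta> B. (\<forall>u\<in>?U. cmod (\<Theta> u) \<le> B) \<longrightarrow>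
    cmod (\<Sum>u\<leftarrow>W. \<Theta> (act v u) - \<Theta> u) \<le> \<delta>' * B * length W)"
    by (rule Folner[where op=act and U="?U", OF _ _ unitaries_unit[OF pI] d' vsU]) (rule unitaries_act[OF pI] comm; assumption)+
  then obtain W where W: "W \<noteq> []" "set W \<subseteq> ?U"
    "\<forall>v\<in>set vs. \<forall>\<Theta> B. (\<forall>u\<in>?U. cmod (\<Theta> u) \<le> B) \<longrightarrow> cmod (\<Sum>u\<leftarrow>W. \<Theta> (act v u) - \<Theta> u) \<le> \<delta>' * B * length W"
    by (elim exE conjE) (rule that)
  have "cmod (\<Sum>u\<leftarrow>W. \<phi> (act u (act (avg s) e)) (act (star u) e) - \<phi> (act u e) (act (star u) (act (avg s) e))) \<le> \<delta> * length W"
    if s: "s \<in> T" and \<phi>: "\<phi> \<in> bil" for s \<phi>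
  proof -
    define \<Theta> where "\<Theta> u = \<phi> (act u e) (act (act (v s) (star u)) e)" for u
    have Z: "act u e \<in> ZL1 M" if "u \<in> ?U" for u by (rule ZF_ZL1[OF act_ZF[OF unitariesD(1)[OF that] e(1)]])
    have bd: "N (act u e) \<le> ?k" if "u \<in> ?U" for u
      using order.trans[OF act_unitary_bound[OF pI that ZF_ZL1[OF e(1)]] mult_left_mono[OF e(2), of ?k]] by simp
    note vs_U = v[OF s]
    note sU = unitaries_star and vU = unitaries_act[OF pI vs_U]
    have "cmod (\<Theta> u) \<le> ?k * ?k" if u: "u \<in> ?U" for u
    proof -
      have "cmod (\<Theta> u) \<le> N (act u e) * N (act (act (v s) (star u)) e)"
        unfolding \<Theta>_def by (rule bil_bound[OF \<phi> Z[OF u] Z[OF vU[OF sU[OF u]]]])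
      also have "\<dots> \<le> ?k * ?k" by (intro mult_mono bd u vU sU) auto
      finally show ?thesis .
    qed
    then have "\<forall>u\<in>?U. cmod (\<Theta> u) \<le> ?k * ?k" by blast
    moreover have "v s \<in> set vs" using vs s by blast
    ultimately have F: "cmod (\<Sum>u\<leftarrow>W. \<Theta> (act (v s) u) - \<Theta> u) \<le> \<delta>' * (?k * ?k) * length W"
      using W(3)[THEN bspec, THEN spec, THEN spec, THEN mp, of "v s" \<Theta> "?k * ?k"] by (simp only:)
    have "\<phi> (act u (act (avg s) e)) (act (star u) e) - \<phi> (act u e) (act (star u) (act (avg s) e))
        = c s * (\<Theta> (act (v s) u) - \<Theta> u)" if u: "u \<in> ?U" for u
    proof -
      note vZ = unitariesD(1)[OF vs_U]
      have "act (v s) (star (act (v s) u)) = star u"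
        unfolding ZZ_star_act[OF vZ] ZZ_assoc[OF vZ ZZ_star[OF vZ], symmetric] unitariesD(2)[OF vs_U]
        by (rule unitaries_absorb[OF pI sU[OF u]])
      then have 1: "\<Theta> (act (v s) u) = \<phi> (act (act (v s) u) e) (act (star u) e)" unfolding \<Theta>_def by simp
      show ?thesis
        unfolding vc[OF s u] vc[OF s sU[OF u]] 1 unfolding \<Theta>_def
        using bil_cmult[OF \<phi> Z[OF vU[OF u]] Z[OF sU[OF u]], of "c s"] bil_cmult[OF \<phi> Z[OF u] Z[OF vU[OF sU[OF u]]], of "c s"]
        by (simp add: right_diff_distrib)
    qed
    then have "(\<Sum>u\<leftarrow>W. \<phi> (act u (act (avg s) e)) (act (star u) e) - \<phi> (act u e) (act (star u) (act (avg s) e)))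
        = (\<Sum>u\<leftarrow>W. c s * (\<Theta> (act (v s) u) - \<Theta> u))"
      using W(2) by (intro arg_cong[where f=sum_list] map_cong refl) auto
    also have "\<dots> = c s * (\<Sum>u\<leftarrow>W. \<Theta> (act (v s) u) - \<Theta> u)" by (simp add: sum_list_const_mult)
    also have "cmod \<dots> \<le> C * (\<delta>' * (?k * ?k) * length W)"
      unfolding norm_mult using F cC[OF s] C by (intro mult_mono) auto
    also have "\<dots> = \<delta> * length W" using k C by (simp add: \<delta>'_def)
    finally show ?thesis .
  qed
  then show ?thesis using W(1,2) by (intro exI[of _ W]) blast
qed

text \<open>Passes from class averages to central \<open>a\<close> by approximating
  \<open>conv M a e\<close> with a combination of \<open>act (avg s) e\<close>. The action of a
  unitary commutes with convolution by \<open>a\<close>, so one approximation serves for all of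
  them.\<close>

lemma Folner_central:
  assumes p: "p \<in> Minimal" and e: "e \<in> ZF" "N e \<le> 1" and A: "finite A" "A \<subseteq> ZL1 M" and eps: "0 < (\<epsilon>::real)"
  shows "\<exists>W. W \<noteq> [] \<and> set W \<subseteq> unitaries p \<and> (\<forall>a\<in>A. \<forall>\<phi>\<in>bil.
    cmod (\<Sum>u\<leftarrow>W. \<phi> (conv M a (act u e)) (act (star u) e) - \<phi> (act u e) (conv M (act (star u) e) a)) \<le> \<epsilon> * length W)"
proof -
  have pI: "p \<in> Idem" using p by (simp add: Minimal_def)
  let ?U = "unitaries p" and ?k = "real (card K)"
  have k: "?k > 0" using card_K_pos by simp
  \<comment> \<open>A unitary magnifies the error by at most \<open>card K\<close>, the other entry
    of the form has norm at most \<open>card K\<close>, and there are two terms; together they cost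
    \<open>\<epsilon> / 2\<close>.\<close>
  define \<eta> where "\<eta> = \<epsilon> / (4 * (?k * ?k))"
  have eta: "0 < \<eta>" using eps k by (simp add: \<eta>_def)
  have "\<forall>a\<in>A. \<exists>S w. finite S \<and> S \<subseteq> G0 \<and> N (\<lambda>x. conv M a e x - (\<Sum>s\<in>S. w s * act (avg s) e x)) \<le> \<eta>"
  proof
    fix a assume "a \<in> A"
    then have aZ: "a \<in> ZL1 M" using A by blast
    show "\<exists>S w. finite S \<and> S \<subseteq> G0 \<and> N (\<lambda>x. conv M a e x - (\<Sum>s\<in>S. w s * act (avg s) e x)) \<le> \<eta>"
      by (rule central_approx[OF aZ e(1) eta]) (intro exI conjI)
  qed
  from bchoice[OF this] obtain S where
    "\<forall>a\<in>A. \<exists>w. finite (S a) \<and> S a \<subseteq> G0 \<and> N (\<lambda>x. conv M a e x - (\<Sum>s\<in>S a. w s * act (avg s) e x)) \<le> \<eta>"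
    by (elim exE) (rule that)
  from bchoice[OF this] obtain w where
    Sw: "\<forall>a\<in>A. finite (S a) \<and> S a \<subseteq> G0 \<and> N (\<lambda>x. conv M a e x - (\<Sum>s\<in>S a. w a s * act (avg s) e x)) \<le> \<eta>"
    by (elim exE) (rule that)
  note S = bspec[OF Sw, THEN conjunct1] bspec[OF Sw, THEN conjunct2, THEN conjunct1]
    and w = bspec[OF Sw, THEN conjunct2, THEN conjunct2]
  \<comment> \<open>Bounds the total weight of each combination, so that errors of
    \<open>\<epsilon> / (2 * B)\<close> for the single averages add up to at most
    \<open>\<epsilon> / 2\<close>.\<close>
  define B where "B = 1 + (\<Sum>a\<in>A. \<Sum>s\<in>S a. cmod (w a s))"
  have B: "B > 0" unfolding B_def by (intro add_pos_nonneg sum_nonneg) auto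
  have wB: "(\<Sum>s\<in>S a. cmod (w a s)) \<le> B" if "a \<in> A" for a
    using member_le_sum[of a A "\<lambda>a. \<Sum>s\<in>S a. cmod (w a s)"] that A(1) by (simp add: B_def sum_nonneg)
  have "finite (\<Union>a\<in>A. S a)" by (rule finite_UN_I[OF A(1) S(1)])
  moreover have "(\<Union>a\<in>A. S a) \<subseteq> G0" by (rule UN_least[OF S(2)])
  moreover have "0 < \<epsilon> / (2 * B)" using B eps by simp
  ultimately have "\<exists>W. W \<noteq> [] \<and> set W \<subseteq> ?U \<and> (\<forall>s\<in>(\<Union>a\<in>A. S a). \<forall>\<phi>\<in>bil.
      cmod (\<Sum>u\<leftarrow>W. \<phi> (act u (act (avg s) e)) (act (star u) e) - \<phi> (act u e) (act (star u) (act (avg s) e))) \<le> \<epsilon> / (2 * B) * length W)"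
    by (rule Folner_avg[OF p e])
  then obtain W where W: "W \<noteq> []" "set W \<subseteq> ?U"
    "\<forall>s\<in>(\<Union>a\<in>A. S a). \<forall>\<phi>\<in>bil. cmod (\<Sum>u\<leftarrow>W. \<phi> (act u (act (avg s) e)) (act (star u) e) - \<phi> (act u e) (act (star u) (act (avg s) e))) \<le> \<epsilon> / (2 * B) * length W"
    by (elim exE conjE) (rule that)
  have "cmod (\<Sum>u\<leftarrow>W. \<phi> (conv M a (act u e)) (act (star u) e) - \<phi> (act u e) (conv M (act (star u) e) a)) \<le> \<epsilon> * length W"
    if a: "a \<in> A" and \<phi>: "\<phi> \<in> bil" for a \<phi>
  proof -
    have aZ: "a \<in> ZL1 M" using a A by blast
    note eZ = ZF_ZL1[OF e(1)]
    have sG: "s \<in> G0" if "s \<in> S a" for s using that S(2)[OF a] by blast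
    define b where "b = (\<lambda>x. \<Sum>s\<in>S a. w a s * act (avg s) e x)"
    define D where "D u = \<phi> (act u b) (act (star u) e) - \<phi> (act u e) (act (star u) b)" for u
    define E where "E s u = \<phi> (act u (act (avg s) e)) (act (star u) e) - \<phi> (act u e) (act (star u) (act (avg s) e))" for s u
    have sZ: "act (avg s) e \<in> ZF" if "s \<in> S a" for s by (rule act_ZF[OF avg_ZZ[OF sG[OF that]] e(1)])
    have bZ: "b \<in> ZL1 M" unfolding b_def by (rule ZL1_sum[OF S(1)[OF a] ZF_ZL1[OF sZ]])
    have cZ: "conv M a e \<in> ZL1 M" by (rule ZL1_conv[OF aZ eZ])
    have actb: "act u b = (\<lambda>x. \<Sum>s\<in>S a. w a s * act u (act (avg s) e) x)" if "u \<in> ZZ" for u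
      unfolding b_def act_sum_right[OF ZZD(2)[OF that]] act_cmult_right[OF ZZD(2)[OF that]] ..
    have aZL: "act u f \<in> ZL1 M" if "u \<in> ZZ" "f \<in> ZF" for u f by (rule ZF_ZL1[OF act_ZF[OF that]])
    have abZ: "act u b \<in> ZL1 M" if u: "u \<in> ZZ" for u
      unfolding actb[OF u] by (rule ZL1_sum[OF S(1)[OF a] aZL[OF u sZ]])
    have close: "N (\<lambda>x. act u (conv M a e) x - act u b x) \<le> ?k * \<eta>" if u: "u \<in> ?U" for u
    proof -
      have "N (\<lambda>x. act u (conv M a e) x - act u b x) = N (act u (\<lambda>x. conv M a e x - b x))"
        unfolding act_diff_right[OF ZZD(2)[OF unitariesD(1)[OF u]]] ..
      also have "\<dots> \<le> ?k * N (\<lambda>x. conv M a e x - b x)" by (rule act_unitary_bound[OF pI u ZL1_diff[OF cZ bZ]])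
      also have "\<dots> \<le> ?k * \<eta>" using w[OF a] by (intro mult_left_mono) (simp_all add: b_def)
      finally show ?thesis .
    qed
    have bd: "N (act u e) \<le> ?k" if "u \<in> ?U" for u
      using order.trans[OF act_unitary_bound[OF pI that eZ] mult_left_mono[OF e(2), of ?k]] by simp
    have err: "cmod ((\<phi> (conv M a (act u e)) (act (star u) e) - \<phi> (act u e) (conv M (act (star u) e) a)) - D u) \<le> \<epsilon> / 2"
      if u: "u \<in> ?U" for u
    proof -
      note uZ = unitariesD(1)[OF u] and suU = unitaries_star[OF u]
      note suZ = unitariesD(1)[OF suU]
      have c1: "conv M a (act u e) \<in> ZL1 M" by (rule ZL1_conv[OF aZ aZL[OF uZ e(1)]])
      have c2: "conv M (act (star u) e) a \<in> ZL1 M" by (rule ZL1_conv[OF aZL[OF suZ e(1)] aZ])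
      have n: "N (\<lambda>x. f x - act u' b x) \<le> ?k * \<eta>"
        if "f \<in> ZL1 M" "u' \<in> ?U" "AE x in M. f x = act u' (conv M a e) x" for f u'
      proof -
        note i = ZL1_integrable[OF that(1)] integrable_act[OF unitariesD(1)[OF that(2)] ZL1_integrable[OF cZ]] ZL1_integrable[OF abZ[OF unitariesD(1)[OF that(2)]]]
        have "AE x in M. f x - act u' b x = act u' (conv M a e) x - act u' b x" using that(3) by eventually_elim simp
        from N_cong_AE[OF Bochner_Integration.integrable_diff[OF i(1,3)] Bochner_Integration.integrable_diff[OF i(2,3)] this]
        show ?thesis using close[OF that(2)] by simp
      qed
      have e1: "cmod (\<phi> (conv M a (act u e)) (act (star u) e) - \<phi> (act u b) (act (star u) e)) \<le> (?k * \<eta>) * ?k"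
        by (rule order.trans[OF bil_close(1)[OF \<phi> c1 abZ[OF uZ] aZL[OF suZ e(1)]]])
          (rule mult_mono[OF n[OF c1 u conv_act_right(1)[OF uZ e(1) aZ]] bd[OF suU]], use eta in auto)
      have e2: "cmod (\<phi> (act u e) (conv M (act (star u) e) a) - \<phi> (act u e) (act (star u) b)) \<le> ?k * (?k * \<eta>)"
        by (rule order.trans[OF bil_close(2)[OF \<phi> c2 abZ[OF suZ] aZL[OF uZ e(1)]]])
          (rule mult_mono[OF bd[OF u] n[OF c2 suU conv_act_right(2)[OF suZ e(1) aZ]]], auto)
      have tri: "cmod ((x - y) - (x' - y')) \<le> cmod (x - x') + cmod (y - y')" for x y x' y' :: complex
        using norm_triangle_ineq4[of "x - x'" "y - y'"] by (simp add: algebra_simps)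
      have q: "?k * (?k * \<eta>) = \<epsilon> / 4" "(?k * \<eta>) * ?k = \<epsilon> / 4" using k by (simp_all add: \<eta>_def)
      show ?thesis using order.trans[OF tri add_mono[OF e1 e2]] unfolding D_def q by simp
    qed
    have D: "D u = (\<Sum>s\<in>S a. w a s * E s u)" if u: "u \<in> ?U" for u
    proof -
      note uZ = unitariesD(1)[OF u] and suZ = unitariesD(1)[OF unitaries_star[OF u]]
      have "\<phi> (act u b) (act (star u) e) = (\<Sum>s\<in>S a. w a s * \<phi> (act u (act (avg s) e)) (act (star u) e))"
        unfolding actb[OF uZ] by (rule bil_sum(1)[OF \<phi> S(1)[OF a] _ aZL[OF suZ e(1)]]) (rule aZL[OF uZ sZ])
      moreover have "\<phi> (act u e) (act (star u) b) = (\<Sum>s\<in>S a. w a s * \<phi> (act u e) (act (star u) (act (avg s) e)))"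
        unfolding actb[OF suZ] by (rule bil_sum(2)[OF \<phi> S(1)[OF a] _ aZL[OF uZ e(1)]]) (rule aZL[OF suZ sZ])
      ultimately show ?thesis unfolding D_def E_def by (simp add: sum_subtractf right_diff_distrib)
    qed
    have "cmod (\<Sum>u\<leftarrow>W. D u) \<le> \<epsilon> / 2 * length W"
    proof -
      have "(\<Sum>u\<leftarrow>W. D u) = (\<Sum>u\<leftarrow>W. \<Sum>s\<in>S a. w a s * E s u)"
        using W(2) D by (intro arg_cong[where f=sum_list] map_cong refl) auto
      also have "\<dots> = (\<Sum>s\<in>S a. w a s * (\<Sum>u\<leftarrow>W. E s u))"
        by (induction W) (simp_all add: sum.distrib distrib_left)
      also have "cmod \<dots> \<le> (\<Sum>s\<in>S a. cmod (w a s) * (\<epsilon> / (2 * B) * length W))"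
      proof (rule order.trans[OF norm_sum sum_mono])
        fix s assume s: "s \<in> S a"
        then have "cmod (\<Sum>u\<leftarrow>W. E s u) \<le> \<epsilon> / (2 * B) * length W" using W(3) a \<phi> unfolding E_def by blast
        then show "cmod (w a s * (\<Sum>u\<leftarrow>W. E s u)) \<le> cmod (w a s) * (\<epsilon> / (2 * B) * length W)"
          unfolding norm_mult by (rule mult_left_mono) simp
      qed
      also have "\<dots> = (\<Sum>s\<in>S a. cmod (w a s)) * (\<epsilon> / (2 * B) * length W)" by (simp only: sum_distrib_right)
      also have "\<dots> \<le> B * (\<epsilon> / (2 * B) * length W)" using wB[OF a] eps B by (intro mult_right_mono) auto
      also have "\<dots> = \<epsilon> / 2 * length W" using B by simp
      finally show ?thesis .
    qed
    moreover have "cmod (\<Sum>u\<leftarrow>W. (\<phi> (conv M a (act u e)) (act (star u) e) - \<phi> (act u e) (conv M (act (star u) e) a)) - D u) \<le> \<epsilon> / 2 * length W"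
    proof -
      have "cmod (\<Sum>u\<leftarrow>W. (\<phi> (conv M a (act u e)) (act (star u) e) - \<phi> (act u e) (conv M (act (star u) e) a)) - D u) \<le> (\<Sum>u\<leftarrow>W. \<epsilon> / 2)"
        using err W(2) by (intro order.trans[OF norm_sum_list_le] sum_list_mono) auto
      then show ?thesis by (simp add: sum_list_triv mult.commute)
    qed
    ultimately have "cmod ((\<Sum>u\<leftarrow>W. (\<phi> (conv M a (act u e)) (act (star u) e) - \<phi> (act u e) (conv M (act (star u) e) a)) - D u) + (\<Sum>u\<leftarrow>W. D u))
        \<le> \<epsilon> / 2 * length W + \<epsilon> / 2 * length W"
      by (rule norm_triangle_mono[rotated])
    then show ?thesis by (simp add: sum_list_addf[symmetric])
  qed
  then show ?thesis using W(1,2) by (intro exI[of _ W]) blast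
qed

text \<open>For a unitary \<open>u\<close> of the corner of \<open>p\<close>, the product of
  \<open>act u e\<close> and \<open>act (star u) e\<close> is \<open>act p (conv M e e)\<close>.
  Averaging over \<open>u\<close> keeps this, and summing over \<open>p\<close> leaves
  \<open>conv M e e\<close>, again an approximate unit. The norm bound, the number of idempotents
  times the square of \<open>card K\<close>, depends neither on the finite set nor on
  \<open>\<epsilon>\<close>.\<close>

lemma amenable_ZL1: "amenable_alg (ZL1 M) N (conv M)"
proof -
  let ?k = "real (card K)"
  obtain ps where ps: "set ps \<subseteq> Minimal" and sum_ps: "\<And>x. (\<Sum>p\<leftarrow>ps. p x) = (dirac x :: complex)"
    using minimal_decomposition[OF dirac_Id] by (elim exE conjE) (rule that; blast)
  have psI: "p \<in> Idem" if "p \<in> set ps" for p using subsetD[OF ps that] by (simp add: Minimal_def)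
  have split: "(\<Sum>p\<leftarrow>ps. act p f x) = f x" for f x
  proof -
    have "act (\<lambda>x. \<Sum>p\<leftarrow>ps. p x) f = (\<lambda>x. \<Sum>p\<leftarrow>ps. act p f x)"
      by (rule act_sum_list[THEN conjunct2]) (rule ZZD(2)[OF IdD(2)[OF psI]])
    then show ?thesis unfolding sum_ps act_dirac by (rule fun_cong[symmetric])
  qed
  show ?thesis
  proof (rule amenable_finite_tensors[where C="real (length ps) * (?k * ?k)"])
    fix S :: "('a \<Rightarrow> complex) set" and \<epsilon> :: real
    assume S: "finite S" "S \<subseteq> ZL1 M" and eps: "0 < \<epsilon>"
    have "0 < \<epsilon> / 4" using eps by simp
    then obtain e where e: "e \<in> ZF" "N e \<le> 1" and unit: "\<And>a. a \<in> S \<Longrightarrow> N (\<lambda>x. conv M e a x - a x) \<le> \<epsilon> / 4"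
      by (rule central_approximate_unit[OF S]) (rule that; assumption)
    note ie = ZFD(2)[OF e(1)] and eZ = ZF_ZL1[OF e(1)]
    have eZL: "act u e \<in> ZL1 M" if "u \<in> ZZ" for u by (rule ZF_ZL1[OF act_ZF[OF that e(1)]])
    \<comment> \<open>One share of \<open>\<epsilon>\<close> for each idempotent; the summand 1
      keeps the denominator positive.\<close>
    define \<epsilon>' where "\<epsilon>' = \<epsilon> / (real (length ps) + 1)"
    have e': "0 < \<epsilon>'" "real (length ps) * \<epsilon>' \<le> \<epsilon>" using eps by (simp_all add: \<epsilon>'_def field_simps)
    have "\<forall>p\<in>Minimal. \<exists>W. W \<noteq> [] \<and> set W \<subseteq> unitaries p \<and> (\<forall>a\<in>S. \<forall>\<phi>\<in>bil.
      cmod (\<Sum>u\<leftarrow>W. \<phi> (conv M a (act u e)) (act (star u) e) - \<phi> (act u e) (conv M (act (star u) e) a)) \<le> \<epsilon>' * length W)"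
      by (rule ballI, rule Folner_central[OF _ e S e'(1)])
    from bchoice[OF this] obtain W where W: "\<forall>p\<in>Minimal. W p \<noteq> [] \<and> set (W p) \<subseteq> unitaries p \<and> (\<forall>a\<in>S. \<forall>\<phi>\<in>bil.
      cmod (\<Sum>u\<leftarrow>W p. \<phi> (conv M a (act u e)) (act (star u) e) - \<phi> (act u e) (conv M (act (star u) e) a)) \<le> \<epsilon>' * length (W p))"
      by (elim exE) (rule that)
    define c where "c p = 1 / complex_of_nat (length (W p))" for p
    have Wp: "W p \<noteq> []" "set (W p) \<subseteq> unitaries p" if "p \<in> set ps" for p
      by (fact bspec[OF W subsetD[OF ps that], THEN conjunct1] bspec[OF W subsetD[OF ps that], THEN conjunct2, THEN conjunct1])+
    have cl: "c p * of_nat (length (W p)) = 1" "cmod (c p) * real (length (W p)) = 1" if "p \<in> set ps" for p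
      using Wp(1)[OF that] by (simp_all add: c_def norm_divide)
    have uZ: "u \<in> ZZ" "star u \<in> ZZ" if "p \<in> set ps" "u \<in> set (W p)" for p u
      using Wp(2)[OF that(1)] that(2) unitariesD(1) ZZ_star by blast+
    define t where "t p u = ((\<lambda>x. c p * act u e x), act (star u) e)" for p u
    define xs where "xs = concat (map (\<lambda>p. map (t p) (W p)) ps)"
    have sum_xs: "(\<Sum>q\<leftarrow>xs. F q) = (\<Sum>p\<leftarrow>ps. \<Sum>u\<leftarrow>W p. F (t p u))" for F :: "_ \<Rightarrow> complex"
      unfolding xs_def by (induction ps) (simp_all add: o_def)
    have sub: "cmod (\<Sum>p\<leftarrow>ps. F p) \<le> real (length ps) * B" if "\<And>p. p \<in> set ps \<Longrightarrow> cmod (F p) \<le> B" for F B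
    proof -
      have "cmod (\<Sum>p\<leftarrow>ps. F p) \<le> (\<Sum>p\<leftarrow>ps. B)" using that by (intro order.trans[OF norm_sum_list_le] sum_list_mono) auto
      then show ?thesis by (simp add: sum_list_triv)
    qed
    have mem: "\<forall>q\<in>set xs. fst q \<in> ZL1 M \<and> snd q \<in> ZL1 M"
    proof
      fix q assume "q \<in> set xs"
      then obtain p u where q: "p \<in> set ps" "u \<in> set (W p)" "q = t p u" unfolding xs_def by auto
      show "fst q \<in> ZL1 M \<and> snd q \<in> ZL1 M"
        unfolding q(3) t_def fst_conv snd_conv using ZL1_cmult[OF eZL[OF uZ(1)[OF q(1,2)]]] eZL[OF uZ(2)[OF q(1,2)]] by blast
    qed
    have bounded: "cmod (\<Sum>q\<leftarrow>xs. \<phi> (fst q) (snd q)) \<le> real (length ps) * (?k * ?k)" if \<phi>: "\<phi> \<in> bil" for \<phi>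
      unfolding sum_xs
    proof (rule sub)
      fix p assume p: "p \<in> set ps"
      have "cmod (\<phi> (fst (t p u)) (snd (t p u))) \<le> cmod (c p) * (?k * ?k)" if u: "u \<in> set (W p)" for u
      proof -
        have uU: "u \<in> unitaries p" using Wp(2)[OF p] u by blast
        have n: "N (act u e) \<le> ?k" if "u \<in> unitaries p" for u
          using order.trans[OF act_unitary_bound[OF psI[OF p] that eZ] mult_left_mono[OF e(2), of ?k]] by simp
        have "\<phi> (fst (t p u)) (snd (t p u)) = c p * \<phi> (act u e) (act (star u) e)"
          unfolding t_def fst_conv snd_conv using bil_cmult[OF \<phi> eZL[OF uZ(1)[OF p u]] eZL[OF uZ(2)[OF p u]]] by blast
        moreover have "cmod (\<phi> (act u e) (act (star u) e)) \<le> ?k * ?k"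
          by (rule order.trans[OF bil_bound[OF \<phi> eZL[OF uZ(1)[OF p u]] eZL[OF uZ(2)[OF p u]]]])
            (rule mult_mono[OF n[OF uU] n[OF unitaries_star[OF uU]]], auto)
        ultimately show ?thesis by (simp add: norm_mult mult_left_mono)
      qed
      then have "cmod (\<Sum>u\<leftarrow>W p. \<phi> (fst (t p u)) (snd (t p u))) \<le> (\<Sum>u\<leftarrow>W p. cmod (c p) * (?k * ?k))"
        by (intro order.trans[OF norm_sum_list_le] sum_list_mono) auto
      also have "\<dots> = (cmod (c p) * real (length (W p))) * (?k * ?k)" by (simp add: sum_list_triv mult_ac)
      also have "\<dots> = ?k * ?k" unfolding cl(2)[OF p] by simp
      finally show "cmod (\<Sum>u\<leftarrow>W p. \<phi> (fst (t p u)) (snd (t p u))) \<le> ?k * ?k" .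
    qed
    define m where "m = (\<lambda>z. \<Sum>q\<leftarrow>xs. conv M (fst q) (snd q) z)"
    have im: "integrable M m"
    proof -
      have "\<forall>q\<in>set xs. integrable M (conv M (fst q) (snd q))" using mem ZL1_integrable conv_integrable(1) by blast
      then show ?thesis unfolding m_def by (induction xs) auto
    qed
    have iee: "integrable M (conv M e e)" by (rule conv_integrable(1)[OF ie ie])
    have m: "AE z in M. m z = conv M e e z"
    proof -
      have 1: "AE z in M. conv M (fst (t p u)) (snd (t p u)) z = c p * act p (conv M e e) z"
        if p: "p \<in> set ps" and u: "u \<in> set (W p)" for p u
      proof -
        have uU: "u \<in> unitaries p" using Wp(2)[OF p] u by blast
        note uz = uZ(1)[OF p u] and sz = uZ(2)[OF p u]
        have eq: "act u (act (star u) (conv M e e)) = act p (conv M e e)"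
          unfolding ZZ_assoc[OF uz sz, symmetric] unitariesD(2)[OF uU] ..
        have "AE z in M. conv M (act u e) (act (star u) e) z = act u (conv M e (act (star u) e)) z"
          by (rule conv_act_left[OF uz ie integrable_act[OF sz ie]])
        moreover have "AE z in M. act u (conv M e (act (star u) e)) z = act u (act (star u) (conv M e e)) z"
          by (rule act_cong_AE[OF uz conv_act_right(1)[OF sz e(1) eZ]])
        ultimately show ?thesis by eventually_elim (simp add: t_def conv_cmult_left eq)
      qed
      have "AE z in M. \<forall>p\<in>set ps. \<forall>u\<in>set (W p). conv M (fst (t p u)) (snd (t p u)) z = c p * act p (conv M e e) z"
        unfolding AE_finite_all[OF finite_set] by (intro ballI 1)
      then show ?thesis
      proof eventually_elim
        case (elim z)
        have "m z = (\<Sum>p\<leftarrow>ps. \<Sum>u\<leftarrow>W p. c p * act p (conv M e e) z)"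
          unfolding m_def sum_xs using elim by (intro arg_cong[where f=sum_list] map_cong refl) auto
        also have "\<dots> = (\<Sum>p\<leftarrow>ps. act p (conv M e e) z)"
        proof (intro arg_cong[where f=sum_list] map_cong refl)
          fix p assume p: "p \<in> set ps"
          have "(\<Sum>u\<leftarrow>W p. c p * act p (conv M e e) z) = (c p * of_nat (length (W p))) * act p (conv M e e) z"
            by (simp add: sum_list_triv mult_ac)
          then show "(\<Sum>u\<leftarrow>W p. c p * act p (conv M e e) z) = act p (conv M e e) z" unfolding cl(1)[OF p] by simp
        qed
        finally show ?case unfolding split .
      qed
    qed
    have approx: "N (\<lambda>x. conv M m a x - a x) < \<epsilon>" "N (\<lambda>x. conv M a m x - a x) < \<epsilon>" if a: "a \<in> S" for a
    proof -
      have aZ: "a \<in> ZL1 M" using S a by blast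
      note ia = ZL1_integrable[OF aZ]
      note iea = conv_integrable(1)[OF ie ia]
      note ieea = conv_integrable(1)[OF iee ia] and ieea' = conv_integrable(1)[OF ie iea]
      note ima = conv_integrable(1)[OF im ia] and iam = conv_integrable(1)[OF ia im]
      have "AE x in M. conv M m a x = conv M (conv M e e) a x" by (rule conv_cong_AE[OF im iee ia ia m]) simp
      with conv_assoc[OF ie ie ia] have "AE x in M. conv M m a x - a x = conv M e (conv M e a) x - a x" by eventually_elim simp
      from N_cong_AE[OF Bochner_Integration.integrable_diff[OF ima ia] Bochner_Integration.integrable_diff[OF ieea' ia] this]
      have "N (\<lambda>x. conv M m a x - a x) = N (\<lambda>x. conv M e (conv M e a) x - a x)" .
      \<comment> \<open>Each factor \<open>e\<close> accounts for one error of
        \<open>\<epsilon> / 4\<close>; the outer one does not magnify it, having norm at most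
        1.\<close>
      also have "\<dots> \<le> N (\<lambda>x. conv M e (conv M e a) x - conv M e a x) + N (\<lambda>x. conv M e a x - a x)"
        by (rule N_tri[OF ieea' iea ia])
      also have "N (\<lambda>x. conv M e (conv M e a) x - conv M e a x) \<le> N e * N (\<lambda>x. conv M e a x - a x)"
        by (rule N_conv_diff_right[OF ie iea ia])
      also have "N e * N (\<lambda>x. conv M e a x - a x) \<le> 1 * N (\<lambda>x. conv M e a x - a x)" by (intro mult_right_mono e) simp
      finally show 1: "N (\<lambda>x. conv M m a x - a x) < \<epsilon>" using unit[OF a] eps by simp
      have "AE x in M. conv M a m x - a x = conv M m a x - a x" using ZL1_commute[OF aZ im] by eventually_elim simp
      from N_cong_AE[OF Bochner_Integration.integrable_diff[OF iam ia] Bochner_Integration.integrable_diff[OF ima ia] this]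
      show "N (\<lambda>x. conv M a m x - a x) < \<epsilon>" using 1 by simp
    qed
    have diagonal: "cmod ((\<Sum>q\<leftarrow>xs. \<phi> (conv M a (fst q)) (snd q)) - (\<Sum>q\<leftarrow>xs. \<phi> (fst q) (conv M (snd q) a))) \<le> \<epsilon>"
      if a: "a \<in> S" and \<phi>: "\<phi> \<in> bil" for a \<phi>
    proof -
      have aZ: "a \<in> ZL1 M" using S a by blast
      define D where "D u = \<phi> (conv M a (act u e)) (act (star u) e) - \<phi> (act u e) (conv M (act (star u) e) a)" for u
      have "(\<Sum>q\<leftarrow>xs. \<phi> (conv M a (fst q)) (snd q)) - (\<Sum>q\<leftarrow>xs. \<phi> (fst q) (conv M (snd q) a))
          = (\<Sum>q\<leftarrow>xs. \<phi> (conv M a (fst q)) (snd q) - \<phi> (fst q) (conv M (snd q) a))"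
        by (simp add: sum_list_subtractf)
      also have "\<dots> = (\<Sum>p\<leftarrow>ps. c p * (\<Sum>u\<leftarrow>W p. D u))"
        unfolding sum_xs
      proof (intro arg_cong[where f=sum_list] map_cong refl)
        fix p assume p: "p \<in> set ps"
        have "\<phi> (conv M a (fst (t p u))) (snd (t p u)) - \<phi> (fst (t p u)) (conv M (snd (t p u)) a) = c p * D u"
          if u: "u \<in> set (W p)" for u
        proof -
          note z = eZL[OF uZ(1)[OF p u]] and z' = eZL[OF uZ(2)[OF p u]]
          show ?thesis
            unfolding t_def fst_conv snd_conv conv_cmult_right[abs_def] D_def
            using bil_cmult[OF \<phi> ZL1_conv[OF aZ z] z', of "c p"] bil_cmult[OF \<phi> z ZL1_conv[OF z' aZ], of "c p"]
            by (simp add: right_diff_distrib)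
        qed
        then have "(\<Sum>u\<leftarrow>W p. \<phi> (conv M a (fst (t p u))) (snd (t p u)) - \<phi> (fst (t p u)) (conv M (snd (t p u)) a)) = (\<Sum>u\<leftarrow>W p. c p * D u)"
          by (intro arg_cong[where f=sum_list] map_cong refl)
        then show "(\<Sum>u\<leftarrow>W p. \<phi> (conv M a (fst (t p u))) (snd (t p u)) - \<phi> (fst (t p u)) (conv M (snd (t p u)) a)) = c p * (\<Sum>u\<leftarrow>W p. D u)"
          by (simp only: sum_list_const_mult)
      qed
      also have "cmod \<dots> \<le> real (length ps) * \<epsilon>'"
      proof (rule sub)
        fix p assume p: "p \<in> set ps"
        have pM: "p \<in> Minimal" using p ps by blast
        note W3 = bspec[OF W pM, THEN conjunct2, THEN conjunct2, THEN bspec, THEN bspec, OF a \<phi>, folded D_def]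
        have "cmod (c p * (\<Sum>u\<leftarrow>W p. D u)) \<le> cmod (c p) * (\<epsilon>' * length (W p))"
          unfolding norm_mult by (rule mult_left_mono[OF W3]) simp
        also have "\<dots> = (cmod (c p) * real (length (W p))) * \<epsilon>'" by simp
        also have "\<dots> = \<epsilon>'" unfolding cl(2)[OF p] by simp
        finally show "cmod (c p * (\<Sum>u\<leftarrow>W p. D u)) \<le> \<epsilon>'" .
      qed
      finally show ?thesis using e'(2) by simp
    qed
    have b1: "\<forall>\<phi>\<in>bil. cmod (\<Sum>p\<leftarrow>xs. \<phi> (fst p) (snd p)) \<le> real (length ps) * (?k * ?k)"
      by (rule ballI, drule bounded)
    have b2: "\<forall>a\<in>S. N (\<lambda>x. conv M (\<lambda>z. \<Sum>p\<leftarrow>xs. conv M (fst p) (snd p) z) a x - a x) < \<epsilon> \<and>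
        N (\<lambda>x. conv M a (\<lambda>z. \<Sum>p\<leftarrow>xs. conv M (fst p) (snd p) z) x - a x) < \<epsilon> \<and>
        (\<forall>\<phi>\<in>bil. cmod ((\<Sum>p\<leftarrow>xs. \<phi> (conv M a (fst p)) (snd p)) - (\<Sum>p\<leftarrow>xs. \<phi> (fst p) (conv M (snd p) a))) \<le> \<epsilon>)"
    proof
      fix a assume a: "a \<in> S"
      have "\<forall>\<phi>\<in>bil. cmod ((\<Sum>p\<leftarrow>xs. \<phi> (conv M a (fst p)) (snd p)) - (\<Sum>p\<leftarrow>xs. \<phi> (fst p) (conv M (snd p) a))) \<le> \<epsilon>"
        by (rule ballI, drule diagonal[OF a])
      then show "N (\<lambda>x. conv M (\<lambda>z. \<Sum>p\<leftarrow>xs. conv M (fst p) (snd p) z) a x - a x) < \<epsilon> \<and>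
        N (\<lambda>x. conv M a (\<lambda>z. \<Sum>p\<leftarrow>xs. conv M (fst p) (snd p) z) x - a x) < \<epsilon> \<and>
        (\<forall>\<phi>\<in>bil. cmod ((\<Sum>p\<leftarrow>xs. \<phi> (conv M a (fst p)) (snd p)) - (\<Sum>p\<leftarrow>xs. \<phi> (fst p) (conv M (snd p) a))) \<le> \<epsilon>)"
        by (rule conjI[OF approx(1)[OF a, unfolded m_def] conjI[OF approx(2)[OF a, unfolded m_def]]])
    qed
    show "\<exists>xs. (\<forall>p\<in>set xs. fst p \<in> ZL1 M \<and> snd p \<in> ZL1 M) \<and>
      (\<forall>\<phi>\<in>bil. cmod (\<Sum>p\<leftarrow>xs. \<phi> (fst p) (snd p)) \<le> real (length ps) * (?k * ?k)) \<and>
      (\<forall>a\<in>S. N (\<lambda>x. conv M (\<lambda>z. \<Sum>p\<leftarrow>xs. conv M (fst p) (snd p) z) a x - a x) < \<epsilon> \<and>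
        N (\<lambda>x. conv M a (\<lambda>z. \<Sum>p\<leftarrow>xs. conv M (fst p) (snd p) z) x - a x) < \<epsilon> \<and>
        (\<forall>\<phi>\<in>bil. cmod ((\<Sum>p\<leftarrow>xs. \<phi> (conv M a (fst p)) (snd p)) - (\<Sum>p\<leftarrow>xs. \<phi> (fst p) (conv M (snd p) a))) \<le> \<epsilon>))"
      by (rule exI[of _ xs], rule conjI[OF mem conjI[OF b1 b2]])
  qed
qed

end

section \<open>Elements with relatively compact conjugacy class\<close>

lemma rc_conj_iff: "(b::'a::{topological_group_add, t2_space}) \<in> rc_conj_elements \<longleftrightarrow> (\<exists>C. compact C \<and> cl b \<subseteq> C)"
proof
  assume "b \<in> rc_conj_elements"
  then have "compact (closure (cl b))" by (simp add: rc_conj_elements_def cl_def)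
  then show "\<exists>C. compact C \<and> cl b \<subseteq> C" by (intro exI[of _ "closure (cl b)"] conjI closure_subset)
next
  assume "\<exists>C. compact C \<and> cl b \<subseteq> C"
  then obtain C where C: "compact C" "cl b \<subseteq> C" by blast
  then have "closure (cl b) \<subseteq> C" by (intro closure_minimal compact_imp_closed)
  then have "compact (closure (cl b))" using compact_Int_closed[OF C(1) closed_closure, of "cl b"] by (simp add: Int_absorb1)
  then show "b \<in> rc_conj_elements" by (simp add: rc_conj_elements_def cl_def)
qed

lemma add_subgroup_rc_conj: "add_subgroup (rc_conj_elements :: 'a::{topological_group_add, t2_space} set)"
  unfolding add_subgroup_def
proof (intro conjI ballI)
  have "cl (0::'a) \<subseteq> {0}" by (auto simp: cl_def)
  then show "(0::'a) \<in> rc_conj_elements" unfolding rc_conj_iff by (intro exI[of _ "{0}"]) simp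
  fix x y :: 'a assume "x \<in> rc_conj_elements" "y \<in> rc_conj_elements"
  then obtain C D where C: "compact C" "cl x \<subseteq> C" and D: "compact D" "cl y \<subseteq> D" unfolding rc_conj_iff by blast
  have "cl (x + y) \<subseteq> {c + d | c d. c \<in> C \<and> d \<in> D}"
  proof
    fix z assume "z \<in> cl (x + y)"
    then obtain a where "z = (a + x - a) + (a + y - a)" unfolding cl_def conj_add by blast
    moreover have "a + x - a \<in> C" "a + y - a \<in> D" using C D unfolding cl_def by blast+
    ultimately show "z \<in> {c + d | c d. c \<in> C \<and> d \<in> D}" by blast
  qed
  then show "x + y \<in> rc_conj_elements" unfolding rc_conj_iff using compact_plus[OF C(1) D(1)] by blast
next
  fix x :: 'a assume "x \<in> rc_conj_elements"
  then obtain C where C: "compact C" "cl x \<subseteq> C" unfolding rc_conj_iff by blast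
  have "cl (- x) \<subseteq> uminus ` C"
  proof
    fix z assume "z \<in> cl (- x)"
    then obtain a where "z = - (a + x - a)" unfolding cl_def conj_minus by blast
    moreover have "a + x - a \<in> C" using C unfolding cl_def by blast
    ultimately show "z \<in> uminus ` C" by blast
  qed
  then show "- x \<in> rc_conj_elements" unfolding rc_conj_iff using compact_uminus[OF C(1)] by blast
qed

lemma conj_rc_conj:
  assumes "(x::'a::{topological_group_add, t2_space}) \<in> rc_conj_elements"
  shows "a + x - a \<in> rc_conj_elements"
proof -
  have "cl (a + x - a) \<subseteq> cl x" unfolding cl_def using conj_conj by blast
  then show ?thesis using assms unfolding rc_conj_iff by blast
qed

lemma add_subgroup_generated: "add_subgroup (closed_subgroup_generated S)"
  unfolding closed_subgroup_generated_def add_subgroup_def by auto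

text \<open>The translate of \<open>V\<close> by a point of \<open>H\<close> stays in
  \<open>H\<close>, and the translate by a point off \<open>H\<close> stays off
  \<open>H\<close>.\<close>

lemma open_subgroup_closed:
  fixes H :: "'a::{topological_group_add, t2_space} set"
  assumes H: "add_subgroup H" and V: "open V" "0 \<in> V" "V \<subseteq> H"
  shows "open H" "closed H"
proof -
  have o: "open {z. z - x \<in> V}" for x
  proof -
    have "{z. z - x \<in> V} = (\<lambda>z. z - x) -` V" by auto
    then show ?thesis using V(1) by (auto intro!: open_vimage continuous_intros)
  qed
  have "z \<in> H" if "x \<in> H" "z - x \<in> V" for x z
  proof -
    have "(z - x) + x \<in> H" using H that V(3) unfolding add_subgroup_def by blast
    then show ?thesis by simp
  qed
  then show "open H" by (subst open_subopen, intro ballI)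
    (rule exI[of _ "{z. z - x \<in> V}" for x], use o V(2) in auto)
  have "x \<in> H" if "z \<in> H" "z - x \<in> V" for x z
  proof -
    have "- (z - x) + z \<in> H" using H that V(3) unfolding add_subgroup_def by blast
    moreover have "- (z - x) + z = x" by (simp add: add.assoc[symmetric] minus_diff_eq)
    ultimately show ?thesis by simp
  qed
  then show "closed H" unfolding closed_def by (subst open_subopen, intro ballI)
    (rule exI[of _ "{z. z - x \<in> V}" for x], use o V(2) in auto)
qed

theorem theorem2p2:
  fixes M :: "'a::{topological_group_add, t2_space} measure"
  assumes "locally_compact_space (euclidean :: 'a topology)"
    and "left_haar_measure M"
    and "finite (closed_subgroup_generated (commutators_G_G0 :: 'a set))"
  shows "amenable_alg (ZL1 M) (L1norm M) (conv M)"
proof -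
  interpret haar_group M by (rule haar_group.intro[OF assms(1,2)])
  show ?thesis
  \<comment> \<open>A centre that is zero in L1 gives no information on the group, and amenability
    is immediate; otherwise one nonzero central function supplies the structure.\<close>
  proof (cases "\<forall>f\<in>ZL1 M. N f = 0")
    case True
    then show ?thesis by (intro amenable_trivial) blast
  next
    case False
    then obtain f where f: "f \<in> ZL1 M" "N f \<noteq> 0" by blast
    obtain V W :: "'a set" where V: "open V" "0 \<in> V" and W: "compact W" "\<And>v v'. v \<in> V \<Longrightarrow> v' \<in> V \<Longrightarrow> - v + v' \<in> W"
      and conj: "\<And>a v. v \<in> V \<Longrightarrow> a + v - a \<in> V"
      by (rule invariant_neighbourhood[OF f]) (rule that; assumption)
    let ?G0 = "rc_conj_elements :: 'a set"
    let ?K = "closed_subgroup_generated (commutators_G_G0 :: 'a set)"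
    have VW: "V \<subseteq> W" using W(2)[OF V(2)] by auto
    \<comment> \<open>\<open>V\<close> is invariant and contained in \<open>W\<close>, so the
      classes of its elements stay in a compact set.\<close>
    have "V \<subseteq> ?G0"
    proof
      fix v assume "v \<in> V"
      then have "cl v \<subseteq> W" using conj VW unfolding cl_def by blast
      then show "v \<in> ?G0" unfolding rc_conj_iff using W(1) by blast
    qed
    note G0 = open_subgroup_closed[OF add_subgroup_rc_conj V this]
    have "commutators_G_G0 \<subseteq> ?G0"
    proof
      fix z :: 'a assume "z \<in> commutators_G_G0"
      then obtain a b where z: "z = a + b - a + - b" "b \<in> ?G0" unfolding commutators_G_G0_def by auto
      show "z \<in> ?G0" unfolding z(1) using conj_rc_conj[OF z(2)] z(2) add_subgroup_rc_conj unfolding add_subgroup_def by blast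
    qed
    \<comment> \<open>\<open>G0\<close> is an open subgroup, hence closed, so the closed subgroup
      generated by the commutators stays inside it.\<close>
    then have "?K \<subseteq> ?G0" using add_subgroup_rc_conj G0(2) unfolding closed_subgroup_generated_def by blast
    moreover have "a + x - a - x \<in> ?K" if "x \<in> ?G0" for a x
      using that unfolding closed_subgroup_generated_def commutators_G_G0_def by blast
    ultimately have fc: "finite_commutator ?G0 ?K"
      by (intro finite_commutator.intro assms(3) add_subgroup_generated add_subgroup_rc_conj conj_rc_conj)
    have "in_group M ?G0 ?K V W"
    proof (rule in_group.intro[OF haar_group_axioms fc], rule in_group_axioms.intro)
      show "distr M borel uminus = M" by (rule distr_uminus[OF f])
      show "open ?G0" "open V" "0 \<in> V" "compact W" by (fact G0(1) V W(1))+
      show "a + v - a \<in> V" if "v \<in> V" for a v by (rule conj[OF that])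
      show "- v + v' \<in> W" if "v \<in> V" "v' \<in> V" for v v' by (rule W(2)[OF that])
      show "\<exists>y\<in>cl x. y \<notin> C" if "x \<notin> ?G0" "compact C" for x C
        using that unfolding rc_conj_iff by blast
    qed
    then interpret in_group M ?G0 ?K V W .
    show ?thesis by (rule amenable_ZL1)
  qed
qed

end
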